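(* Consider any one of the five scenarios (S), (M1), (M2), (C1), (C2) described in the context (with one of the norms on $W=\mathbb{R}^m$ allowed there), with true signal $x^\natural$, random sensing map $\mathcal{A}:V\to W$ and noiseless observations $b=\mathcal{A}(x^\natural)$. Suppose that $x^\natural$ is $k$-sparse (in scenario (S)) or has rank no more than $k$ (in the other scenarios). If $m\ge C\,T(n,N,k)$, where $T(n,N,k)$ is the threshold of the scenario and $C$ is a (suitable) numerical constant, then there are numerical constants $c_1,c_2>0$ such that with high probability the optimization problem $$\min_{x\in V}\{f(x):\ \mathcal{A}(x)=b,\ x\in\mathcal{K}\}$$ is $\left(\tfrac12,\sqrt{c_1k},2\right)$-sharp around $x^\natural$, and the function $$F_{\sqrt{c_1k},2}(x)=f(x)+\sqrt{c_1k}\,\|\mathcal{A}(x)-b\|+2\operatorname{dist}(x,\mathcal{K})$$ has a Lipschitz constant bounded by $\sqrt{c_2k}$ with respect to the norm of $V$. Consequently, the problem has a condition number $\kappa$ bounded by $2\sqrt{c_2k}$.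
   Context: Norms. For a vector, $\|\cdot\|_p$ is the $\ell_p$ norm; for a matrix, $\|\cdot\|_p$ is the Schatten-$p$ norm (the $\ell_p$ norm of the singular values). $\mathbb{S}^n$ is the space of real symmetric $n\times n$ matrices and $\mathbb{S}^n_+$ is the PSD cone. $V$ and $W$ are Euclidean spaces each equipped with a norm (not necessarily the Euclidean one); $\|\cdot\|$ denotes the norm of the space in which its argument lies, and $\operatorname{dist}(x,\mathcal{K})=\min_{y\in \mathcal{K}}\|x-y\|$ is measured in the norm of $V$. Sharpness. A convex $F:V\to\mathbb{R}$ is $\mu$-sharp ($\mu>0$) around a nonempty convex set $\mathcal{X}$ if $\mathcal{X}=\arg\min F$ and $F(\bar x)-\min F\ge\mu\operatorname{dist}(\bar x,\mathcal{X})$ for all $\bar x\in V$. For $\mu>0$, $r,\ell\ge0$, the problem $\min_{x\in V}\{f(x):\mathcal{A}(x)=b,\ x\in\mathcal{K}\}$ ($f$ convex, $\mathcal{K}$ a closed convex cone) is $(\mu,r,\ell)$-sharp around $x^\natural$ if $x^\natural$ is feasible and $F_{r,\ell}(x):=f(x)+r\|\mathcal{A}(x)-b\|+\ell\operatorname{dist}(x,\mathcal{K})$ is $\mu$-sharp around $\{x^\natural\}$. If $F_{r,\ell}$ is $\mu$-sharp around $x^\natural$ and $L$-Lipschitz with respect to the norm of $V$, the condition number is $\kappa=L/\mu$. Scenarios. The map $\mathcal{A}$ is given by $\mathcal{A}(x)_i=\langle\mathcal{A}^*(e_i),x\rangle$, $i=1,\dots,m$ (dot product or trace inner product), where $e_i$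 is the $i$-th standard basis vector of $\mathbb{R}^m$. All random vectors and matrices below are independent. (S) Sparse vector recovery: $V=(\mathbb{R}^n,\|\cdot\|_1)$, $f(x)=\|x\|_1$, $\mathcal{K}=\mathbb{R}^n$, $\mathcal{A}^*(e_i)=a_i$; $W=(\mathbb{R}^m,\|\cdot\|_2)$ with $a_i\sim N(0,I_n/m)$, or $W=(\mathbb{R}^m,\|\cdot\|_1)$ with $a_i\sim N(0,I_n/m^2)$; $T(n,N,k)=k\log(n/k)$. (M1) Low rank matrix sensing I: $V=(\mathbb{R}^{n\times N},\|\cdot\|_1)$, $f(X)=\|X\|_1$, $\mathcal{K}=\mathbb{R}^{n\times N}$, $\mathcal{A}^*(e_i)=A_i\in\mathbb{R}^{n\times N}$; $W=(\mathbb{R}^m,\|\cdot\|_2)$ with the entries of $A_i$ i.i.d. $N(0,1/m)$, or $W=(\mathbb{R}^m,\|\cdot\|_1)$ with the entries of $A_i$ i.i.d. $N(0,1/m^2)$; $T(n,N,k)=\max\{n,N\}k$. (M2) Low rank matrix sensing II: $V,f,\mathcal{K}$ as for (M1), $\mathcal{A}^*(e_i)=a_ib_i^\top$ with $a_i\sim N(0,I_n/m)$, $b_i\sim N(0,I_N/m)$; $W=(\mathbb{R}^m,\|\cdot\|_1)$; $T(n,N,k)=\max\{n,N\}k$. (C1) Covariance estimation I: $V=(\mathbb{S}^n,\|\cdot\|_1)$, $f(X)=\operatorname{tr}(X)$, $\mathcal{K}=\mathbb{S}^n_+$, the signal is PSD, $\mathcal{A}^*(e_i)=a_ia_i^\top$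 with $a_i\sim N(0,I_n/m)$; $W=(\mathbb{R}^m,\|\cdot\|_1)$; $T(n,N,k)=nk$. (C2) Covariance estimation II: $V,f,\mathcal{K}$ and PSD signal as for (C1), $\mathcal{A}^*(e_i)=a_ia_i^\top-b_ib_i^\top$ with $a_i,b_i\sim N(0,I_n/(2m))$; $W=(\mathbb{R}^m,\|\cdot\|_1)$; $T(n,N,k)=nk$. A numerical constant is an absolute constant independent of $n,N,k,m$ and $x^\natural$. An event holds with high probability if its probability is larger than $1-\exp(-cm)$ for some numerical constant $c>0$.
   Formalization: In scenario (S) the threshold k log(n/k) is replaced by k max{log 2, log(n/k)} (unchanged for 2k ≤ n), since at k = n it vanishes and the claim fails (n = k = 2, m = 1, signal (1,1)); also n, N, k ≥ 1 is assumed, as for k = 0 the Lipschitz bound would be 0. *)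

theory Defs
  imports "HOL-Probability.Probability" "Jordan_Normal_Form.Char_Poly" "Jordan_Normal_Form.DL_Rank"
begin

(* "\<bullet>" and "$" denote the Jordan_Normal_Form operations below. *)
unbundle no inner_syntax
unbundle no vec_syntax

section \<open>Finite-dimensional normed spaces with explicit carrier\<close>

text \<open>
  The constants of the theorem must not depend on the dimensions, so the dimensions are natural
  numbers and not types, and the spaces are carrier sets of vectors or matrices. Addition and
  subtraction are the operations of the underlying type; only scaling is stored.
\<close>

record 'v nspace =
  points :: "'v set"
  scale :: "real \<Rightarrow> 'v \<Rightarrow> 'v"
  nrm :: "'v \<Rightarrow> real"

definition convex_set :: "('v::plus, 'z) nspace_scheme \<Rightarrow> 'v set \<Rightarrow> bool" where
  "convex_set V S \<longleftrightarrow> S \<subseteq> points V \<and>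
     (\<forall>x\<in>S. \<forall>y\<in>S. \<forall>t\<in>{0..1}. scale V (1 - t) x + scale V t y \<in> S)"

definition convex_fun :: "('v::plus, 'z) nspace_scheme \<Rightarrow> ('v \<Rightarrow> real) \<Rightarrow> bool" where
  "convex_fun V F \<longleftrightarrow> (\<forall>x\<in>points V. \<forall>y\<in>points V. \<forall>t\<in>{0..1}.
     F (scale V (1 - t) x + scale V t y) \<le> (1 - t) * F x + t * F y)"

definition closed_in_norm :: "('v::minus, 'z) nspace_scheme \<Rightarrow> 'v set \<Rightarrow> bool" where
  "closed_in_norm V S \<longleftrightarrow> (\<forall>s. \<forall>x\<in>points V.
     (\<forall>i::nat. s i \<in> S) \<and> (\<lambda>i. nrm V (s i - x)) \<longlonglongrightarrow> 0 \<longrightarrow> x \<in> S)"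

definition closed_convex_cone :: "('v::{plus,minus}, 'z) nspace_scheme \<Rightarrow> 'v set \<Rightarrow> bool" where
  "closed_convex_cone V K \<longleftrightarrow> K \<noteq> {} \<and> convex_set V K \<and> closed_in_norm V K \<and>
     (\<forall>x\<in>K. \<forall>t\<ge>0. scale V t x \<in> K)"

definition dist_to :: "('v::minus, 'z) nspace_scheme \<Rightarrow> 'v \<Rightarrow> 'v set \<Rightarrow> real" where
  "dist_to V x S = (INF y\<in>S. nrm V (x - y))"

definition argmin :: "('v, 'z) nspace_scheme \<Rightarrow> ('v \<Rightarrow> real) \<Rightarrow> 'v set" where
  "argmin V F = {x \<in> points V. \<forall>y\<in>points V. F x \<le> F y}"

definition lipschitz :: "('v::minus, 'z) nspace_scheme \<Rightarrow> real \<Rightarrow> ('v \<Rightarrow> real) \<Rightarrow> bool" where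
  "lipschitz V L F \<longleftrightarrow> 0 \<le> L \<and>
     (\<forall>x\<in>points V. \<forall>y\<in>points V. \<bar>F x - F y\<bar> \<le> L * nrm V (x - y))"


section \<open>Sharpness and condition number\<close>

definition sharp_around ::
    "('v::{plus,minus}, 'z) nspace_scheme \<Rightarrow> real \<Rightarrow> ('v \<Rightarrow> real) \<Rightarrow> 'v set \<Rightarrow> bool" where
  "sharp_around V \<mu> F X \<longleftrightarrow> 0 < \<mu> \<and> convex_fun V F \<and> X \<noteq> {} \<and> convex_set V X \<and>
     X = argmin V F \<and>
     (\<forall>x\<in>points V. F x - (INF y\<in>points V. F y) \<ge> \<mu> * dist_to V x X)"

definition penalized ::
    "('v::minus, 'z) nspace_scheme \<Rightarrow> ('w::minus, 'y) nspace_scheme \<Rightarrow> ('v \<Rightarrow> real) \<Rightarrow>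
     ('v \<Rightarrow> 'w) \<Rightarrow> 'w \<Rightarrow> 'v set \<Rightarrow> real \<Rightarrow> real \<Rightarrow> 'v \<Rightarrow> real" where
  "penalized V W f A b K r l x = f x + r * nrm W (A x - b) + l * dist_to V x K"

definition sharp_problem ::
    "('v::{plus,minus}, 'z) nspace_scheme \<Rightarrow> ('w::minus, 'y) nspace_scheme \<Rightarrow> ('v \<Rightarrow> real) \<Rightarrow>
     ('v \<Rightarrow> 'w) \<Rightarrow> 'w \<Rightarrow> 'v set \<Rightarrow> real \<Rightarrow> real \<Rightarrow> real \<Rightarrow> 'v \<Rightarrow> bool" where
  "sharp_problem V W f A b K \<mu> r l x0 \<longleftrightarrow>
     convex_fun V f \<and> closed_convex_cone V K \<and> 0 < \<mu> \<and> 0 \<le> r \<and> 0 \<le> l \<and>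
     x0 \<in> points V \<and> A x0 = b \<and> x0 \<in> K \<and>
     sharp_around V \<mu> (penalized V W f A b K r l) {x0}"

definition has_condition_number ::
    "('v::{plus,minus}, 'z) nspace_scheme \<Rightarrow> ('v \<Rightarrow> real) \<Rightarrow> 'v \<Rightarrow> real \<Rightarrow> real \<Rightarrow> real \<Rightarrow> bool" where
  "has_condition_number V F x0 \<mu> L \<kappa> \<longleftrightarrow>
     sharp_around V \<mu> F {x0} \<and> lipschitz V L F \<and> \<kappa> = L / \<mu>"


section \<open>Norms and matrix sets\<close>

definition l1_norm :: "real vec \<Rightarrow> real" where
  "l1_norm v = (\<Sum>i<dim_vec v. \<bar>v $ i\<bar>)"

definition l2_norm :: "real vec \<Rightarrow> real" where
  "l2_norm v = sqrt (\<Sum>i<dim_vec v. (v $ i)\<^sup>2)"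

text \<open>
  Singular values as the square roots of the eigenvalues of \<open>X\<^sup>T X\<close> with multiplicity; its
  characteristic polynomial splits over the reals, so no root is lost in \<open>proots\<close>.
\<close>
definition singular_values :: "real mat \<Rightarrow> real multiset" where
  "singular_values X = image_mset sqrt (proots (char_poly (transpose_mat X * X)))"

definition schatten1_norm :: "real mat \<Rightarrow> real" where
  "schatten1_norm X = sum_mset (singular_values X)"

definition mat_trace :: "real mat \<Rightarrow> real" where
  "mat_trace X = (\<Sum>i<dim_row X. X $$ (i, i))"

definition trace_inner :: "real mat \<Rightarrow> real mat \<Rightarrow> real" where
  "trace_inner X Y = mat_trace (transpose_mat X * Y)"

definition sym_mats :: "nat \<Rightarrow> real mat set" where
  "sym_mats n = {X \<in> carrier_mat n n. transpose_mat X = X}"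

definition psd_mats :: "nat \<Rightarrow> real mat set" where
  "psd_mats n = {X \<in> sym_mats n. \<forall>v\<in>carrier_vec n. 0 \<le> v \<bullet> (X *\<^sub>v v)}"

definition outer :: "real vec \<Rightarrow> real vec \<Rightarrow> real mat" where
  "outer a b = mat (dim_vec a) (dim_vec b) (\<lambda>(i, j). a $ i * b $ j)"

definition vec_space_l1 :: "nat \<Rightarrow> real vec nspace" where
  "vec_space_l1 n = \<lparr>points = carrier_vec n, scale = (\<cdot>\<^sub>v), nrm = l1_norm\<rparr>"

definition mat_space_s1 :: "nat \<Rightarrow> nat \<Rightarrow> real mat nspace" where
  "mat_space_s1 n N = \<lparr>points = carrier_mat n N, scale = (\<cdot>\<^sub>m), nrm = schatten1_norm\<rparr>"

definition sym_space_s1 :: "nat \<Rightarrow> real mat nspace" where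
  "sym_space_s1 n = \<lparr>points = sym_mats n, scale = (\<cdot>\<^sub>m), nrm = schatten1_norm\<rparr>"

definition obs_space :: "(real vec \<Rightarrow> real) \<Rightarrow> nat \<Rightarrow> real vec nspace" where
  "obs_space nr m = \<lparr>points = carrier_vec m, scale = (\<cdot>\<^sub>v), nrm = nr\<rparr>"


section \<open>Scenarios\<close>

text \<open>
  The randomness of a scenario is a family of independent centred Gaussians with a common
  standard deviation, indexed by triples \<open>(i, p, q)\<close> with \<open>i < m\<close> the number of the
  measurement. Where the measurement uses vectors, \<open>\<omega> (i, 0, q)\<close> is the \<open>q\<close>-th entry of
  \<open>a\<^sub>i\<close> and \<open>\<omega> (i, 1, q)\<close> that of \<open>b\<^sub>i\<close>; where it uses a Gaussian matrix, \<open>\<omega> (i, p, q)\<close> is the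
  entry of \<open>A\<^sub>i\<close> in row \<open>p\<close> and column \<open>q\<close>.
\<close>

type_synonym sample = "nat \<times> nat \<times> nat \<Rightarrow> real"

record 'v scenario =
  space_V :: "nat \<Rightarrow> nat \<Rightarrow> 'v nspace"                     \<comment> \<open>arguments \<open>n N\<close>\<close>
  objective :: "'v \<Rightarrow> real"
  cone_K :: "nat \<Rightarrow> nat \<Rightarrow> 'v set"                        \<comment> \<open>arguments \<open>n N\<close>\<close>
  signals :: "nat \<Rightarrow> nat \<Rightarrow> nat \<Rightarrow> 'v set"                \<comment> \<open>arguments \<open>n N k\<close>\<close>
  threshold :: "nat \<Rightarrow> nat \<Rightarrow> nat \<Rightarrow> real"               \<comment> \<open>arguments \<open>n N k\<close>\<close>
  ip :: "'v \<Rightarrow> 'v \<Rightarrow> real"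
  adj_basis :: "nat \<Rightarrow> nat \<Rightarrow> sample \<Rightarrow> nat \<Rightarrow> 'v"        \<comment> \<open>\<open>\<A>\<^sup>*(e\<^sub>i)\<close>, arguments \<open>n N \<omega> i\<close>\<close>
  blocks :: "nat \<Rightarrow> nat \<Rightarrow> (nat \<times> nat) set"              \<comment> \<open>index pairs \<open>(p, q)\<close>, arguments \<open>n N\<close>\<close>
  std_dev :: "nat \<Rightarrow> real"                               \<comment> \<open>argument \<open>m\<close>\<close>
  norm_W :: "real vec \<Rightarrow> real"

definition gvec :: "sample \<Rightarrow> nat \<Rightarrow> nat \<Rightarrow> nat \<Rightarrow> real vec" where
  "gvec \<omega> i p n = Matrix.vec n (\<lambda>q. \<omega> (i, p, q))"

definition gmat :: "sample \<Rightarrow> nat \<Rightarrow> nat \<Rightarrow> nat \<Rightarrow> real mat" where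
  "gmat \<omega> i n N = Matrix.mat n N (\<lambda>(p, q). \<omega> (i, p, q))"

definition sparse_vecs :: "nat \<Rightarrow> nat \<Rightarrow> real vec set" where
  "sparse_vecs n k = {x \<in> carrier_vec n. card {i. i < n \<and> x $ i \<noteq> 0} \<le> k}"

definition rank_le :: "nat \<Rightarrow> nat \<Rightarrow> nat \<Rightarrow> real mat set" where
  "rank_le n N k = {X \<in> carrier_mat n N. vec_space.rank n X \<le> k}"

text \<open>
  For \<open>2 * k \<le> n\<close> this is \<open>k * ln (n / k)\<close>. The maximum only matters for denser signals, where
  \<open>ln (n / k)\<close> tends to zero while exact recovery still needs on the order of \<open>n\<close> measurements.
\<close>
definition sparse_threshold :: "nat \<Rightarrow> nat \<Rightarrow> real" where
  "sparse_threshold n k = real k * max (ln 2) (ln (real n / real k))"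

definition sparse_recovery :: "(real vec \<Rightarrow> real) \<Rightarrow> (nat \<Rightarrow> real) \<Rightarrow> real vec scenario" where
  "sparse_recovery nW sd = \<lparr>
     space_V = (\<lambda>n N. vec_space_l1 n), objective = l1_norm, cone_K = (\<lambda>n N. carrier_vec n),
     signals = (\<lambda>n N k. sparse_vecs n k), threshold = (\<lambda>n N k. sparse_threshold n k),
     ip = (\<bullet>), adj_basis = (\<lambda>n N \<omega> i. gvec \<omega> i 0 n), blocks = (\<lambda>n N. {0} \<times> {..<n}),
     std_dev = sd, norm_W = nW\<rparr>"

definition sparse_recovery_l2 :: "real vec scenario" where
  "sparse_recovery_l2 = sparse_recovery l2_norm (\<lambda>m. 1 / sqrt (real m))"

definition sparse_recovery_l1 :: "real vec scenario" where
  "sparse_recovery_l1 = sparse_recovery l1_norm (\<lambda>m. 1 / real m)"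

definition matrix_sensing_I :: "(real vec \<Rightarrow> real) \<Rightarrow> (nat \<Rightarrow> real) \<Rightarrow> real mat scenario" where
  "matrix_sensing_I nW sd = \<lparr>
     space_V = mat_space_s1, objective = schatten1_norm, cone_K = carrier_mat,
     signals = rank_le, threshold = (\<lambda>n N k. real (max n N) * real k),
     ip = trace_inner, adj_basis = (\<lambda>n N \<omega> i. gmat \<omega> i n N), blocks = (\<lambda>n N. {..<n} \<times> {..<N}),
     std_dev = sd, norm_W = nW\<rparr>"

definition matrix_sensing_I_l2 :: "real mat scenario" where
  "matrix_sensing_I_l2 = matrix_sensing_I l2_norm (\<lambda>m. 1 / sqrt (real m))"

definition matrix_sensing_I_l1 :: "real mat scenario" where
  "matrix_sensing_I_l1 = matrix_sensing_I l1_norm (\<lambda>m. 1 / real m)"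

definition matrix_sensing_II :: "real mat scenario" where
  "matrix_sensing_II = \<lparr>
     space_V = mat_space_s1, objective = schatten1_norm, cone_K = carrier_mat,
     signals = rank_le, threshold = (\<lambda>n N k. real (max n N) * real k),
     ip = trace_inner, adj_basis = (\<lambda>n N \<omega> i. outer (gvec \<omega> i 0 n) (gvec \<omega> i 1 N)),
     blocks = (\<lambda>n N. {0} \<times> {..<n} \<union> {1} \<times> {..<N}),
     std_dev = (\<lambda>m. 1 / sqrt (real m)), norm_W = l1_norm\<rparr>"

definition covariance_estimation_I :: "real mat scenario" where
  "covariance_estimation_I = \<lparr>
     space_V = (\<lambda>n N. sym_space_s1 n), objective = mat_trace, cone_K = (\<lambda>n N. psd_mats n),
     signals = (\<lambda>n N k. psd_mats n \<inter> rank_le n n k), threshold = (\<lambda>n N k. real n * real k),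
     ip = trace_inner, adj_basis = (\<lambda>n N \<omega> i. outer (gvec \<omega> i 0 n) (gvec \<omega> i 0 n)),
     blocks = (\<lambda>n N. {0} \<times> {..<n}),
     std_dev = (\<lambda>m. 1 / sqrt (real m)), norm_W = l1_norm\<rparr>"

definition covariance_estimation_II :: "real mat scenario" where
  "covariance_estimation_II = \<lparr>
     space_V = (\<lambda>n N. sym_space_s1 n), objective = mat_trace, cone_K = (\<lambda>n N. psd_mats n),
     signals = (\<lambda>n N k. psd_mats n \<inter> rank_le n n k), threshold = (\<lambda>n N k. real n * real k),
     ip = trace_inner,
     adj_basis = (\<lambda>n N \<omega> i. outer (gvec \<omega> i 0 n) (gvec \<omega> i 0 n) - outer (gvec \<omega> i 1 n) (gvec \<omega> i 1 n)),
     blocks = (\<lambda>n N. {0, 1} \<times> {..<n}),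
     std_dev = (\<lambda>m. 1 / sqrt (2 * real m)), norm_W = l1_norm\<rparr>"

definition design_law :: "'v scenario \<Rightarrow> nat \<Rightarrow> nat \<Rightarrow> nat \<Rightarrow> sample measure" where
  "design_law sc n N m =
     (\<Pi>\<^sub>M j\<in>{..<m} \<times> blocks sc n N. density lborel (normal_density 0 (std_dev sc m)))"

definition sensing_map ::
    "'v scenario \<Rightarrow> nat \<Rightarrow> nat \<Rightarrow> nat \<Rightarrow> sample \<Rightarrow> 'v \<Rightarrow> real vec" where
  "sensing_map sc n N m \<omega> x = Matrix.vec m (\<lambda>i. ip sc (adj_basis sc n N \<omega> i) x)"

text \<open>The penalized objective and sharpness of the problem with noiseless data \<open>b = \<A>(x0)\<close>.\<close>

definition recovery_penalized ::
    "'v::minus scenario \<Rightarrow> nat \<Rightarrow> nat \<Rightarrow> nat \<Rightarrow> 'v \<Rightarrow> real \<Rightarrow> real \<Rightarrow> sample \<Rightarrow> 'v \<Rightarrow> real" where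
  "recovery_penalized sc n N m x0 r l \<omega> =
     penalized (space_V sc n N) (obs_space (norm_W sc) m) (objective sc)
       (sensing_map sc n N m \<omega>) (sensing_map sc n N m \<omega> x0) (cone_K sc n N) r l"

definition recovery_sharp ::
    "'v::{plus,minus} scenario \<Rightarrow> nat \<Rightarrow> nat \<Rightarrow> nat \<Rightarrow> 'v \<Rightarrow> real \<Rightarrow> real \<Rightarrow> real \<Rightarrow> sample \<Rightarrow> bool" where
  "recovery_sharp sc n N m x0 \<mu> r l \<omega> \<longleftrightarrow>
     sharp_problem (space_V sc n N) (obs_space (norm_W sc) m) (objective sc)
       (sensing_map sc n N m \<omega>) (sensing_map sc n N m \<omega> x0) (cone_K sc n N) \<mu> r l x0"

end

theory Submission
  imports Defs
begin

text \<open>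
  Why the theorem holds. Write \<open>h = x - x\<^sub>0\<close> for a point \<open>x\<close> and let \<open>\<parallel>h\<parallel>\<^sub>2\<close> be the Euclidean (Frobenius) norm.
  Three facts, the first and the last deterministic, give sharpness.

  (1) Decomposability. In every scenario
  \<open>f x + 2 dist(x, K) \<ge> \<parallel>x\<^sub>0\<parallel> + \<parallel>h\<parallel> - 4 sqrt k \<parallel>h\<parallel>\<^sub>2\<close>. For the vector norm this is the triangle
  inequality off the support of \<open>x\<^sub>0\<close> together with Cauchy-Schwarz on it; for the nuclear norm it is
  duality against an orthonormal family that extends the singular vectors of \<open>x\<^sub>0\<close>
  (\<open>nuclear_norm_decomposable\<close>). In the covariance scenarios the trace and the distance to the cone
  together dominate the nuclear norm (\<open>sharp_setup_psd\<close>), which reduces them to the previous case.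

  (2) Conditioning. With high probability \<open>\<parallel>\<A> h\<parallel>\<close> is at least a constant
  times \<open>\<parallel>h\<parallel>\<^sub>2\<close> on the cone \<open>\<parallel>h\<parallel> \<le> 8 sqrt k \<parallel>h\<parallel>\<^sub>2\<close> and at most a constant times \<open>\<parallel>h\<parallel>\<close>
  everywhere (\<open>well_conditioned\<close>).

  (3) Case distinction (\<open>sharp_if_good\<close>). If \<open>\<parallel>h\<parallel> > 8 sqrt k \<parallel>h\<parallel>\<^sub>2\<close>, then (1) alone gives growth
  \<open>\<parallel>h\<parallel> / 2\<close>. Otherwise the penalty with weight of order \<open>sqrt k\<close> outweighs the loss
  \<open>4 sqrt k \<parallel>h\<parallel>\<^sub>2\<close>, and the growth is even \<open>\<parallel>h\<parallel>\<close>. The upper bound in (2) gives the Lipschitz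
  constant, hence the condition number.

  The probabilistic part is (2). In terms of standard Gaussians, \<open>\<parallel>\<A> h\<parallel>\<close> is the mean absolute value or
  the root mean square of \<open>m\<close> independent copies of a Gaussian form, which is linear or bilinear except
  in the covariance scenarios and then has variance \<open>\<parallel>h\<parallel>\<^sub>2\<^sup>2\<close>. Normalized to unit variance, such a form has
  bounded exponential moments, so for each fixed \<open>h\<close> the average stays between
  two constants up to probability \<open>exp (- c m)\<close>. A union bound over a net extends this to all
  sparse, respectively low rank, \<open>h\<close> at once (\<open>rip_with_high_probability\<close>); the logarithm of the
  size of the net is the threshold \<open>T(n, N, k)\<close> up to a constant. Cutting a vector, or a singular
  value decomposition, into blocks of decreasing entries passes from sparse directions to the cone
  (\<open>compressible_lower_bound\<close>). The nets are rounded integer lattices, and their size is counted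
  with a generating function, so no volume argument occurs.

  The quadratic forms \<open>a\<^sup>T H a\<close> of the covariance scenarios are not bilinear forms in independent
  vectors. The identity \<open>a\<^sup>T H a - b\<^sup>T H b = (a - b)\<^sup>T H (a + b)\<close> for symmetric \<open>H\<close> makes them so: the
  vectors \<open>(a - b) / sqrt 2\<close> and \<open>(a + b) / sqrt 2\<close> are again independent standard Gaussians
  (\<open>std_gaussians_rotate\<close>). This is exactly the second covariance scenario; in the first one it is
  applied to pairs of measurements for the lower bound, and the upper bound follows from the
  singular value decomposition of \<open>H\<close> and the isometry for vectors.
\<close>

section \<open>Orthonormal families\<close>

definition dotp :: "'e set \<Rightarrow> ('e \<Rightarrow> real) \<Rightarrow> ('e \<Rightarrow> real) \<Rightarrow> real" where
  "dotp E x y = (\<Sum>e\<in>E. x e * y e)"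

text \<open>
  Orthogonal families whose members may also vanish. Gram-Schmidt applied to a dependent family
  stays within this class without discarding members, and Bessel's inequality still holds.
\<close>

definition onz :: "'e set \<Rightarrow> 'i set \<Rightarrow> ('i \<Rightarrow> 'e \<Rightarrow> real) \<Rightarrow> bool" where
  "onz E I u \<longleftrightarrow> (\<forall>i\<in>I. dotp E (u i) (u i) \<in> {0, 1}) \<and>
     (\<forall>i\<in>I. \<forall>j\<in>I. i \<noteq> j \<longrightarrow> dotp E (u i) (u j) = 0)"

lemma dotp_commute: "dotp E x y = dotp E y x"
  by (simp add: dotp_def mult.commute)

lemma dotp_self: "dotp E x x = (L2_set x E)\<^sup>2"
  by (simp add: dotp_def L2_set_def power2_eq_square sum_nonneg)

lemma dotp_self_nonneg [simp]: "0 \<le> dotp E x x"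
  by (simp add: dotp_self)

lemma dotp_add_left: "dotp E (\<lambda>e. x e + y e) z = dotp E x z + dotp E y z"
  by (simp add: dotp_def algebra_simps sum.distrib)

lemma dotp_add_right: "dotp E z (\<lambda>e. x e + y e) = dotp E z x + dotp E z y"
  by (simp add: dotp_def algebra_simps sum.distrib)

lemma dotp_diff_left: "dotp E (\<lambda>e. x e - y e) z = dotp E x z - dotp E y z"
  by (simp add: dotp_def algebra_simps sum_subtractf)

lemma dotp_diff_right: "dotp E z (\<lambda>e. x e - y e) = dotp E z x - dotp E z y"
  by (simp add: dotp_def algebra_simps sum_subtractf)

lemma dotp_scale_left: "dotp E (\<lambda>e. c * x e) y = c * dotp E x y"
  by (simp add: dotp_def sum_distrib_left mult.assoc)

lemma dotp_scale_right: "dotp E y (\<lambda>e. c * x e) = c * dotp E y x"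
  by (simp add: dotp_def sum_distrib_left mult_ac)

lemma dotp_sum_left: "dotp E (\<lambda>e. \<Sum>i\<in>I. f i e) y = (\<Sum>i\<in>I. dotp E (f i) y)"
  unfolding dotp_def sum_distrib_right by (rule sum.swap)

lemma dotp_sum_right: "dotp E y (\<lambda>e. \<Sum>i\<in>I. f i e) = (\<Sum>i\<in>I. dotp E y (f i))"
  by (simp add: dotp_commute[of E y] dotp_sum_left)

lemmas dotp_linear = dotp_add_left dotp_add_right dotp_diff_left dotp_diff_right
  dotp_scale_left dotp_scale_right dotp_sum_left dotp_sum_right

lemma dotp_zero_imp:
  assumes "finite E" "dotp E x x = 0" "e \<in> E"
  shows "x e = 0"
proof -
  have "\<forall>e\<in>E. x e * x e = 0"
    using assms by (subst (asm) dotp_def, subst (asm) sum_nonneg_eq_0_iff) auto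
  then show ?thesis using assms by auto
qed

lemma dotp_zero_left:
  assumes "finite E" "dotp E x x = 0"
  shows "dotp E x y = 0"
  using dotp_zero_imp[OF assms] by (simp add: dotp_def)

lemma onzD:
  assumes "onz E I u" "i \<in> I" "j \<in> I"
  shows "i \<noteq> j \<Longrightarrow> dotp E (u i) (u j) = 0" "dotp E (u i) (u i) \<le> 1"
    "(dotp E (u i) (u i))\<^sup>2 = dotp E (u i) (u i)"
proof -
  have "dotp E (u i) (u i) = 0 \<or> dotp E (u i) (u i) = 1" using assms by (auto simp: onz_def)
  then show "dotp E (u i) (u i) \<le> 1" "(dotp E (u i) (u i))\<^sup>2 = dotp E (u i) (u i)" by auto
qed (use assms in \<open>auto simp: onz_def\<close>)

lemma onz_dotp_lincomb:
  assumes "onz E I u" "finite I" "j \<in> I"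
  shows "dotp E (\<lambda>e. \<Sum>i\<in>I. c i * u i e) (u j) = c j * dotp E (u j) (u j)"
proof -
  have "dotp E (\<lambda>e. \<Sum>i\<in>I. c i * u i e) (u j) = (\<Sum>i\<in>I. c i * dotp E (u i) (u j))"
    by (simp add: dotp_linear)
  also have "\<dots> = (\<Sum>i\<in>I. if i = j then c j * dotp E (u j) (u j) else 0)"
    by (rule sum.cong) (use assms onzD(1)[OF assms(1)] in auto)
  finally show ?thesis using assms by simp
qed

lemma onz_norm_lincomb:
  assumes "onz E I u" "finite I"
  shows "dotp E (\<lambda>e. \<Sum>i\<in>I. c i * u i e) (\<lambda>e. \<Sum>i\<in>I. c i * u i e) =
    (\<Sum>i\<in>I. (c i)\<^sup>2 * dotp E (u i) (u i))"
proof -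
  have "dotp E (\<lambda>e. \<Sum>i\<in>I. c i * u i e) (\<lambda>e. \<Sum>i\<in>I. c i * u i e) =
     (\<Sum>j\<in>I. c j * dotp E (\<lambda>e. \<Sum>i\<in>I. c i * u i e) (u j))"
    by (subst dotp_sum_right) (simp add: dotp_scale_right)
  also have "\<dots> = (\<Sum>i\<in>I. (c i)\<^sup>2 * dotp E (u i) (u i))"
    by (rule sum.cong) (use assms in \<open>auto simp: onz_dotp_lincomb power2_eq_square\<close>)
  finally show ?thesis .
qed

lemma residual_norm:
  fixes x :: "'e \<Rightarrow> real"
  assumes "onz E I u" "finite I"
  defines "r \<equiv> \<lambda>e. x e - (\<Sum>i\<in>I. dotp E x (u i) * u i e)"
  shows "dotp E r r = dotp E x x - 2 * (\<Sum>i\<in>I. (dotp E x (u i))\<^sup>2) +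
     (\<Sum>i\<in>I. (dotp E x (u i))\<^sup>2 * dotp E (u i) (u i))"
proof -
  let ?s = "\<lambda>e. \<Sum>i\<in>I. dotp E x (u i) * u i e"
  have "dotp E r r = dotp E x x - 2 * dotp E x ?s + dotp E ?s ?s"
    unfolding r_def dotp_diff_left dotp_diff_right using dotp_commute[of E ?s x] by simp
  moreover have "dotp E x ?s = (\<Sum>i\<in>I. (dotp E x (u i))\<^sup>2)"
    by (subst dotp_sum_right) (simp add: dotp_scale_right power2_eq_square)
  ultimately show ?thesis using onz_norm_lincomb[OF assms(1,2)] by simp
qed

text \<open>
  The squared norm of the residual \<open>x - \<Sum> \<langle>x, u i\<rangle> u i\<close> is nonnegative.
\<close>

lemma bessel:
  assumes "onz E I u" "finite I"
  shows "(\<Sum>i\<in>I. (dotp E x (u i))\<^sup>2) \<le> dotp E x x"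
proof -
  have "(\<Sum>i\<in>I. (dotp E x (u i))\<^sup>2 * dotp E (u i) (u i)) \<le> (\<Sum>i\<in>I. (dotp E x (u i))\<^sup>2)"
    by (intro sum_mono mult_left_le) (use onzD(2)[OF assms(1)] in auto)
  moreover have "0 \<le> dotp E (\<lambda>e. x e - (\<Sum>i\<in>I. dotp E x (u i) * u i e))
      (\<lambda>e. x e - (\<Sum>i\<in>I. dotp E x (u i) * u i e))" by simp
  ultimately show ?thesis unfolding residual_norm[OF assms] by linarith
qed

lemma dotp_cauchy_schwarz: "\<bar>dotp E x y\<bar> \<le> L2_set x E * L2_set y E"
proof -
  have "\<bar>dotp E x y\<bar> \<le> (\<Sum>e\<in>E. \<bar>x e\<bar> * \<bar>y e\<bar>)"
    unfolding dotp_def by (rule order_trans[OF sum_abs]) (simp add: abs_mult)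
  then show ?thesis using L2_set_mult_ineq[of x y E] by linarith
qed

section \<open>The spectral theorem for symmetric matrices\<close>

definition onb :: "nat \<Rightarrow> nat \<Rightarrow> (nat \<Rightarrow> nat \<Rightarrow> real) \<Rightarrow> bool" where
  "onb n r v \<longleftrightarrow> (\<forall>i<r. \<forall>j<r. dotp {..<n} (v i) (v j) = (if i = j then 1 else 0))"

lemma onb_onz: "onb n r v \<Longrightarrow> onz {..<n} {..<r} v"
  by (auto simp: onb_def onz_def)

text \<open>
  The squared lengths of the residuals of the \<open>n\<close> coordinate vectors add up to \<open>n - r > 0\<close>, so one of these
  residuals can be normalized.
\<close>

lemma onb_extend:
  assumes "onb n r v" "r < n"
  shows "\<exists>w. (\<forall>i<r. dotp {..<n} w (v i) = 0) \<and> dotp {..<n} w w = 1 \<and> (\<forall>i\<ge>n. w i = 0)"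
proof -
  have o: "onz {..<n} {..<r} v" using onb_onz[OF assms(1)] .
  let ?e = "\<lambda>p q. if q = p then 1 else (0::real)"
  let ?res = "\<lambda>p e. ?e p e - (\<Sum>i<r. dotp {..<n} (?e p) (v i) * v i e)"
  have ev: "dotp {..<n} (?e p) y = y p" if "p < n" for p y
    using that by (simp add: dotp_def if_distrib[of "\<lambda>c. c * _"] cong: if_cong)
  have nr: "dotp {..<n} (?res p) (?res p) = 1 - (\<Sum>i<r. (v i p)\<^sup>2)" if "p < n" for p
    using residual_norm[OF o, of "?e p"] ev[OF that] assms(1) that by (simp add: onb_def)
  have "(\<Sum>p<n. dotp {..<n} (?res p) (?res p)) = (\<Sum>p<n. 1 - (\<Sum>i<r. (v i p)\<^sup>2))"
    by (rule sum.cong) (use nr in auto)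
  also have "\<dots> = real n - (\<Sum>i<r. \<Sum>p<n. (v i p)\<^sup>2)"
    unfolding sum_subtractf by (subst sum.swap) simp
  also have "(\<Sum>i<r. \<Sum>p<n. (v i p)\<^sup>2) = (\<Sum>i<r. dotp {..<n} (v i) (v i))"
    by (simp add: dotp_def power2_eq_square)
  also have "\<dots> = real r" using assms(1) by (simp add: onb_def)
  finally have "(\<Sum>p<n. dotp {..<n} (?res p) (?res p)) > 0" using assms(2) by simp
  then obtain p where p: "p < n" "dotp {..<n} (?res p) (?res p) > 0"
    by (meson lessThan_iff not_le sum_nonpos)
  define c where "c = inverse (sqrt (dotp {..<n} (?res p) (?res p)))"
  define w where "w = (\<lambda>q. if q < n then c * ?res p q else 0)"
  have wd: "dotp {..<n} w y = c * dotp {..<n} (?res p) y" for y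
    unfolding dotp_scale_left[symmetric] unfolding dotp_def w_def by (rule sum.cong) auto
  have "dotp {..<n} w (v i) = 0" if "i < r" for i
  proof -
    have "dotp {..<n} (v i) (v i) = 1" using assms(1) that by (simp add: onb_def)
    then have "dotp {..<n} (?res p) (v i) = 0"
      unfolding dotp_diff_left using onz_dotp_lincomb[OF o _, of i] that by simp
    then show ?thesis by (simp add: wd)
  qed
  moreover have "dotp {..<n} w w = 1"
  proof -
    have "inverse (sqrt D) * (inverse (sqrt D) * D) = 1" if "D > 0" for D
      using that by (simp add: field_simps)
    from this[OF p(2)] have "c * (c * dotp {..<n} (?res p) (?res p)) = 1" unfolding c_def .
    moreover have "dotp {..<n} w w = c * (c * dotp {..<n} (?res p) (?res p))"
      using wd[of w] wd[of "?res p"] dotp_commute[of "{..<n}" "?res p" w] by simp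
    ultimately show ?thesis by simp
  qed
  ultimately show ?thesis by (intro exI[of _ w]) (auto simp: w_def)
qed

lemma compact_unit_sphere_perp:
  "compact {w :: nat \<Rightarrow> real. (\<forall>i\<in>{..<r}. dotp {..<n} w (v i) = 0) \<and> dotp {..<n} w w = 1 \<and> (\<forall>i\<in>{n..}. w i = 0)}"
    (is "compact ?S")
proof -
  let ?B = "PiE UNIV (\<lambda>i::nat. if i < n then {-1..1::real} else {0})"
  have B: "compact ?B" 
    using compactin_PiE[of "\<lambda>_. euclidean" UNIV "\<lambda>i::nat. if i < n then {-1..1::real} else {0}"]
    by (auto simp: euclidean_product_topology)
  have c: "continuous_on UNIV (\<lambda>w::nat\<Rightarrow>real. w i)" for i by simp
  have "closed {w. dotp {..<n} w (v i) = 0}" for i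
    unfolding dotp_def by (intro closed_Collect_eq continuous_intros c)
  moreover have "closed {w. dotp {..<n} w w = 1}"
    unfolding dotp_def by (intro closed_Collect_eq continuous_intros c)
  moreover have "closed {w::nat \<Rightarrow> real. w i = 0}" for i
    by (intro closed_Collect_eq continuous_intros c)
  moreover have "?S = (\<Inter>i\<in>{..<r}. {w. dotp {..<n} w (v i) = 0}) \<inter> {w. dotp {..<n} w w = 1} \<inter>
      (\<Inter>i\<in>{n..}. {w. w i = 0})"
    by blast
  ultimately have S: "closed ?S" by (simp only:) (intro closed_Int closed_INT ballI)
  have "w \<in> ?B" if "w \<in> ?S" for w
  proof -
    have "w i \<in> {-1..1}" if "i < n" for i
    proof -
      have "w i * w i \<le> dotp {..<n} w w" unfolding dotp_def
        using that by (intro member_le_sum) auto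
      then have "(w i)\<^sup>2 \<le> 1\<^sup>2" using \<open>w \<in> ?S\<close> by (simp add: power2_eq_square)
      then have "\<bar>w i\<bar> \<le> 1" using abs_le_square_iff[of "w i" 1] by simp
      then show ?thesis by auto
    qed
    then show ?thesis using that by auto
  qed
  then have "?B \<inter> ?S = ?S" by blast
  then show ?thesis using compact_Int_closed[OF B S] by simp
qed

definition app :: "nat \<Rightarrow> (nat \<times> nat \<Rightarrow> real) \<Rightarrow> (nat \<Rightarrow> real) \<Rightarrow> nat \<Rightarrow> real" where
  "app N h y p = (\<Sum>q<N. h (p, q) * y q)"

text \<open>
  A maximizer \<open>w\<close> of the Rayleigh quotient on the unit sphere of the orthogonal complement of the
  eigenvectors found so far is an eigenvector: the residual \<open>g = a w - l w\<close> lies in that complement, and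
  moving from \<open>w\<close> in direction \<open>g\<close> would increase the quotient at first order if \<open>g \<noteq> 0\<close>.
\<close>

lemma symmetric_eigenvector_extend:
  assumes sym: "\<And>p q. p < n \<Longrightarrow> q < n \<Longrightarrow> a (p, q) = a (q, p)"
    and v: "onb n r v" "r < n"
    and eig: "\<And>i p. i < r \<Longrightarrow> p < n \<Longrightarrow> app n a (v i) p = d i * v i p"
  shows "\<exists>w l. (\<forall>i<r. dotp {..<n} w (v i) = 0) \<and> dotp {..<n} w w = 1 \<and>
     (\<forall>p<n. app n a w p = l * w p)"
proof -
  let ?D = "dotp {..<n}"
  define S where "S = {w. (\<forall>i\<in>{..<r}. ?D w (v i) = 0) \<and> ?D w w = 1 \<and> (\<forall>i\<in>{n..}. w i = 0)}"
  have ne: "S \<noteq> {}" using onb_extend[OF v] by (auto simp: S_def)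
  have cp: "compact S" unfolding S_def by (rule compact_unit_sphere_perp)
  have [continuous_intros]: "continuous_on X (\<lambda>w::nat\<Rightarrow>real. w i)" for i X
    by (rule continuous_on_subset[of UNIV]) simp_all
  have "continuous_on S (\<lambda>w. ?D w (app n a w))"
    unfolding dotp_def app_def by (intro continuous_intros)
  then obtain w where w: "w \<in> S" and mx: "\<And>z. z \<in> S \<Longrightarrow> ?D z (app n a z) \<le> ?D w (app n a w)"
    using continuous_attains_sup[OF cp ne] by blast
  define l where "l = ?D w (app n a w)"
  have selfadj: "?D x (app n a y) = ?D (app n a x) y" for x y
  proof -
    have "?D x (app n a y) = (\<Sum>p<n. \<Sum>q<n. x p * (a (p, q) * y q))"
      by (simp add: dotp_def app_def sum_distrib_left)
    also have "\<dots> = (\<Sum>q<n. \<Sum>p<n. x p * (a (p, q) * y q))" by (rule sum.swap)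
    also have "\<dots> = (\<Sum>q<n. \<Sum>p<n. (a (q, p) * x p) * y q)"
      by (intro sum.cong refl) (use sym in auto)
    also have "\<dots> = ?D (app n a x) y" by (simp add: dotp_def app_def sum_distrib_right)
    finally show ?thesis .
  qed
  have app_lin: "app n a (\<lambda>q. x q + t * y q) p = app n a x p + t * app n a y p" for x y t p
    by (simp add: app_def algebra_simps sum.distrib sum_distrib_left)
  have perp: "?D x x * l \<ge> ?D x (app n a x)" if "\<And>i. i < r \<Longrightarrow> ?D x (v i) = 0" for x
  proof (cases "?D x x = 0")
    case True
    then show ?thesis using dotp_zero_left[of "{..<n}" x] by simp
  next
    case False
    define c where "c = inverse (L2_set x {..<n})"
    define z where "z = (\<lambda>q. if q < n then c * x q else 0)"
    have c: "c * c * ?D x x = 1" "c > 0"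
      using False unfolding dotp_self c_def
      by (auto simp: power2_eq_square field_simps order_less_le)
    have zd: "?D z y = c * ?D x y" for y
      unfolding dotp_scale_left[symmetric] unfolding dotp_def z_def by (rule sum.cong) auto
    have za: "app n a z = (\<lambda>p. c * app n a x p)"
      unfolding app_def z_def sum_distrib_left by (intro ext sum.cong) auto
    have "?D z z = c * (c * ?D x x)" using zd[of z] zd[of x] dotp_commute[of "{..<n}" x z] by simp
    then have "z \<in> S" using c that by (auto simp: S_def zd) (simp add: z_def)
    then have "?D z (app n a z) \<le> l" using mx by (simp add: l_def)
    then have "c * c * ?D x (app n a x) \<le> c * c * ?D x x * l"
      unfolding c by (simp add: zd za dotp_scale_right mult.assoc)
    then show ?thesis using c(2) by (simp add: mult.assoc)
  qed
  define g where "g = (\<lambda>p. app n a w p - l * w p)"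
  have wS: "\<And>i. i < r \<Longrightarrow> ?D w (v i) = 0" "?D w w = 1" using w by (auto simp: S_def)
  have gv: "?D g (v i) = 0" if "i < r" for i
  proof -
    have "?D (app n a w) (v i) = ?D w (app n a (v i))" by (rule selfadj[symmetric])
    also have "\<dots> = ?D w (\<lambda>p. d i * v i p)"
      unfolding dotp_def by (rule sum.cong) (use eig that in auto)
    also have "\<dots> = 0" using wS that by (simp add: dotp_scale_right)
    finally show ?thesis using wS that by (simp add: g_def dotp_linear)
  qed
  have quad: "2 * t * ?D g g \<le> t\<^sup>2 * (l * ?D g g - ?D g (app n a g))" for t
  proof -
    have "?D (\<lambda>q. w q + t * g q) (\<lambda>q. w q + t * g q) * l \<ge>
       ?D (\<lambda>q. w q + t * g q) (app n a (\<lambda>q. w q + t * g q))"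
      by (rule perp) (use wS gv in \<open>simp add: dotp_linear\<close>)
    moreover have "?D (\<lambda>q. w q + t * g q) (\<lambda>q. w q + t * g q) = 1 + 2 * t * ?D w g + t\<^sup>2 * ?D g g"
      using wS dotp_commute[of _ g w] by (simp add: dotp_linear algebra_simps power2_eq_square)
    moreover have "?D (\<lambda>q. w q + t * g q) (app n a (\<lambda>q. w q + t * g q)) =
       l + 2 * t * ?D g (app n a w) + t\<^sup>2 * ?D g (app n a g)"
    proof -
      have "?D w (app n a g) = ?D g (app n a w)"
        using selfadj[of w g] dotp_commute[of "{..<n}" "app n a w" g] by simp
      then show ?thesis
        unfolding app_lin by (simp add: dotp_linear algebra_simps power2_eq_square l_def)
    qed
    moreover have "?D g (app n a w) = ?D g g + l * ?D w g"
    proof -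
      have "app n a w = (\<lambda>p. g p + l * w p)" by (simp add: g_def)
      then have "?D g (app n a w) = ?D g (\<lambda>p. g p + l * w p)" by simp
      then show ?thesis using dotp_commute[of "{..<n}" g w] by (simp add: dotp_add_right dotp_scale_right)
    qed
    ultimately show ?thesis by (simp add: algebra_simps)
  qed
  have "?D g g = 0"
  proof (rule ccontr)
    assume "?D g g \<noteq> 0"
    then have G: "?D g g > 0" by (simp add: order_less_le)
    define C where "C = l * ?D g g - ?D g (app n a g)"
    \<comment> \<open>a step so short that the second order term cannot compensate\<close>
    define t where "t = ?D g g / (\<bar>C\<bar> + 1)"
    have t: "t > 0" using G by (simp add: t_def)
    have "2 * t * ?D g g \<le> t * (t * C)" using quad[of t] by (simp add: C_def power2_eq_square mult.assoc)
    then have "t * (2 * ?D g g) \<le> t * (t * C)" by (simp only: mult_ac)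
    then have "2 * ?D g g \<le> t * C" using t by simp
    also have "\<dots> \<le> t * (\<bar>C\<bar> + 1)" using t by (intro mult_left_mono) auto
    also have "\<dots> = ?D g g" by (simp add: t_def)
    finally show False using G by simp
  qed
  then have "app n a w p = l * w p" if "p < n" for p
    using dotp_zero_imp[of "{..<n}" g p] that by (simp add: g_def)
  then show ?thesis using wS by blast
qed

lemma symmetric_eigenbasis:
  assumes sym: "\<And>p q. p < n \<Longrightarrow> q < n \<Longrightarrow> a (p, q) = a (q, p)" and "r \<le> n"
  shows "\<exists>v d. onb n r v \<and> (\<forall>i<r. \<forall>p<n. app n a (v i) p = d i * v i p)"
  using \<open>r \<le> n\<close>
proof (induction r)
  case 0
  show ?case by (auto simp: onb_def)
next
  case (Suc r)
  then obtain v d where v: "onb n r v" "\<And>i p. i < r \<Longrightarrow> p < n \<Longrightarrow> app n a (v i) p = d i * v i p"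
    by auto
  obtain w l where w: "\<forall>i<r. dotp {..<n} w (v i) = 0" "dotp {..<n} w w = 1"
     "\<forall>p<n. app n a w p = l * w p"
    using symmetric_eigenvector_extend[of n a r v d] sym v Suc.prems by auto
  have "onb n (Suc r) (v(r := w))"
    using v(1) w(1,2) unfolding onb_def by (auto simp: less_Suc_eq dotp_commute[of _ "v _" w])
  moreover have "\<forall>i<Suc r. \<forall>p<n. app n a ((v(r := w)) i) p = (d(r := l)) i * (v(r := w)) i p"
    using v(2) w(3) by (auto simp: less_Suc_eq)
  ultimately show ?case by blast
qed

section \<open>Singular value decompositions\<close>

definition ons :: "'e set \<Rightarrow> 'i set \<Rightarrow> ('i \<Rightarrow> 'e \<Rightarrow> real) \<Rightarrow> bool" where
  "ons E I u \<longleftrightarrow> (\<forall>i\<in>I. \<forall>j\<in>I. dotp E (u i) (u j) = (if i = j then 1 else 0))"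

lemma ons_onz: "ons E I u \<Longrightarrow> onz E I u"
  by (auto simp: ons_def onz_def)

definition bil :: "nat \<Rightarrow> nat \<Rightarrow> (nat \<times> nat \<Rightarrow> real) \<Rightarrow> (nat \<Rightarrow> real) \<Rightarrow> (nat \<Rightarrow> real) \<Rightarrow> real" where
  "bil n N h x y = (\<Sum>p<n. \<Sum>q<N. h (p, q) * x p * y q)"

text \<open>
  Only positive singular values are listed, so the index set has as many elements as the rank.
\<close>

definition is_svd :: "nat \<Rightarrow> nat \<Rightarrow> (nat \<times> nat \<Rightarrow> real) \<Rightarrow> nat set \<Rightarrow> (nat \<Rightarrow> real) \<Rightarrow>
    (nat \<Rightarrow> nat \<Rightarrow> real) \<Rightarrow> (nat \<Rightarrow> nat \<Rightarrow> real) \<Rightarrow> bool" where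
  "is_svd n N h J \<sigma> u v \<longleftrightarrow> finite J \<and> ons {..<n} J u \<and> ons {..<N} J v \<and> (\<forall>j\<in>J. 0 < \<sigma> j) \<and>
     (\<forall>p<n. \<forall>q<N. h (p, q) = (\<Sum>j\<in>J. \<sigma> j * u j p * v j q))"

lemma bil_eq_dotp: "bil n N h x y = dotp {..<n} x (app N h y)"
  by (simp add: bil_def dotp_def app_def sum_distrib_left mult_ac)

lemma bil_rank_one_sum:
  assumes "\<And>p q. p < n \<Longrightarrow> q < N \<Longrightarrow> h (p, q) = (\<Sum>j\<in>J. s j * u j p * v j q)"
  shows "bil n N h x y = (\<Sum>j\<in>J. s j * dotp {..<n} x (u j) * dotp {..<N} (v j) y)"
proof -
  have "bil n N h x y = (\<Sum>p<n. \<Sum>q<N. \<Sum>j\<in>J. s j * (x p * u j p) * (v j q * y q))"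
    unfolding bil_def by (intro sum.cong refl) (auto simp: assms sum_distrib_left sum_distrib_right mult_ac)
  also have "\<dots> = (\<Sum>p<n. \<Sum>j\<in>J. \<Sum>q<N. s j * (x p * u j p) * (v j q * y q))"
    by (intro sum.cong refl sum.swap)
  also have "\<dots> = (\<Sum>j\<in>J. \<Sum>p<n. \<Sum>q<N. s j * (x p * u j p) * (v j q * y q))"
    by (rule sum.swap)
  also have "\<dots> = (\<Sum>j\<in>J. s j * dotp {..<n} x (u j) * dotp {..<N} (v j) y)"
    by (simp add: dotp_def sum_distrib_left sum_distrib_right mult_ac)
  finally show ?thesis .
qed

text \<open>
  The matrix of the eigenvectors is orthogonal and diagonalizes \<open>A\<close>; the second claim is the
  orthogonality of its rows.
\<close>

lemma char_poly_of_eigenbasis: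
  fixes A :: "real mat"
  assumes A: "A \<in> carrier_mat n n" and v: "onb n n v"
    and eig: "\<And>i p. i < n \<Longrightarrow> p < n \<Longrightarrow> app n (($$) A) (v i) p = d i * v i p"
  shows "char_poly A = (\<Prod>i\<leftarrow>[0..<n]. [:- d i, 1:])"
    and "\<And>p q. p < n \<Longrightarrow> q < n \<Longrightarrow> (\<Sum>i<n. v i p * v i q) = (if p = q then 1 else 0)"
proof -
  define P where "P = Matrix.mat n n (\<lambda>(i, j). v j i)"
  define D where "D = Matrix.mat n n (\<lambda>(i, j). if i = j then d i else 0)"
  have car: "P \<in> carrier_mat n n" "D \<in> carrier_mat n n" "transpose_mat P \<in> carrier_mat n n"
    by (auto simp: P_def D_def)
  have 1: "transpose_mat P * P = 1\<^sub>m n"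
  proof (rule eq_matI)
    fix i j assume "i < dim_row (1\<^sub>m n :: real mat)" "j < dim_col (1\<^sub>m n :: real mat)"
    then have ij: "i < n" "j < n" by auto
    then have "(transpose_mat P * P) $$ (i, j) = dotp {..<n} (v i) (v j)"
      by (simp add: P_def scalar_prod_def dotp_def lessThan_atLeast0)
    then show "(transpose_mat P * P) $$ (i, j) = 1\<^sub>m n $$ (i, j)"
      using v ij by (simp add: onb_def)
  qed (auto simp: P_def)
  have 2: "P * transpose_mat P = 1\<^sub>m n"
    by (rule mat_mult_left_right_inverse[OF _ _ 1]) (use car in auto)
  have 3: "A * P = P * D"
  proof (rule eq_matI)
    fix i j assume "i < dim_row (P * D)" "j < dim_col (P * D)"
    then have ij: "i < n" "j < n" using car by auto
    have "(A * P) $$ (i, j) = app n (($$) A) (v j) i"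
      using A ij by (simp add: P_def scalar_prod_def app_def lessThan_atLeast0)
    also have "\<dots> = d j * v j i" using eig ij by simp
    also have "\<dots> = (\<Sum>k<n. if k = j then v j i * d j else 0)" using ij by simp
    also have "\<dots> = (\<Sum>k<n. v k i * (if k = j then d k else 0))" by (rule sum.cong) auto
    also have "\<dots> = (P * D) $$ (i, j)"
      using ij by (simp add: P_def D_def scalar_prod_def lessThan_atLeast0 cong: if_cong)
    finally show "(A * P) $$ (i, j) = (P * D) $$ (i, j)" .
  qed (use A car in auto)
  have "A = A * (P * transpose_mat P)" unfolding 2 using A by simp
  also have "\<dots> = A * P * transpose_mat P" by (rule assoc_mult_mat[symmetric, OF A car(1) car(3)])
  also have "\<dots> = P * D * transpose_mat P" unfolding 3 ..
  finally have "similar_mat A D"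
    by (intro similar_matI[of A D P "transpose_mat P" n]) (use A car 1 2 in auto)
  then have "char_poly A = char_poly D" by (rule char_poly_similar)
  also have "upper_triangular D" by (auto simp: D_def)
  then have "char_poly D = (\<Prod>a\<leftarrow>diag_mat D. [:- a, 1:])"
    using char_poly_upper_triangular[OF car(2)] by blast
  also have "diag_mat D = map d [0..<n]"
    by (auto simp: diag_mat_def D_def intro!: map_cong)
  finally show "char_poly A = (\<Prod>i\<leftarrow>[0..<n]. [:- d i, 1:])" by (simp add: comp_def)
  fix p q assume pq: "p < n" "q < n"
  have "(P * transpose_mat P) $$ (p, q) = (\<Sum>i<n. v i p * v i q)"
    using pq by (simp add: P_def scalar_prod_def lessThan_atLeast0)
  then show "(\<Sum>i<n. v i p * v i q) = (if p = q then 1 else 0)"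
    using pq unfolding 2 by simp
qed

lemma proots_linear_factors:
  fixes d :: "nat \<Rightarrow> real"
  shows "proots (\<Prod>i\<leftarrow>xs. [:- d i, 1:]) = mset (map d xs)"
proof (induction xs)
  case (Cons x xs)
  have "(\<Prod>i\<leftarrow>xs. [:- d i, 1:]) \<noteq> 0" by (auto simp: prod_list_zero_iff)
  then show ?case using Cons by (simp add: proots_mult del: mult_pCons_left)
qed simp

text \<open>
  The eigenvectors \<open>v j\<close> of \<open>X\<^sup>T X\<close> are mapped by \<open>X\<close> to orthogonal vectors of squared length equal to
  the eigenvalue. Normalizing those of positive length gives the left singular vectors, and expanding the
  rows of \<open>X\<close> in the basis \<open>v\<close> gives the decomposition. The multiset of roots of the
  characteristic polynomial consists of these eigenvalues, which identifies the nuclear norm.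
\<close>

theorem svd_exists:
  assumes X: "X \<in> carrier_mat n N"
  shows "\<exists>J \<sigma> u v. is_svd n N (($$) X) J \<sigma> u v \<and> schatten1_norm X = (\<Sum>j\<in>J. \<sigma> j)"
proof -
  define A where "A = transpose_mat X * X"
  have A: "A \<in> carrier_mat N N" using X by (simp add: A_def)
  have Aent: "A $$ (p, q) = (\<Sum>r<n. X $$ (r, p) * X $$ (r, q))" if "p < N" "q < N" for p q
    using that X by (simp add: A_def scalar_prod_def lessThan_atLeast0)
  have "\<exists>v d. onb N N v \<and> (\<forall>i<N. \<forall>p<N. app N (($$) A) (v i) p = d i * v i p)"
    by (rule symmetric_eigenbasis) (auto simp: Aent mult.commute)
  then obtain v d where v: "onb N N v"
    and eig: "\<And>i p. i < N \<Longrightarrow> p < N \<Longrightarrow> app N (($$) A) (v i) p = d i * v i p" by blast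
  define Xv where "Xv j = app N (($$) X) (v j)" for j
  have XX: "dotp {..<n} (Xv i) (Xv j) = (if i = j then d j else 0)" if "i < N" "j < N" for i j
  proof -
    have "dotp {..<n} (Xv i) (Xv j) =
        (\<Sum>r<n. \<Sum>p<N. \<Sum>q<N. v i p * (X $$ (r, p) * X $$ (r, q) * v j q))"
      unfolding dotp_def Xv_def app_def sum_product
      by (rule sum.cong[OF refl], rule sum.cong[OF refl], rule sum.cong[OF refl]) simp
    also have "\<dots> = (\<Sum>p<N. \<Sum>r<n. \<Sum>q<N. v i p * (X $$ (r, p) * X $$ (r, q) * v j q))"
      by (rule sum.swap)
    also have "\<dots> = (\<Sum>p<N. \<Sum>q<N. \<Sum>r<n. v i p * (X $$ (r, p) * X $$ (r, q) * v j q))"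
      by (rule sum.cong[OF refl], rule sum.swap)
    also have "\<dots> = (\<Sum>p<N. v i p * (\<Sum>q<N. A $$ (p, q) * v j q))"
    proof (rule sum.cong[OF refl])
      fix p assume "p \<in> {..<N}"
      then have "A $$ (p, q) * v j q = (\<Sum>r<n. X $$ (r, p) * X $$ (r, q) * v j q)" if "q < N" for q
        using that by (simp add: Aent sum_distrib_right)
      then show "(\<Sum>q<N. \<Sum>r<n. v i p * (X $$ (r, p) * X $$ (r, q) * v j q)) =
          v i p * (\<Sum>q<N. A $$ (p, q) * v j q)"
        by (simp add: sum_distrib_left)
    qed
    also have "\<dots> = (\<Sum>p<N. v i p * (d j * v j p))"
      by (rule sum.cong[OF refl]) (use eig that in \<open>simp add: app_def\<close>)
    also have "\<dots> = d j * dotp {..<N} (v i) (v j)"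
      by (simp add: dotp_def sum_distrib_left mult_ac)
    finally show ?thesis using v that by (auto simp: onb_def)
  qed
  have d0: "0 \<le> d j" if "j < N" for j
    using XX[OF that that] dotp_self_nonneg[of "{..<n}" "Xv j"] by simp
  define \<sigma> where "\<sigma> j = sqrt (d j)" for j
  define J where "J = {j. j < N \<and> 0 < \<sigma> j}"
  define u where "u j p = Xv j p / \<sigma> j" for j p
  have d\<sigma>: "d j = \<sigma> j * \<sigma> j" if "j < N" for j using d0[OF that] by (simp add: \<sigma>_def)
  have "ons {..<n} J u"
  proof -
    have "dotp {..<n} (u i) (u j) = dotp {..<n} (Xv i) (Xv j) / (\<sigma> i * \<sigma> j)" for i j
      by (simp add: dotp_def u_def sum_divide_distrib)
    then show ?thesis using XX d\<sigma> by (auto simp: ons_def J_def)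
  qed
  moreover have "ons {..<N} J v" using v by (auto simp: ons_def onb_def J_def)
  moreover have "X $$ (p, q) = (\<Sum>j\<in>J. \<sigma> j * u j p * v j q)" if "p < n" "q < N" for p q
  proof -
    have Xv0: "Xv j p = 0" if "j < N" "j \<notin> J" for j
    proof -
      have "\<sigma> j = 0" using that d0[of j] by (auto simp: J_def \<sigma>_def)
      then have "dotp {..<n} (Xv j) (Xv j) = 0" using XX that(1) d\<sigma>[OF that(1)] by simp
      then show ?thesis using dotp_zero_imp[of "{..<n}"] \<open>p < n\<close> by blast
    qed
    have "X $$ (p, q) = (\<Sum>r<N. if r = q then X $$ (p, r) else 0)" using that by simp
    also have "\<dots> = (\<Sum>r<N. X $$ (p, r) * (\<Sum>j<N. v j r * v j q))"
      using char_poly_of_eigenbasis(2)[OF A v eig] that by (intro sum.cong refl) auto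
    also have "\<dots> = (\<Sum>r<N. \<Sum>j<N. X $$ (p, r) * v j r * v j q)"
      by (simp add: sum_distrib_left mult_ac)
    also have "\<dots> = (\<Sum>j<N. \<Sum>r<N. X $$ (p, r) * v j r * v j q)" by (rule sum.swap)
    also have "\<dots> = (\<Sum>j<N. Xv j p * v j q)"
      by (simp add: Xv_def app_def sum_distrib_right)
    also have "\<dots> = (\<Sum>j\<in>J. Xv j p * v j q)"
      by (rule sum.mono_neutral_right) (auto simp: J_def dest: Xv0[unfolded J_def, simplified])
    also have "\<dots> = (\<Sum>j\<in>J. \<sigma> j * u j p * v j q)"
      by (rule sum.cong) (auto simp: u_def J_def)
    finally show ?thesis .
  qed
  ultimately have "is_svd n N (($$) X) J \<sigma> u v" by (auto simp: is_svd_def J_def)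
  moreover have "schatten1_norm X = (\<Sum>j\<in>J. \<sigma> j)"
  proof -
    have cp: "char_poly A = (\<Prod>i\<leftarrow>[0..<N]. [:- d i, 1:])"
      by (rule char_poly_of_eigenbasis(1)[OF A v eig])
    have "proots (char_poly A) = mset (map d [0..<N])"
      unfolding cp by (rule proots_linear_factors)
    then have "schatten1_norm X = sum_mset (image_mset sqrt (mset (map d [0..<N])))"
      by (simp only: schatten1_norm_def singular_values_def A_def)
    also have "\<dots> = (\<Sum>j\<leftarrow>[0..<N]. \<sigma> j)"
    proof -
      have "sum_mset (image_mset sqrt (mset (map d xs))) = (\<Sum>j\<leftarrow>xs. \<sigma> j)" for xs
        by (induction xs) (auto simp: \<sigma>_def)
      then show ?thesis .
    qed
    also have "\<dots> = (\<Sum>j<N. \<sigma> j)" by (simp add: interv_sum_list_conv_sum_set_nat lessThan_atLeast0)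
    also have "\<dots> = (\<Sum>j\<in>J. \<sigma> j)"
      by (rule sum.mono_neutral_right) (use d0 in \<open>auto simp: J_def \<sigma>_def order_less_le\<close>)
    finally show ?thesis .
  qed
  ultimately show ?thesis by blast
qed

lemma gram_schmidt_onz:
  fixes f :: "'i \<Rightarrow> 'e \<Rightarrow> real"
  assumes "finite I" "finite E"
  shows "\<exists>w c. onz E I w \<and> (\<forall>i\<in>I. \<forall>e\<in>E. f i e = (\<Sum>j\<in>I. c i j * w j e))"
  using assms(1)
proof (induction I)
  case empty
  show ?case by (auto simp: onz_def)
next
  case (insert i I)
  then obtain w c where w: "onz E I w"
    and c: "\<And>l e. l \<in> I \<Longrightarrow> e \<in> E \<Longrightarrow> f l e = (\<Sum>j\<in>I. c l j * w j e)" by blast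
  define r where "r e = f i e - (\<Sum>j\<in>I. dotp E (f i) (w j) * w j e)" for e
  have rp: "dotp E r (w j) = 0" if "j \<in> I" for j
  proof -
    have "dotp E r (w j) = dotp E (f i) (w j) - dotp E (f i) (w j) * dotp E (w j) (w j)"
      unfolding r_def dotp_diff_left using onz_dotp_lincomb[OF w insert.hyps(1) that] by simp
    moreover have "dotp E (w j) (w j) = 0 \<or> dotp E (w j) (w j) = 1"
      using w that by (auto simp: onz_def)
    ultimately show ?thesis
      using dotp_zero_left[OF assms(2), of "w j" "f i"] dotp_commute[of E "f i" "w j"] by auto
  qed
  define t where "t = L2_set r E"
  define z where "z e = r e / t" for e
  have zz: "dotp E z y = dotp E r y / t" for y by (simp add: dotp_def z_def sum_divide_distrib)
  have z01: "dotp E z z \<in> {0, 1}"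
  proof -
    have "dotp E z z = dotp E r r / (t * t)"
      using zz[of z] zz[of r] dotp_commute[of E r z] by simp
    then show ?thesis by (cases "t = 0") (auto simp: t_def dotp_self power2_eq_square)
  qed
  have rz: "r e = t * z e" if "e \<in> E" for e
  proof (cases "t = 0")
    case True
    then show ?thesis using dotp_zero_imp[OF assms(2), of r e] that by (simp add: t_def dotp_self)
  qed (simp add: z_def)
  define w' where "w' = w(i := z)"
  define c' where "c' l j = (if l = i then (if j = i then t else dotp E (f i) (w j))
      else (if j = i then 0 else c l j))" for l j
  have w': "w' i = z" "\<And>j. j \<in> I \<Longrightarrow> w' j = w j" using insert.hyps by (auto simp: w'_def)
  have zw: "dotp E z (w j) = 0" "dotp E (w j) z = 0" if "j \<in> I" for j
    using rp[OF that] dotp_commute[of E "w j" z] by (auto simp: zz)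
  have "onz E (insert i I) w'"
    unfolding onz_def
  proof (intro conjI ballI impI)
    show "dotp E (w' l) (w' l) \<in> {0, 1}" if "l \<in> insert i I" for l
      using that z01 w by (auto simp: w' onz_def)
    show "dotp E (w' l) (w' m) = 0" if "l \<in> insert i I" "m \<in> insert i I" "l \<noteq> m" for l m
      using that zw onzD(1)[OF w] by (auto simp: w')
  qed
  moreover have "f l e = (\<Sum>j\<in>insert i I. c' l j * w' j e)" if "l \<in> insert i I" "e \<in> E" for l e
  proof -
    have s: "(\<Sum>j\<in>I. c' l j * w' j e) = (\<Sum>j\<in>I. (if l = i then dotp E (f i) (w j) else c l j) * w j e)"
      by (rule sum.cong) (use insert.hyps w' in \<open>auto simp: c'_def\<close>)
    have "(\<Sum>j\<in>insert i I. c' l j * w' j e) = c' l i * z e +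
        (\<Sum>j\<in>I. (if l = i then dotp E (f i) (w j) else c l j) * w j e)"
      using insert.hyps s by (simp add: w')
    then show ?thesis
      using that c[of l e] rz[OF that(2)] by (cases "l = i") (auto simp: c'_def r_def)
  qed
  ultimately show ?case by blast
qed

text \<open>
  A dimension count by double counting \<open>\<Sum>\<^sub>j \<Sum>\<^sub>i \<langle>w i, u j\<rangle>\<^sup>2\<close>, where \<open>w\<close> is an orthogonalized family of
  generators: the inner sum is 1 for every \<open>j\<close> by Parseval and at most 1 for every \<open>i\<close> by Bessel.
\<close>

lemma card_ons_le_generators:
  assumes fin: "finite I" "finite E" "finite J" and u: "ons E J u"
    and span: "\<And>j e. j \<in> J \<Longrightarrow> e \<in> E \<Longrightarrow> u j e = (\<Sum>i\<in>I. c j i * f i e)"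
  shows "card J \<le> card I"
proof -
  obtain w b where w: "onz E I w" and b: "\<And>i e. i \<in> I \<Longrightarrow> e \<in> E \<Longrightarrow> f i e = (\<Sum>l\<in>I. b i l * w l e)"
    using gram_schmidt_onz[OF fin(1,2), of f] by blast
  define a where "a j l = (\<Sum>i\<in>I. c j i * b i l)" for j l
  have ua: "u j e = (\<Sum>l\<in>I. a j l * w l e)" if "j \<in> J" "e \<in> E" for j e
  proof -
    have "u j e = (\<Sum>i\<in>I. \<Sum>l\<in>I. c j i * b i l * w l e)"
      using span[OF that] b that by (simp add: sum_distrib_left mult.assoc)
    also have "\<dots> = (\<Sum>l\<in>I. \<Sum>i\<in>I. c j i * b i l * w l e)" by (rule sum.swap)
    finally show ?thesis by (simp add: a_def sum_distrib_right)
  qed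
  have du: "dotp E (u j) y = dotp E (\<lambda>e. \<Sum>l\<in>I. a j l * w l e) y" if "j \<in> J" for j y
    unfolding dotp_def by (rule sum.cong) (use ua that in auto)
  have one: "(\<Sum>i\<in>I. (dotp E (w i) (u j))\<^sup>2) = 1" if "j \<in> J" for j
  proof -
    have "1 = dotp E (u j) (u j)" using u that by (simp add: ons_def)
    also have "\<dots> = dotp E (\<lambda>e. \<Sum>l\<in>I. a j l * w l e) (\<lambda>e. \<Sum>l\<in>I. a j l * w l e)"
      using du[OF that, of "u j"] du[OF that, of "\<lambda>e. \<Sum>l\<in>I. a j l * w l e"]
        dotp_commute[of E "u j" "\<lambda>e. \<Sum>l\<in>I. a j l * w l e"] by simp
    also have "\<dots> = (\<Sum>l\<in>I. (a j l)\<^sup>2 * dotp E (w l) (w l))"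
      by (rule onz_norm_lincomb[OF w fin(1)])
    also have "\<dots> = (\<Sum>l\<in>I. (dotp E (w l) (u j))\<^sup>2)"
    proof (rule sum.cong[OF refl])
      fix l assume l: "l \<in> I"
      have "dotp E (w l) (u j) = a j l * dotp E (w l) (w l)"
        using du[OF that, of "w l"] onz_dotp_lincomb[OF w fin(1) l, of "a j"] dotp_commute[of E "w l" "u j"]
        by simp
      then show "(a j l)\<^sup>2 * dotp E (w l) (w l) = (dotp E (w l) (u j))\<^sup>2"
        using onzD(3)[OF w l l] by (simp add: power_mult_distrib)
    qed
    finally show ?thesis by simp
  qed
  have "real (card J) = (\<Sum>j\<in>J. \<Sum>i\<in>I. (dotp E (w i) (u j))\<^sup>2)" using one by simp
  also have "\<dots> = (\<Sum>i\<in>I. \<Sum>j\<in>J. (dotp E (w i) (u j))\<^sup>2)" by (rule sum.swap)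
  also have "\<dots> \<le> (\<Sum>i\<in>I. 1)"
    using bessel[OF ons_onz[OF u] fin(3)] onzD(2)[OF w] by (intro sum_mono) (meson order_trans)
  finally show ?thesis by simp
qed

lemma svd_card_le_rank_one_terms:
  assumes svd: "is_svd n N h J \<sigma> u v" and "finite I"
    and h: "\<And>p q. p < n \<Longrightarrow> q < N \<Longrightarrow> h (p, q) = (\<Sum>i\<in>I. x i p * y i q)"
  shows "card J \<le> card I"
proof (rule card_ons_le_generators[of I "{..<n}" J u "\<lambda>j i. dotp {..<N} (y i) (v j) / \<sigma> j" x])
  fix j e assume j: "j \<in> J" and e: "e \<in> {..<n}"
  have J: "finite J" "ons {..<N} J v" "\<sigma> j > 0" using svd j by (auto simp: is_svd_def)
  have "app N h (v j) e = (\<Sum>q<N. \<Sum>l\<in>J. \<sigma> l * u l e * v l q * v j q)"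
    using svd e unfolding app_def is_svd_def by (intro sum.cong refl) (auto simp: sum_distrib_right)
  also have "\<dots> = (\<Sum>l\<in>J. \<sigma> l * u l e * dotp {..<N} (v l) (v j))"
    by (subst sum.swap) (simp add: dotp_def sum_distrib_left mult.assoc)
  also have "\<dots> = (\<Sum>l\<in>J. if l = j then \<sigma> l * u l e else 0)"
    by (rule sum.cong) (use J j in \<open>auto simp: ons_def\<close>)
  also have "\<dots> = \<sigma> j * u j e" using J j by simp
  finally have a: "app N h (v j) e = \<sigma> j * u j e" .
  have "app N h (v j) e = (\<Sum>q<N. \<Sum>i\<in>I. x i e * (y i q * v j q))"
    unfolding app_def using h e by (intro sum.cong refl) (auto simp: sum_distrib_left sum_distrib_right mult_ac)
  also have "\<dots> = (\<Sum>i\<in>I. x i e * dotp {..<N} (y i) (v j))"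
    by (subst sum.swap) (simp add: dotp_def sum_distrib_left)
  finally show "u j e = (\<Sum>i\<in>I. dotp {..<N} (y i) (v j) / \<sigma> j * x i e)"
    using a J(3) by (simp add: eq_divide_eq mult.commute flip: sum_divide_distrib)
qed (use assms in \<open>auto simp: is_svd_def\<close>)

text \<open>
  A maximal independent set of columns generates all columns.
\<close>

lemma (in vec_space) rank_factorization:
  assumes X: "X \<in> carrier_mat n nc"
  shows "\<exists>S a. finite S \<and> card S = rank X \<and>
     (\<forall>p<n. \<forall>q<nc. X $$ (p, q) = (\<Sum>s\<in>S. s $ p * a s q))"
proof -
  let ?C = "set (cols X)"
  have C: "?C \<subseteq> carrier_vec n" "finite ?C" using cols_dim[of X] carrier_matD(1)[OF X] by simp_all
  obtain S where S: "maximal S (\<lambda>T. T \<subseteq> ?C \<and> lin_indpt T)" "finite S"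
    using maximal_exists_superset[of ?C "(\<lambda>T. T \<subseteq> ?C \<and> lin_indpt T)" "{}"]
    by (auto simp: lin_dep_def)
  have SC: "S \<subseteq> ?C" "lin_indpt S" "S \<subseteq> carrier_vec n" using S C by (auto simp: maximal_def)
  have sp: "c \<in> span S" if "c \<in> ?C" for c
  proof (rule ccontr)
    assume n: "c \<notin> span S"
    then have "c \<notin> S" using span_mem[of S c] SC by auto
    have "lin_indpt (insert c S)"
      using lin_dep_iff_in_span[of S c] n SC C that \<open>c \<notin> S\<close> by auto
    then have "S = insert c S" using S(1) that SC unfolding maximal_def by blast
    then show False using \<open>c \<notin> S\<close> by blast
  qed
  have "\<exists>a. \<forall>p<n. X $$ (p, q) = (\<Sum>s\<in>S. s $ p * a s)" if q: "q < nc" for q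
  proof -
    have "col X q \<in> ?C" using q X by (auto simp: cols_def)
    then obtain a where a: "lincomb a S = col X q"
      using sp finite_in_span[OF S(2) SC(3)] by metis
    have "X $$ (p, q) = (\<Sum>s\<in>S. s $ p * a s)" if "p < n" for p
    proof -
      have "X $$ (p, q) = lincomb a S $ p" using a q X that by simp
      then show ?thesis using lincomb_index[OF that SC(3), of a] by (simp add: mult.commute)
    qed
    then show ?thesis by blast
  qed
  then obtain a where a: "\<And>p q. q < nc \<Longrightarrow> p < n \<Longrightarrow> X $$ (p, q) = (\<Sum>s\<in>S. s $ p * a q s)"
    by metis
  have "card S = rank X" using rank_card_indpt[OF X S(1)] by simp
  then show ?thesis using S(2) a by (intro exI[of _ S] exI[of _ "\<lambda>s q. a q s"]) auto
qed

lemma svd_card_le_rank: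
  assumes "X \<in> carrier_mat n N" "is_svd n N (($$) X) J \<sigma> u v"
  shows "card J \<le> vec_space.rank n X"
proof -
  obtain S a where S: "finite S" "card S = vec_space.rank n X"
     "\<forall>p<n. \<forall>q<N. X $$ (p, q) = (\<Sum>s\<in>S. s $ p * a s q)"
    using vec_space.rank_factorization[OF assms(1)] by blast
  then show ?thesis
    using svd_card_le_rank_one_terms[OF assms(2) S(1), of "\<lambda>s p. s $ p" a] by auto
qed

section \<open>The nuclear norm\<close>

text \<open>
  Bessel's inequality applied on both sides of the bilinear form.
\<close>

lemma frobenius_onz_le:
  assumes a: "onz {..<n} I a" and b: "onz {..<N} L b" and fin: "finite I" "finite L"
  shows "(\<Sum>i\<in>I. \<Sum>l\<in>L. (bil n N h (a i) (b l))\<^sup>2) \<le> (L2_set h ({..<n} \<times> {..<N}))\<^sup>2"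
proof -
  have "(\<Sum>i\<in>I. \<Sum>l\<in>L. (bil n N h (a i) (b l))\<^sup>2) =
      (\<Sum>l\<in>L. \<Sum>i\<in>I. (dotp {..<n} (app N h (b l)) (a i))\<^sup>2)"
    unfolding bil_eq_dotp dotp_commute[of _ "a _"] by (rule sum.swap)
  also have "\<dots> \<le> (\<Sum>l\<in>L. dotp {..<n} (app N h (b l)) (app N h (b l)))"
    by (intro sum_mono bessel[OF a fin(1)])
  also have "\<dots> = (\<Sum>p<n. \<Sum>l\<in>L. (dotp {..<N} (\<lambda>q. h (p, q)) (b l))\<^sup>2)"
    by (subst sum.swap) (simp add: dotp_def app_def power2_eq_square)
  also have "\<dots> \<le> (\<Sum>p<n. dotp {..<N} (\<lambda>q. h (p, q)) (\<lambda>q. h (p, q)))"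
    by (intro sum_mono bessel[OF b fin(2)])
  also have "\<dots> = (L2_set h ({..<n} \<times> {..<N}))\<^sup>2"
    by (simp add: dotp_def L2_set_def sum_nonneg sum.cartesian_product power2_eq_square)
  finally show ?thesis .
qed

lemma sum_le_sqrt_card:
  fixes x :: "'i \<Rightarrow> real"
  assumes "(\<Sum>i\<in>I. (x i)\<^sup>2) \<le> B\<^sup>2" "0 \<le> B" "real (card I) \<le> k"
  shows "(\<Sum>i\<in>I. x i) \<le> sqrt k * B"
proof -
  have "(\<Sum>i\<in>I. x i) \<le> (\<Sum>i\<in>I. \<bar>1\<bar> * \<bar>x i\<bar>)" by (intro sum_mono) auto
  also have "\<dots> \<le> L2_set (\<lambda>_. 1) I * L2_set x I" by (rule L2_set_mult_ineq)
  also have "\<dots> \<le> sqrt k * B"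
  proof (rule mult_mono)
    show "L2_set x I \<le> B" unfolding L2_set_def using assms real_le_lsqrt by (simp add: sum_nonneg)
  qed (use assms in \<open>auto simp: L2_set_def sum_nonneg intro: order_trans[of 0 "real (card I)"]\<close>)
  finally show ?thesis .
qed

lemma sum_mult_le_sqrt:
  fixes x y :: "'i \<Rightarrow> real"
  assumes "(\<Sum>i\<in>I. (x i)\<^sup>2) \<le> A" "(\<Sum>i\<in>I. (y i)\<^sup>2) \<le> B\<^sup>2" "0 \<le> B"
  shows "(\<Sum>i\<in>I. x i * y i) \<le> sqrt A * B"
proof -
  have "(\<Sum>i\<in>I. x i * y i) \<le> (\<Sum>i\<in>I. \<bar>x i\<bar> * \<bar>y i\<bar>)"
    by (intro sum_mono) (metis abs_ge_self abs_mult)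
  also have "\<dots> \<le> L2_set x I * L2_set y I" by (rule L2_set_mult_ineq)
  also have "\<dots> \<le> sqrt A * B"
  proof (rule mult_mono)
    show x: "L2_set x I \<le> sqrt A" unfolding L2_set_def using assms(1) by simp
    show "0 \<le> sqrt A" by (rule order_trans[OF L2_set_nonneg x])
    show "L2_set y I \<le> B" unfolding L2_set_def
      by (rule real_le_lsqrt[OF assms(3,2)])
  qed simp
  finally show ?thesis .
qed

lemma ons_pair_sum_le_1:
  assumes "onz E L a" "onz F L b" "finite L" "dotp E x x \<le> 1" "dotp F y y \<le> 1"
  shows "(\<Sum>l\<in>L. dotp E (a l) x * dotp F y (b l)) \<le> 1"
proof -
  have "(\<Sum>l\<in>L. dotp E (a l) x * dotp F y (b l)) \<le>
      (\<Sum>l\<in>L. ((dotp E x (a l))\<^sup>2 + (dotp F y (b l))\<^sup>2) / 2)"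
  proof (rule sum_mono)
    fix l
    have "s * t \<le> (s\<^sup>2 + t\<^sup>2) / 2" for s t :: real
      using sum_squares_bound[of s t] by simp
    then show "dotp E (a l) x * dotp F y (b l) \<le> ((dotp E x (a l))\<^sup>2 + (dotp F y (b l))\<^sup>2) / 2"
      by (simp add: dotp_commute[of E "a l"])
  qed
  also have "\<dots> = ((\<Sum>l\<in>L. (dotp E x (a l))\<^sup>2) + (\<Sum>l\<in>L. (dotp F y (b l))\<^sup>2)) / 2"
    by (simp add: sum.distrib flip: sum_divide_distrib)
  also have "\<dots> \<le> 1"
  proof -
    have "(\<Sum>l\<in>L. (dotp E x (a l))\<^sup>2) \<le> 1" by (rule order_trans[OF bessel[OF assms(1,3)] assms(4)])
    moreover have "(\<Sum>l\<in>L. (dotp F y (b l))\<^sup>2) \<le> 1" by (rule order_trans[OF bessel[OF assms(2,3)] assms(5)])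
    ultimately show ?thesis by simp
  qed
  finally show ?thesis .
qed

text \<open>
  Half of the duality between nuclear and operator norm. Inserting the decomposition
  \<open>X = \<Sum> \<sigma> j u j v j\<^sup>T\<close> turns the left side into a combination of the \<open>\<sigma> j\<close> whose coefficients are at most 1
  by Cauchy-Schwarz and Bessel. Equality for the singular vectors of \<open>X\<close> makes this the source of all
  inequalities for the nuclear norm below.
\<close>

lemma nuclear_dual:
  assumes X: "X \<in> carrier_mat n N" and ab: "onz {..<n} L a" "onz {..<N} L b" "finite L"
  shows "(\<Sum>l\<in>L. bil n N (($$) X) (a l) (b l)) \<le> schatten1_norm X"
proof -
  obtain J \<sigma> u v where svd: "is_svd n N (($$) X) J \<sigma> u v"
    and nrm: "schatten1_norm X = (\<Sum>j\<in>J. \<sigma> j)" using svd_exists[OF X] by blast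
  have "(\<Sum>l\<in>L. bil n N (($$) X) (a l) (b l)) =
      (\<Sum>l\<in>L. \<Sum>j\<in>J. \<sigma> j * dotp {..<n} (a l) (u j) * dotp {..<N} (v j) (b l))"
    by (intro sum.cong refl bil_rank_one_sum) (use svd in \<open>auto simp: is_svd_def\<close>)
  also have "\<dots> = (\<Sum>j\<in>J. \<sigma> j * (\<Sum>l\<in>L. dotp {..<n} (a l) (u j) * dotp {..<N} (v j) (b l)))"
    by (subst sum.swap) (simp add: sum_distrib_left mult.assoc)
  also have "\<dots> \<le> (\<Sum>j\<in>J. \<sigma> j * 1)"
    using svd by (intro sum_mono mult_left_mono ons_pair_sum_le_1 ab)
      (auto simp: is_svd_def ons_def)
  finally show ?thesis by (simp add: nrm)
qed

lemma bil_add: "bil n N (\<lambda>e. f e + g e) x y = bil n N f x y + bil n N g x y"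
  by (simp add: bil_def algebra_simps sum.distrib)

lemma bil_diff: "bil n N (\<lambda>e. f e - g e) x y = bil n N f x y - bil n N g x y"
  by (simp add: bil_def algebra_simps sum_subtractf)

lemma bil_diff_right: "bil n N h x (\<lambda>e. y e - z e) = bil n N h x y - bil n N h x z"
  by (simp add: bil_def algebra_simps sum_subtractf)

lemma bil_diff_left: "bil n N h (\<lambda>e. y e - z e) x = bil n N h y x - bil n N h z x"
  by (simp add: bil_def algebra_simps sum_subtractf)

lemma bil_scale_left: "bil n N h (\<lambda>e. c * x e) y = c * bil n N h x y"
  by (simp add: bil_def sum_distrib_left mult_ac)

lemma bil_sum_left: "bil n N h (\<lambda>e. \<Sum>i\<in>I. f i e) y = (\<Sum>i\<in>I. bil n N h (f i) y)"
  by (simp add: bil_eq_dotp dotp_sum_left)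

lemma bil_scale_right: "bil n N h x (\<lambda>e. c * y e) = c * bil n N h x y"
  by (simp add: bil_def sum_distrib_left mult_ac)

lemma bil_sum_right: "bil n N h x (\<lambda>e. \<Sum>i\<in>I. f i e) = (\<Sum>i\<in>I. bil n N h x (f i))"
proof -
  have "app N h (\<lambda>e. \<Sum>i\<in>I. f i e) = (\<lambda>p. \<Sum>i\<in>I. app N h (f i) p)"
    unfolding app_def sum_distrib_left by (intro ext sum.swap)
  then show ?thesis by (simp add: bil_eq_dotp dotp_sum_right)
qed

lemma bil_scale: "bil n N (\<lambda>e. c * f e) x y = c * bil n N f x y"
  by (simp add: bil_def sum_distrib_left mult.assoc)

lemma bil_cong:
  "(\<And>p q. p < n \<Longrightarrow> q < N \<Longrightarrow> f (p, q) = g (p, q)) \<Longrightarrow> bil n N f x y = bil n N g x y"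
  by (simp add: bil_def)

lemma bil_svd_right:
  assumes svd: "is_svd n N h J \<sigma> u v" and j: "j \<in> J"
  shows "bil n N h x (v j) = \<sigma> j * dotp {..<n} x (u j)"
proof -
  have "bil n N h x (v j) = (\<Sum>l\<in>J. \<sigma> l * dotp {..<n} x (u l) * dotp {..<N} (v l) (v j))"
    by (rule bil_rank_one_sum) (use svd in \<open>auto simp: is_svd_def\<close>)
  also have "\<dots> = (\<Sum>l\<in>J. if l = j then \<sigma> j * dotp {..<n} x (u j) else 0)"
    by (rule sum.cong) (use svd j in \<open>auto simp: is_svd_def ons_def\<close>)
  finally show ?thesis using svd j by (simp add: is_svd_def)
qed

lemma bil_svd_left:
  assumes svd: "is_svd n N h J \<sigma> u v" and j: "j \<in> J"
  shows "bil n N h (u j) y = \<sigma> j * dotp {..<N} (v j) y"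
proof -
  have "bil n N h (u j) y = (\<Sum>l\<in>J. \<sigma> l * dotp {..<n} (u j) (u l) * dotp {..<N} (v l) y)"
    by (rule bil_rank_one_sum) (use svd in \<open>auto simp: is_svd_def\<close>)
  also have "\<dots> = (\<Sum>l\<in>J. if l = j then \<sigma> j * dotp {..<N} (v j) y else 0)"
    by (rule sum.cong) (use svd j in \<open>auto simp: is_svd_def ons_def\<close>)
  finally show ?thesis using svd j by (simp add: is_svd_def)
qed

lemma bil_svd:
  assumes "is_svd n N h J \<sigma> u v" "j \<in> J"
  shows "bil n N h (u j) (v j) = \<sigma> j"
  using bil_svd_right[OF assms, of "u j"] assms by (simp add: is_svd_def ons_def)

lemma svd_onz:
  assumes "is_svd n N h J \<sigma> u v"
  shows "finite J" "onz {..<n} J u" "onz {..<N} J v"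
  using assms by (auto simp: is_svd_def ons_onz)

lemma schatten1_nonneg: "X \<in> carrier_mat n N \<Longrightarrow> 0 \<le> schatten1_norm X"
  using nuclear_dual[of X n N "{}"] by (auto simp: onz_def)

text \<open>
  Test the combination against its own singular vectors and use duality for both terms.
\<close>

lemma schatten1_le_combination:
  assumes X: "X \<in> carrier_mat n N" and Y: "Y \<in> carrier_mat n N" and Z: "Z \<in> carrier_mat n N"
    and ent: "\<And>p q. p < n \<Longrightarrow> q < N \<Longrightarrow> Z $$ (p, q) = s * X $$ (p, q) + t * Y $$ (p, q)"
  shows "schatten1_norm Z \<le> \<bar>s\<bar> * schatten1_norm X + \<bar>t\<bar> * schatten1_norm Y"
proof -
  obtain J \<sigma> u v where svd: "is_svd n N (($$) Z) J \<sigma> u v"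
    and nrm: "schatten1_norm Z = (\<Sum>j\<in>J. \<sigma> j)" using svd_exists[OF Z] by blast
  note onz = svd_onz[OF svd]
  have dual: "c * (\<Sum>j\<in>J. bil n N (($$) A) (u j) (v j)) \<le> \<bar>c\<bar> * schatten1_norm A"
    if A: "A \<in> carrier_mat n N" for A c
  proof -
    have m: "onz {..<n} J (\<lambda>j e. - u j e)" using onz(2)
      by (auto simp: onz_def dotp_def)
    have "bil n N (($$) A) (\<lambda>e. - u j e) (v j) = - bil n N (($$) A) (u j) (v j)" for j
      by (simp add: bil_def sum_negf)
    then have S: "\<bar>\<Sum>j\<in>J. bil n N (($$) A) (u j) (v j)\<bar> \<le> schatten1_norm A"
      using nuclear_dual[OF A onz(2,3,1)] nuclear_dual[OF A m onz(3,1)]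
      by (simp add: sum_negf abs_le_iff)
    have "c * (\<Sum>j\<in>J. bil n N (($$) A) (u j) (v j)) \<le> \<bar>c\<bar> * \<bar>\<Sum>j\<in>J. bil n N (($$) A) (u j) (v j)\<bar>"
      unfolding abs_mult[symmetric] by (rule abs_ge_self)
    also have "\<dots> \<le> \<bar>c\<bar> * schatten1_norm A" using S by (intro mult_left_mono) auto
    finally show ?thesis .
  qed
  have "(\<Sum>j\<in>J. \<sigma> j) = (\<Sum>j\<in>J. bil n N (\<lambda>e. s * X $$ e + t * Y $$ e) (u j) (v j))"
    by (rule sum.cong) (use bil_svd[OF svd] ent in \<open>auto cong: bil_cong\<close>)
  also have "\<dots> = s * (\<Sum>j\<in>J. bil n N (($$) X) (u j) (v j)) + t * (\<Sum>j\<in>J. bil n N (($$) Y) (u j) (v j))"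
    by (simp add: bil_add bil_scale sum.distrib sum_distrib_left)
  also have "\<dots> \<le> \<bar>s\<bar> * schatten1_norm X + \<bar>t\<bar> * schatten1_norm Y"
    using dual[OF X, of s] dual[OF Y, of t] by linarith
  finally show ?thesis by (simp add: nrm)
qed

lemma schatten1_zero_imp:
  assumes X: "X \<in> carrier_mat n N" and 0: "schatten1_norm X = 0" and "p < n" "q < N"
  shows "X $$ (p, q) = 0"
proof -
  obtain J \<sigma> u v where svd: "is_svd n N (($$) X) J \<sigma> u v"
    and nrm: "schatten1_norm X = (\<Sum>j\<in>J. \<sigma> j)" using svd_exists[OF X] by blast
  have "J = {}" using 0 svd unfolding nrm is_svd_def
    by (metis sum_pos less_irrefl)
  then show ?thesis using svd assms(3,4) by (auto simp: is_svd_def)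
qed

lemma abs_bil_le:
  assumes X: "X \<in> carrier_mat n N" and x: "dotp {..<n} x x = 1" and y: "dotp {..<N} y y = 1"
  shows "\<bar>bil n N (($$) X) x y\<bar> \<le> schatten1_norm X"
proof -
  have "bil n N (($$) X) x y \<le> schatten1_norm X"
    using nuclear_dual[OF X, of "{0::nat}" "\<lambda>_. x" "\<lambda>_. y"] x y by (simp add: onz_def)
  moreover have "bil n N (($$) X) (\<lambda>e. - x e) y \<le> schatten1_norm X"
    using nuclear_dual[OF X, of "{0::nat}" "\<lambda>_ e. - x e" "\<lambda>_. y"] x y
    by (simp add: onz_def dotp_def)
  moreover have "bil n N (($$) X) (\<lambda>e. - x e) y = - bil n N (($$) X) x y"
    by (simp add: bil_def sum_negf)
  ultimately show ?thesis by simp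
qed

lemma abs_bil_le_general:
  assumes X: "X \<in> carrier_mat n n"
  shows "\<bar>bil n n (($$) X) x x\<bar> \<le> dotp {..<n} x x * schatten1_norm X"
proof (cases "dotp {..<n} x x = 0")
  case True
  then have "\<forall>p<n. x p = 0" using dotp_zero_imp[of "{..<n}" x] by auto
  then show ?thesis using True by (simp add: bil_def)
next
  case False
  define t where "t = L2_set x {..<n}"
  have t: "t \<noteq> 0" using False by (auto simp: t_def dotp_self)
  define y where "y e = x e / t" for e
  have "dotp {..<n} y y = dotp {..<n} x x / (t * t)"
    by (simp add: dotp_def y_def sum_divide_distrib)
  then have "dotp {..<n} y y = 1" using t by (simp add: dotp_self power2_eq_square flip: t_def)
  then have "\<bar>bil n n (($$) X) y y\<bar> \<le> schatten1_norm X" by (intro abs_bil_le[OF X])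
  moreover have "bil n n (($$) X) x x = (t * t) * bil n n (($$) X) y y"
    using t by (simp add: bil_def y_def sum_distrib_left)
  moreover have "dotp {..<n} x x = t * t" by (simp add: t_def dotp_self power2_eq_square)
  ultimately show ?thesis by (simp add: abs_mult mult_left_mono)
qed

lemma mat_trace_svd:
  assumes X: "X \<in> carrier_mat n n" and svd: "is_svd n n (($$) X) J \<sigma> u v"
  shows "mat_trace X = (\<Sum>j\<in>J. \<sigma> j * dotp {..<n} (u j) (v j))"
proof -
  have "mat_trace X = (\<Sum>i<n. \<Sum>j\<in>J. \<sigma> j * u j i * v j i)"
    using X svd by (auto simp: mat_trace_def is_svd_def)
  also have "\<dots> = (\<Sum>j\<in>J. \<sigma> j * dotp {..<n} (u j) (v j))"
    by (subst sum.swap) (simp add: dotp_def sum_distrib_left mult.assoc)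
  finally show ?thesis .
qed

lemma abs_trace_le:
  assumes X: "X \<in> carrier_mat n n"
  shows "\<bar>mat_trace X\<bar> \<le> schatten1_norm X"
proof -
  obtain J \<sigma> u v where svd: "is_svd n n (($$) X) J \<sigma> u v"
    and nrm: "schatten1_norm X = (\<Sum>j\<in>J. \<sigma> j)" using svd_exists[OF X] by blast
  have "\<bar>dotp {..<n} (u j) (v j)\<bar> \<le> 1" if "j \<in> J" for j
  proof -
    have "dotp {..<n} (u j) (u j) = 1" "dotp {..<n} (v j) (v j) = 1"
      using svd that by (auto simp: is_svd_def ons_def)
    then have "L2_set (u j) {..<n} = 1" "L2_set (v j) {..<n} = 1"
      unfolding dotp_self by (simp_all add: power2_eq_1_iff) (use L2_set_nonneg in \<open>smt (verit)\<close>)+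
    then show ?thesis using dotp_cauchy_schwarz[of "{..<n}" "u j" "v j"] by simp
  qed
  then have "\<bar>\<sigma> j * dotp {..<n} (u j) (v j)\<bar> \<le> \<sigma> j" if "j \<in> J" for j
    using svd that by (simp add: abs_mult is_svd_def mult_left_le less_imp_le)
  then have "\<bar>\<Sum>j\<in>J. \<sigma> j * dotp {..<n} (u j) (v j)\<bar> \<le> (\<Sum>j\<in>J. \<sigma> j)"
    by (intro order_trans[OF sum_abs] sum_mono)
  then show ?thesis by (simp add: mat_trace_svd[OF X svd] nrm)
qed

lemma psd_bil_nonneg:
  assumes X: "X \<in> psd_mats n"
  shows "0 \<le> bil n n (($$) X) x x"
proof -
  have car: "X \<in> carrier_mat n n" using X by (simp add: psd_mats_def sym_mats_def)
  have "0 \<le> Matrix.vec n x \<bullet> (X *\<^sub>v Matrix.vec n x)" using X by (simp add: psd_mats_def)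
  also have "\<dots> = bil n n (($$) X) x x"
    using car by (auto simp: scalar_prod_def bil_def lessThan_atLeast0 sum_distrib_left mult_ac
        intro!: sum.cong)
  finally show ?thesis .
qed

lemma sym_bil_commute:
  assumes X: "X \<in> sym_mats n"
  shows "bil n n (($$) X) x y = bil n n (($$) X) y x"
proof -
  have "X $$ (p, q) = X $$ (q, p)" if "p < n" "q < n" for p q
  proof -
    have car: "X \<in> carrier_mat n n" using X by (simp add: sym_mats_def)
    have "transpose_mat X $$ (p, q) = X $$ (q, p)" using car that by simp
    then show ?thesis using X by (simp add: sym_mats_def)
  qed
  then show ?thesis unfolding bil_def
    by (subst sum.swap) (auto intro!: sum.cong simp: mult_ac)
qed

text \<open>
  For a positive semidefinite matrix the left and right singular vectors agree: the quadratic form at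
  \<open>u j - v j\<close> equals \<open>- \<sigma> j \<parallel>u j - v j\<parallel>\<^sup>2\<close>.
\<close>

lemma schatten1_psd:
  assumes X: "X \<in> psd_mats n"
  shows "schatten1_norm X = mat_trace X"
proof -
  have sym: "X \<in> sym_mats n" and car: "X \<in> carrier_mat n n"
    using X by (simp_all add: psd_mats_def sym_mats_def)
  obtain J \<sigma> u v where svd: "is_svd n n (($$) X) J \<sigma> u v"
    and nrm: "schatten1_norm X = (\<Sum>j\<in>J. \<sigma> j)" using svd_exists[OF car] by blast
  have *: "dotp {..<n} (u j) (v j) = 1" if j: "j \<in> J" for j
  proof -
    have pos: "\<sigma> j > 0" and on: "ons {..<n} J u" "ons {..<n} J v" "finite J"
      using svd j by (auto simp: is_svd_def)
    define w where "w e = u j e - v j e" for e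
    note xv = bil_svd_right[OF svd j] and ux = bil_svd_left[OF svd j]
    have "bil n n (($$) X) w w = bil n n (($$) X) w (u j) - bil n n (($$) X) w (v j)"
      unfolding bil_diff_right[symmetric] w_def[abs_def] ..
    also have "\<dots> = \<sigma> j * dotp {..<n} (v j) w - \<sigma> j * dotp {..<n} w (u j)"
      using ux[of w] xv[of w] sym_bil_commute[OF sym, of w "u j"] by simp
    also have "\<dots> = - \<sigma> j * dotp {..<n} w w"
    proof -
      have "dotp {..<n} w w = dotp {..<n} w (u j) - dotp {..<n} w (v j)"
        unfolding dotp_diff_right[symmetric] w_def[abs_def] ..
      moreover have "dotp {..<n} (v j) w = dotp {..<n} w (v j)" by (rule dotp_commute)
      ultimately show ?thesis by (simp only:) (simp add: algebra_simps)
    qed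
    finally have "\<sigma> j * dotp {..<n} w w \<le> 0" using psd_bil_nonneg[OF X, of w] by simp
    then have "dotp {..<n} w w = 0"
      using pos dotp_self_nonneg[of "{..<n}" w] by (simp add: mult_le_0_iff)
    then have "dotp {..<n} w (v j) = 0" using dotp_zero_left[of "{..<n}"] by simp
    moreover have "dotp {..<n} w (v j) = dotp {..<n} (u j) (v j) - dotp {..<n} (v j) (v j)"
      unfolding dotp_diff_left[symmetric] w_def[abs_def] ..
    ultimately show ?thesis using on j by (simp add: ons_def)
  qed
  show ?thesis unfolding mat_trace_svd[OF car svd] nrm using * by simp
qed

lemma bil_cong_vec:
  "(\<And>p. p < n \<Longrightarrow> x p = x' p) \<Longrightarrow> (\<And>q. q < N \<Longrightarrow> y q = y' q) \<Longrightarrow> bil n N h x y = bil n N h x' y'"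
  by (simp add: bil_def)

lemma onz_Plus:
  assumes "onz E J u" "onz E L a" and perp: "\<And>j l. j \<in> J \<Longrightarrow> l \<in> L \<Longrightarrow> dotp E (u j) (a l) = 0"
  shows "onz E (J <+> L) (case_sum u a)"
  unfolding onz_def
proof (intro conjI ballI impI)
  fix i assume "i \<in> J <+> L"
  then show "dotp E (case_sum u a i) (case_sum u a i) \<in> {0, 1}"
    using assms(1,2) by (cases i) (auto simp: onz_def)
next
  fix i i' assume "i \<in> J <+> L" "i' \<in> J <+> L" "i \<noteq> i'"
  then show "dotp E (case_sum u a i) (case_sum u a i') = 0"
    using onzD(1)[OF assms(1)] onzD(1)[OF assms(2)] perp
    by (cases i; cases i') (auto simp: dotp_commute[of E "a _" "u _"])
qed

text \<open>
  Let \<open>H'\<close> be the part of \<open>H\<close> that is orthogonal to the row and the column space of \<open>X\<close>. The singular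
  vectors of \<open>X\<close> and of \<open>H'\<close> together form orthogonal families, and testing \<open>X + H\<close> against them gives
  \<open>\<parallel>X\<parallel> + \<parallel>H'\<parallel>\<close> up to the diagonal of \<open>H\<close> in the singular basis of \<open>X\<close>, which is at most
  \<open>sqrt k \<parallel>H\<parallel>\<^sub>2\<close>. On the other hand \<open>H - H'\<close> is a sum of three matrices of rank at most \<open>k\<close>, each of nuclear
  norm at most \<open>sqrt k \<parallel>H\<parallel>\<^sub>2\<close>.
\<close>

theorem nuclear_norm_decomposable:
  assumes X: "X \<in> carrier_mat n N" and H: "H \<in> carrier_mat n N"
    and rk: "vec_space.rank n X \<le> k"
  shows "schatten1_norm (X + H) \<ge> schatten1_norm X + schatten1_norm H -
    4 * sqrt (real k) * L2_set (($$) H) ({..<n} \<times> {..<N})"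
proof -
  define h where "h = (($$) H)"
  define B where "B = L2_set h ({..<n} \<times> {..<N})"
  have B0: "0 \<le> B" by (simp add: B_def)
  obtain J \<sigma> u v where svd: "is_svd n N (($$) X) J \<sigma> u v"
    and nX: "schatten1_norm X = (\<Sum>j\<in>J. \<sigma> j)" using svd_exists[OF X] by blast
  note J = svd_onz[OF svd]
  have uu: "dotp {..<n} (u i) (u j) = (if i = j then 1 else 0)"
    and vv: "dotp {..<N} (v i) (v j) = (if i = j then 1 else 0)" if "i \<in> J" "j \<in> J" for i j
    using svd that by (auto simp: is_svd_def ons_def)
  have cJ: "real (card J) \<le> real k" using svd_card_le_rank[OF X svd] rk by simp
  define P where "P x = (\<lambda>p. \<Sum>j\<in>J. dotp {..<n} x (u j) * u j p)" for x
  define R where "R y = (\<lambda>q. \<Sum>j\<in>J. dotp {..<N} y (v j) * v j q)" for y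
  \<comment> \<open>rows of the projections onto the complements of the spans of \<open>u\<close> and \<open>v\<close>\<close>
  define pe where "pe p = (\<lambda>r. (if r = p then 1 else 0) - (\<Sum>j\<in>J. u j p * u j r))" for p
  define re where "re q = (\<lambda>r. (if r = q then 1 else 0) - (\<Sum>j\<in>J. v j q * v j r))" for q
  define H' where "H' = Matrix.mat n N (\<lambda>(p, q). bil n N h (pe p) (re q))"
  have H': "H' \<in> carrier_mat n N" by (simp add: H'_def)
  have proj: "(\<Sum>p<m. x p * ((if r = p then 1 else 0) - (\<Sum>j\<in>J. w j p * w j r))) =
      x r - (\<Sum>j\<in>J. dotp {..<m} x (w j) * w j r)" if "r < m" for m r and x :: "nat \<Rightarrow> real" and w
  proof -
    have "(\<Sum>p<m. x p * ((if r = p then 1 else 0) - (\<Sum>j\<in>J. w j p * w j r))) =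
        (\<Sum>p<m. if p = r then x r else 0) - (\<Sum>p<m. \<Sum>j\<in>J. x p * w j p * w j r)"
      unfolding sum_subtractf[symmetric]
      by (rule sum.cong) (auto simp: algebra_simps sum_distrib_left)
    also have "(\<Sum>p<m. \<Sum>j\<in>J. x p * w j p * w j r) = (\<Sum>j\<in>J. dotp {..<m} x (w j) * w j r)"
      by (subst sum.swap) (simp add: dotp_def sum_distrib_right)
    finally show ?thesis using that by simp
  qed
  have bH': "bil n N (($$) H') x y = bil n N h (\<lambda>p. x p - P x p) (\<lambda>q. y q - R y q)" for x y
  proof -
    have "bil n N (($$) H') x y = (\<Sum>p<n. \<Sum>q<N. x p * (y q * bil n N h (pe p) (re q)))"
      unfolding bil_def[of n N "($$) H'"] by (intro sum.cong refl) (simp add: H'_def mult_ac)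
    also have "\<dots> = bil n N h (\<lambda>r. \<Sum>p<n. x p * pe p r) (\<lambda>r. \<Sum>q<N. y q * re q r)"
      by (simp add: bil_sum_left bil_sum_right bil_scale_left bil_scale_right sum_distrib_left)
    also have "\<dots> = bil n N h (\<lambda>p. x p - P x p) (\<lambda>q. y q - R y q)"
      by (rule bil_cong_vec) (simp_all add: pe_def re_def P_def R_def proj)
    finally show ?thesis .
  qed
  obtain L \<tau> a b where svd': "is_svd n N (($$) H') L \<tau> a b"
    and nH': "schatten1_norm H' = (\<Sum>l\<in>L. \<tau> l)" using svd_exists[OF H'] by blast
  note L = svd_onz[OF svd']
  have Pu: "P (u j) p = u j p" if "j \<in> J" for j p
  proof -
    have "P (u j) p = (\<Sum>i\<in>J. if i = j then u j p else 0)"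
      unfolding P_def by (rule sum.cong) (use uu that in auto)
    then show ?thesis using that J by simp
  qed
  have Rv: "R (v j) p = v j p" if "j \<in> J" for j p
  proof -
    have "R (v j) p = (\<Sum>i\<in>J. if i = j then v j p else 0)"
      unfolding R_def by (rule sum.cong) (use vv that in auto)
    then show ?thesis using that J by simp
  qed
  have au: "dotp {..<n} (u j) (a l) = 0" "dotp {..<n} (a l) (u j) = 0" if "j \<in> J" "l \<in> L" for j l
  proof -
    have "\<tau> l * dotp {..<n} (u j) (a l) = bil n N (($$) H') (u j) (b l)"
      using bil_svd_right[OF svd' that(2)] by simp
    also have "\<dots> = 0" unfolding bH' using Pu[OF that(1)] by (simp add: bil_def)
    finally show "dotp {..<n} (u j) (a l) = 0" using svd' that(2) by (auto simp: is_svd_def)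
    then show "dotp {..<n} (a l) (u j) = 0" by (simp add: dotp_commute)
  qed
  have bv: "dotp {..<N} (b l) (v j) = 0" "dotp {..<N} (v j) (b l) = 0" if "j \<in> J" "l \<in> L" for j l
  proof -
    have "\<tau> l * dotp {..<N} (b l) (v j) = bil n N (($$) H') (a l) (v j)"
      using bil_svd_left[OF svd' that(2)] by simp
    also have "\<dots> = 0" unfolding bH' using Rv[OF that(1)] by (simp add: bil_def)
    finally show "dotp {..<N} (b l) (v j) = 0" using svd' that(2) by (auto simp: is_svd_def)
    then show "dotp {..<N} (v j) (b l) = 0" by (simp add: dotp_commute)
  qed
  have hab: "bil n N h (a l) (b l) = \<tau> l" if "l \<in> L" for l
  proof -
    have "P (a l) = (\<lambda>_. 0)" "R (b l) = (\<lambda>_. 0)"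
      using au bv that by (auto simp: P_def R_def)
    then have "bil n N (($$) H') (a l) (b l) = bil n N h (a l) (b l)" by (simp add: bH')
    then show ?thesis using bil_svd[OF svd' that] by simp
  qed
  have Xab: "bil n N (($$) X) (a l) (b l) = 0" if "l \<in> L" for l
  proof -
    have "bil n N (($$) X) (a l) (b l) =
        (\<Sum>j\<in>J. \<sigma> j * dotp {..<n} (a l) (u j) * dotp {..<N} (v j) (b l))"
      by (rule bil_rank_one_sum) (use svd in \<open>auto simp: is_svd_def\<close>)
    then show ?thesis using au that by simp
  qed
  have XH: "bil n N (($$) (X + H)) x y = bil n N (($$) X) x y + bil n N h x y" for x y
    unfolding bil_add[symmetric] by (rule bil_cong) (use X H in \<open>simp add: h_def\<close>)

  have lower: "schatten1_norm (X + H) \<ge> schatten1_norm X + (\<Sum>j\<in>J. bil n N h (u j) (v j)) + schatten1_norm H'"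
  proof -
    have "onz {..<n} (J <+> L) (case_sum u a)" "onz {..<N} (J <+> L) (case_sum v b)"
      using J L au bv by (auto intro!: onz_Plus)
    then have "(\<Sum>i\<in>J <+> L. bil n N (($$) (X + H)) (case_sum u a i) (case_sum v b i)) \<le> schatten1_norm (X + H)"
      using J L X H by (intro nuclear_dual[of "X + H" n N]) auto
    moreover have "(\<Sum>i\<in>J <+> L. bil n N (($$) (X + H)) (case_sum u a i) (case_sum v b i)) =
      (\<Sum>j\<in>J. \<sigma> j) + (\<Sum>j\<in>J. bil n N h (u j) (v j)) + (\<Sum>l\<in>L. \<tau> l)"
      using J L by (simp add: sum.Plus XH hab Xab bil_svd[OF svd] sum.distrib)
    ultimately show ?thesis by (simp add: nX nH')
  qed
  have t1: "- (\<Sum>j\<in>J. bil n N h (u j) (v j)) \<le> sqrt (real k) * B"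
  proof -
    have "(\<Sum>j\<in>J. (bil n N h (u j) (v j))\<^sup>2) \<le> (\<Sum>j\<in>J. \<Sum>l\<in>J. (bil n N h (u j) (v l))\<^sup>2)"
      using J by (intro sum_mono member_le_sum) auto
    then have "(\<Sum>j\<in>J. (- bil n N h (u j) (v j))\<^sup>2) \<le> B\<^sup>2"
      using frobenius_onz_le[OF J(2,3,1,1), of h] by (simp add: B_def)
    from sum_le_sqrt_card[OF this B0 cJ] show ?thesis by (simp add: sum_negf)
  qed
  obtain I s c d where svdH: "is_svd n N (($$) H) I s c d"
    and nH: "schatten1_norm H = (\<Sum>i\<in>I. s i)" using svd_exists[OF H] by blast
  note I = svd_onz[OF svdH]
  have dd: "dotp {..<N} (d i) (d i) = 1" if "i \<in> I" for i
    using svdH that by (simp add: is_svd_def ons_def)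
  have split: "bil n N h x y = bil n N h (\<lambda>p. x p - P x p) (\<lambda>q. y q - R y q) +
     bil n N h x (R y) + bil n N h (P x) y - bil n N h (P x) (R y)" for x y
    by (simp add: bil_diff_left bil_diff_right)
  have bc: "(\<Sum>i\<in>I. (dotp {..<n} (c i) (u j))\<^sup>2) \<le> 1" if "j \<in> J" for j
    using bessel[OF I(2,1), of "u j"] uu[OF that that] by (simp add: dotp_commute[of _ "c _"])
  have bd: "(\<Sum>i\<in>I. (dotp {..<N} (d i) (v j))\<^sup>2) \<le> 1" if "j \<in> J" for j
    using bessel[OF I(3,1), of "v j"] vv[OF that that] by (simp add: dotp_commute[of _ "d _"])
  have t2: "(\<Sum>i\<in>I. bil n N h (P (c i)) (d i)) \<le> sqrt (real k) * B"
  proof -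
    have "(\<Sum>i\<in>I. bil n N h (P (c i)) (d i)) =
       (\<Sum>(j, i)\<in>J \<times> I. dotp {..<n} (c i) (u j) * bil n N h (u j) (d i))"
      unfolding P_def bil_sum_left bil_scale_left
      by (subst sum.swap) (rule sum.cartesian_product)
    also have "\<dots> \<le> sqrt (real k) * B"
      unfolding case_prod_unfold
    proof (rule sum_mult_le_sqrt[OF _ _ B0])
      have "(\<Sum>z\<in>J \<times> I. (dotp {..<n} (c (snd z)) (u (fst z)))\<^sup>2) =
          (\<Sum>j\<in>J. \<Sum>i\<in>I. (dotp {..<n} (c i) (u j))\<^sup>2)"
        by (simp add: sum.cartesian_product case_prod_unfold)
      also have "\<dots> \<le> (\<Sum>j\<in>J. 1)" by (intro sum_mono bc)
      finally show "(\<Sum>z\<in>J \<times> I. (dotp {..<n} (c (snd z)) (u (fst z)))\<^sup>2) \<le> real k" using cJ by simp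
      show "(\<Sum>z\<in>J \<times> I. (bil n N h (u (fst z)) (d (snd z)))\<^sup>2) \<le> B\<^sup>2"
        using frobenius_onz_le[OF J(2) I(3) J(1) I(1), of h]
        by (simp add: sum.cartesian_product case_prod_unfold B_def)
    qed
    finally show ?thesis .
  qed
  have t3: "(\<Sum>i\<in>I. bil n N h (c i) (R (d i))) \<le> sqrt (real k) * B"
  proof -
    have "(\<Sum>i\<in>I. bil n N h (c i) (R (d i))) =
       (\<Sum>(j, i)\<in>J \<times> I. dotp {..<N} (d i) (v j) * bil n N h (c i) (v j))"
      unfolding R_def bil_sum_right bil_scale_right
      by (subst sum.swap) (rule sum.cartesian_product)
    also have "\<dots> \<le> sqrt (real k) * B"
      unfolding case_prod_unfold
    proof (rule sum_mult_le_sqrt[OF _ _ B0])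
      have "(\<Sum>z\<in>J \<times> I. (dotp {..<N} (d (snd z)) (v (fst z)))\<^sup>2) =
          (\<Sum>j\<in>J. \<Sum>i\<in>I. (dotp {..<N} (d i) (v j))\<^sup>2)"
        by (simp add: sum.cartesian_product case_prod_unfold)
      also have "\<dots> \<le> (\<Sum>j\<in>J. 1)" by (intro sum_mono bd)
      finally show "(\<Sum>z\<in>J \<times> I. (dotp {..<N} (d (snd z)) (v (fst z)))\<^sup>2) \<le> real k" using cJ by simp
      have "(\<Sum>z\<in>J \<times> I. (bil n N h (c (snd z)) (v (fst z)))\<^sup>2) =
          (\<Sum>j\<in>J. \<Sum>i\<in>I. (bil n N h (c i) (v j))\<^sup>2)"
        by (simp add: sum.cartesian_product case_prod_unfold)
      also have "\<dots> = (\<Sum>i\<in>I. \<Sum>j\<in>J. (bil n N h (c i) (v j))\<^sup>2)" by (rule sum.swap)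
      also have "\<dots> \<le> B\<^sup>2" using frobenius_onz_le[OF I(2) J(3) I(1) J(1), of h] by (simp add: B_def)
      finally show "(\<Sum>z\<in>J \<times> I. (bil n N h (c (snd z)) (v (fst z)))\<^sup>2) \<le> B\<^sup>2" .
    qed
    finally show ?thesis .
  qed
  have t4: "- (\<Sum>i\<in>I. bil n N h (P (c i)) (R (d i))) \<le> sqrt (real k) * B"
  proof -
    define C where "C j l = (\<Sum>i\<in>I. dotp {..<n} (c i) (u j) * dotp {..<N} (d i) (v l))" for j l
    have C1: "(\<Sum>l\<in>J. (C j l)\<^sup>2) \<le> 1" if "j \<in> J" for j
    proof -
      let ?w = "\<lambda>q. \<Sum>i\<in>I. dotp {..<n} (c i) (u j) * d i q"
      have "(\<Sum>l\<in>J. (C j l)\<^sup>2) = (\<Sum>l\<in>J. (dotp {..<N} ?w (v l))\<^sup>2)"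
        by (simp add: C_def dotp_sum_left dotp_scale_left)
      also have "\<dots> \<le> dotp {..<N} ?w ?w" by (rule bessel[OF J(3,1)])
      also have "\<dots> = (\<Sum>i\<in>I. (dotp {..<n} (c i) (u j))\<^sup>2 * dotp {..<N} (d i) (d i))"
        by (rule onz_norm_lincomb[OF I(3,1)])
      also have "\<dots> \<le> 1" using bc[OF that] dd by simp
      finally show ?thesis .
    qed
    have "(\<Sum>i\<in>I. bil n N h (P (c i)) (R (d i))) =
      (\<Sum>i\<in>I. \<Sum>j\<in>J. \<Sum>l\<in>J. dotp {..<n} (c i) (u j) * (dotp {..<N} (d i) (v l) * bil n N h (u j) (v l)))"
      unfolding P_def R_def bil_sum_left bil_scale_left bil_sum_right bil_scale_right sum_distrib_left ..
    also have "\<dots> = (\<Sum>j\<in>J. \<Sum>i\<in>I. \<Sum>l\<in>J. dotp {..<n} (c i) (u j) * (dotp {..<N} (d i) (v l) * bil n N h (u j) (v l)))"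
      by (rule sum.swap)
    also have "\<dots> = (\<Sum>j\<in>J. \<Sum>l\<in>J. \<Sum>i\<in>I. dotp {..<n} (c i) (u j) * (dotp {..<N} (d i) (v l) * bil n N h (u j) (v l)))"
      by (rule sum.cong[OF refl], rule sum.swap)
    also have "\<dots> = (\<Sum>j\<in>J. \<Sum>l\<in>J. C j l * bil n N h (u j) (v l))"
      by (simp add: C_def sum_distrib_right mult.assoc)
    finally have "- (\<Sum>i\<in>I. bil n N h (P (c i)) (R (d i))) =
        (\<Sum>z\<in>J \<times> J. C (fst z) (snd z) * (- bil n N h (u (fst z)) (v (snd z))))"
      by (simp add: sum.cartesian_product case_prod_unfold sum_negf)
    also have "\<dots> \<le> sqrt (real k) * B"
    proof (rule sum_mult_le_sqrt[OF _ _ B0])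
      have "(\<Sum>z\<in>J \<times> J. (C (fst z) (snd z))\<^sup>2) = (\<Sum>j\<in>J. \<Sum>l\<in>J. (C j l)\<^sup>2)"
        by (simp add: sum.cartesian_product case_prod_unfold)
      also have "\<dots> \<le> (\<Sum>j\<in>J. 1)" by (intro sum_mono C1)
      finally show "(\<Sum>z\<in>J \<times> J. (C (fst z) (snd z))\<^sup>2) \<le> real k" using cJ by simp
      show "(\<Sum>z\<in>J \<times> J. (- bil n N h (u (fst z)) (v (snd z)))\<^sup>2) \<le> B\<^sup>2"
        using frobenius_onz_le[OF J(2,3,1,1), of h]
        by (simp add: sum.cartesian_product case_prod_unfold B_def)
    qed
    finally show ?thesis .
  qed
  have upper: "schatten1_norm H \<le> schatten1_norm H' + 3 * (sqrt (real k) * B)"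
  proof -
    have "(\<Sum>i\<in>I. s i) = (\<Sum>i\<in>I. bil n N h (c i) (d i))"
      by (rule sum.cong) (simp_all add: bil_svd[OF svdH] h_def)
    also have "\<dots> = (\<Sum>i\<in>I. bil n N (($$) H') (c i) (d i) + bil n N h (c i) (R (d i)) +
        bil n N h (P (c i)) (d i) - bil n N h (P (c i)) (R (d i)))"
      by (rule sum.cong[OF refl]) (simp only: bH' split[symmetric])
    also have "\<dots> = (\<Sum>i\<in>I. bil n N (($$) H') (c i) (d i)) + (\<Sum>i\<in>I. bil n N h (c i) (R (d i))) +
        (\<Sum>i\<in>I. bil n N h (P (c i)) (d i)) - (\<Sum>i\<in>I. bil n N h (P (c i)) (R (d i)))"
      by (simp add: sum.distrib sum_subtractf)
    also have "\<dots> \<le> schatten1_norm H' + 3 * (sqrt (real k) * B)"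
      using nuclear_dual[OF H' I(2,3,1)] t2 t3 t4 by linarith
    finally show ?thesis by (simp add: nH)
  qed
  show ?thesis using lower t1 upper by (simp add: B_def h_def)
qed

section \<open>Finite nets for sparse vectors and low rank matrices\<close>

text \<open>
  The weight of a single coordinate in the generating function for lattice points.
\<close>

lemma sum_half_power_le: "(\<Sum>z\<in>{-R..R}. (if z = 0 then 1 else x) * (1/2::real) ^ nat \<bar>z\<bar>) \<le> 1 + 2 * x"
  if "0 \<le> x" for R :: int
proof (cases "0 \<le> R")
  case True
  have geo: "(\<Sum>z\<in>{1..R}. (1/2::real) ^ nat z) \<le> 1"
  proof -
    have "(\<Sum>z\<in>{1..R}. (1/2::real) ^ nat z) = (\<Sum>i\<in>{1..nat R}. (1/2) ^ i)"
      by (rule sum.reindex_bij_witness[of _ int nat]) auto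
    also have "\<dots> \<le> (\<Sum>i. (1/2) ^ Suc i)"
    proof -
      have "(\<Sum>i\<in>{1..nat R}. (1/2::real) ^ i) = (\<Sum>i<nat R. (1/2) ^ Suc i)"
        by (rule sum.reindex_bij_witness[of _ Suc "\<lambda>i. i - 1"]) auto
      also have "\<dots> \<le> (\<Sum>i. (1/2) ^ Suc i)"
        by (rule sum_le_suminf) (use power_half_series in \<open>auto simp: sums_iff\<close>)
      finally show ?thesis .
    qed
    also have "\<dots> = 1" using power_half_series by (simp add: sums_iff)
    finally show ?thesis .
  qed
  have neg: "(\<Sum>z\<in>{-R..-1}. (1/2::real) ^ nat (-z)) = (\<Sum>z\<in>{1..R}. (1/2::real) ^ nat z)"
    by (rule sum.reindex_bij_witness[of _ uminus uminus]) auto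
  have "{-R..R} = insert 0 ({-R..-1} \<union> {1..R})" using True by auto
  then have "(\<Sum>z\<in>{-R..R}. (if z = 0 then 1 else x) * (1/2::real) ^ nat \<bar>z\<bar>) =
     1 + ((\<Sum>z\<in>{-R..-1}. x * (1/2::real) ^ nat (-z)) + (\<Sum>z\<in>{1..R}. x * (1/2::real) ^ nat z))"
    by (simp add: sum.union_disjoint)
  also have "\<dots> = 1 + 2 * x * (\<Sum>z\<in>{1..R}. (1/2::real) ^ nat z)"
    by (simp add: neg flip: sum_distrib_left)
  also have "\<dots> \<le> 1 + 2 * x" using geo that by (simp add: mult_left_le)
  finally show ?thesis .
qed (use that in simp)

text \<open>
  Every admissible lattice point has weight at least \<open>exp (- B K) x\<^sup>K\<close> under the product weight that
  charges \<open>x\<close> for a nonzero coordinate and \<open>1/2\<close> per unit of size, while the total weight is at most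
  \<open>(1 + 2 x)\<^sup>n \<le> exp (2 x n)\<close>. The choice \<open>x = min 1 (K / n)\<close> balances the two.
\<close>

lemma card_sparse_lattice_points:
  fixes E :: "'e set" and K B :: real and R :: int
  assumes E: "finite E" and K: "0 < K" and B: "0 \<le> B"
  defines "W \<equiv> {w \<in> E \<rightarrow>\<^sub>E {- R..R}. real (card {e\<in>E. w e \<noteq> 0}) \<le> K \<and>
      (\<Sum>e\<in>E. (real_of_int (w e))\<^sup>2) \<le> B * K}"
  shows "real (card W) \<le> exp (K * (B + 2 + max 0 (ln (real (card E) / K))))"
proof -
  define n where "n = real (card E)"
  \<comment> \<open>the minimizer of \<open>2 x n - K ln x\<close> up to a factor, capped at 1\<close>
  define x where "x = (if n \<le> K then 1 else K / n)"
  have x: "0 < x" "x \<le> 1" "x * n \<le> K" using K by (auto simp: x_def field_simps n_def)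
  have lnx: "- ln x = max 0 (ln (n / K))"
    using K by (auto simp: x_def ln_div max_def ln_le_zero_iff)
      (smt (verit) divide_le_eq_1 ln_ge_zero_iff ln_div n_def of_nat_0_le_iff)
  define G where "G w = (\<Prod>e\<in>E. (if w e = 0 then 1 else x) * (1/2::real) ^ nat \<bar>w e\<bar>)" for w :: "'e \<Rightarrow> int"
  have G: "exp (- (B * K)) * x powr K \<le> G w" if w: "w \<in> W" for w
  proof -
    have "x powr K \<le> x powr real (card {e\<in>E. w e \<noteq> 0})"
      using w x by (intro powr_mono') (auto simp: W_def)
    also have "\<dots> = x ^ card {e\<in>E. w e \<noteq> 0}" using x by (simp add: powr_realpow)
    also have "\<dots> = (\<Prod>e\<in>E. if w e = 0 then 1 else x)"
    proof -
      have "(\<Prod>e\<in>E. if w e = 0 then 1 else x) = (\<Prod>e\<in>{e\<in>E. w e \<noteq> 0}. x)"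
        using E by (intro prod.mono_neutral_cong_right) auto
      then show ?thesis by simp
    qed
    finally have 1: "x powr K \<le> (\<Prod>e\<in>E. if w e = 0 then 1 else x)" .
    have "exp (- (B * K)) \<le> exp (- (\<Sum>e\<in>E. (real_of_int (w e))\<^sup>2))" using w by (simp add: W_def)
    also have "\<dots> = (\<Prod>e\<in>E. exp (- (real_of_int (w e))\<^sup>2))"
      using E by (simp add: exp_sum flip: sum_negf)
    also have "\<dots> \<le> (\<Prod>e\<in>E. (1/2::real) ^ nat \<bar>w e\<bar>)"
    proof (rule prod_mono)
      fix e assume "e \<in> E"
      define z where "z = nat \<bar>w e\<bar>"
      have "real z \<le> (real_of_int (w e))\<^sup>2"
      proof -
        have "int z \<le> \<bar>w e\<bar> * \<bar>w e\<bar>" unfolding z_def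
          using mult_left_mono[of 1 "\<bar>w e\<bar>" "\<bar>w e\<bar>"] by (cases "w e = 0") auto
        then have "real_of_int (int z) \<le> real_of_int (\<bar>w e\<bar> * \<bar>w e\<bar>)" by (simp only: of_int_le_iff)
        then show ?thesis by (simp add: power2_eq_square)
      qed
      then have "exp (- (real_of_int (w e))\<^sup>2) \<le> exp (- real z)" by simp
      also have "\<dots> = exp (-1) ^ z" by (simp flip: exp_of_nat_mult)
      also have "\<dots> \<le> (1/2) ^ z"
      proof (rule power_mono)
        have "2 \<le> exp (1::real)" using exp_ge_add_one_self[of 1] by simp
        then show "exp (-1) \<le> (1/2::real)" by (simp add: exp_minus field_simps)
      qed simp
      finally show "0 \<le> exp (- (real_of_int (w e))\<^sup>2) \<and> exp (- (real_of_int (w e))\<^sup>2) \<le> (1/2) ^ nat \<bar>w e\<bar>"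
        by (simp add: z_def)
    qed
    finally have 2: "exp (- (B * K)) \<le> (\<Prod>e\<in>E. (1/2::real) ^ nat \<bar>w e\<bar>)" .
    have "exp (- (B * K)) * x powr K \<le>
        (\<Prod>e\<in>E. (1/2::real) ^ nat \<bar>w e\<bar>) * (\<Prod>e\<in>E. if w e = 0 then 1 else x)"
      using 1 2 by (intro mult_mono) (auto intro: prod_nonneg)
    also have "\<dots> = G w" unfolding G_def prod.distrib[symmetric] by (simp add: mult.commute)
    finally show ?thesis .
  qed
  have finPi: "finite (E \<rightarrow>\<^sub>E {- R..R})" using E by (intro finite_PiE) auto
  have "real (card W) * (exp (- (B * K)) * x powr K) \<le> (\<Sum>w\<in>W. G w)"
    using sum_mono[of W "\<lambda>_. exp (- (B * K)) * x powr K" G] G by simp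
  also have "\<dots> \<le> (\<Sum>w\<in>E \<rightarrow>\<^sub>E {- R..R}. G w)"
  proof (rule sum_mono2[OF finPi])
    show "0 \<le> G w" for w using x unfolding G_def by (intro prod_nonneg) auto
  qed (auto simp: W_def)
  also have "\<dots> = (\<Prod>e\<in>E. \<Sum>z\<in>{- R..R}. (if z = 0 then 1 else x) * (1/2::real) ^ nat \<bar>z\<bar>)"
    unfolding G_def using E by (subst prod_sum_PiE) auto
  also have "\<dots> \<le> (\<Prod>e\<in>E. 1 + 2 * x)"
    using x by (intro prod_mono conjI sum_half_power_le sum_nonneg) auto
  also have "\<dots> = (1 + 2 * x) ^ card E" by simp
  also have "\<dots> \<le> exp (2 * x) ^ card E"
    using x by (intro power_mono) auto
  also have "\<dots> = exp (2 * (x * n))" by (simp add: n_def mult.commute mult.left_commute flip: exp_of_nat_mult)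
  also have "\<dots> \<le> exp (2 * K)" using x by simp
  finally have "real (card W) * (exp (- (B * K)) * x powr K) \<le> exp (2 * K)" .
  then have "real (card W) \<le> exp (2 * K) / (exp (- (B * K)) * x powr K)"
    using x by (simp add: field_simps)
  also have "\<dots> = exp (2 * K + B * K + K * (- ln x))"
    using x by (simp add: powr_def exp_add exp_minus exp_diff field_simps)
  finally show ?thesis unfolding lnx n_def by (simp add: algebra_simps)
qed

definition sparse_on :: "'e set \<Rightarrow> real \<Rightarrow> ('e \<Rightarrow> real) \<Rightarrow> bool" where
  "sparse_on E K h \<longleftrightarrow> real (card {e\<in>E. h e \<noteq> 0}) \<le> K"

text \<open>
  Rounding towards zero to multiples of \<open>\<delta>\<close> increases neither the support nor the norm, so the rounded
  vectors are among the counted lattice points.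
\<close>

lemma lattice_net:
  fixes E :: "'e set" and K B \<delta> :: real
  assumes E: "finite E" and K: "0 < K" and B: "0 \<le> B" and \<delta>: "0 < \<delta>"
  shows "\<exists>T. finite T \<and> real (card T) \<le> exp (K * (B + 2 + max 0 (ln (real (card E) / K)))) \<and>
    (\<forall>h. sparse_on E K h \<and> (\<Sum>e\<in>E. (h e)\<^sup>2) \<le> B * K * \<delta>\<^sup>2 \<longrightarrow>
      (\<exists>h'\<in>T. \<forall>e\<in>E. \<bar>h e - h' e\<bar> \<le> \<delta> \<and> (h e = 0 \<longrightarrow> h' e = 0)))"
proof -
  define R :: int where "R = \<lceil>B * K\<rceil> + 1"
  \<comment> \<open>the range \<open>R\<close> only makes the set visibly finite; the norm bound implies it\<close>
  define W where "W = {w \<in> E \<rightarrow>\<^sub>E {- R..R}. real (card {e\<in>E. w e \<noteq> 0}) \<le> K \<and>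
      (\<Sum>e\<in>E. (real_of_int (w e))\<^sup>2) \<le> B * K}"
  define T where "T = (\<lambda>w e. \<delta> * real_of_int (w e)) ` W"
  have finW: "finite W" unfolding W_def
    by (rule finite_subset[of _ "E \<rightarrow>\<^sub>E {- R..R}"]) (use E in \<open>auto intro!: finite_PiE\<close>)
  have "real (card T) \<le> real (card W)" unfolding T_def using finW by (simp add: card_image_le)
  also have "\<dots> \<le> exp (K * (B + 2 + max 0 (ln (real (card E) / K))))"
    unfolding W_def by (rule card_sparse_lattice_points[OF E K B])
  finally have c: "real (card T) \<le> exp (K * (B + 2 + max 0 (ln (real (card E) / K))))" .
  moreover have "\<exists>h'\<in>T. \<forall>e\<in>E. \<bar>h e - h' e\<bar> \<le> \<delta> \<and> (h e = 0 \<longrightarrow> h' e = 0)"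
    if sp: "sparse_on E K h" and nh: "(\<Sum>e\<in>E. (h e)\<^sup>2) \<le> B * K * \<delta>\<^sup>2" for h
  proof -
    define r where "r t = (if 0 \<le> t then \<lfloor>t\<rfloor> else - \<lfloor>- t\<rfloor>)" for t :: real
    have r: "\<bar>t - real_of_int (r t)\<bar> \<le> 1" "\<bar>real_of_int (r t)\<bar> \<le> \<bar>t\<bar>" "r 0 = 0" for t
    proof -
      have f: "0 \<le> real_of_int \<lfloor>s\<rfloor>" "real_of_int \<lfloor>s\<rfloor> \<le> s" "s \<le> real_of_int \<lfloor>s\<rfloor> + 1"
        if "0 \<le> s" for s :: real
        using that floor_correct[of s] by auto
      have "\<bar>t - real_of_int (r t)\<bar> \<le> 1 \<and> \<bar>real_of_int (r t)\<bar> \<le> \<bar>t\<bar>"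
      proof (cases "0 \<le> t")
        case True
        then have "real_of_int (r t) = real_of_int \<lfloor>t\<rfloor>" by (simp only: r_def if_True)
        then show ?thesis using f[OF True] True by linarith
      next
        case False
        then have "real_of_int (r t) = - real_of_int \<lfloor>- t\<rfloor>" by (simp only: r_def if_False of_int_minus)
        then show ?thesis using f[of "- t"] False by linarith
      qed
      then show "\<bar>t - real_of_int (r t)\<bar> \<le> 1" "\<bar>real_of_int (r t)\<bar> \<le> \<bar>t\<bar>" by blast+
    qed (simp add: r_def)
    define w where "w = (\<lambda>e\<in>E. r (h e / \<delta>))"
    have sq: "(real_of_int (w e))\<^sup>2 \<le> (h e)\<^sup>2 / \<delta>\<^sup>2" if "e \<in> E" for e
      using r(2)[of "h e / \<delta>"] that unfolding abs_le_square_iff by (simp add: w_def power_divide)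
    have "(\<Sum>e\<in>E. (real_of_int (w e))\<^sup>2) \<le> (\<Sum>e\<in>E. (h e)\<^sup>2 / \<delta>\<^sup>2)" by (rule sum_mono[OF sq])
    also have "\<dots> = (\<Sum>e\<in>E. (h e)\<^sup>2) / \<delta>\<^sup>2" by (rule sum_divide_distrib[symmetric])
    also have "\<dots> \<le> B * K" using nh \<delta> by (simp add: divide_le_eq)
    finally have sw: "(\<Sum>e\<in>E. (real_of_int (w e))\<^sup>2) \<le> B * K" .
    have "w e \<in> {- R..R}" if e: "e \<in> E" for e
    proof -
      have "\<bar>w e\<bar> \<le> \<bar>w e\<bar> * \<bar>w e\<bar>"
        using mult_left_mono[of 1 "\<bar>w e\<bar>" "\<bar>w e\<bar>"] by (cases "w e = 0") auto
      then have "real_of_int \<bar>w e\<bar> \<le> real_of_int (\<bar>w e\<bar> * \<bar>w e\<bar>)" by (simp only: of_int_le_iff)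
      also have "\<dots> = (real_of_int (w e))\<^sup>2" by (simp add: power2_eq_square)
      also have "\<dots> \<le> (\<Sum>e\<in>E. (real_of_int (w e))\<^sup>2)" using E e by (intro member_le_sum) auto
      also have "\<dots> \<le> B * K" by (rule sw)
      finally have "real_of_int \<bar>w e\<bar> \<le> real_of_int \<lceil>B * K\<rceil>" by linarith
      then have "\<bar>w e\<bar> \<le> R" unfolding R_def by linarith
      then show ?thesis by auto
    qed
    moreover have "card {e\<in>E. w e \<noteq> 0} \<le> card {e\<in>E. h e \<noteq> 0}"
      using E r(3) by (intro card_mono) (auto simp: w_def)
    ultimately have "w \<in> W" using sp sw by (auto simp: W_def sparse_on_def w_def)
    moreover have "\<bar>h e - \<delta> * real_of_int (w e)\<bar> \<le> \<delta>" if "e \<in> E" for e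
    proof -
      have "h e - \<delta> * real_of_int (w e) = \<delta> * (h e / \<delta> - real_of_int (r (h e / \<delta>)))"
        using \<delta> that by (simp add: w_def field_simps)
      then show ?thesis using r(1)[of "h e / \<delta>"] \<delta> by (simp add: abs_mult)
    qed
    moreover have "h e = 0 \<Longrightarrow> w e = 0" if "e \<in> E" for e using that r(3) by (simp add: w_def)
    ultimately show ?thesis
      by (intro bexI[of _ "\<lambda>e. \<delta> * real_of_int (w e)"]) (auto simp: T_def)
  qed
  ultimately show ?thesis using finW by (intro exI[of _ T]) (auto simp: T_def)
qed

text \<open>
  The error is split into two members of the same class. For low rank matrices a difference of two
  members has twice the rank; with two error terms the class need only be a cone.
\<close>

definition has_net :: "'e set \<Rightarrow> (('e \<Rightarrow> real) \<Rightarrow> bool) \<Rightarrow> real \<Rightarrow> real \<Rightarrow> bool" where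
  "has_net E D \<epsilon> C \<longleftrightarrow> (\<exists>T. finite T \<and> real (card T) \<le> exp C \<and>
     (\<forall>h. D h \<and> L2_set h E \<le> 1 \<longrightarrow> (\<exists>h'\<in>T. \<exists>d\<^sub>1 d\<^sub>2. D d\<^sub>1 \<and> D d\<^sub>2 \<and> L2_set d\<^sub>1 E \<le> \<epsilon> \<and> L2_set d\<^sub>2 E \<le> \<epsilon> \<and>
        (\<forall>e\<in>E. h e = h' e + d\<^sub>1 e + d\<^sub>2 e))))"

lemma has_net_mono: "has_net E D \<epsilon> C \<Longrightarrow> C \<le> C' \<Longrightarrow> has_net E D \<epsilon> C'"
  unfolding has_net_def
  by (erule ex_forward, elim conjE, intro conjI, assumption, erule order_trans, simp, assumption)

lemma sparse_net:
  fixes E :: "'e set"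
  assumes E: "finite E" and K: "0 < K" and \<epsilon>: "0 < \<epsilon>"
  shows "has_net E (sparse_on E K) \<epsilon> (K * (1 / \<epsilon>\<^sup>2 + 2 + max 0 (ln (real (card E) / K))))"
proof -
  define \<delta> where "\<delta> = \<epsilon> / sqrt K"
  have \<delta>: "0 < \<delta>" "\<delta>\<^sup>2 = \<epsilon>\<^sup>2 / K" using K \<epsilon> by (auto simp: \<delta>_def power_divide)
  obtain T where T: "finite T" "real (card T) \<le> exp (K * (1 / \<epsilon>\<^sup>2 + 2 + max 0 (ln (real (card E) / K))))"
    and net: "\<And>h. sparse_on E K h \<Longrightarrow> (\<Sum>e\<in>E. (h e)\<^sup>2) \<le> 1 / \<epsilon>\<^sup>2 * K * \<delta>\<^sup>2 \<Longrightarrow>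
      (\<exists>h'\<in>T. \<forall>e\<in>E. \<bar>h e - h' e\<bar> \<le> \<delta> \<and> (h e = 0 \<longrightarrow> h' e = 0))"
    using lattice_net[OF E K _ \<delta>(1), of "1 / \<epsilon>\<^sup>2"] by (simp only: zero_le_divide_1_iff zero_le_power2) blast
  have "\<exists>h'\<in>T. \<exists>d\<^sub>1 d\<^sub>2. sparse_on E K d\<^sub>1 \<and> sparse_on E K d\<^sub>2 \<and> L2_set d\<^sub>1 E \<le> \<epsilon> \<and> L2_set d\<^sub>2 E \<le> \<epsilon> \<and>
        (\<forall>e\<in>E. h e = h' e + d\<^sub>1 e + d\<^sub>2 e)" if h: "sparse_on E K h" "L2_set h E \<le> 1" for h
  proof -
    have "(\<Sum>e\<in>E. (h e)\<^sup>2) \<le> 1" using h(2) by (simp add: L2_set_def)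
    then have "(\<Sum>e\<in>E. (h e)\<^sup>2) \<le> 1 / \<epsilon>\<^sup>2 * K * \<delta>\<^sup>2" using \<delta> K \<epsilon> by simp
    then obtain h' where h': "h' \<in> T" "\<forall>e\<in>E. \<bar>h e - h' e\<bar> \<le> \<delta> \<and> (h e = 0 \<longrightarrow> h' e = 0)"
      using net[OF h(1)] by blast
    define d where "d e = h e - h' e" for e
    have "card {e\<in>E. d e \<noteq> 0} \<le> card {e\<in>E. h e \<noteq> 0}"
      using E h'(2) by (intro card_mono) (auto simp: d_def)
    then have sd: "sparse_on E K d" using h(1) by (simp add: sparse_on_def)
    have "(\<Sum>e\<in>E. (d e)\<^sup>2) = (\<Sum>e\<in>{e\<in>E. h e \<noteq> 0}. (d e)\<^sup>2)"
      using E h'(2) by (intro sum.mono_neutral_right) (auto simp: d_def)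
    also have "\<dots> \<le> (\<Sum>e\<in>{e\<in>E. h e \<noteq> 0}. \<delta>\<^sup>2)"
    proof (rule sum_mono)
      fix e assume "e \<in> {e \<in> E. h e \<noteq> 0}"
      then have "\<bar>d e\<bar> \<le> \<bar>\<delta>\<bar>" using h'(2) \<delta>(1) by (simp add: d_def)
      then show "(d e)\<^sup>2 \<le> \<delta>\<^sup>2" by (simp only: abs_le_square_iff)
    qed
    also have "\<dots> \<le> K * \<delta>\<^sup>2" using h(1) by (simp add: sparse_on_def mult_right_mono)
    also have "\<dots> = \<epsilon>\<^sup>2" using \<delta> K by simp
    finally have "L2_set d E \<le> \<epsilon>" using \<epsilon> by (simp add: L2_set_def real_le_lsqrt sum_nonneg)
    moreover have "sparse_on E K (\<lambda>_. 0)" using K by (simp add: sparse_on_def)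
    moreover have "L2_set (\<lambda>_. 0) E \<le> \<epsilon>" using \<epsilon> by (simp add: L2_set_def)
    moreover have "\<forall>e\<in>E. h e = h' e + d e + 0" by (simp add: d_def)
    ultimately show ?thesis using h'(1) sd by blast
  qed
  then show ?thesis unfolding has_net_def using T by blast
qed

definition low_rank :: "nat \<Rightarrow> nat \<Rightarrow> nat \<Rightarrow> (nat \<times> nat \<Rightarrow> real) \<Rightarrow> bool" where
  "low_rank n N K h \<longleftrightarrow> (\<exists>x y. \<forall>p<n. \<forall>q<N. h (p, q) = (\<Sum>i<K. x i p * y i q))"

lemma L2_set_rank_one_sum:
  assumes "\<And>p q. p < n \<Longrightarrow> q < N \<Longrightarrow> h (p, q) = (\<Sum>i\<in>I. x i p * y i q)"
  shows "(L2_set h ({..<n} \<times> {..<N}))\<^sup>2 = (\<Sum>i\<in>I. \<Sum>j\<in>I. dotp {..<n} (x i) (x j) * dotp {..<N} (y i) (y j))"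
proof -
  have "(L2_set h ({..<n} \<times> {..<N}))\<^sup>2 = (\<Sum>p<n. \<Sum>q<N. h (p, q) * h (p, q))"
    by (simp add: L2_set_def sum_nonneg sum.cartesian_product power2_eq_square)
  also have "\<dots> = (\<Sum>p<n. \<Sum>q<N. \<Sum>i\<in>I. \<Sum>j\<in>I. (x i p * x j p) * (y i q * y j q))"
    by (intro sum.cong refl) (auto simp: assms sum_product mult_ac)
  also have "\<dots> = (\<Sum>p<n. \<Sum>i\<in>I. \<Sum>j\<in>I. \<Sum>q<N. (x i p * x j p) * (y i q * y j q))"
    by (rule sum.cong[OF refl], subst sum.swap, rule sum.cong[OF refl], rule sum.swap)
  also have "\<dots> = (\<Sum>i\<in>I. \<Sum>j\<in>I. \<Sum>p<n. \<Sum>q<N. (x i p * x j p) * (y i q * y j q))"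
    by (subst sum.swap, rule sum.cong[OF refl], rule sum.swap)
  also have "\<dots> = (\<Sum>i\<in>I. \<Sum>j\<in>I. dotp {..<n} (x i) (x j) * dotp {..<N} (y i) (y j))"
    by (simp add: dotp_def sum_product)
  finally show ?thesis .
qed

lemma L2_set_orthogonal_sum:
  assumes h: "\<And>p q. p < n \<Longrightarrow> q < N \<Longrightarrow> h (p, q) = (\<Sum>i\<in>I. x i p * y i q)" and "finite I"
    and orth: "\<And>i j. i \<in> I \<Longrightarrow> j \<in> I \<Longrightarrow> i \<noteq> j \<Longrightarrow> dotp {..<n} (x i) (x j) = 0 \<or> dotp {..<N} (y i) (y j) = 0"
  shows "(L2_set h ({..<n} \<times> {..<N}))\<^sup>2 = (\<Sum>i\<in>I. dotp {..<n} (x i) (x i) * dotp {..<N} (y i) (y i))"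
proof -
  have "(L2_set h ({..<n} \<times> {..<N}))\<^sup>2 = (\<Sum>i\<in>I. \<Sum>j\<in>I. dotp {..<n} (x i) (x j) * dotp {..<N} (y i) (y j))"
    by (rule L2_set_rank_one_sum) (rule h)
  also have "\<dots> = (\<Sum>i\<in>I. \<Sum>j\<in>I. if j = i then dotp {..<n} (x i) (x i) * dotp {..<N} (y i) (y i) else 0)"
    by (intro sum.cong refl) (use orth in auto)
  finally show ?thesis using \<open>finite I\<close> by simp
qed

text \<open>
  The normal form behind the net: coefficients in an orthogonal frame, indexed by \<open>K\<close> even if
  the rank is smaller, in which case the remaining frame vectors vanish.
\<close>

lemma low_rank_svd:
  assumes "low_rank n N K h"
  shows "\<exists>x q. onz {..<N} {..<K} q \<and> (\<forall>i<K. \<forall>j<K. i \<noteq> j \<longrightarrow> dotp {..<n} (x i) (x j) = 0) \<and>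
    (\<Sum>i<K. dotp {..<n} (x i) (x i)) = (L2_set h ({..<n} \<times> {..<N}))\<^sup>2 \<and>
    (\<forall>p<n. \<forall>r<N. h (p, r) = (\<Sum>i<K. x i p * q i r))"
proof -
  define X where "X = Matrix.mat n N h"
  have X: "X \<in> carrier_mat n N" by (simp add: X_def)
  obtain J \<sigma> u v where svdX: "is_svd n N (($$) X) J \<sigma> u v" using svd_exists[OF X] by blast
  then have svd: "is_svd n N h J \<sigma> u v" by (simp add: is_svd_def X_def)
  obtain a b where ab: "\<forall>p<n. \<forall>q<N. h (p, q) = (\<Sum>i<K. a i p * b i q)"
    using assms by (auto simp: low_rank_def)
  have cJ: "card J \<le> K"
    using svd_card_le_rank_one_terms[OF svd, of "{..<K}" a b] ab by simp
  have J: "finite J" "ons {..<n} J u" "ons {..<N} J v" using svd by (auto simp: is_svd_def)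
  obtain f where f: "bij_betw f {..<card J} J"
    using ex_bij_betw_nat_finite[OF J(1)] by (auto simp: lessThan_atLeast0)
  have fJ: "f i \<in> J" if "i < card J" for i using f that by (auto simp: bij_betw_def)
  have fi: "f i = f j \<longleftrightarrow> i = j" if "i < card J" "j < card J" for i j
    using f that by (auto simp: bij_betw_def inj_on_def)
  define x where "x i p = (if i < card J then \<sigma> (f i) * u (f i) p else 0)" for i p
  define q where "q i p = (if i < card J then v (f i) p else 0)" for i p
  have dq: "dotp {..<N} (q i) (q j) = (if i < card J \<and> i = j then 1 else 0)" for i j
  proof -
    have "dotp {..<N} (q i) (q j) = (if i < card J \<and> j < card J then dotp {..<N} (v (f i)) (v (f j)) else 0)"
      by (simp add: q_def dotp_def)
    moreover have "dotp {..<N} (v (f i)) (v (f j)) = (if i = j then 1 else 0)"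
      if "i < card J" "j < card J"
      using J(3) fJ[OF that(1)] fJ[OF that(2)] fi[OF that] by (simp only: ons_def)
    ultimately show ?thesis by (cases "i = j") simp_all
  qed
  have dx: "dotp {..<n} (x i) (x j) = (if i < card J \<and> i = j then (\<sigma> (f i))\<^sup>2 else 0)" for i j
  proof -
    have "dotp {..<n} (x i) (x j) = (if i < card J \<and> j < card J then
        \<sigma> (f i) * \<sigma> (f j) * dotp {..<n} (u (f i)) (u (f j)) else 0)"
      by (simp add: x_def dotp_def sum_distrib_left mult_ac)
    moreover have "dotp {..<n} (u (f i)) (u (f j)) = (if i = j then 1 else 0)"
      if "i < card J" "j < card J"
      using J(2) fJ[OF that(1)] fJ[OF that(2)] fi[OF that] by (simp only: ons_def)
    ultimately show ?thesis by (cases "i = j") (simp_all add: power2_eq_square)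
  qed
  have on: "onz {..<N} {..<K} q" by (auto simp: onz_def dq)
  have ex: "h (p, r) = (\<Sum>i<K. x i p * q i r)" if "p < n" "r < N" for p r
  proof -
    have "h (p, r) = (\<Sum>j\<in>J. \<sigma> j * u j p * v j r)" using svd that unfolding is_svd_def by blast
    also have "\<dots> = (\<Sum>i<card J. \<sigma> (f i) * u (f i) p * v (f i) r)"
      by (rule sum.reindex_bij_betw[OF f, symmetric])
    also have "\<dots> = (\<Sum>i<K. x i p * q i r)"
      by (rule sum.mono_neutral_cong_left) (use cJ in \<open>auto simp: x_def q_def\<close>)
    finally show ?thesis .
  qed
  have "(L2_set h ({..<n} \<times> {..<N}))\<^sup>2 = (\<Sum>i<K. dotp {..<n} (x i) (x i) * dotp {..<N} (q i) (q i))"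
    by (rule L2_set_orthogonal_sum) (auto simp: dq ex)
  also have "\<dots> = (\<Sum>i<K. dotp {..<n} (x i) (x i))" by (rule sum.cong) (auto simp: dq dx)
  finally show ?thesis using on ex dx by (intro exI[of _ x] exI[of _ q]) auto
qed

text \<open>
  Lattice points near a frame need not be frames themselves. The net therefore takes one frame near
  every lattice point that has one, at the price of doubling the distance.
\<close>

lemma frame_net:
  assumes n: "1 \<le> N" "1 \<le> K" and \<epsilon>: "0 < \<epsilon>"
  shows "\<exists>T :: (nat \<Rightarrow> nat \<Rightarrow> real) set. finite T \<and> real (card T) \<le> exp (real K * real N * (1 / \<epsilon>\<^sup>2 + 2)) \<and>
    (\<forall>q\<in>T. onz {..<N} {..<K} q) \<and>
    (\<forall>q. onz {..<N} {..<K} q \<longrightarrow> (\<exists>q'\<in>T. \<forall>i<K. dotp {..<N} (\<lambda>r. q i r - q' i r) (\<lambda>r. q i r - q' i r) \<le> (2 * \<epsilon>)\<^sup>2))"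
proof -
  define E where "E = {..<K} \<times> {..<N}"
  define \<delta> where "\<delta> = \<epsilon> / sqrt (real N)"
  have \<delta>: "0 < \<delta>" "\<delta>\<^sup>2 = \<epsilon>\<^sup>2 / real N" using n \<epsilon> by (auto simp: \<delta>_def power_divide)
  have cE: "finite E" "real (card E) = real K * real N" "0 < real (card E)" using n by (auto simp: E_def)
  have ce: "max 0 (ln (real (card E) / real (card E))) = 0" using cE(3) by simp
  obtain T0 where T0: "finite T0" "real (card T0) \<le> exp (real (card E) * (1 / \<epsilon>\<^sup>2 + 2 + max 0 (ln (real (card E) / real (card E)))))"
    and net: "\<And>h. sparse_on E (real (card E)) h \<Longrightarrow> (\<Sum>e\<in>E. (h e)\<^sup>2) \<le> 1 / \<epsilon>\<^sup>2 * real (card E) * \<delta>\<^sup>2 \<Longrightarrow>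
      (\<exists>h'\<in>T0. \<forall>e\<in>E. \<bar>h e - h' e\<bar> \<le> \<delta> \<and> (h e = 0 \<longrightarrow> h' e = 0))"
    using lattice_net[OF cE(1,3) _ \<delta>(1), of "1 / \<epsilon>\<^sup>2"] by (simp only: zero_le_divide_1_iff zero_le_power2) blast
  \<comment> \<open>a frame entrywise close to the lattice point \<open>h\<close>\<close>
  define near where "near h q \<longleftrightarrow> onz {..<N} {..<K} q \<and> (\<forall>i<K. \<forall>r<N. \<bar>q i r - h (i, r)\<bar> \<le> \<delta>)" for h q
  define T where "T = (\<lambda>h. SOME q. near h q) ` {h\<in>T0. \<exists>q. near h q}"
  have nr: "near h (SOME q. near h q)" if "near h q" for h q using that by (rule someI[of "\<lambda>q. near h q"])
  have "card T \<le> card {h\<in>T0. \<exists>q. near h q}" using T0(1) by (simp add: T_def card_image_le)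
  also have "\<dots> \<le> card T0" by (rule card_mono) (use T0(1) in auto)
  finally have "real (card T) \<le> real (card T0)" by simp
  then have "real (card T) \<le> exp (real K * real N * (1 / \<epsilon>\<^sup>2 + 2))"
    using T0(2) unfolding ce cE(2) by simp
  moreover have "\<forall>q\<in>T. onz {..<N} {..<K} q" using nr by (auto simp: T_def near_def)
  moreover have "\<exists>q'\<in>T. \<forall>i<K. dotp {..<N} (\<lambda>r. q i r - q' i r) (\<lambda>r. q i r - q' i r) \<le> (2 * \<epsilon>)\<^sup>2"
    if q: "onz {..<N} {..<K} q" for q
  proof -
    define h where "h = (\<lambda>(i, r). q i r)"
    have "card {e\<in>E. h e \<noteq> 0} \<le> card E" using cE(1) by (intro card_mono) auto
    then have "sparse_on E (real (card E)) h" by (simp add: sparse_on_def)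
    moreover have "(\<Sum>e\<in>E. (h e)\<^sup>2) \<le> 1 / \<epsilon>\<^sup>2 * real (card E) * \<delta>\<^sup>2"
    proof -
      have "(\<Sum>e\<in>E. (h e)\<^sup>2) = (\<Sum>i<K. dotp {..<N} (q i) (q i))"
        by (simp add: E_def h_def dotp_def sum.cartesian_product case_prod_unfold power2_eq_square)
      also have "\<dots> \<le> (\<Sum>i<K. 1)" by (intro sum_mono) (use onzD(2)[OF q] in auto)
      also have "\<dots> = 1 / \<epsilon>\<^sup>2 * real (card E) * \<delta>\<^sup>2" using \<epsilon> n by (simp add: cE \<delta>)
      finally show ?thesis .
    qed
    ultimately obtain h' where h': "h' \<in> T0" "\<forall>e\<in>E. \<bar>h e - h' e\<bar> \<le> \<delta>" using net by blast
    then have "near h' q" using q by (auto simp: near_def E_def h_def)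
    define q' where "q' = (SOME q. near h' q)"
    have q': "near h' q'" unfolding q'_def by (rule nr[OF \<open>near h' q\<close>])
    have "q' \<in> T" using h'(1) \<open>near h' q\<close> by (auto simp: T_def q'_def)
    moreover have "dotp {..<N} (\<lambda>r. q i r - q' i r) (\<lambda>r. q i r - q' i r) \<le> (2 * \<epsilon>)\<^sup>2" if i: "i < K" for i
    proof -
      have "dotp {..<N} (\<lambda>r. q i r - q' i r) (\<lambda>r. q i r - q' i r) \<le> (\<Sum>r<N. (2 * \<delta>)\<^sup>2)"
        unfolding dotp_def
      proof (rule sum_mono)
        fix r assume "r \<in> {..<N}"
        then have "\<bar>q i r - h' (i, r)\<bar> \<le> \<delta>" "\<bar>q' i r - h' (i, r)\<bar> \<le> \<delta>"
          using \<open>near h' q\<close> q' i by (auto simp: near_def)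
        then have "\<bar>q i r - q' i r\<bar> \<le> \<bar>2 * \<delta>\<bar>" by linarith
        then show "(q i r - q' i r) * (q i r - q' i r) \<le> (2 * \<delta>)\<^sup>2"
          unfolding abs_le_square_iff by (simp add: power2_eq_square)
      qed
      also have "\<dots> = (2 * \<epsilon>)\<^sup>2" using n by (simp add: power_mult_distrib \<delta>)
      finally show ?thesis .
    qed
    ultimately show ?thesis by blast
  qed
  moreover have "finite T" using T0(1) by (simp add: T_def)
  ultimately show ?thesis by blast
qed

text \<open>
  Approximating the coefficients \<open>x\<close> and the frame \<open>q\<close> of \<open>h = \<Sum> x i q i\<^sup>T\<close> separately leaves the errors
  \<open>(x - w) q'\<^sup>T\<close> and \<open>x (q - q')\<^sup>T\<close>, both of rank at most \<open>K\<close>. Orthogonality of the \<open>q'\<close> controls the first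
  and orthogonality of the \<open>x i\<close> the second.
\<close>

lemma low_rank_net:
  assumes n: "1 \<le> n" "1 \<le> N" "1 \<le> K" and \<epsilon>: "0 < \<epsilon>"
  shows "has_net ({..<n} \<times> {..<N}) (low_rank n N K) (2 * \<epsilon>) (real K * real (n + N) * (1 / \<epsilon>\<^sup>2 + 2))"
proof -
  define F where "F = {..<n} \<times> {..<N}"
  define E where "E = {..<K} \<times> {..<n}"
  have cE: "finite E" "real (card E) = real K * real n" "0 < real (card E)" using n by (auto simp: E_def)
  define \<delta> where "\<delta> = \<epsilon> / sqrt (real (card E))"
  have \<delta>: "0 < \<delta>" "\<delta>\<^sup>2 = \<epsilon>\<^sup>2 / real (card E)" using cE \<epsilon> by (auto simp: \<delta>_def power_divide)
  have ce: "max 0 (ln (real (card E) / real (card E))) = 0" using cE(3) by simp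
  obtain T1 where T1: "finite T1" "real (card T1) \<le> exp (real (card E) * (1 / \<epsilon>\<^sup>2 + 2 + max 0 (ln (real (card E) / real (card E)))))"
    and net1: "\<And>h. sparse_on E (real (card E)) h \<Longrightarrow> (\<Sum>e\<in>E. (h e)\<^sup>2) \<le> 1 / \<epsilon>\<^sup>2 * real (card E) * \<delta>\<^sup>2 \<Longrightarrow>
      (\<exists>h'\<in>T1. \<forall>e\<in>E. \<bar>h e - h' e\<bar> \<le> \<delta> \<and> (h e = 0 \<longrightarrow> h' e = 0))"
    using lattice_net[OF cE(1,3) _ \<delta>(1), of "1 / \<epsilon>\<^sup>2"] by (simp only: zero_le_divide_1_iff zero_le_power2) blast
  obtain T2 :: "(nat \<Rightarrow> nat \<Rightarrow> real) set" where T2: "finite T2"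
      "real (card T2) \<le> exp (real K * real N * (1 / \<epsilon>\<^sup>2 + 2))" "\<And>q. q \<in> T2 \<Longrightarrow> onz {..<N} {..<K} q"
    and net2: "\<And>q. onz {..<N} {..<K} q \<Longrightarrow>
      (\<exists>q'\<in>T2. \<forall>i<K. dotp {..<N} (\<lambda>r. q i r - q' i r) (\<lambda>r. q i r - q' i r) \<le> (2 * \<epsilon>)\<^sup>2)"
    using frame_net[OF n(2,3) \<epsilon>] by blast
  define T where "T = (\<lambda>(w, q) (p, r). \<Sum>i<K. w (i, p) * q i r) ` (T1 \<times> T2)"
  have "real (card T) \<le> real (card (T1 \<times> T2))"
    unfolding T_def using T1(1) T2(1) by (simp only: of_nat_le_iff) (intro card_image_le, simp)
  also have "\<dots> = real (card T1) * real (card T2)" by (simp add: card_cartesian_product)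
  also have "\<dots> \<le> exp (real K * real n * (1 / \<epsilon>\<^sup>2 + 2)) * exp (real K * real N * (1 / \<epsilon>\<^sup>2 + 2))"
    using T1(2) T2(2) unfolding ce cE(2) by (intro mult_mono) auto
  also have "\<dots> = exp (real K * real (n + N) * (1 / \<epsilon>\<^sup>2 + 2))"
    by (simp add: algebra_simps flip: exp_add)
  finally have cT: "real (card T) \<le> exp (real K * real (n + N) * (1 / \<epsilon>\<^sup>2 + 2))" .
  have "\<exists>h'\<in>T. \<exists>d\<^sub>1 d\<^sub>2. low_rank n N K d\<^sub>1 \<and> low_rank n N K d\<^sub>2 \<and> L2_set d\<^sub>1 F \<le> 2 * \<epsilon> \<and>
       L2_set d\<^sub>2 F \<le> 2 * \<epsilon> \<and> (\<forall>e\<in>F. h e = h' e + d\<^sub>1 e + d\<^sub>2 e)"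
    if h: "low_rank n N K h" "L2_set h F \<le> 1" for h
  proof -
    obtain x q where q: "onz {..<N} {..<K} q"
      and x: "\<And>i j. i < K \<Longrightarrow> j < K \<Longrightarrow> i \<noteq> j \<Longrightarrow> dotp {..<n} (x i) (x j) = 0"
      and xs: "(\<Sum>i<K. dotp {..<n} (x i) (x i)) = (L2_set h F)\<^sup>2"
      and hx: "\<And>p r. p < n \<Longrightarrow> r < N \<Longrightarrow> h (p, r) = (\<Sum>i<K. x i p * q i r)"
      using low_rank_svd[OF h(1)] unfolding F_def by blast
    have xs1: "(\<Sum>i<K. dotp {..<n} (x i) (x i)) \<le> 1" using h(2) by (simp add: xs abs_square_le_1)
    have "card {e\<in>E. (case e of (i, p) \<Rightarrow> x i p) \<noteq> 0} \<le> card E" using cE(1) by (intro card_mono) auto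
    then have "sparse_on E (real (card E)) (\<lambda>(i, p). x i p)" by (simp add: sparse_on_def)
    moreover have "(\<Sum>e\<in>E. ((\<lambda>(i, p). x i p) e)\<^sup>2) \<le> 1 / \<epsilon>\<^sup>2 * real (card E) * \<delta>\<^sup>2"
    proof -
      have "(\<Sum>e\<in>E. ((\<lambda>(i, p). x i p) e)\<^sup>2) = (\<Sum>i<K. dotp {..<n} (x i) (x i))"
        by (simp add: E_def dotp_def sum.cartesian_product case_prod_unfold power2_eq_square)
      moreover have "1 / \<epsilon>\<^sup>2 * c * (\<epsilon>\<^sup>2 / c) = 1" if "0 < c" for c using that \<epsilon> by simp
      ultimately show ?thesis using xs1 cE(3) unfolding \<delta>(2) by (simp only:)
    qed
    ultimately obtain w where w1: "w \<in> T1" "\<forall>e\<in>E. \<bar>(case e of (i, p) \<Rightarrow> x i p) - w e\<bar> \<le> \<delta>"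
      using net1[of "\<lambda>(i, p). x i p"] by blast
    have w: "w \<in> T1" "\<And>i p. i < K \<Longrightarrow> p < n \<Longrightarrow> \<bar>x i p - w (i, p)\<bar> \<le> \<delta>"
      using w1 by (auto simp: E_def)
    obtain q' where q': "q' \<in> T2"
       "\<And>i. i < K \<Longrightarrow> dotp {..<N} (\<lambda>r. q i r - q' i r) (\<lambda>r. q i r - q' i r) \<le> (2 * \<epsilon>)\<^sup>2"
      using net2[OF q] by blast
    note on' = T2(3)[OF q'(1)]
    define h' where "h' = (\<lambda>(p, r). \<Sum>i<K. w (i, p) * q' i r)"
    define d1 where "d1 = (\<lambda>(p, r). \<Sum>i<K. (x i p - w (i, p)) * q' i r)"
    define d2 where "d2 = (\<lambda>(p, r). \<Sum>i<K. x i p * (q i r - q' i r))"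
    have "h' \<in> T" unfolding T_def
      by (rule image_eqI[of _ _ "(w, q')"]) (use w(1) q'(1) in \<open>simp_all add: h'_def\<close>)
    moreover have lr: "low_rank n N K d1" "low_rank n N K d2"
      unfolding low_rank_def d1_def d2_def by auto
    moreover have "L2_set d1 F \<le> 2 * \<epsilon>"
    proof -
      have "(L2_set d1 F)\<^sup>2 = (\<Sum>i<K. dotp {..<n} (\<lambda>p. x i p - w (i, p)) (\<lambda>p. x i p - w (i, p)) *
          dotp {..<N} (q' i) (q' i))"
        unfolding F_def
        by (rule L2_set_orthogonal_sum[where x = "\<lambda>i p. x i p - w (i, p)"])
          (use onzD(1)[OF on'] in \<open>auto simp: d1_def\<close>)
      also have "\<dots> \<le> (\<Sum>i<K. (\<Sum>p<n. \<delta>\<^sup>2) * 1)"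
      proof (rule sum_mono, rule mult_mono)
        fix i assume i: "i \<in> {..<K}"
        show "dotp {..<n} (\<lambda>p. x i p - w (i, p)) (\<lambda>p. x i p - w (i, p)) \<le> (\<Sum>p<n. \<delta>\<^sup>2)"
          unfolding dotp_def
        proof (rule sum_mono)
          fix p assume "p \<in> {..<n}"
          then have "\<bar>x i p - w (i, p)\<bar> \<le> \<bar>\<delta>\<bar>" using w(2)[of i p] i \<delta> by auto
          then show "(x i p - w (i, p)) * (x i p - w (i, p)) \<le> \<delta>\<^sup>2"
            unfolding abs_le_square_iff by (simp add: power2_eq_square)
        qed
        show "dotp {..<N} (q' i) (q' i) \<le> 1" by (rule onzD(2)[OF on' i i])
        show "0 \<le> (\<Sum>p<n. \<delta>\<^sup>2)" by (rule sum_nonneg) simp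
        show "0 \<le> dotp {..<N} (q' i) (q' i)" by (rule dotp_self_nonneg)
      qed
      also have "(\<Sum>i<K. (\<Sum>p<n. \<delta>\<^sup>2) * 1) = real K * real n * \<delta>\<^sup>2"
        by (simp only: sum_constant card_lessThan mult_1_right mult.assoc)
      also have "real K * real n * \<delta>\<^sup>2 = \<epsilon>\<^sup>2"
      proof -
        have "c * (\<epsilon>\<^sup>2 / c) = \<epsilon>\<^sup>2" if "0 < c" for c :: real using that by simp
        then show ?thesis using cE(3) \<delta>(2) cE(2) by metis
      qed
      finally have "L2_set d1 F \<le> \<epsilon>" by (rule power2_le_imp_le) (use \<epsilon> in simp)
      then show ?thesis using \<epsilon> by linarith
    qed
    moreover have "L2_set d2 F \<le> 2 * \<epsilon>"
    proof -
      have "(L2_set d2 F)\<^sup>2 = (\<Sum>i<K. dotp {..<n} (x i) (x i) *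
          dotp {..<N} (\<lambda>r. q i r - q' i r) (\<lambda>r. q i r - q' i r))"
        unfolding F_def
        by (rule L2_set_orthogonal_sum[where y = "\<lambda>i r. q i r - q' i r"])
          (use x in \<open>auto simp: d2_def\<close>)
      also have "\<dots> \<le> (\<Sum>i<K. dotp {..<n} (x i) (x i) * (2 * \<epsilon>)\<^sup>2)"
        by (intro sum_mono mult_left_mono) (use q'(2) in auto)
      also have "\<dots> = (\<Sum>i<K. dotp {..<n} (x i) (x i)) * (2 * \<epsilon>)\<^sup>2" by (simp add: sum_distrib_right)
      also have "\<dots> \<le> 1 * (2 * \<epsilon>)\<^sup>2" using xs1 by (intro mult_right_mono) auto
      finally have "(L2_set d2 F)\<^sup>2 \<le> (2 * \<epsilon>)\<^sup>2" by simp
      then show ?thesis by (rule power2_le_imp_le) (use \<epsilon> in simp)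
    qed
    moreover have "\<forall>e\<in>F. h e = h' e + d1 e + d2 e"
    proof -
      have "h (p, r) = h' (p, r) + d1 (p, r) + d2 (p, r)" if "p < n" "r < N" for p r
        unfolding hx[OF that] h'_def d1_def d2_def case_prod_conv sum.distrib[symmetric]
        by (rule sum.cong) (simp_all add: algebra_simps)
      then show ?thesis by (auto simp: F_def)
    qed
    ultimately show ?thesis by (intro bexI[of _ h'] exI[of _ d1] exI[of _ d2]) simp_all
  qed
  moreover have "finite T" using T1(1) T2(1) by (simp add: T_def)
  ultimately show ?thesis using cT unfolding has_net_def F_def by blast
qed

section \<open>Gaussian linear and bilinear forms\<close>

lemma nn_integral_std_normal_square:
  "(\<integral>\<^sup>+x. ennreal (std_normal_density x) * ennreal (x\<^sup>2) \<partial>lborel) = 1"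
proof -
  have "has_bochner_integral lborel (\<lambda>x. std_normal_density x * x ^ (2 * 1)) 1"
    using std_normal_moment_even[of 1] by (simp add: fact_numeral)
  then have "(\<integral>\<^sup>+x. ennreal (std_normal_density x * x ^ (2 * 1)) \<partial>lborel) = ennreal 1"
    using nn_integral_eq_integral[of lborel "\<lambda>x. std_normal_density x * x ^ (2 * 1)"]
    by (simp add: has_bochner_integral_iff)
  then show ?thesis by (simp add: ennreal_mult' normal_density_nonneg)
qed

lemma nn_integral_std_normal_exp_square:
  "(\<integral>\<^sup>+x. ennreal (std_normal_density x) * ennreal (exp (x\<^sup>2 / 4)) \<partial>lborel) = ennreal (sqrt 2)"
proof -
  have "std_normal_density x * exp (x\<^sup>2 / 4) = sqrt 2 * normal_density 0 (sqrt 2) x" for x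
  proof -
    have "exp (- x\<^sup>2 / 2) * exp (x\<^sup>2 / 4) = exp (- x\<^sup>2 / 4)" by (simp flip: exp_add)
    then show ?thesis by (simp add: normal_density_def real_sqrt_mult field_simps)
  qed
  then have "(\<integral>\<^sup>+x. ennreal (std_normal_density x) * ennreal (exp (x\<^sup>2 / 4)) \<partial>lborel) =
      (\<integral>\<^sup>+x. ennreal (sqrt 2) * ennreal (normal_density 0 (sqrt 2) x) \<partial>lborel)"
    by (simp add: normal_density_nonneg flip: ennreal_mult)
  also have "\<dots> = ennreal (sqrt 2) * (\<integral>\<^sup>+x. ennreal (normal_density 0 (sqrt 2) x) \<partial>lborel)"
    by (rule nn_integral_cmult) simp
  also have "(\<integral>\<^sup>+x. ennreal (normal_density 0 (sqrt 2) x) \<partial>lborel) = 1"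
    using prob_space.emeasure_space_1[OF prob_space_normal_density[of "sqrt 2" 0]]
    by (simp add: emeasure_density)
  finally show ?thesis by simp
qed

text \<open>
  The family lives on an arbitrary probability space, so that rotated families are again instances.
\<close>

definition std_gaussians :: "'a measure \<Rightarrow> 'j set \<Rightarrow> ('j \<Rightarrow> 'a \<Rightarrow> real) \<Rightarrow> bool" where
  "std_gaussians M J g \<longleftrightarrow> prob_space M \<and> prob_space.indep_vars M (\<lambda>_. borel) g J \<and>
     (\<forall>j\<in>J. distributed M lborel (g j) std_normal_density)"

lemma std_gaussians_measurable:
  "std_gaussians M J g \<Longrightarrow> j \<in> J \<Longrightarrow> g j \<in> borel_measurable M"
  unfolding std_gaussians_def using distributed_measurable by fastforce

text \<open>
  The stability of the normal law under independent sums.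
\<close>

lemma linear_form_normal:
  assumes G: "std_gaussians M J g" and \<iota>: "inj_on \<iota> E" "\<iota> ` E \<subseteq> J" and E: "finite E"
    and s: "0 < L2_set a E"
  shows "distributed M lborel (\<lambda>\<omega>. (\<Sum>e\<in>E. a e * g (\<iota> e) \<omega>) / L2_set a E) std_normal_density"
proof -
  interpret prob_space M using G by (simp add: std_gaussians_def)
  define E' where "E' = {e\<in>E. a e \<noteq> 0}"
  define f where "f = inv_into E \<iota>"
  have E': "finite E'" "E' \<subseteq> E" using E by (auto simp: E'_def)
  have ne: "E' \<noteq> {}"
  proof
    assume "E' = {}"
    then have "\<forall>e\<in>E. a e = 0" by (auto simp: E'_def)
    then have "L2_set a E = 0" by (simp add: L2_set_eq_0_iff E)
    then show False using s by simp
  qed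
  have inv: "f (\<iota> e) = e" if "e \<in> E'" for e using that E' \<iota>(1) by (auto simp: f_def)
  have inj': "inj_on \<iota> E'" using \<iota>(1) E'(2) by (rule inj_on_subset)
  have ind: "indep_vars (\<lambda>_. borel) (\<lambda>j \<omega>. a (f j) * g j \<omega>) (\<iota> ` E')"
  proof (rule indep_vars_compose2[where Y="\<lambda>j x. a (f j) * x"])
    show "indep_vars (\<lambda>_. borel) g (\<iota> ` E')"
      by (rule indep_vars_subset[of _ _ J]) (use G \<iota>(2) E'(2) in \<open>auto simp: std_gaussians_def\<close>)
  qed simp
  have dist: "distributed M lborel (\<lambda>\<omega>. a (f j) * g j \<omega>) (normal_density 0 \<bar>a (f j)\<bar>)"
    if "j \<in> \<iota> ` E'" for j
  proof -
    have "a (f j) \<noteq> 0" using that inv by (auto simp: E'_def)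
    moreover have "distributed M lborel (g j) (normal_density 0 1)"
      using G that \<iota>(2) E'(2) by (auto simp: std_gaussians_def)
    ultimately show ?thesis using normal_density_affine[of "g j" 0 1 "a (f j)" 0] by simp
  qed
  have "distributed M lborel (\<lambda>\<omega>. \<Sum>j\<in>\<iota> ` E'. a (f j) * g j \<omega>)
      (normal_density (\<Sum>j\<in>\<iota> ` E'. 0) (sqrt (\<Sum>j\<in>\<iota> ` E'. \<bar>a (f j)\<bar>\<^sup>2)))"
    by (rule sum_indep_normal) (use E' ne ind dist inv in \<open>auto simp: E'_def\<close>)
  moreover have "(\<Sum>j\<in>\<iota> ` E'. a (f j) * g j \<omega>) = (\<Sum>e\<in>E. a e * g (\<iota> e) \<omega>)" for \<omega>
  proof -
    have "(\<Sum>j\<in>\<iota> ` E'. a (f j) * g j \<omega>) = (\<Sum>e\<in>E'. a e * g (\<iota> e) \<omega>)"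
      using inj' inv by (simp add: sum.reindex)
    also have "\<dots> = (\<Sum>e\<in>E. a e * g (\<iota> e) \<omega>)"
      using E by (intro sum.mono_neutral_left) (auto simp: E'_def)
    finally show ?thesis .
  qed
  moreover have "sqrt (\<Sum>j\<in>\<iota> ` E'. \<bar>a (f j)\<bar>\<^sup>2) = L2_set a E"
  proof -
    have "(\<Sum>j\<in>\<iota> ` E'. \<bar>a (f j)\<bar>\<^sup>2) = (\<Sum>e\<in>E'. (a e)\<^sup>2)"
      using inj' inv by (simp add: sum.reindex)
    also have "\<dots> = (\<Sum>e\<in>E. (a e)\<^sup>2)"
      using E by (intro sum.mono_neutral_left) (auto simp: E'_def)
    finally show ?thesis by (simp add: L2_set_def)
  qed
  ultimately have "distributed M lborel (\<lambda>\<omega>. \<Sum>e\<in>E. a e * g (\<iota> e) \<omega>) (normal_density 0 (L2_set a E))"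
    by simp
  then show ?thesis using normal_standard_normal_convert[OF s, of "\<lambda>\<omega>. \<Sum>e\<in>E. a e * g (\<iota> e) \<omega>" 0] by simp
qed

lemma linear_form_measurable:
  assumes "std_gaussians M J g" "\<iota> ` E \<subseteq> J"
  shows "(\<lambda>\<omega>. \<Sum>e\<in>E. a e * g (\<iota> e) \<omega>) \<in> borel_measurable M"
  using assms by (intro borel_measurable_sum borel_measurable_times std_gaussians_measurable[OF assms(1)]) auto

lemma linear_form_zero:
  assumes "finite E" "L2_set a E = 0"
  shows "(\<Sum>e\<in>E. a e * x e) = 0"
  using assms by (intro sum.neutral) (simp add: L2_set_eq_0_iff)

lemma nn_integral_linear_form_square:
  assumes G: "std_gaussians M J g" and \<iota>: "inj_on \<iota> E" "\<iota> ` E \<subseteq> J" and E: "finite E"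
  shows "(\<integral>\<^sup>+\<omega>. ennreal ((\<Sum>e\<in>E. a e * g (\<iota> e) \<omega>)\<^sup>2) \<partial>M) = ennreal ((L2_set a E)\<^sup>2)"
proof (cases "L2_set a E = 0")
  case True
  then show ?thesis by (simp add: linear_form_zero[OF E])
next
  case False
  define s where "s = L2_set a E"
  have s: "0 < s" using False by (simp add: s_def order_less_le)
  define Y where "Y \<omega> = (\<Sum>e\<in>E. a e * g (\<iota> e) \<omega>)" for \<omega>
  have mY: "Y \<in> borel_measurable M"
    unfolding Y_def[abs_def] by (rule linear_form_measurable[OF G \<iota>(2)])
  have d: "distributed M lborel (\<lambda>\<omega>. Y \<omega> / s) std_normal_density"
    unfolding Y_def s_def by (rule linear_form_normal[OF G \<iota> E]) (use s in \<open>simp add: s_def\<close>)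
  have "(\<integral>\<^sup>+\<omega>. ennreal ((Y \<omega>)\<^sup>2) \<partial>M) = (\<integral>\<^sup>+\<omega>. ennreal (s\<^sup>2) * ennreal ((Y \<omega> / s)\<^sup>2) \<partial>M)"
    using s by (intro nn_integral_cong) (simp add: power_divide flip: ennreal_mult)
  also have "\<dots> = ennreal (s\<^sup>2) * (\<integral>\<^sup>+\<omega>. ennreal ((Y \<omega> / s)\<^sup>2) \<partial>M)"
    using mY by (intro nn_integral_cmult) simp
  also have "(\<integral>\<^sup>+\<omega>. ennreal ((Y \<omega> / s)\<^sup>2) \<partial>M) = 1"
    using distributed_nn_integral[OF d, of "\<lambda>x. ennreal (x\<^sup>2)"] nn_integral_std_normal_square by simp
  finally show ?thesis by (simp add: Y_def s_def)
qed

lemma nn_integral_linear_form_exp_square: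
  assumes G: "std_gaussians M J g" and \<iota>: "inj_on \<iota> E" "\<iota> ` E \<subseteq> J" and E: "finite E"
    and t: "L2_set a E \<le> 1"
  shows "(\<integral>\<^sup>+\<omega>. ennreal (exp ((\<Sum>e\<in>E. a e * g (\<iota> e) \<omega>)\<^sup>2 / 4)) \<partial>M) \<le> ennreal (sqrt 2)"
proof (cases "L2_set a E = 0")
  case True
  interpret prob_space M using G by (simp add: std_gaussians_def)
  show ?thesis using True by (simp add: linear_form_zero[OF E] emeasure_space_1)
next
  case False
  define s where "s = L2_set a E"
  have s: "0 < s" "s \<le> 1" using False t by (simp_all add: s_def order_less_le)
  define Y where "Y \<omega> = (\<Sum>e\<in>E. a e * g (\<iota> e) \<omega>)" for \<omega>
  have d: "distributed M lborel (\<lambda>\<omega>. Y \<omega> / s) std_normal_density"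
    unfolding Y_def s_def by (rule linear_form_normal[OF G \<iota> E]) (use s in \<open>simp add: s_def\<close>)
  have "(\<integral>\<^sup>+\<omega>. ennreal (exp ((Y \<omega>)\<^sup>2 / 4)) \<partial>M) \<le> (\<integral>\<^sup>+\<omega>. ennreal (exp ((Y \<omega> / s)\<^sup>2 / 4)) \<partial>M)"
  proof (rule nn_integral_mono)
    fix \<omega>
    have "s\<^sup>2 \<le> 1" using s by (simp add: abs_square_le_1)
    then have "(Y \<omega>)\<^sup>2 \<le> (Y \<omega> / s)\<^sup>2"
      using s by (simp add: power_divide le_divide_eq mult_left_le)
    then show "ennreal (exp ((Y \<omega>)\<^sup>2 / 4)) \<le> ennreal (exp ((Y \<omega> / s)\<^sup>2 / 4))" by (intro ennreal_leI) simp
  qed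
  also have "\<dots> = ennreal (sqrt 2)"
    using distributed_nn_integral[OF d, of "\<lambda>x. ennreal (exp (x\<^sup>2 / 4))"] nn_integral_std_normal_exp_square by simp
  finally show ?thesis by (simp add: Y_def)
qed

text \<open>
  Integration over an independent pair as an iterated integral over the same space, which avoids naming
  the marginal laws.
\<close>

lemma (in prob_space) nn_integral_indep_pair:
  assumes ind: "indep_var S U T V" and F: "F \<in> borel_measurable (S \<Otimes>\<^sub>M T)"
  shows "(\<integral>\<^sup>+\<omega>. F (U \<omega>, V \<omega>) \<partial>M) = (\<integral>\<^sup>+\<omega>'. (\<integral>\<^sup>+\<omega>. F (U \<omega>, V \<omega>') \<partial>M) \<partial>M)"
proof -
  have U: "U \<in> measurable M S" and V: "V \<in> measurable M T"
    and eq: "distr M S U \<Otimes>\<^sub>M distr M T V = distr M (S \<Otimes>\<^sub>M T) (\<lambda>x. (U x, V x))"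
    using ind unfolding indep_var_distribution_eq by auto
  interpret U: prob_space "distr M S U" by (rule prob_space_distr[OF U])
  interpret V: prob_space "distr M T V" by (rule prob_space_distr[OF V])
  interpret UV: pair_sigma_finite "distr M S U" "distr M T V" ..
  have F': "F \<in> borel_measurable (distr M S U \<Otimes>\<^sub>M distr M T V)"
    using F by (simp add: sets_pair_measure_cong[OF sets_distr sets_distr] cong: measurable_cong_sets)
  have "(\<integral>\<^sup>+\<omega>. F (U \<omega>, V \<omega>) \<partial>M) = (\<integral>\<^sup>+z. F z \<partial>(distr M S U \<Otimes>\<^sub>M distr M T V))"
    unfolding eq using F U V by (subst nn_integral_distr) auto
  also have "\<dots> = (\<integral>\<^sup>+v. (\<integral>\<^sup>+u. F (u, v) \<partial>distr M S U) \<partial>distr M T V)"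
    by (rule UV.nn_integral_snd[symmetric]) (use F' in simp)
  also have "\<dots> = (\<integral>\<^sup>+\<omega>'. (\<integral>\<^sup>+u. F (u, V \<omega>') \<partial>distr M S U) \<partial>M)"
    by (rule nn_integral_distr[OF V]) (use U.borel_measurable_nn_integral_fst in \<open>measurable, use F in simp\<close>)
  also have "\<dots> = (\<integral>\<^sup>+\<omega>'. (\<integral>\<^sup>+\<omega>. F (U \<omega>, V \<omega>') \<partial>M) \<partial>M)"
  proof (rule nn_integral_cong)
    fix \<omega>' assume "\<omega>' \<in> space M"
    then have "V \<omega>' \<in> space T" using V by (rule measurable_space[rotated])
    then have "(\<lambda>u. F (u, V \<omega>')) \<in> borel_measurable S" using F by measurable
    then show "(\<integral>\<^sup>+u. F (u, V \<omega>') \<partial>distr M S U) = (\<integral>\<^sup>+\<omega>. F (U \<omega>, V \<omega>') \<partial>M)"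
      by (simp add: nn_integral_distr[OF U])
  qed
  finally show ?thesis .
qed

text \<open>
  Given the second vector, a bilinear form is a linear form in the first; independence
  lets the two be integrated one after the other.
\<close>

lemma bilinear_form_decouple:
  fixes h :: "nat \<times> nat \<Rightarrow> real" and n N :: nat and \<phi> :: "real \<Rightarrow> ennreal"
  assumes G: "std_gaussians M J g" and \<iota>: "\<iota> ` {..<n} \<subseteq> J" and \<kappa>: "\<kappa> ` {..<N} \<subseteq> J"
    and disj: "\<iota> ` {..<n} \<inter> \<kappa> ` {..<N} = {}" and \<phi>: "\<phi> \<in> borel_measurable borel"
  shows "(\<integral>\<^sup>+\<omega>. \<phi> (\<Sum>p<n. \<Sum>q<N. h (p, q) * g (\<iota> p) \<omega> * g (\<kappa> q) \<omega>) \<partial>M) =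
    (\<integral>\<^sup>+\<omega>'. (\<integral>\<^sup>+\<omega>. \<phi> (\<Sum>p<n. (\<Sum>q<N. h (p, q) * g (\<kappa> q) \<omega>') * g (\<iota> p) \<omega>) \<partial>M) \<partial>M)"
proof -
  interpret prob_space M using G by (simp add: std_gaussians_def)
  let ?A = "\<iota> ` {..<n}" and ?B = "\<kappa> ` {..<N}"
  let ?U = "\<lambda>\<omega>. restrict (\<lambda>j. g j \<omega>) ?A" and ?V = "\<lambda>\<omega>. restrict (\<lambda>j. g j \<omega>) ?B"
  define F where "F = (\<lambda>(u, v). \<phi> (\<Sum>p<n. (\<Sum>q<N. h (p, q) * v (\<kappa> q)) * u (\<iota> p)))"
  have ind: "indep_var (PiM ?A (\<lambda>_. borel)) ?U (PiM ?B (\<lambda>_. borel)) ?V"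
    by (rule indep_var_restrict[of _ _ J]) (use G \<iota> \<kappa> disj in \<open>auto simp: std_gaussians_def\<close>)
  have F: "F \<in> borel_measurable (PiM ?A (\<lambda>_. borel) \<Otimes>\<^sub>M PiM ?B (\<lambda>_. borel))"
  proof -
    have "(\<lambda>z. \<Sum>p<n. (\<Sum>q<N. h (p, q) * snd z (\<kappa> q)) * fst z (\<iota> p)) \<in>
        borel_measurable (PiM ?A (\<lambda>_. borel) \<Otimes>\<^sub>M PiM ?B (\<lambda>_. borel))"
    proof (intro borel_measurable_sum borel_measurable_times borel_measurable_const)
      fix p assume "p \<in> {..<n}"
      then have a: "(\<lambda>u. u (\<iota> p)) \<in> borel_measurable (PiM ?A (\<lambda>_. borel :: real measure))"
        by (intro measurable_component_singleton) auto
      show "(\<lambda>z. fst z (\<iota> p)) \<in> borel_measurable (PiM ?A (\<lambda>_. borel :: real measure) \<Otimes>\<^sub>M PiM ?B (\<lambda>_. borel :: real measure))"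
        by (rule measurable_compose[OF measurable_fst a])
    next
      fix q assume "q \<in> {..<N}"
      then have a: "(\<lambda>u. u (\<kappa> q)) \<in> borel_measurable (PiM ?B (\<lambda>_. borel :: real measure))"
        by (intro measurable_component_singleton) auto
      show "(\<lambda>z. snd z (\<kappa> q)) \<in> borel_measurable (PiM ?A (\<lambda>_. borel :: real measure) \<Otimes>\<^sub>M PiM ?B (\<lambda>_. borel :: real measure))"
        by (rule measurable_compose[OF measurable_snd a])
    qed
    from measurable_compose[OF this \<phi>] show ?thesis by (simp add: F_def case_prod_unfold)
  qed
  have "(\<integral>\<^sup>+\<omega>. F (?U \<omega>, ?V \<omega>) \<partial>M) = (\<integral>\<^sup>+\<omega>'. (\<integral>\<^sup>+\<omega>. F (?U \<omega>, ?V \<omega>') \<partial>M) \<partial>M)"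
    by (rule nn_integral_indep_pair[OF ind F])
  moreover have "F (?U \<omega>, ?V \<omega>') = \<phi> (\<Sum>p<n. (\<Sum>q<N. h (p, q) * g (\<kappa> q) \<omega>') * g (\<iota> p) \<omega>)" for \<omega> \<omega>'
    by (simp add: F_def)
  moreover have "(\<Sum>p<n. (\<Sum>q<N. h (p, q) * g (\<kappa> q) \<omega>) * g (\<iota> p) \<omega>) =
      (\<Sum>p<n. \<Sum>q<N. h (p, q) * g (\<iota> p) \<omega> * g (\<kappa> q) \<omega>)" for \<omega>
    by (simp add: sum_distrib_left sum_distrib_right mult_ac)
  ultimately show ?thesis by simp
qed

lemma L2_set_rows:
  "(L2_set h ({..<n} \<times> {..<N}))\<^sup>2 = (\<Sum>p<n. (L2_set (\<lambda>q. h (p, q)) {..<N})\<^sup>2)"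
  by (simp add: L2_set_def sum_nonneg sum.cartesian_product)

lemma nn_integral_bilinear_form_square:
  fixes h :: "nat \<times> nat \<Rightarrow> real" and n N :: nat
  assumes G: "std_gaussians M J g" and \<iota>: "inj_on \<iota> {..<n}" "\<iota> ` {..<n} \<subseteq> J"
    and \<kappa>: "inj_on \<kappa> {..<N}" "\<kappa> ` {..<N} \<subseteq> J" and disj: "\<iota> ` {..<n} \<inter> \<kappa> ` {..<N} = {}"
  shows "(\<integral>\<^sup>+\<omega>. ennreal ((\<Sum>p<n. \<Sum>q<N. h (p, q) * g (\<iota> p) \<omega> * g (\<kappa> q) \<omega>)\<^sup>2) \<partial>M) =
    ennreal ((L2_set h ({..<n} \<times> {..<N}))\<^sup>2)"
proof -
  let ?w = "\<lambda>\<omega> p. \<Sum>q<N. h (p, q) * g (\<kappa> q) \<omega>"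
  have m: "(\<lambda>\<omega>. ?w \<omega> p) \<in> borel_measurable M" for p
    by (rule linear_form_measurable[OF G \<kappa>(2)])
  have "(\<integral>\<^sup>+\<omega>. ennreal ((\<Sum>p<n. \<Sum>q<N. h (p, q) * g (\<iota> p) \<omega> * g (\<kappa> q) \<omega>)\<^sup>2) \<partial>M) =
     (\<integral>\<^sup>+\<omega>'. (\<integral>\<^sup>+\<omega>. ennreal ((\<Sum>p<n. ?w \<omega>' p * g (\<iota> p) \<omega>)\<^sup>2) \<partial>M) \<partial>M)"
    by (rule bilinear_form_decouple[OF G \<iota>(2) \<kappa>(2) disj, of "\<lambda>x. ennreal (x\<^sup>2)"]) simp
  also have "\<dots> = (\<integral>\<^sup>+\<omega>'. ennreal ((L2_set (?w \<omega>') {..<n})\<^sup>2) \<partial>M)"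
    by (intro nn_integral_cong nn_integral_linear_form_square[OF G \<iota>]) simp
  also have "\<dots> = (\<integral>\<^sup>+\<omega>'. (\<Sum>p<n. ennreal ((?w \<omega>' p)\<^sup>2)) \<partial>M)"
    by (simp add: L2_set_def sum_nonneg sum_ennreal)
  also have "\<dots> = (\<Sum>p<n. (\<integral>\<^sup>+\<omega>'. ennreal ((?w \<omega>' p)\<^sup>2) \<partial>M))"
    by (rule nn_integral_sum) (use m in simp)
  also have "\<dots> = (\<Sum>p<n. ennreal ((L2_set (\<lambda>q. h (p, q)) {..<N})\<^sup>2))"
    by (intro sum.cong refl nn_integral_linear_form_square[OF G \<kappa>]) simp
  also have "\<dots> = ennreal ((L2_set h ({..<n} \<times> {..<N}))\<^sup>2)"
    unfolding L2_set_rows by (rule sum_ennreal) simp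
  finally show ?thesis .
qed

lemma exp_convex_combination:
  assumes "finite I" "\<And>i. i \<in> I \<Longrightarrow> 0 \<le> w i" "(\<Sum>i\<in>I. w i) = 1"
  shows "exp (\<Sum>i\<in>I. w i * x i) \<le> (\<Sum>i\<in>I. w i * exp (x i :: real))"
proof -
  have "I \<noteq> {}" using assms(3) by auto
  have "convex_on UNIV (exp :: real \<Rightarrow> real)" by (rule exp_convex)
  from convex_on_sum[OF assms(1) \<open>I \<noteq> {}\<close> this assms(3), of x] assms(2) show ?thesis by simp
qed

text \<open>
  Given the second vector, the form is normal with standard deviation \<open>s\<close>, and
  \<open>\<bar>s y\<bar> / 2 \<le> s\<^sup>2 / 4 + y\<^sup>2 / 4\<close> bounds the conditional moment by \<open>sqrt 2 exp (s\<^sup>2 / 4)\<close>. Now \<open>s\<^sup>2\<close> is a sum of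
  squares of linear forms, one for every row of \<open>h\<close>; convexity of the exponential, with the squared row norms
  as weights, reduces to a single normalized row.
\<close>

lemma nn_integral_bilinear_form_exp:
  fixes h :: "nat \<times> nat \<Rightarrow> real" and n N :: nat
  assumes G: "std_gaussians M J g" and \<iota>: "inj_on \<iota> {..<n}" "\<iota> ` {..<n} \<subseteq> J"
    and \<kappa>: "inj_on \<kappa> {..<N}" "\<kappa> ` {..<N} \<subseteq> J" and disj: "\<iota> ` {..<n} \<inter> \<kappa> ` {..<N} = {}"
    and h: "L2_set h ({..<n} \<times> {..<N}) = 1"
  shows "(\<integral>\<^sup>+\<omega>. ennreal (exp (\<bar>\<Sum>p<n. \<Sum>q<N. h (p, q) * g (\<iota> p) \<omega> * g (\<kappa> q) \<omega>\<bar> / 2)) \<partial>M) \<le> 2"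
proof -
  let ?w = "\<lambda>\<omega> p. \<Sum>q<N. h (p, q) * g (\<kappa> q) \<omega>"
  have m: "(\<lambda>\<omega>. ?w \<omega> p) \<in> borel_measurable M" for p
    by (rule linear_form_measurable[OF G \<kappa>(2)])
  define r where "r p = L2_set (\<lambda>q. h (p, q)) {..<N}" for p
  have r1: "(\<Sum>p<n. (r p)\<^sup>2) = 1" using L2_set_rows[of h n N] h by (simp add: r_def)
  have inner: "(\<integral>\<^sup>+\<omega>. ennreal (exp (\<bar>\<Sum>p<n. b p * g (\<iota> p) \<omega>\<bar> / 2)) \<partial>M) \<le>
      ennreal (sqrt 2) * ennreal (exp ((L2_set b {..<n})\<^sup>2 / 4))" for b
  proof -
    define s where "s = L2_set b {..<n}"
    define c where "c p = b p / s" for p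
    have s0: "0 \<le> s" by (simp add: s_def)
    have c1: "L2_set c {..<n} \<le> 1"
    proof (cases "s = 0")
      case False
      have "L2_set c {..<n} = L2_set b {..<n} / \<bar>s\<bar>"
        by (simp add: c_def L2_set_def power_divide real_sqrt_divide flip: sum_divide_distrib)
      then show ?thesis using False s0 by (simp flip: s_def)
    qed (simp add: c_def L2_set_def)
    have bc: "(\<Sum>p<n. b p * x p) = s * (\<Sum>p<n. c p * x p)" for x
    proof (cases "s = 0")
      case True
      then show ?thesis using linear_form_zero[of "{..<n}" b x] by (simp add: s_def)
    qed (simp add: c_def sum_distrib_left)
    have "(\<integral>\<^sup>+\<omega>. ennreal (exp (\<bar>\<Sum>p<n. b p * g (\<iota> p) \<omega>\<bar> / 2)) \<partial>M) \<le>
       (\<integral>\<^sup>+\<omega>. ennreal (exp ((\<Sum>p<n. c p * g (\<iota> p) \<omega>)\<^sup>2 / 4)) * ennreal (exp (s\<^sup>2 / 4)) \<partial>M)"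
    proof (rule nn_integral_mono)
      fix \<omega>
      let ?y = "\<Sum>p<n. c p * g (\<iota> p) \<omega>"
      have "2 * (s * \<bar>?y\<bar>) \<le> s\<^sup>2 + ?y\<^sup>2" using sum_squares_bound[of s "\<bar>?y\<bar>"] by simp
      then have "\<bar>\<Sum>p<n. b p * g (\<iota> p) \<omega>\<bar> / 2 \<le> ?y\<^sup>2 / 4 + s\<^sup>2 / 4"
        using s0 by (simp add: bc abs_mult)
      then have "exp (\<bar>\<Sum>p<n. b p * g (\<iota> p) \<omega>\<bar> / 2) \<le> exp (?y\<^sup>2 / 4) * exp (s\<^sup>2 / 4)"
        by (simp flip: exp_add)
      then show "ennreal (exp (\<bar>\<Sum>p<n. b p * g (\<iota> p) \<omega>\<bar> / 2)) \<le> ennreal (exp (?y\<^sup>2 / 4)) * ennreal (exp (s\<^sup>2 / 4))"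
        by (simp add: ennreal_leI flip: ennreal_mult)
    qed
    also have "\<dots> = (\<integral>\<^sup>+\<omega>. ennreal (exp ((\<Sum>p<n. c p * g (\<iota> p) \<omega>)\<^sup>2 / 4)) \<partial>M) * ennreal (exp (s\<^sup>2 / 4))"
    proof (rule nn_integral_multc)
      have [measurable]: "(\<lambda>\<omega>. \<Sum>p<n. c p * g (\<iota> p) \<omega>) \<in> borel_measurable M"
        by (rule linear_form_measurable[OF G \<iota>(2)])
      show "(\<lambda>\<omega>. ennreal (exp ((\<Sum>p<n. c p * g (\<iota> p) \<omega>)\<^sup>2 / 4))) \<in> borel_measurable M" by simp
    qed
    also have "\<dots> \<le> ennreal (sqrt 2) * ennreal (exp (s\<^sup>2 / 4))"
      by (intro mult_right_mono nn_integral_linear_form_exp_square[OF G \<iota>] c1) auto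
    finally show ?thesis by (simp add: s_def)
  qed
  define c where "c p q = h (p, q) / r p" for p q
  have c1: "L2_set (c p) {..<N} \<le> 1" for p
  proof (cases "r p = 0")
    case False
    have "L2_set (c p) {..<N} = r p / \<bar>r p\<bar>"
      by (simp add: c_def r_def L2_set_def power_divide real_sqrt_divide flip: sum_divide_distrib)
    then show ?thesis using False by (simp add: r_def)
  qed (simp add: c_def L2_set_def)
  have wc: "?w \<omega> p = r p * (\<Sum>q<N. c p q * g (\<kappa> q) \<omega>)" for p \<omega>
  proof (cases "r p = 0")
    case True
    then show ?thesis using linear_form_zero[of "{..<N}" "\<lambda>q. h (p, q)"] by (simp add: r_def)
  qed (simp add: c_def sum_distrib_left)
  have "(\<integral>\<^sup>+\<omega>. ennreal (exp (\<bar>\<Sum>p<n. \<Sum>q<N. h (p, q) * g (\<iota> p) \<omega> * g (\<kappa> q) \<omega>\<bar> / 2)) \<partial>M) =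
     (\<integral>\<^sup>+\<omega>'. (\<integral>\<^sup>+\<omega>. ennreal (exp (\<bar>\<Sum>p<n. ?w \<omega>' p * g (\<iota> p) \<omega>\<bar> / 2)) \<partial>M) \<partial>M)"
    by (rule bilinear_form_decouple[OF G \<iota>(2) \<kappa>(2) disj, of "\<lambda>x. ennreal (exp (\<bar>x\<bar> / 2))"]) simp
  also have "\<dots> \<le> (\<integral>\<^sup>+\<omega>'. ennreal (sqrt 2) * ennreal (exp ((L2_set (?w \<omega>') {..<n})\<^sup>2 / 4)) \<partial>M)"
    by (intro nn_integral_mono inner)
  also have "\<dots> \<le> (\<integral>\<^sup>+\<omega>'. ennreal (sqrt 2) *
      (\<Sum>p<n. ennreal ((r p)\<^sup>2) * ennreal (exp ((\<Sum>q<N. c p q * g (\<kappa> q) \<omega>')\<^sup>2 / 4))) \<partial>M)"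
  proof (intro nn_integral_mono mult_left_mono)
    fix \<omega>
    have "(L2_set (?w \<omega>) {..<n})\<^sup>2 / 4 = (\<Sum>p<n. (r p)\<^sup>2 * ((\<Sum>q<N. c p q * g (\<kappa> q) \<omega>)\<^sup>2 / 4))"
      unfolding wc by (simp add: L2_set_def sum_nonneg power_mult_distrib sum_divide_distrib)
    moreover have "exp (\<Sum>p<n. (r p)\<^sup>2 * ((\<Sum>q<N. c p q * g (\<kappa> q) \<omega>)\<^sup>2 / 4)) \<le>
        (\<Sum>p<n. (r p)\<^sup>2 * exp ((\<Sum>q<N. c p q * g (\<kappa> q) \<omega>)\<^sup>2 / 4))"
      by (rule exp_convex_combination[OF _ _ r1]) simp_all
    ultimately have "exp ((L2_set (?w \<omega>) {..<n})\<^sup>2 / 4) \<le>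
        (\<Sum>p<n. (r p)\<^sup>2 * exp ((\<Sum>q<N. c p q * g (\<kappa> q) \<omega>)\<^sup>2 / 4))" by (simp only:)
    then show "ennreal (exp ((L2_set (?w \<omega>) {..<n})\<^sup>2 / 4)) \<le>
        (\<Sum>p<n. ennreal ((r p)\<^sup>2) * ennreal (exp ((\<Sum>q<N. c p q * g (\<kappa> q) \<omega>)\<^sup>2 / 4)))"
      by (simp add: ennreal_leI sum_ennreal flip: ennreal_mult)
  qed simp
  also have "\<dots> = ennreal (sqrt 2) *
      (\<Sum>p<n. ennreal ((r p)\<^sup>2) * (\<integral>\<^sup>+\<omega>'. ennreal (exp ((\<Sum>q<N. c p q * g (\<kappa> q) \<omega>')\<^sup>2 / 4)) \<partial>M))"
  proof -
    have mm: "(\<lambda>\<omega>'. ennreal (exp ((\<Sum>q<N. c p q * g (\<kappa> q) \<omega>')\<^sup>2 / 4))) \<in> borel_measurable M" for p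
      using linear_form_measurable[OF G \<kappa>(2), of "c p"] by measurable
    show ?thesis
      by (subst nn_integral_cmult, use mm in measurable)
        (subst nn_integral_sum, use mm in measurable, simp add: nn_integral_cmult mm)
  qed
  also have "\<dots> \<le> ennreal (sqrt 2) * (\<Sum>p<n. ennreal ((r p)\<^sup>2) * ennreal (sqrt 2))"
    by (intro mult_left_mono sum_mono nn_integral_linear_form_exp_square[OF G \<kappa>] c1) auto
  also have "\<dots> = ennreal (sqrt 2) * (ennreal (\<Sum>p<n. (r p)\<^sup>2) * ennreal (sqrt 2))"
    by (simp add: sum_ennreal flip: sum_distrib_right)
  also have "\<dots> = 2" unfolding r1 by (simp flip: ennreal_mult)
  finally show ?thesis .
qed

section \<open>Tail bounds for sums of independent variables\<close>

text \<open>
  Markov's inequality for the exponential of the sum.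
\<close>

lemma (in prob_space) chernoff_bound:
  fixes Z :: "nat \<Rightarrow> 'a \<Rightarrow> real"
  assumes ind: "indep_vars (\<lambda>_. borel) Z {..<m}" and A: "0 < A"
    and mgf: "\<And>i. i < m \<Longrightarrow> (\<integral>\<^sup>+\<omega>. ennreal (exp (Z i \<omega>)) \<partial>M) \<le> ennreal A"
  shows "prob {\<omega>\<in>space M. b * real m \<le> (\<Sum>i<m. Z i \<omega>)} \<le> exp ((ln A - b) * real m)"
proof -
  have rv: "Z i \<in> borel_measurable M" if "i < m" for i
    using ind that by (simp add: indep_vars_def)
  have ms: "(\<lambda>\<omega>. \<Sum>i<m. Z i \<omega>) \<in> borel_measurable M" using rv by (intro borel_measurable_sum) auto
  have "emeasure M {\<omega>\<in>space M. b * real m \<le> (\<Sum>i<m. Z i \<omega>)} \<le>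
      ennreal (exp (- b * real m)) * (\<integral>\<^sup>+\<omega>. ennreal (exp (\<Sum>i<m. Z i \<omega>)) \<partial>M)"
  proof -
    have "{\<omega>\<in>space M. b * real m \<le> (\<Sum>i<m. Z i \<omega>)} =
        {\<omega>\<in>space M. 1 \<le> ennreal (exp (- b * real m)) * ennreal (exp (\<Sum>i<m. Z i \<omega>))}"
      by (auto simp flip: ennreal_mult exp_add)
    also have "emeasure M \<dots> \<le> ennreal (exp (- b * real m)) *
        (\<integral>\<^sup>+\<omega>. ennreal (exp (\<Sum>i<m. Z i \<omega>)) * indicator (space M) \<omega> \<partial>M)"
      by (rule nn_integral_Markov_inequality) (use ms in measurable)
    also have "(\<integral>\<^sup>+\<omega>. ennreal (exp (\<Sum>i<m. Z i \<omega>)) * indicator (space M) \<omega> \<partial>M) =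
        (\<integral>\<^sup>+\<omega>. ennreal (exp (\<Sum>i<m. Z i \<omega>)) \<partial>M)"
      by (rule nn_integral_cong) simp
    finally show ?thesis .
  qed
  also have "(\<integral>\<^sup>+\<omega>. ennreal (exp (\<Sum>i<m. Z i \<omega>)) \<partial>M) =
      (\<integral>\<^sup>+\<omega>. (\<Prod>i<m. ennreal (exp (Z i \<omega>))) \<partial>M)"
    by (simp add: exp_sum prod_ennreal)
  also have "\<dots> = (\<Prod>i<m. \<integral>\<^sup>+\<omega>. ennreal (exp (Z i \<omega>)) \<partial>M)"
    by (rule indep_vars_nn_integral) (use indep_vars_compose2[OF ind, of "\<lambda>_ x. ennreal (exp x)" "\<lambda>_. borel"] in auto)
  also have "\<dots> \<le> (\<Prod>i<m. ennreal A)"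
    by (intro prod_mono_ennreal mgf) auto
  also have "\<dots> = ennreal (A ^ m)" using A by (simp add: prod_ennreal ennreal_power)
  also have "ennreal (exp (- b * real m)) * ennreal (A ^ m) = ennreal (exp ((ln A - b) * real m))"
  proof -
    have "A ^ m = exp (ln A * real m)" using A by (simp add: exp_of_nat2_mult)
    then show ?thesis by (simp add: algebra_simps flip: ennreal_mult exp_add)
  qed
  finally show ?thesis by (simp add: emeasure_eq_measure mult_left_mono)
qed

text \<open>
  The averages that the observation norms become after division by the standard deviation.
\<close>

definition avg1 :: "nat \<Rightarrow> (nat \<Rightarrow> real) \<Rightarrow> real" where
  "avg1 m y = (\<Sum>i<m. \<bar>y i\<bar>) / real m"

definition avg2 :: "nat \<Rightarrow> (nat \<Rightarrow> real) \<Rightarrow> real" where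
  "avg2 m y = sqrt ((\<Sum>i<m. (y i)\<^sup>2) / real m)"

lemma avg1_le_avg2: "avg1 m y \<le> avg2 m y"
proof (cases "m = 0")
  case False
  have "(\<Sum>i<m. \<bar>1\<bar> * \<bar>y i\<bar>) \<le> L2_set (\<lambda>_. 1) {..<m} * L2_set y {..<m}"
    by (rule L2_set_mult_ineq)
  then have "(\<Sum>i<m. \<bar>y i\<bar>) \<le> sqrt (real m) * sqrt (\<Sum>i<m. (y i)\<^sup>2)" by (simp add: L2_set_def)
  then have "(\<Sum>i<m. \<bar>y i\<bar>) / real m \<le> sqrt (real m) * sqrt (\<Sum>i<m. (y i)\<^sup>2) / real m"
    by (rule divide_right_mono) simp
  also have "\<dots> = sqrt (\<Sum>i<m. (y i)\<^sup>2) / sqrt (real m)"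
    using False by (simp add: field_simps)
  finally show ?thesis by (simp add: avg1_def avg2_def real_sqrt_divide)
qed (simp add: avg1_def avg2_def)

text \<open>
  The quantitative form of \<open>P(\<bar>Y\<bar> small) < 1\<close> for a variable of unit variance with bounded fourth moment.
  It integrates \<open>exp (- \<bar>x\<bar>) \<le> 1 - x\<^sup>2 / 2 + x\<^sup>4 / 8\<close> at \<open>x = l Y\<close>. As the fourth moment is at most 16384,
  \<open>l\<^sup>2 = 1 / 8192\<close> makes the last term half as large as the second.
\<close>

lemma small_exp_moment:
  fixes Y :: "'a \<Rightarrow> real"
  assumes "prob_space M" and Y: "Y \<in> borel_measurable M"
    and two: "(\<integral>\<^sup>+\<omega>. ennreal ((Y \<omega>)\<^sup>2) \<partial>M) = 1"
    and ex: "(\<integral>\<^sup>+\<omega>. ennreal (exp (\<bar>Y \<omega>\<bar> / 2)) \<partial>M) \<le> 4"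
  shows "(\<integral>\<^sup>+\<omega>. ennreal (exp (- sqrt (1/8192) * \<bar>Y \<omega>\<bar>)) \<partial>M) \<le> ennreal (exp (- 1/32768))"
proof -
  interpret prob_space M by fact
  have i2: "integrable M (\<lambda>\<omega>. (Y \<omega>)\<^sup>2)"
    by (rule integrableI_nonneg) (use Y two in simp_all)
  have "ennreal (expectation (\<lambda>\<omega>. (Y \<omega>)\<^sup>2)) = 1"
    using nn_integral_eq_integral[OF i2] two by simp
  then have e2: "expectation (\<lambda>\<omega>. (Y \<omega>)\<^sup>2) = 1" by (simp only: ennreal_eq_1)
  have x4: "x ^ 4 \<le> 4096 * exp (\<bar>x\<bar> / 2)" for x :: real
  proof -
    have "(\<bar>x\<bar> / 8) ^ 4 \<le> (1 + \<bar>x\<bar> / 2 / 4) ^ 4" by (intro power_mono) auto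
    also have "\<dots> \<le> exp (\<bar>x\<bar> / 2)"
      using exp_ge_one_plus_x_over_n_power_n[of 4 "\<bar>x\<bar> / 2"] by simp
    finally show ?thesis by (simp add: power_divide)
  qed
  have n4: "(\<integral>\<^sup>+\<omega>. ennreal ((Y \<omega>) ^ 4) \<partial>M) \<le> 16384"
  proof -
    have "(\<integral>\<^sup>+\<omega>. ennreal ((Y \<omega>) ^ 4) \<partial>M) \<le> (\<integral>\<^sup>+\<omega>. ennreal 4096 * ennreal (exp (\<bar>Y \<omega>\<bar> / 2)) \<partial>M)"
    proof (rule nn_integral_mono)
      show "ennreal ((Y \<omega>) ^ 4) \<le> ennreal 4096 * ennreal (exp (\<bar>Y \<omega>\<bar> / 2))" for \<omega>
        by (subst ennreal_mult[symmetric]) (auto intro: ennreal_leI x4)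
    qed
    also have "\<dots> = ennreal 4096 * (\<integral>\<^sup>+\<omega>. ennreal (exp (\<bar>Y \<omega>\<bar> / 2)) \<partial>M)"
      by (rule nn_integral_cmult) (use Y in measurable)
    also have "\<dots> \<le> ennreal 4096 * ennreal 4" using ex by (intro mult_left_mono) auto
    also have "\<dots> = 16384" by (subst ennreal_mult[symmetric]) auto
    finally show ?thesis .
  qed
  have i4: "integrable M (\<lambda>\<omega>. (Y \<omega>) ^ 4)"
    using n4 Y by (intro integrableI_nonneg) (auto intro: le_less_trans)
  have e4: "expectation (\<lambda>\<omega>. (Y \<omega>) ^ 4) \<le> 16384"
  proof -
    have "ennreal (expectation (\<lambda>\<omega>. (Y \<omega>) ^ 4)) \<le> ennreal 16384"
      using n4 nn_integral_eq_integral[OF i4] by simp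
    then show ?thesis by (subst (asm) ennreal_le_iff) auto
  qed
  have key: "exp (- \<bar>x\<bar>) \<le> 1 - x\<^sup>2 / 2 + x ^ 4 / 8" for x :: real
  proof -
    define a where "a = \<bar>x\<bar>"
    have a: "0 \<le> a" "x\<^sup>2 = a\<^sup>2" "x ^ 4 = a\<^sup>2 * a\<^sup>2"
      by (auto simp: a_def power4_eq_xxxx power2_eq_square)
    have half: "exp (- 1) \<le> (1/2::real)"
      using exp_ge_add_one_self[of 1] by (simp add: exp_minus field_simps)
    show ?thesis
    proof (cases "a \<le> 1")
      case True
      \<comment> \<open>chord of the convex function \<open>exp (- a)\<close> over \<open>[0, 1]\<close>\<close>
      have "exp ((1 - a) * 0 + a * (-1)) \<le> (1 - a) * exp 0 + a * exp (-1)"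
        using convex_onD[OF exp_convex, of a 0 "-1"] a True by simp
      then have "exp (- a) \<le> 1 - a / 2" using mult_left_mono[OF half a(1)] by simp
      moreover have "a\<^sup>2 \<le> a" using a True by (simp add: power2_eq_square mult_left_le)
      ultimately have "exp (- a) \<le> 1 - a\<^sup>2 / 2" by simp
      moreover have "0 \<le> a\<^sup>2 * a\<^sup>2" by simp
      ultimately show ?thesis unfolding a(2,3) a_def[symmetric] by linarith
    next
      case False
      then have "exp (- a) \<le> exp (-1)" by simp
      then have "exp (- a) \<le> 1/2" using half by linarith
      moreover have "0 \<le> (a\<^sup>2 - 2)\<^sup>2" by simp
      then have "a\<^sup>2 - a\<^sup>2 * a\<^sup>2 / 4 \<le> 1" by (simp add: power2_eq_square algebra_simps)
      ultimately show ?thesis unfolding a(2,3) a_def[symmetric] by linarith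
    qed
  qed
  define l :: real where "l = sqrt (1/8192)"
  have l: "0 \<le> l" "l\<^sup>2 = 1/8192" "l ^ 4 = 1/67108864"
    by (auto simp: l_def power4_eq_xxxx power2_eq_square)
  have ie: "integrable M (\<lambda>\<omega>. exp (- l * \<bar>Y \<omega>\<bar>))"
    using l Y by (intro integrable_const_bound[of _ 1]) auto
  have "expectation (\<lambda>\<omega>. exp (- l * \<bar>Y \<omega>\<bar>)) \<le>
      expectation (\<lambda>\<omega>. 1 - l\<^sup>2 / 2 * (Y \<omega>)\<^sup>2 + l ^ 4 / 8 * (Y \<omega>) ^ 4)"
  proof (rule integral_mono[OF ie])
    show "integrable M (\<lambda>\<omega>. 1 - l\<^sup>2 / 2 * (Y \<omega>)\<^sup>2 + l ^ 4 / 8 * (Y \<omega>) ^ 4)" using i2 i4 by simp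
    show "exp (- l * \<bar>Y \<omega>\<bar>) \<le> 1 - l\<^sup>2 / 2 * (Y \<omega>)\<^sup>2 + l ^ 4 / 8 * (Y \<omega>) ^ 4" for \<omega>
    proof -
      have "- l * \<bar>Y \<omega>\<bar> = - \<bar>l * Y \<omega>\<bar>" using l(1) by (simp add: abs_mult)
      then show ?thesis using key[of "l * Y \<omega>"] unfolding power_mult_distrib by simp
    qed
  qed
  also have "\<dots> = 1 - l\<^sup>2 / 2 * 1 + l ^ 4 / 8 * expectation (\<lambda>\<omega>. (Y \<omega>) ^ 4)"
    using i2 i4 e2 by (simp add: prob_space)
  also have "\<dots> \<le> 1 - 1/32768" using e4 unfolding l by simp
  also have "\<dots> \<le> exp (- 1/32768)" using exp_ge_add_one_self[of "- 1/32768 :: real"] by simp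
  finally have "expectation (\<lambda>\<omega>. exp (- l * \<bar>Y \<omega>\<bar>)) \<le> exp (- 1/32768)" .
  then show ?thesis using nn_integral_eq_integral[OF ie] by (simp add: l_def ennreal_leI)
qed

text \<open>
  The Chernoff bound for \<open>- l \<bar>Y\<bar>\<close> with the moment bound \<open>exp (- 1/32768)\<close> is applied at half of
  the exponent, which fixes both constants.
\<close>

definition \<alpha>\<^sub>0 :: real where "\<alpha>\<^sub>0 = 1 / (65536 * sqrt (1/8192))"
definition c\<^sub>0 :: real where "c\<^sub>0 = 1 / 65536"

lemma \<alpha>\<^sub>0_pos: "0 < \<alpha>\<^sub>0" and c\<^sub>0_pos: "0 < c\<^sub>0" by (simp_all add: \<alpha>\<^sub>0_def c\<^sub>0_def)

lemma (in prob_space) avg1_lower_tail: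
  assumes ind: "indep_vars (\<lambda>_. borel) Y {..<m}" and m: "1 \<le> m"
    and two: "\<And>i. i < m \<Longrightarrow> (\<integral>\<^sup>+\<omega>. ennreal ((Y i \<omega>)\<^sup>2) \<partial>M) = 1"
    and ex: "\<And>i. i < m \<Longrightarrow> (\<integral>\<^sup>+\<omega>. ennreal (exp (\<bar>Y i \<omega>\<bar> / 2)) \<partial>M) \<le> 4"
  shows "prob {\<omega>\<in>space M. avg1 m (\<lambda>i. Y i \<omega>) \<le> \<alpha>\<^sub>0} \<le> exp (- c\<^sub>0 * real m)"
proof -
  let ?l = "sqrt (1/8192)"
  have l: "0 < ?l" by simp
  have rv: "Y i \<in> borel_measurable M" if "i < m" for i using ind that by (simp add: indep_vars_def)
  have ind': "indep_vars (\<lambda>_. borel) (\<lambda>i \<omega>. - ?l * \<bar>Y i \<omega>\<bar>) {..<m}"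
    by (rule indep_vars_compose2[OF ind, of "\<lambda>_ x. - ?l * \<bar>x\<bar>"]) simp
  have "prob {\<omega>\<in>space M. (- 1/65536) * real m \<le> (\<Sum>i<m. - ?l * \<bar>Y i \<omega>\<bar>)} \<le>
      exp ((ln (exp (- 1/32768)) - (- 1/65536)) * real m)"
    by (rule chernoff_bound[OF ind'])
      (use small_exp_moment[OF prob_space_axioms rv two ex] in auto)
  moreover have "{\<omega>\<in>space M. avg1 m (\<lambda>i. Y i \<omega>) \<le> \<alpha>\<^sub>0} =
      {\<omega>\<in>space M. (- 1/65536) * real m \<le> (\<Sum>i<m. - ?l * \<bar>Y i \<omega>\<bar>)}"
  proof -
    have "s / real m \<le> 1 / (65536 * ?l) \<longleftrightarrow> (- 1/65536) * real m \<le> - ?l * s" for s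
      using m l by (simp only: field_simps) (simp add: field_simps)
    then show ?thesis unfolding avg1_def \<alpha>\<^sub>0_def sum_distrib_left[symmetric] by blast
  qed
  ultimately show ?thesis by (simp add: c\<^sub>0_def)
qed

lemma ln4_le: "ln 4 \<le> (2::real)"
  using ln_le_minus_one[of "2::real"] ln_mult[of 2 2] by simp

lemma (in prob_space) avg1_upper_tail:
  assumes ind: "indep_vars (\<lambda>_. borel) Y {..<m}" and m: "1 \<le> m"
    and ex: "\<And>i. i < m \<Longrightarrow> (\<integral>\<^sup>+\<omega>. ennreal (exp (\<bar>Y i \<omega>\<bar> / 2)) \<partial>M) \<le> 4"
  shows "prob {\<omega>\<in>space M. 6 \<le> avg1 m (\<lambda>i. Y i \<omega>)} \<le> exp (- c\<^sub>0 * real m)"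
proof -
  have ind': "indep_vars (\<lambda>_. borel) (\<lambda>i \<omega>. \<bar>Y i \<omega>\<bar> / 2) {..<m}"
    by (rule indep_vars_compose2[OF ind, of "\<lambda>_ x. \<bar>x\<bar> / 2"]) simp
  have "prob {\<omega>\<in>space M. 3 * real m \<le> (\<Sum>i<m. \<bar>Y i \<omega>\<bar> / 2)} \<le> exp ((ln 4 - 3) * real m)"
    by (rule chernoff_bound[OF ind']) (use ex in auto)
  also have "\<dots> \<le> exp (- c\<^sub>0 * real m)"
    using ln4_le unfolding exp_le_cancel_iff by (intro mult_right_mono) (auto simp: c\<^sub>0_def)
  also have "{\<omega>\<in>space M. 3 * real m \<le> (\<Sum>i<m. \<bar>Y i \<omega>\<bar> / 2)} = {\<omega>\<in>space M. 6 \<le> avg1 m (\<lambda>i. Y i \<omega>)}"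
  proof -
    have "3 * real m \<le> s / 2 \<longleftrightarrow> 6 \<le> s / real m" for s using m by (simp add: field_simps)
    then show ?thesis unfolding avg1_def sum_divide_distrib[symmetric] by blast
  qed
  finally show ?thesis .
qed

lemma (in prob_space) avg2_upper_tail:
  assumes ind: "indep_vars (\<lambda>_. borel) Y {..<m}" and m: "1 \<le> m"
    and ex: "\<And>i. i < m \<Longrightarrow> (\<integral>\<^sup>+\<omega>. ennreal (exp ((Y i \<omega>)\<^sup>2 / 4)) \<partial>M) \<le> 4"
  shows "prob {\<omega>\<in>space M. 6 \<le> avg2 m (\<lambda>i. Y i \<omega>)} \<le> exp (- c\<^sub>0 * real m)"
proof -
  have ind': "indep_vars (\<lambda>_. borel) (\<lambda>i \<omega>. (Y i \<omega>)\<^sup>2 / 4) {..<m}"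
    by (rule indep_vars_compose2[OF ind, of "\<lambda>_ x. x\<^sup>2 / 4"]) simp
  have "prob {\<omega>\<in>space M. 9 * real m \<le> (\<Sum>i<m. (Y i \<omega>)\<^sup>2 / 4)} \<le> exp ((ln 4 - 9) * real m)"
    by (rule chernoff_bound[OF ind']) (use ex in auto)
  also have "\<dots> \<le> exp (- c\<^sub>0 * real m)"
    using ln4_le unfolding exp_le_cancel_iff by (intro mult_right_mono) (auto simp: c\<^sub>0_def)
  also have "{\<omega>\<in>space M. 9 * real m \<le> (\<Sum>i<m. (Y i \<omega>)\<^sup>2 / 4)} = {\<omega>\<in>space M. 6 \<le> avg2 m (\<lambda>i. Y i \<omega>)}"
  proof -
    have "9 * real m \<le> s / 4 \<longleftrightarrow> 6 \<le> sqrt (s / real m)" for s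
    proof -
      have "6 \<le> sqrt (s / real m) \<longleftrightarrow> sqrt 36 \<le> sqrt (s / real m)" by simp
      also have "\<dots> \<longleftrightarrow> 36 \<le> s / real m" by (simp only: real_sqrt_le_iff)
      finally show ?thesis using m by (simp add: field_simps)
    qed
    then show ?thesis unfolding avg2_def sum_divide_distrib[symmetric] by blast
  qed
  finally show ?thesis .
qed

section \<open>Restricted isometry from a net\<close>

definition seminorm_on :: "'e set \<Rightarrow> (('e \<Rightarrow> real) \<Rightarrow> real) \<Rightarrow> bool" where
  "seminorm_on E f \<longleftrightarrow> (\<forall>h. 0 \<le> f h) \<and> (\<forall>h d. f (\<lambda>e. h e + d e) \<le> f h + f d) \<and>
     (\<forall>h c. f (\<lambda>e. c * h e) = \<bar>c\<bar> * f h) \<and> (\<forall>h d. (\<forall>e\<in>E. h e = d e) \<longrightarrow> f h = f d) \<and>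
     (\<exists>B. \<forall>h. f h \<le> B * L2_set h E)"

lemma seminorm_onD:
  assumes "seminorm_on E f"
  shows "0 \<le> f h" "f (\<lambda>e. h e + d e) \<le> f h + f d" "f (\<lambda>e. c * h e) = \<bar>c\<bar> * f h"
    "(\<And>e. e \<in> E \<Longrightarrow> h e = d e) \<Longrightarrow> f h = f d"
  using assms unfolding seminorm_on_def by blast+

text \<open>
  The supremum \<open>Q\<close> of \<open>g\<close> over unit directions satisfies \<open>Q \<le> 6 (1 + 2 \<epsilon>) + 2 \<epsilon> Q\<close>, because a direction differs
  from a net point by two short members of the same cone. This bounds \<open>Q\<close>, and with \<open>g\<close> under control on
  the error terms the lower bound passes from the net to all directions. The finiteness of \<open>Q\<close> is the last
  clause of \<open>seminorm_on\<close>.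
\<close>

lemma rip_of_net:
  fixes D :: "('e \<Rightarrow> real) \<Rightarrow> bool"
  assumes f: "seminorm_on E f" and g: "seminorm_on E g" and fg: "\<And>h. f h \<le> g h"
    and cone: "\<And>h c. D h \<Longrightarrow> D (\<lambda>e. c * h e)"
    and D0: "D (\<lambda>_. 0)"
    and \<epsilon>: "0 < \<epsilon>" "\<epsilon> \<le> 1/8" and \<alpha>: "0 < \<alpha>" "\<epsilon> * (2 * \<alpha> + 24) \<le> \<alpha> / 2"
    and net: "\<And>h. D h \<Longrightarrow> L2_set h E \<le> 1 \<Longrightarrow> \<exists>h'\<in>T. \<exists>d\<^sub>1 d\<^sub>2. D d\<^sub>1 \<and> D d\<^sub>2 \<and> L2_set d\<^sub>1 E \<le> \<epsilon> \<and>
        L2_set d\<^sub>2 E \<le> \<epsilon> \<and> (\<forall>e\<in>E. h e = h' e + d\<^sub>1 e + d\<^sub>2 e)"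
    and lowT: "\<And>h. h \<in> T \<Longrightarrow> \<alpha> * L2_set h E \<le> f h"
    and upT: "\<And>h. h \<in> T \<Longrightarrow> g h \<le> 6 * L2_set h E"
  shows "D h \<Longrightarrow> g h \<le> 12 * L2_set h E" and "D h \<Longrightarrow> \<alpha> / 2 * L2_set h E \<le> f h"
proof -
  \<comment> \<open>the ball and not the sphere, since the class may contain only the zero direction\<close>
  define U where "U = {h. D h \<and> L2_set h E \<le> 1}"
  define Q where "Q = (SUP h\<in>U. g h)"
  have neU: "U \<noteq> {}" using D0 by (auto simp: U_def L2_set_def)
  obtain B where B: "\<And>h. g h \<le> B * L2_set h E" using g by (auto simp: seminorm_on_def)
  have bdd: "bdd_above (g ` U)"
  proof (rule bdd_aboveI2)
    fix h assume "h \<in> U"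
    have "B * L2_set h E \<le> \<bar>B\<bar> * L2_set h E" by (intro mult_right_mono) auto
    also have "\<dots> \<le> \<bar>B\<bar> * 1" using \<open>h \<in> U\<close> by (intro mult_left_mono) (auto simp: U_def)
    finally have "B * L2_set h E \<le> \<bar>B\<bar> * 1" .
    then show "g h \<le> \<bar>B\<bar>" using B[of h] by simp
  qed
  have gQ: "g h \<le> Q" if "h \<in> U" for h unfolding Q_def by (rule cSUP_upper[OF that bdd])
  have Q0: "0 \<le> Q"
  proof -
    obtain h where "h \<in> U" using neU by blast
    from order_trans[OF seminorm_onD(1)[OF g] gQ[OF this]] show ?thesis .
  qed
  have small: "g d \<le> \<epsilon> * Q" if "D d" "L2_set d E \<le> \<epsilon>" for d
  proof -
    have "L2_set (\<lambda>e. (1/\<epsilon>) * d e) E = \<bar>1/\<epsilon>\<bar> * L2_set d E"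
      by (simp add: L2_set_def power_divide real_sqrt_divide flip: sum_divide_distrib)
    also have "\<dots> \<le> 1" using that(2) \<epsilon> by simp
    finally have "(\<lambda>e. (1/\<epsilon>) * d e) \<in> U" using cone[OF that(1), of "1/\<epsilon>"] unfolding U_def by blast
    from gQ[OF this] have "(1/\<epsilon>) * g d \<le> Q" using seminorm_onD(3)[OF g, of "1/\<epsilon>" d] \<epsilon> by simp
    then show ?thesis using \<epsilon> by (simp add: field_simps)
  qed
  have tri: "L2_set h' E \<le> L2_set h E + L2_set d\<^sub>1 E + L2_set d\<^sub>2 E \<and> L2_set h E \<le> L2_set h' E + L2_set d\<^sub>1 E + L2_set d\<^sub>2 E"
    if "\<forall>e\<in>E. h e = h' e + d\<^sub>1 e + d\<^sub>2 e" for h h' d\<^sub>1 d\<^sub>2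
  proof -
    have neg: "L2_set (\<lambda>e. - d e) E = L2_set d E" for d by (simp add: L2_set_def)
    have "L2_set h' E = L2_set (\<lambda>e. (h e + - d\<^sub>1 e) + - d\<^sub>2 e) E"
      using that by (intro L2_set_cong refl) simp
    also have "\<dots> \<le> L2_set h E + L2_set d\<^sub>1 E + L2_set d\<^sub>2 E"
      using L2_set_triangle_ineq[of "\<lambda>e. h e + - d\<^sub>1 e" "\<lambda>e. - d\<^sub>2 e" E]
        L2_set_triangle_ineq[of h "\<lambda>e. - d\<^sub>1 e" E] by (simp add: neg)
    finally have 1: "L2_set h' E \<le> L2_set h E + L2_set d\<^sub>1 E + L2_set d\<^sub>2 E" .
    have "L2_set h E = L2_set (\<lambda>e. (h' e + d\<^sub>1 e) + d\<^sub>2 e) E"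
      using that by (intro L2_set_cong refl) simp
    also have "\<dots> \<le> L2_set h' E + L2_set d\<^sub>1 E + L2_set d\<^sub>2 E"
      using L2_set_triangle_ineq[of "\<lambda>e. h' e + d\<^sub>1 e" d\<^sub>2 E]
        L2_set_triangle_ineq[of h' d\<^sub>1 E] by simp
    finally show ?thesis using 1 by simp
  qed
  have tri_s: "s h \<le> s h' + s d\<^sub>1 + s d\<^sub>2 \<and> s h' \<le> s h + s d\<^sub>1 + s d\<^sub>2"
    if s: "seminorm_on E s" and eq: "\<forall>e\<in>E. h e = h' e + d\<^sub>1 e + d\<^sub>2 e" for s h h' d\<^sub>1 d\<^sub>2
  proof -
    have neg: "s (\<lambda>e. - d e) = s d" for d using seminorm_onD(3)[OF s, of "-1" d] by simp
    have "s h = s (\<lambda>e. (h' e + d\<^sub>1 e) + d\<^sub>2 e)" by (rule seminorm_onD(4)[OF s]) (use eq in simp)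
    also have "\<dots> \<le> s h' + s d\<^sub>1 + s d\<^sub>2"
      using seminorm_onD(2)[OF s, of "\<lambda>e. h' e + d\<^sub>1 e" d\<^sub>2] seminorm_onD(2)[OF s, of h' d\<^sub>1] by linarith
    finally have 1: "s h \<le> s h' + s d\<^sub>1 + s d\<^sub>2" .
    have "s h' = s (\<lambda>e. (h e + - d\<^sub>1 e) + - d\<^sub>2 e)" by (rule seminorm_onD(4)[OF s]) (use eq in simp)
    also have "\<dots> \<le> s h + s d\<^sub>1 + s d\<^sub>2"
      using seminorm_onD(2)[OF s, of "\<lambda>e. h e + - d\<^sub>1 e" "\<lambda>e. - d\<^sub>2 e"]
        seminorm_onD(2)[OF s, of h "\<lambda>e. - d\<^sub>1 e"] neg by simp
    finally show ?thesis using 1 by simp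
  qed
  have "Q \<le> 6 * (1 + 2 * \<epsilon>) + 2 * (\<epsilon> * Q)"
    unfolding Q_def
  proof (rule cSUP_least[OF neU])
    fix h assume h: "h \<in> U"
    then obtain h' d\<^sub>1 d\<^sub>2 where h': "h' \<in> T" and d: "D d\<^sub>1" "D d\<^sub>2" "L2_set d\<^sub>1 E \<le> \<epsilon>" "L2_set d\<^sub>2 E \<le> \<epsilon>"
      and eq: "\<forall>e\<in>E. h e = h' e + d\<^sub>1 e + d\<^sub>2 e" using net[of h] by (auto simp: U_def)
    have "L2_set h' E \<le> 1 + 2 * \<epsilon>" using tri[OF eq] d h by (simp add: U_def)
    then have "6 * L2_set h' E \<le> 6 * (1 + 2 * \<epsilon>)" by (rule mult_left_mono) simp
    then have "g h' \<le> 6 * (1 + 2 * \<epsilon>)" by (rule order_trans[OF upT[OF h']])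
    then show "g h \<le> 6 * (1 + 2 * \<epsilon>) + 2 * (\<epsilon> * (SUP h\<in>U. g h))"
      using tri_s[OF g eq] small[OF d(1,3)] small[OF d(2,4)] unfolding Q_def by linarith
  qed
  moreover have "\<epsilon> * Q \<le> 1/8 * Q" using \<epsilon> Q0 by (intro mult_right_mono) auto
  moreover have "6 * (1 + 2 * \<epsilon>) = 6 + 12 * \<epsilon>" by simp
  ultimately have "Q \<le> 6 + 12 * \<epsilon> + 2 * (1/8 * Q)" by linarith
  then have Q12: "Q \<le> 12" using \<epsilon> by simp
  have norm: "\<exists>d. d \<in> U \<and> L2_set d E = 1 \<and> (\<forall>s. seminorm_on E s \<longrightarrow> s h = L2_set h E * s d)"
    if "D h" "L2_set h E \<noteq> 0" for h
  proof -
    define t where "t = L2_set h E"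
    have t: "0 < t" using that by (simp add: t_def order_less_le)
    have "L2_set (\<lambda>e. (1/t) * h e) E = \<bar>1/t\<bar> * L2_set h E"
      by (simp add: L2_set_def power_divide real_sqrt_divide flip: sum_divide_distrib)
    then have "L2_set (\<lambda>e. (1/t) * h e) E = 1" using t by (simp flip: t_def)
    moreover have "s h = t * s (\<lambda>e. (1/t) * h e)" if "seminorm_on E s" for s
      using seminorm_onD(3)[OF that, of "1/t" h] t by simp
    ultimately show ?thesis using cone[OF that(1), of "1/t"]
      by (intro exI[of _ "\<lambda>e. (1/t) * h e"]) (auto simp: U_def t_def)
  qed
  have zero: "s h = 0" if z: "L2_set h E = 0" and s: "seminorm_on E s" for h s
  proof -
    obtain B where "s h \<le> B * L2_set h E" using s unfolding seminorm_on_def by blast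
    then show ?thesis using z seminorm_onD(1)[OF s, of h] by simp
  qed
  show "g h \<le> 12 * L2_set h E" if Dh: "D h"
  proof (cases "L2_set h E = 0")
    case False
    then obtain d where d: "d \<in> U" "g h = L2_set h E * g d" using norm[OF Dh False] g by blast
    have "L2_set h E * g d \<le> L2_set h E * 12" using gQ[OF d(1)] Q12 by (intro mult_left_mono) auto
    then show ?thesis using d(2) by simp
  qed (simp add: zero[OF _ g])
  show "\<alpha> / 2 * L2_set h E \<le> f h" if Dh: "D h"
  proof (cases "L2_set h E = 0")
    case False
    then obtain d where d: "d \<in> U" "L2_set d E = 1" "f h = L2_set h E * f d" using norm[OF Dh False] f by blast
    then obtain h' d\<^sub>1 d\<^sub>2 where h': "h' \<in> T" and dd: "D d\<^sub>1" "D d\<^sub>2" "L2_set d\<^sub>1 E \<le> \<epsilon>" "L2_set d\<^sub>2 E \<le> \<epsilon>"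
      and eq: "\<forall>e\<in>E. d e = h' e + d\<^sub>1 e + d\<^sub>2 e" using net[of d] by (auto simp: U_def)
    have "f d\<^sub>1 \<le> \<epsilon> * 12" "f d\<^sub>2 \<le> \<epsilon> * 12"
      using small[OF dd(1,3)] small[OF dd(2,4)] fg[of d\<^sub>1] fg[of d\<^sub>2] mult_left_mono[OF Q12, of \<epsilon>] \<epsilon> by linarith+
    moreover have "1 - 2 * \<epsilon> \<le> L2_set h' E" using tri[OF eq] dd d(2) by simp
    then have "\<alpha> * (1 - 2 * \<epsilon>) \<le> \<alpha> * L2_set h' E" using \<alpha>(1) by (intro mult_left_mono) auto
    then have "\<alpha> * (1 - 2 * \<epsilon>) \<le> f h'" using lowT[OF h'] by linarith
    ultimately have "\<alpha> * (1 - 2 * \<epsilon>) - 24 * \<epsilon> \<le> f d" using tri_s[OF f eq] by linarith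
    then have "\<alpha> / 2 \<le> f d" using \<alpha>(2) by (simp add: algebra_simps)
    then have "L2_set h E * (\<alpha> / 2) \<le> L2_set h E * f d" by (intro mult_left_mono) auto
    then show ?thesis using d(3) by (simp add: mult.commute)
  qed (simp add: zero[OF _ f])
qed

section \<open>Rotating independent Gaussian pairs\<close>

text \<open>
  The rotation by 45 degrees preserves \<open>x\<^sup>2 + y\<^sup>2\<close> and Lebesgue measure. The latter is obtained from two
  one-dimensional affine substitutions instead of a change of variables in the plane.
\<close>

lemma nn_integral_std_normal_rotate:
  fixes F :: "real \<Rightarrow> real \<Rightarrow> ennreal"
  assumes F: "case_prod F \<in> borel_measurable (borel \<Otimes>\<^sub>M borel)"
  defines "N \<equiv> density lborel (\<lambda>x. ennreal (std_normal_density x))"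
  shows "(\<integral>\<^sup>+y. (\<integral>\<^sup>+x. F ((x - y) / sqrt 2) ((x + y) / sqrt 2) \<partial>N) \<partial>N) = (\<integral>\<^sup>+y. (\<integral>\<^sup>+x. F x y \<partial>N) \<partial>N)"
proof -
  note [measurable] = F
  let ?d = "\<lambda>x. ennreal (std_normal_density x)"
  have Fm[measurable (raw)]: "(\<lambda>z. F (a z) (b z)) \<in> borel_measurable K"
    if "a \<in> borel_measurable K" "b \<in> borel_measurable K" for a b and K :: "'c measure"
    using measurable_compose[OF measurable_Pair[OF that] F] by simp
  have dens: "(\<integral>\<^sup>+y. (\<integral>\<^sup>+x. G x y \<partial>N) \<partial>N) = (\<integral>\<^sup>+y. (\<integral>\<^sup>+x. ?d x * ?d y * G x y \<partial>lborel) \<partial>lborel)"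
    if [measurable]: "case_prod G \<in> borel_measurable (borel \<Otimes>\<^sub>M borel)" for G :: "real \<Rightarrow> real \<Rightarrow> ennreal"
  proof -
    have Gm[measurable (raw)]: "(\<lambda>z. G (a z) (b z)) \<in> borel_measurable K"
      if "a \<in> borel_measurable K" "b \<in> borel_measurable K" for a b and K :: "'d measure"
      using measurable_compose[OF measurable_Pair[OF that] \<open>case_prod G \<in> _\<close>] by simp
    have "(\<integral>\<^sup>+x. G x y \<partial>N) = (\<integral>\<^sup>+x. ?d x * G x y \<partial>lborel)" for y
      unfolding N_def by (rule nn_integral_density) measurable
    then have "(\<integral>\<^sup>+y. (\<integral>\<^sup>+x. G x y \<partial>N) \<partial>N) = (\<integral>\<^sup>+y. ?d y * (\<integral>\<^sup>+x. ?d x * G x y \<partial>lborel) \<partial>lborel)"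
      unfolding N_def by (simp add: nn_integral_density)
    also have "\<dots> = (\<integral>\<^sup>+y. (\<integral>\<^sup>+x. ?d y * (?d x * G x y) \<partial>lborel) \<partial>lborel)"
      by (intro nn_integral_cong nn_integral_cmult[symmetric]) measurable
    finally show ?thesis by (simp add: mult_ac)
  qed
  have "(\<integral>\<^sup>+y. (\<integral>\<^sup>+x. F ((x - y) / sqrt 2) ((x + y) / sqrt 2) \<partial>N) \<partial>N) =
     (\<integral>\<^sup>+y. (\<integral>\<^sup>+x. ?d x * ?d y * F ((x - y) / sqrt 2) ((x + y) / sqrt 2) \<partial>lborel) \<partial>lborel)"
    by (rule dens) measurable
  also have "\<dots> = (\<integral>\<^sup>+y. (\<integral>\<^sup>+s. ennreal (sqrt 2) * (?d (y + sqrt 2 * s) * ?d y * F s (s + sqrt 2 * y)) \<partial>lborel) \<partial>lborel)"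
  proof (rule nn_integral_cong)
    fix y :: real
    have "(\<integral>\<^sup>+x. ?d x * ?d y * F ((x - y) / sqrt 2) ((x + y) / sqrt 2) \<partial>lborel) =
       \<bar>sqrt 2\<bar> * (\<integral>\<^sup>+s. ?d (y + sqrt 2 * s) * ?d y *
           F ((y + sqrt 2 * s - y) / sqrt 2) ((y + sqrt 2 * s + y) / sqrt 2) \<partial>lborel)"
      by (rule nn_integral_real_affine) auto
    moreover have "(y + sqrt 2 * s - y) / sqrt 2 = s" for s by simp
    moreover have "(y + sqrt 2 * s + y) / sqrt 2 = s + sqrt 2 * y" for s
      by (simp add: field_simps)
    ultimately have "(\<integral>\<^sup>+x. ?d x * ?d y * F ((x - y) / sqrt 2) ((x + y) / sqrt 2) \<partial>lborel) =
       ennreal (sqrt 2) * (\<integral>\<^sup>+s. ?d (y + sqrt 2 * s) * ?d y * F s (s + sqrt 2 * y) \<partial>lborel)"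
      by simp
    then show "(\<integral>\<^sup>+x. ?d x * ?d y * F ((x - y) / sqrt 2) ((x + y) / sqrt 2) \<partial>lborel) =
       (\<integral>\<^sup>+s. ennreal (sqrt 2) * (?d (y + sqrt 2 * s) * ?d y * F s (s + sqrt 2 * y)) \<partial>lborel)"
      by (subst nn_integral_cmult) auto
  qed
  also have "\<dots> = (\<integral>\<^sup>+s. (\<integral>\<^sup>+y. ennreal (sqrt 2) * (?d (y + sqrt 2 * s) * ?d y * F s (s + sqrt 2 * y)) \<partial>lborel) \<partial>lborel)"
    by (rule lborel_pair.Fubini') measurable
  also have "\<dots> = (\<integral>\<^sup>+s. (\<integral>\<^sup>+t. ?d s * ?d t * F s t \<partial>lborel) \<partial>lborel)"
  proof (rule nn_integral_cong)
    fix s :: real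
    have "(\<integral>\<^sup>+y. ennreal (sqrt 2) * (?d (y + sqrt 2 * s) * ?d y * F s (s + sqrt 2 * y)) \<partial>lborel) =
      \<bar>1 / sqrt 2\<bar> * (\<integral>\<^sup>+t. ennreal (sqrt 2) * (?d ((- s / sqrt 2 + 1 / sqrt 2 * t) + sqrt 2 * s) *
         ?d (- s / sqrt 2 + 1 / sqrt 2 * t) * F s (s + sqrt 2 * (- s / sqrt 2 + 1 / sqrt 2 * t))) \<partial>lborel)"
      by (rule nn_integral_real_affine) auto
    also have "\<dots> = (\<integral>\<^sup>+t. ennreal (1 / sqrt 2) * (ennreal (sqrt 2) * (?d ((- s / sqrt 2 + 1 / sqrt 2 * t) + sqrt 2 * s) *
         ?d (- s / sqrt 2 + 1 / sqrt 2 * t) * F s (s + sqrt 2 * (- s / sqrt 2 + 1 / sqrt 2 * t)))) \<partial>lborel)"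
      by (subst nn_integral_cmult) auto
    also have "\<dots> = (\<integral>\<^sup>+t. ?d s * ?d t * F s t \<partial>lborel)"
    proof (rule nn_integral_cong)
      fix t :: real
      have 1: "s + sqrt 2 * (- s / sqrt 2 + 1 / sqrt 2 * t) = t" by (simp add: algebra_simps)
      have 2: "- s / sqrt 2 + 1 / sqrt 2 * t + sqrt 2 * s = (t + s) / sqrt 2"
        by (simp add: field_simps)
      have 3: "- s / sqrt 2 + 1 / sqrt 2 * t = (t - s) / sqrt 2" by (simp add: field_simps)
      have "((t + s) / sqrt 2)\<^sup>2 + ((t - s) / sqrt 2)\<^sup>2 = s\<^sup>2 + t\<^sup>2"
        by (simp add: power_divide power2_eq_square field_simps)
      then have "std_normal_density ((t + s) / sqrt 2) * std_normal_density ((t - s) / sqrt 2) =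
          std_normal_density s * std_normal_density t"
        by (simp add: std_normal_density_def flip: exp_add add_divide_distrib)
      then have 4: "?d ((t + s) / sqrt 2) * ?d ((t - s) / sqrt 2) = ?d s * ?d t"
        by (simp add: normal_density_nonneg flip: ennreal_mult)
      have 5: "ennreal (1 / sqrt 2) * ennreal (sqrt 2) = 1" by (subst ennreal_mult[symmetric]) auto
      have "ennreal (1 / sqrt 2) * (ennreal (sqrt 2) * (?d ((t + s) / sqrt 2) * ?d ((t - s) / sqrt 2) * F s t)) =
         (ennreal (1 / sqrt 2) * ennreal (sqrt 2)) * ((?d ((t + s) / sqrt 2) * ?d ((t - s) / sqrt 2)) * F s t)"
        by (simp only: mult.assoc)
      then show "ennreal (1 / sqrt 2) * (ennreal (sqrt 2) * (?d ((- s / sqrt 2 + 1 / sqrt 2 * t) + sqrt 2 * s) *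
         ?d (- s / sqrt 2 + 1 / sqrt 2 * t) * F s (s + sqrt 2 * (- s / sqrt 2 + 1 / sqrt 2 * t)))) = ?d s * ?d t * F s t"
        unfolding 1 2 unfolding 3 4 5 by simp
    qed
    finally show "(\<integral>\<^sup>+y. ennreal (sqrt 2) * (?d (y + sqrt 2 * s) * ?d y * F s (s + sqrt 2 * y)) \<partial>lborel) =
       (\<integral>\<^sup>+t. ?d s * ?d t * F s t \<partial>lborel)" .
  qed
  also have "\<dots> = (\<integral>\<^sup>+t. (\<integral>\<^sup>+s. ?d s * ?d t * F s t \<partial>lborel) \<partial>lborel)"
    by (rule lborel_pair.Fubini') measurable
  also have "\<dots> = (\<integral>\<^sup>+y. (\<integral>\<^sup>+x. F x y \<partial>N) \<partial>N)" by (rule dens[symmetric]) measurable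
  finally show ?thesis .
qed

abbreviation std_normal :: "real measure" where
  "std_normal \<equiv> density lborel (\<lambda>x. ennreal (std_normal_density x))"

lemma prob_space_std_normal: "prob_space std_normal"
  by (rule prob_space_normal_density) simp

text \<open>
  The description by the joint law, in which a measure preserving substitution of coordinates can be
  carried out.
\<close>

lemma std_gaussians_iff_distr:
  assumes "J \<noteq> {}"
  shows "std_gaussians M J g \<longleftrightarrow> prob_space M \<and> (\<forall>j\<in>J. g j \<in> borel_measurable M) \<and>
    distr M (\<Pi>\<^sub>M j\<in>J. borel) (\<lambda>\<omega>. \<lambda>j\<in>J. g j \<omega>) = (\<Pi>\<^sub>M j\<in>J. std_normal)"
    (is "?L \<longleftrightarrow> ?R")
proof
  assume L: ?L
  interpret prob_space M using L by (simp add: std_gaussians_def)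
  have rv: "g j \<in> borel_measurable M" if "j \<in> J" for j using std_gaussians_measurable[OF L that] .
  have d: "distr M borel (g j) = std_normal" if "j \<in> J" for j
  proof -
    have "distr M lborel (g j) = std_normal"
      using L that by (auto simp: std_gaussians_def dest: distributed_distr_eq_density)
    moreover have "distr M lborel (g j) = distr M borel (g j)" by (rule distr_cong) auto
    ultimately show ?thesis by simp
  qed
  have "distr M (\<Pi>\<^sub>M j\<in>J. borel) (\<lambda>\<omega>. \<lambda>j\<in>J. g j \<omega>) = (\<Pi>\<^sub>M j\<in>J. distr M borel (g j))"
    using L rv by (subst indep_vars_iff_distr_eq_PiM'[symmetric]) (auto simp: std_gaussians_def assms)
  also have "\<dots> = (\<Pi>\<^sub>M j\<in>J. std_normal)" by (rule PiM_cong) (use d in auto)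
  finally show ?R using rv prob_space_axioms by auto
next
  assume R: ?R
  interpret prob_space M using R by simp
  have rv: "g j \<in> borel_measurable M" if "j \<in> J" for j using R that by simp
  have mr: "(\<lambda>\<omega>. \<lambda>j\<in>J. g j \<omega>) \<in> measurable M (\<Pi>\<^sub>M j\<in>J. borel)"
    using rv by (intro measurable_restrict) auto
  interpret P: product_prob_space "\<lambda>_. std_normal" J
    by (intro product_prob_spaceI prob_space_std_normal)
  have d: "distr M borel (g j) = std_normal" if j: "j \<in> J" for j
  proof -
    have "distr M borel (g j) = distr (distr M (\<Pi>\<^sub>M j\<in>J. borel) (\<lambda>\<omega>. \<lambda>j\<in>J. g j \<omega>)) borel (\<lambda>w. w j)"
      using j by (subst distr_distr[OF _ mr]) (auto simp: comp_def intro!: distr_cong measurable_component_singleton)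
    also have "\<dots> = distr (\<Pi>\<^sub>M j\<in>J. std_normal) std_normal (\<lambda>w. w j)"
      using R by (intro distr_cong) auto
    also have "\<dots> = std_normal" by (rule P.PiM_component[OF j])
    finally show ?thesis .
  qed
  have "distr M (\<Pi>\<^sub>M j\<in>J. borel) (\<lambda>\<omega>. \<lambda>j\<in>J. g j \<omega>) = (\<Pi>\<^sub>M j\<in>J. distr M borel (g j))"
    using R by (auto intro!: PiM_cong simp: d)
  then have "indep_vars (\<lambda>_. borel) g J"
    using rv by (subst indep_vars_iff_distr_eq_PiM') (auto simp: assms)
  moreover have "distributed M lborel (g j) std_normal_density" if "j \<in> J" for j
    unfolding distributed_def using d[OF that] rv[OF that] distr_cong[of M M lborel borel "g j" "g j"] by simp
  ultimately show ?L using prob_space_axioms by (auto simp: std_gaussians_def)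
qed

lemma std_gaussians_rotate_pair:
  fixes M :: "'a measure" and J :: "'j set"
  assumes G: "std_gaussians M J g" and J: "finite J" and ij: "i \<in> J" "j \<in> J" "i \<noteq> j"
  shows "std_gaussians M J (g(i := \<lambda>\<omega>. (g i \<omega> - g j \<omega>) / sqrt 2, j := \<lambda>\<omega>. (g i \<omega> + g j \<omega>) / sqrt 2))"
    (is "std_gaussians M J ?g'")
proof -
  have ne: "J \<noteq> {}" using ij by auto
  define R where "R w = w(i := (w i - w j) / sqrt 2, j := (w i + w j) / sqrt 2)" for w :: "'j \<Rightarrow> real"
  have g: "prob_space M" "\<And>l. l \<in> J \<Longrightarrow> g l \<in> borel_measurable M"
    "distr M (\<Pi>\<^sub>M j\<in>J. borel) (\<lambda>\<omega>. \<lambda>j\<in>J. g j \<omega>) = (\<Pi>\<^sub>M j\<in>J. std_normal)"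
    using G unfolding std_gaussians_iff_distr[OF ne] by auto
  let ?P = "\<Pi>\<^sub>M j\<in>J. std_normal"
  have setsP: "sets ?P = sets (\<Pi>\<^sub>M j\<in>J. borel)" by (rule sets_PiM_cong) auto
  have comp: "(\<lambda>w. w l) \<in> borel_measurable (\<Pi>\<^sub>M j\<in>J. borel :: real measure)" if "l \<in> J" for l
    using that by (rule measurable_component_singleton)
  have mR: "R \<in> measurable (\<Pi>\<^sub>M j\<in>J. borel) (\<Pi>\<^sub>M j\<in>J. borel)"
  proof (rule measurable_PiM_single')
    show "(\<lambda>w. R w l) \<in> borel_measurable (\<Pi>\<^sub>M j\<in>J. borel)" if "l \<in> J" for l
      using comp[OF that] comp[OF ij(1)] comp[OF ij(2)] by (cases "l = i"; cases "l = j") (auto simp: R_def)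
    show "R \<in> space (\<Pi>\<^sub>M j\<in>J. borel) \<rightarrow> (\<Pi>\<^sub>E j\<in>J. space borel)"
      using ij by (auto simp: R_def space_PiM PiE_def extensional_def)
  qed
  have mR': "R \<in> measurable ?P ?P" using mR setsP by (simp cong: measurable_cong_sets)
  interpret product_sigma_finite "\<lambda>_::'j. std_normal"
    by (rule product_sigma_finite.intro) (rule prob_space_imp_sigma_finite[OF prob_space_std_normal])
  have inv: "(\<integral>\<^sup>+w. F (R w) \<partial>?P) = (\<integral>\<^sup>+w. F w \<partial>?P)" if F: "F \<in> borel_measurable ?P" for F
  proof -
    define J' where "J' = J - {i, j}"
    have J': "finite J'" "j \<notin> J'" "i \<notin> insert j J'" "J = insert i (insert j J')"
      using J ij by (auto simp: J'_def)
    have FR: "(\<lambda>w. F (R w)) \<in> borel_measurable ?P" by (rule measurable_compose[OF mR' F])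
    have ins: "(\<integral>\<^sup>+w. K w \<partial>?P) = (\<integral>\<^sup>+w. (\<integral>\<^sup>+y. (\<integral>\<^sup>+x. K (w(j := y, i := x)) \<partial>std_normal) \<partial>std_normal) \<partial>(\<Pi>\<^sub>M j\<in>J'. std_normal))"
      if K: "K \<in> borel_measurable ?P" for K
    proof -
      have "(\<integral>\<^sup>+w. K w \<partial>?P) = (\<integral>\<^sup>+w. (\<integral>\<^sup>+x. K (w(i := x)) \<partial>std_normal) \<partial>(\<Pi>\<^sub>M j\<in>insert j J'. std_normal))"
        using K J' by (simp only: J'(4)) (rule product_nn_integral_insert, auto)
      also have "\<dots> = (\<integral>\<^sup>+w. (\<integral>\<^sup>+y. (\<integral>\<^sup>+x. K (w(j := y, i := x)) \<partial>std_normal) \<partial>std_normal) \<partial>(\<Pi>\<^sub>M j\<in>J'. std_normal))"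
      proof (rule product_nn_integral_insert)
        have "(\<lambda>(w, x). K (w(i := x))) \<in> borel_measurable ((\<Pi>\<^sub>M j\<in>insert j J'. std_normal) \<Otimes>\<^sub>M std_normal)"
          using measurable_compose[OF measurable_add_dim[of i "insert j J'" "\<lambda>_. std_normal"]] K J'(4)
          by (simp add: case_prod_unfold)
        then show "(\<lambda>w. \<integral>\<^sup>+x. K (w(i := x)) \<partial>std_normal) \<in> borel_measurable (\<Pi>\<^sub>M j\<in>insert j J'. std_normal)"
          by (rule sigma_finite_measure.borel_measurable_nn_integral[rotated])
            (rule prob_space_imp_sigma_finite[OF prob_space_std_normal])
      qed (use J' in auto)
      finally show ?thesis .
    qed
    show ?thesis
      unfolding ins[OF FR] ins[OF F]
    proof (rule nn_integral_cong)
      fix w assume w: "w \<in> space (\<Pi>\<^sub>M j\<in>J'. std_normal)"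
      define H where "H x y = F (w(j := y, i := x))" for x y
      have "case_prod H \<in> borel_measurable (borel \<Otimes>\<^sub>M borel)"
      proof -
        have "(\<lambda>z. w(j := snd z, i := fst z)) \<in> measurable (borel \<Otimes>\<^sub>M borel) (\<Pi>\<^sub>M j\<in>J. borel)"
        proof (rule measurable_PiM_single')
          show "(\<lambda>z. (w(j := snd z, i := fst z)) l) \<in> borel_measurable (borel \<Otimes>\<^sub>M borel)" for l
            by (cases "l = i"; cases "l = j") auto
          show "(\<lambda>z. w(j := snd z, i := fst z)) \<in> space (borel \<Otimes>\<^sub>M borel) \<rightarrow> (\<Pi>\<^sub>E j\<in>J. space borel)"
            using w J'(4) by (auto simp: space_PiM PiE_def extensional_def)
        qed
        then have "(\<lambda>z. w(j := snd z, i := fst z)) \<in> measurable (borel \<Otimes>\<^sub>M borel) ?P"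
          using setsP by (simp cong: measurable_cong_sets)
        from measurable_compose[OF this F] show ?thesis by (simp add: H_def case_prod_unfold)
      qed
      from nn_integral_std_normal_rotate[OF this]
      show "(\<integral>\<^sup>+y. (\<integral>\<^sup>+x. F (R (w(j := y, i := x))) \<partial>std_normal) \<partial>std_normal) =
          (\<integral>\<^sup>+y. (\<integral>\<^sup>+x. F (w(j := y, i := x)) \<partial>std_normal) \<partial>std_normal)"
      proof -
        have "R (w(j := y, i := x)) = w(j := (x + y) / sqrt 2, i := (x - y) / sqrt 2)" for x y
          using ij by (auto simp: R_def fun_eq_iff)
        then show ?thesis
          using nn_integral_std_normal_rotate[OF \<open>case_prod H \<in> _\<close>] by (simp add: H_def)
      qed
    qed
  qed
  have distR: "distr ?P ?P R = ?P"
  proof (rule measure_eqI)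
    fix A assume "A \<in> sets (distr ?P ?P R)"
    then have A: "A \<in> sets ?P" by simp
    have "emeasure (distr ?P ?P R) A = (\<integral>\<^sup>+w. indicator A w \<partial>distr ?P ?P R)" using A by simp
    also have "\<dots> = (\<integral>\<^sup>+w. indicator A (R w) \<partial>?P)" by (rule nn_integral_distr[OF mR']) (use A in simp)
    also have "\<dots> = (\<integral>\<^sup>+w. indicator A w \<partial>?P)" by (rule inv) (use A in simp)
    finally show "emeasure (distr ?P ?P R) A = emeasure ?P A" using A by simp
  qed simp
  have mg: "(\<lambda>\<omega>. \<lambda>l\<in>J. g l \<omega>) \<in> measurable M (\<Pi>\<^sub>M j\<in>J. borel)"
    using g(2) by (intro measurable_restrict) auto
  have "(\<lambda>\<omega>. \<lambda>l\<in>J. ?g' l \<omega>) = (\<lambda>\<omega>. R (\<lambda>l\<in>J. g l \<omega>))"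
    using ij by (auto simp: R_def fun_eq_iff)
  then have "distr M (\<Pi>\<^sub>M j\<in>J. borel) (\<lambda>\<omega>. \<lambda>l\<in>J. ?g' l \<omega>) =
      distr (distr M (\<Pi>\<^sub>M j\<in>J. borel) (\<lambda>\<omega>. \<lambda>l\<in>J. g l \<omega>)) (\<Pi>\<^sub>M j\<in>J. borel) R"
    by (simp add: distr_distr[OF mR mg] comp_def)
  also have "\<dots> = distr ?P ?P R" unfolding g(3) by (rule distr_cong) (use setsP in auto)
  also have "\<dots> = ?P" by (rule distR)
  finally have "distr M (\<Pi>\<^sub>M j\<in>J. borel) (\<lambda>\<omega>. \<lambda>l\<in>J. ?g' l \<omega>) = ?P" .
  moreover have "?g' l \<in> borel_measurable M" if "l \<in> J" for l
    using g(2)[OF that] g(2)[OF ij(1)] g(2)[OF ij(2)] by auto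
  ultimately show ?thesis unfolding std_gaussians_iff_distr[OF ne] using g(1) by blast
qed

text \<open>
  Rotates disjoint pairs one after the other.
\<close>

lemma std_gaussians_rotate:
  assumes G: "std_gaussians M J g" and J: "finite J" and P: "finite P"
    and ab: "inj_on a P" "inj_on b P" "a ` P \<subseteq> J" "b ` P \<subseteq> J" "a ` P \<inter> b ` P = {}"
  shows "\<exists>g'. std_gaussians M J g' \<and> (\<forall>p\<in>P. \<forall>\<omega>. g' (a p) \<omega> = (g (a p) \<omega> - g (b p) \<omega>) / sqrt 2 \<and>
      g' (b p) \<omega> = (g (a p) \<omega> + g (b p) \<omega>) / sqrt 2)"
proof -
  have "\<exists>g'. std_gaussians M J g' \<and> (\<forall>p\<in>S. \<forall>\<omega>. g' (a p) \<omega> = (g (a p) \<omega> - g (b p) \<omega>) / sqrt 2 \<and>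
      g' (b p) \<omega> = (g (a p) \<omega> + g (b p) \<omega>) / sqrt 2) \<and> (\<forall>j. j \<notin> a ` S \<union> b ` S \<longrightarrow> g' j = g j)"
    if "S \<subseteq> P" for S
    using finite_subset[OF that P] that
  proof (induction S)
    case empty
    then show ?case using G by auto
  next
    case (insert p S)
    then obtain g' where g': "std_gaussians M J g'"
      "\<And>p \<omega>. p \<in> S \<Longrightarrow> g' (a p) \<omega> = (g (a p) \<omega> - g (b p) \<omega>) / sqrt 2"
      "\<And>p \<omega>. p \<in> S \<Longrightarrow> g' (b p) \<omega> = (g (a p) \<omega> + g (b p) \<omega>) / sqrt 2"
      "\<And>j. j \<notin> a ` S \<union> b ` S \<Longrightarrow> g' j = g j" by auto
    have pP: "p \<in> P" "S \<subseteq> P" using insert.prems by auto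
    have sep: "a p \<noteq> b q" "b p \<noteq> a q" if "q \<in> P" for q
      using ab(5) pP that by (metis IntI empty_iff imageI)+
    have seq: "a q \<noteq> a p" "b q \<noteq> b p" if "q \<in> S" for q
      using that insert.hyps(2) pP ab(1,2) by (auto simp: inj_on_def)
    have nin: "a p \<notin> a ` S \<union> b ` S" "b p \<notin> a ` S \<union> b ` S"
      using sep seq pP(2) by (fastforce dest: subsetD)+
    then have gp: "g' (a p) = g (a p)" "g' (b p) = g (b p)" using g'(4) by auto
    let ?h = "g'(a p := \<lambda>\<omega>. (g' (a p) \<omega> - g' (b p) \<omega>) / sqrt 2, b p := \<lambda>\<omega>. (g' (a p) \<omega> + g' (b p) \<omega>) / sqrt 2)"
    have "std_gaussians M J ?h"
      by (rule std_gaussians_rotate_pair[OF g'(1) J]) (use pP ab sep in auto)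
    moreover have "?h (a q) \<omega> = (g (a q) \<omega> - g (b q) \<omega>) / sqrt 2 \<and>
      ?h (b q) \<omega> = (g (a q) \<omega> + g (b q) \<omega>) / sqrt 2" if "q \<in> insert p S" for q \<omega>
    proof (cases "q = p")
      case True
      then show ?thesis using sep[OF pP(1)] by (simp add: gp)
    next
      case False
      then have q: "q \<in> S" "q \<in> P" using that pP by auto
      then show ?thesis using seq[OF q(1)] sep[OF q(2)] g'(2,3)[OF q(1)] by auto
    qed
    moreover have "?h j = g j" if "j \<notin> a ` insert p S \<union> b ` insert p S" for j using that g'(4)[of j] by auto
    ultimately show ?case by (intro exI[of _ ?h] conjI) (simp_all only:, blast+)
  qed
  from this[of P] show ?thesis by auto
qed

section \<open>Random measurement ensembles\<close>

text \<open>
  What the union bound needs of a random linear map: exponential tails of the averages in every fixed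
  direction. The lower tail is always that of the \<open>\<ell>\<^sub>1\<close> average, which is the smaller one.
\<close>

definition ensemble :: "'a measure \<Rightarrow> nat \<Rightarrow> 'e set \<Rightarrow> (nat \<Rightarrow> 'e \<Rightarrow> 'a \<Rightarrow> real) \<Rightarrow>
    (nat \<Rightarrow> (nat \<Rightarrow> real) \<Rightarrow> real) \<Rightarrow> bool" where
  "ensemble M m E Z g \<longleftrightarrow> prob_space M \<and> (\<forall>i<m. \<forall>e\<in>E. Z i e \<in> borel_measurable M) \<and>
    (\<forall>h. L2_set h E = 1 \<longrightarrow>
      measure M {\<omega>\<in>space M. avg1 m (\<lambda>i. dotp E h (\<lambda>e. Z i e \<omega>)) \<le> \<alpha>\<^sub>0} \<le> exp (- c\<^sub>0 * real m) \<and>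
      measure M {\<omega>\<in>space M. 6 \<le> g m (\<lambda>i. dotp E h (\<lambda>e. Z i e \<omega>))} \<le> exp (- c\<^sub>0 * real m))"

text \<open>
  Functions of disjoint groups of the Gaussian variables are independent.
\<close>

lemma indep_blocks:
  assumes G: "std_gaussians M J g" and K: "\<And>i. i < m \<Longrightarrow> K i \<subseteq> J" "disjoint_family_on K {..<m}"
    and \<Psi>: "\<And>i. i < m \<Longrightarrow> \<Psi> i \<in> borel_measurable (\<Pi>\<^sub>M j\<in>K i. borel)"
  shows "prob_space.indep_vars M (\<lambda>_. borel) (\<lambda>i \<omega>. \<Psi> i (restrict (\<lambda>j. g j \<omega>) (K i)) :: real) {..<m}"
proof -
  interpret prob_space M using G by (simp add: std_gaussians_def)
  have "indep_vars (\<lambda>i. \<Pi>\<^sub>M j\<in>K i. borel) (\<lambda>i \<omega>. restrict (\<lambda>j. g j \<omega>) (K i)) {..<m}"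
    by (rule indep_vars_restrict[of _ _ J]) (use G K in \<open>auto simp: std_gaussians_def\<close>)
  then show ?thesis by (rule indep_vars_compose2) (use \<Psi> in auto)
qed

lemma gaussian_ensemble:
  assumes G: "std_gaussians M J g" and m: "1 \<le> m" and E: "finite E"
    and \<iota>: "\<And>i. i < m \<Longrightarrow> inj_on (\<iota> i) E" "\<And>i. i < m \<Longrightarrow> \<iota> i ` E \<subseteq> J"
      "disjoint_family_on (\<lambda>i. \<iota> i ` E) {..<m}"
    and f: "f = avg1 \<or> f = avg2"
  shows "ensemble M m E (\<lambda>i e. g (\<iota> i e)) f"
proof -
  interpret prob_space M using G by (simp add: std_gaussians_def)
  have rv: "g (\<iota> i e) \<in> borel_measurable M" if "i < m" "e \<in> E" for i e
    using \<iota>(2)[OF that(1)] that(2) by (intro std_gaussians_measurable[OF G]) auto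
  have tails: "prob {\<omega>\<in>space M. avg1 m (\<lambda>i. dotp E h (\<lambda>e. g (\<iota> i e) \<omega>)) \<le> \<alpha>\<^sub>0} \<le> exp (- c\<^sub>0 * real m) \<and>
      prob {\<omega>\<in>space M. 6 \<le> f m (\<lambda>i. dotp E h (\<lambda>e. g (\<iota> i e) \<omega>))} \<le> exp (- c\<^sub>0 * real m)"
    if h: "L2_set h E = 1" for h
  proof -
    define Y where "Y i \<omega> = dotp E h (\<lambda>e. g (\<iota> i e) \<omega>)" for i \<omega>
    have ind: "indep_vars (\<lambda>_. borel) Y {..<m}"
    proof -
      have "indep_vars (\<lambda>_. borel) (\<lambda>i \<omega>. dotp E h (\<lambda>e. (\<lambda>j\<in>\<iota> i ` E. g j \<omega>) (\<iota> i e))) {..<m}"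
      proof (rule indep_blocks[OF G, where \<Psi> = "\<lambda>i w. dotp E h (\<lambda>e. w (\<iota> i e))"])
        show "(\<lambda>w. dotp E h (\<lambda>e. w (\<iota> i e))) \<in> borel_measurable (\<Pi>\<^sub>M j\<in>\<iota> i ` E. borel)" if "i < m" for i
          unfolding dotp_def
          by (intro borel_measurable_sum borel_measurable_times borel_measurable_const
              measurable_component_singleton) auto
      qed (use \<iota> in auto)
      moreover have "dotp E h (\<lambda>e. (\<lambda>j\<in>\<iota> i ` E. g j \<omega>) (\<iota> i e)) = Y i \<omega>" for i \<omega>
        unfolding Y_def dotp_def by (rule sum.cong) auto
      ultimately show ?thesis by simp
    qed
    have rvY: "Y i \<in> borel_measurable M" if "i < m" for i
      using ind that by (simp add: indep_vars_def)
    have two: "(\<integral>\<^sup>+\<omega>. ennreal ((Y i \<omega>)\<^sup>2) \<partial>M) = 1" if "i < m" for i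
      unfolding Y_def dotp_def using nn_integral_linear_form_square[OF G \<iota>(1,2)[OF that] E, of h] h by simp
    have sq: "(\<integral>\<^sup>+\<omega>. ennreal (exp ((Y i \<omega>)\<^sup>2 / 4)) \<partial>M) \<le> ennreal (sqrt 2)" if "i < m" for i
      unfolding Y_def dotp_def using nn_integral_linear_form_exp_square[OF G \<iota>(1,2)[OF that] E, of h] h by simp
    have s2: "sqrt 2 \<le> (2::real)" by (rule real_le_lsqrt) auto
    have sq4: "(\<integral>\<^sup>+\<omega>. ennreal (exp ((Y i \<omega>)\<^sup>2 / 4)) \<partial>M) \<le> 4" if "i < m" for i
    proof -
      have "ennreal (sqrt 2) \<le> ennreal 4" using s2 by (intro ennreal_leI) simp
      then show ?thesis using order_trans[OF sq[OF that]] by simp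
    qed
    have ex: "(\<integral>\<^sup>+\<omega>. ennreal (exp (\<bar>Y i \<omega>\<bar> / 2)) \<partial>M) \<le> 4" if "i < m" for i
    proof -
      have e2: "exp (1/4) \<le> (2::real)"
      proof -
        have "exp (1/4) \<le> (1 + 1/4 + (1/4)\<^sup>2 :: real)" by (rule exp_bound) auto
        then show ?thesis by (simp add: power2_eq_square)
      qed
      have "(\<integral>\<^sup>+\<omega>. ennreal (exp (\<bar>Y i \<omega>\<bar> / 2)) \<partial>M) \<le> (\<integral>\<^sup>+\<omega>. ennreal 2 * ennreal (exp ((Y i \<omega>)\<^sup>2 / 4)) \<partial>M)"
      proof (rule nn_integral_mono)
        fix \<omega>
        have "2 * \<bar>Y i \<omega>\<bar> \<le> (Y i \<omega>)\<^sup>2 + 1" using sum_squares_bound[of "\<bar>Y i \<omega>\<bar>" 1] by simp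
        then have "exp (\<bar>Y i \<omega>\<bar> / 2) \<le> exp ((Y i \<omega>)\<^sup>2 / 4 + 1/4)" by simp
        also have "\<dots> = exp (1/4) * exp ((Y i \<omega>)\<^sup>2 / 4)" by (subst exp_add) simp
        also have "\<dots> \<le> 2 * exp ((Y i \<omega>)\<^sup>2 / 4)" by (rule mult_right_mono[OF e2]) simp
        finally show "ennreal (exp (\<bar>Y i \<omega>\<bar> / 2)) \<le> ennreal 2 * ennreal (exp ((Y i \<omega>)\<^sup>2 / 4))"
          by (subst ennreal_mult[symmetric]) (auto intro: ennreal_leI)
      qed
      also have "\<dots> = ennreal 2 * (\<integral>\<^sup>+\<omega>. ennreal (exp ((Y i \<omega>)\<^sup>2 / 4)) \<partial>M)"
        by (rule nn_integral_cmult) (use rvY[OF that] in measurable)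
      also have "\<dots> \<le> ennreal 2 * ennreal (sqrt 2)" by (intro mult_left_mono sq that) auto
      also have "\<dots> = ennreal (2 * sqrt 2)" by (rule ennreal_mult[symmetric]) auto
      also have "\<dots> \<le> ennreal 4" using s2 by (intro ennreal_leI) simp
      finally show ?thesis by simp
    qed
    show ?thesis
      using avg1_lower_tail[OF ind m two ex] avg1_upper_tail[OF ind m ex] avg2_upper_tail[OF ind m sq4] f
      unfolding Y_def by auto
  qed
  show ?thesis unfolding ensemble_def using prob_space_axioms rv tails by blast
qed

lemma bilinear_ensemble:
  fixes n N :: nat
  assumes G: "std_gaussians M J g" and m: "1 \<le> m"
    and \<iota>: "\<And>i. i < m \<Longrightarrow> inj_on (\<iota> i) {..<n}" "\<And>i. i < m \<Longrightarrow> \<iota> i ` {..<n} \<subseteq> J"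
    and \<kappa>: "\<And>i. i < m \<Longrightarrow> inj_on (\<kappa> i) {..<N}" "\<And>i. i < m \<Longrightarrow> \<kappa> i ` {..<N} \<subseteq> J"
    and disj: "\<And>i. i < m \<Longrightarrow> \<iota> i ` {..<n} \<inter> \<kappa> i ` {..<N} = {}"
      "disjoint_family_on (\<lambda>i. \<iota> i ` {..<n} \<union> \<kappa> i ` {..<N}) {..<m}"
  shows "ensemble M m ({..<n} \<times> {..<N}) (\<lambda>i (p, q) \<omega>. g (\<iota> i p) \<omega> * g (\<kappa> i q) \<omega>) avg1"
proof -
  interpret prob_space M using G by (simp add: std_gaussians_def)
  let ?E = "{..<n} \<times> {..<N}"
  let ?Z = "\<lambda>i (p, q) \<omega>. g (\<iota> i p) \<omega> * g (\<kappa> i q) \<omega>"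
  let ?K = "\<lambda>i. \<iota> i ` {..<n} \<union> \<kappa> i ` {..<N}"
  have rv: "?Z i e \<in> borel_measurable M" if "i < m" "e \<in> ?E" for i e
    using \<iota>(2)[OF that(1)] \<kappa>(2)[OF that(1)] that(2)
    by (auto intro!: borel_measurable_times std_gaussians_measurable[OF G])
  have tails: "prob {\<omega>\<in>space M. avg1 m (\<lambda>i. dotp ?E h (\<lambda>e. ?Z i e \<omega>)) \<le> \<alpha>\<^sub>0} \<le> exp (- c\<^sub>0 * real m) \<and>
      prob {\<omega>\<in>space M. 6 \<le> avg1 m (\<lambda>i. dotp ?E h (\<lambda>e. ?Z i e \<omega>))} \<le> exp (- c\<^sub>0 * real m)"
    if h: "L2_set h ?E = 1" for h
  proof -
    define Y where "Y i \<omega> = dotp ?E h (\<lambda>e. ?Z i e \<omega>)" for i \<omega>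
    have Y2: "Y i \<omega> = (\<Sum>p<n. \<Sum>q<N. h (p, q) * g (\<iota> i p) \<omega> * g (\<kappa> i q) \<omega>)" for i \<omega>
      by (simp add: Y_def dotp_def sum.cartesian_product case_prod_unfold mult.assoc)
    have ind: "indep_vars (\<lambda>_. borel) Y {..<m}"
    proof -
      have "indep_vars (\<lambda>_. borel) (\<lambda>i \<omega>. \<Sum>p<n. \<Sum>q<N. h (p, q) * (\<lambda>j\<in>?K i. g j \<omega>) (\<iota> i p) * (\<lambda>j\<in>?K i. g j \<omega>) (\<kappa> i q)) {..<m}"
      proof (rule indep_blocks[OF G, where \<Psi> = "\<lambda>i w. \<Sum>p<n. \<Sum>q<N. h (p, q) * w (\<iota> i p) * w (\<kappa> i q)"])
        show "(\<lambda>w. \<Sum>p<n. \<Sum>q<N. h (p, q) * w (\<iota> i p) * w (\<kappa> i q)) \<in> borel_measurable (\<Pi>\<^sub>M j\<in>?K i. borel)"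
          if "i < m" for i
          by (intro borel_measurable_sum borel_measurable_times borel_measurable_const
              measurable_component_singleton) auto
        show "?K i \<subseteq> J" if "i < m" for i using \<iota>(2)[OF that] \<kappa>(2)[OF that] by blast
      qed (rule disj(2))
      moreover have "(\<Sum>p<n. \<Sum>q<N. h (p, q) * (\<lambda>j\<in>?K i. g j \<omega>) (\<iota> i p) * (\<lambda>j\<in>?K i. g j \<omega>) (\<kappa> i q)) = Y i \<omega>" for i \<omega>
        unfolding Y2 by (intro sum.cong refl) auto
      ultimately show ?thesis by simp
    qed
    have two: "(\<integral>\<^sup>+\<omega>. ennreal ((Y i \<omega>)\<^sup>2) \<partial>M) = 1" if "i < m" for i
      unfolding Y2 using nn_integral_bilinear_form_square[OF G \<iota>[OF that] \<kappa>[OF that] disj(1)[OF that], of h] h by simp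
    have ex: "(\<integral>\<^sup>+\<omega>. ennreal (exp (\<bar>Y i \<omega>\<bar> / 2)) \<partial>M) \<le> 4" if "i < m" for i
    proof -
      have "(\<integral>\<^sup>+\<omega>. ennreal (exp (\<bar>Y i \<omega>\<bar> / 2)) \<partial>M) \<le> 2"
        unfolding Y2 by (rule nn_integral_bilinear_form_exp[OF G \<iota>[OF that] \<kappa>[OF that] disj(1)[OF that] h])
      also have "\<dots> \<le> (4 :: ennreal)" by simp
      finally show ?thesis .
    qed
    show ?thesis
      using avg1_lower_tail[OF ind m two ex] avg1_upper_tail[OF ind m ex] unfolding Y_def by auto
  qed
  show ?thesis unfolding ensemble_def using prob_space_axioms rv tails by blast
qed

lemma avg2_eq_L2_set: "avg2 m y = L2_set y {..<m} / sqrt (real m)"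
  by (simp add: avg2_def L2_set_def real_sqrt_divide)

lemma avg_facts:
  assumes "f = avg1 \<or> f = avg2"
  shows "0 \<le> f m y" "f m (\<lambda>i. y i + z i) \<le> f m y + f m z" "f m (\<lambda>i. c * y i) = \<bar>c\<bar> * f m y"
    "avg1 m y \<le> f m y" "(\<And>i. i < m \<Longrightarrow> \<bar>y i\<bar> \<le> B i) \<Longrightarrow> f m y \<le> f m B"
    "(\<And>i. i < m \<Longrightarrow> y i = z i) \<Longrightarrow> f m y = f m z"
proof -
  have a1: "0 \<le> avg1 m y" "0 \<le> avg2 m y" by (simp_all add: avg1_def avg2_def sum_nonneg)
  then show "0 \<le> f m y" using assms by auto
  have "avg1 m (\<lambda>i. y i + z i) \<le> avg1 m y + avg1 m z"
    unfolding avg1_def add_divide_distrib[symmetric] sum.distrib[symmetric]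
    by (intro divide_right_mono sum_mono) auto
  moreover have "avg2 m (\<lambda>i. y i + z i) \<le> avg2 m y + avg2 m z"
    unfolding avg2_eq_L2_set add_divide_distrib[symmetric]
    by (intro divide_right_mono L2_set_triangle_ineq) auto
  ultimately show "f m (\<lambda>i. y i + z i) \<le> f m y + f m z" using assms by auto
  have "avg1 m (\<lambda>i. c * y i) = \<bar>c\<bar> * avg1 m y"
    by (simp add: avg1_def abs_mult flip: sum_distrib_left)
  moreover have "avg2 m (\<lambda>i. c * y i) = \<bar>c\<bar> * avg2 m y"
    by (simp add: avg2_def power_mult_distrib real_sqrt_mult real_sqrt_divide flip: sum_distrib_left)
  ultimately show "f m (\<lambda>i. c * y i) = \<bar>c\<bar> * f m y" using assms by auto
  show "avg1 m y \<le> f m y" using assms avg1_le_avg2 by auto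
  show "f m y \<le> f m B" if b: "\<And>i. i < m \<Longrightarrow> \<bar>y i\<bar> \<le> B i"
  proof -
    have "avg1 m y \<le> avg1 m B" unfolding avg1_def
      by (intro divide_right_mono sum_mono) (use b in \<open>auto intro: order_trans[OF _ abs_ge_self]\<close>)
    moreover have "avg2 m y \<le> avg2 m B"
    proof -
      have "(y i)\<^sup>2 \<le> (B i)\<^sup>2" if "i < m" for i
        using b[OF that] by (intro power2_le_iff_abs_le[THEN iffD2] order_trans[OF abs_ge_zero]) auto
      then show ?thesis unfolding avg2_def by (intro real_sqrt_le_mono divide_right_mono sum_mono) auto
    qed
    ultimately show ?thesis using assms by auto
  qed
  show "f m y = f m z" if "\<And>i. i < m \<Longrightarrow> y i = z i"
    using assms that by (auto simp: avg1_def avg2_def)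
qed

lemma seminorm_on_avg:
  assumes E: "finite E" and f: "f = avg1 \<or> f = avg2"
  shows "seminorm_on E (\<lambda>h. f m (\<lambda>i. dotp E h (z i)))"
  unfolding seminorm_on_def
proof (intro conjI allI impI)
  fix h d :: "'a \<Rightarrow> real" and c :: real
  show "0 \<le> f m (\<lambda>i. dotp E h (z i))" by (rule avg_facts(1)[OF f])
  have "dotp E (\<lambda>e. h e + d e) (z i) = dotp E h (z i) + dotp E d (z i)" for i
    by (simp add: dotp_def algebra_simps sum.distrib)
  then show "f m (\<lambda>i. dotp E (\<lambda>e. h e + d e) (z i)) \<le> f m (\<lambda>i. dotp E h (z i)) + f m (\<lambda>i. dotp E d (z i))"
    using avg_facts(2)[OF f] by simp
  have "dotp E (\<lambda>e. c * h e) (z i) = c * dotp E h (z i)" for i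
    by (simp add: dotp_def sum_distrib_left mult.assoc)
  then show "f m (\<lambda>i. dotp E (\<lambda>e. c * h e) (z i)) = \<bar>c\<bar> * f m (\<lambda>i. dotp E h (z i))"
    using avg_facts(3)[OF f] by simp
  show "f m (\<lambda>i. dotp E h (z i)) = f m (\<lambda>i. dotp E d (z i))" if "\<forall>e\<in>E. h e = d e"
    using that by (simp add: dotp_def)
next
  show "\<exists>B. \<forall>h. f m (\<lambda>i. dotp E h (z i)) \<le> B * L2_set h E"
  proof (intro exI allI)
    fix h :: "'a \<Rightarrow> real"
    have "f m (\<lambda>i. dotp E h (z i)) \<le> f m (\<lambda>i. L2_set h E * L2_set (z i) E)"
      using dotp_cauchy_schwarz[of E h] by (intro avg_facts(5)[OF f]) (simp add: dotp_def)
    also have "\<dots> = f m (\<lambda>i. L2_set (z i) E) * L2_set h E"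
      by (simp add: avg_facts(3)[OF f])
    finally show "f m (\<lambda>i. dotp E h (z i)) \<le> f m (\<lambda>i. L2_set (z i) E) * L2_set h E" .
  qed
qed

text \<open>
  A mesh that meets both conditions of \<open>rip_of_net\<close> for the constant \<open>\<alpha>\<^sub>0\<close>.
\<close>

definition \<epsilon>\<^sub>0 :: real where "\<epsilon>\<^sub>0 = \<alpha>\<^sub>0 / (8 * \<alpha>\<^sub>0 + 48)"

lemma \<epsilon>\<^sub>0: "0 < \<epsilon>\<^sub>0" "\<epsilon>\<^sub>0 \<le> 1/8" "\<epsilon>\<^sub>0 * (2 * \<alpha>\<^sub>0 + 24) \<le> \<alpha>\<^sub>0 / 2"
  using \<alpha>\<^sub>0_pos by (simp_all add: \<epsilon>\<^sub>0_def field_simps)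

text \<open>
  Extends a tail bound from unit directions to all directions by homogeneity; a direction of length 0
  is harmless because the seminorm vanishes there.
\<close>

lemma scaled_tail:
  assumes P: "prob_space M" and s: "\<And>\<omega>. seminorm_on E (s \<omega>)"
    and tail: "\<And>h. L2_set h E = 1 \<Longrightarrow> measure M {\<omega>\<in>space M. Q (s \<omega> h)} \<le> b"
    and hom: "\<And>t x. 0 < t \<Longrightarrow> R (t * x) t \<longleftrightarrow> Q x" and zero: "\<not> R 0 0" and b: "0 \<le> b"
  shows "measure M {\<omega>\<in>space M. R (s \<omega> h) (L2_set h E)} \<le> b"
proof (cases "L2_set h E = 0")
  case True
  have "s \<omega> h = 0" for \<omega>
  proof -
    obtain B where "\<forall>h. s \<omega> h \<le> B * L2_set h E" using s[of \<omega>] unfolding seminorm_on_def by blast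
    then have "s \<omega> h \<le> 0" using True by (metis mult_zero_right)
    then show ?thesis using seminorm_onD(1)[OF s, of \<omega> h] by simp
  qed
  then show ?thesis using True zero b by simp
next
  case False
  define t where "t = L2_set h E"
  have t: "0 < t" using False by (simp add: t_def order_less_le)
  have "L2_set (\<lambda>e. (1/t) * h e) E = \<bar>1/t\<bar> * L2_set h E"
    by (simp add: L2_set_def power_divide real_sqrt_divide flip: sum_divide_distrib)
  then have 1: "L2_set (\<lambda>e. (1/t) * h e) E = 1" using t by (simp flip: t_def)
  have "s \<omega> h = t * s \<omega> (\<lambda>e. (1/t) * h e)" for \<omega>
    using seminorm_onD(3)[OF s, of \<omega> "1/t" h] t by simp
  then have "{\<omega>\<in>space M. R (s \<omega> h) (L2_set h E)} = {\<omega>\<in>space M. Q (s \<omega> (\<lambda>e. (1/t) * h e))}"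
    using hom[OF t] by (auto simp flip: t_def)
  then show ?thesis using tail[OF 1] by simp
qed

text \<open>
  A union bound over the net followed by the deterministic extension to the cone.
\<close>

theorem rip_with_high_probability:
  fixes E :: "'e set" and M :: "'a measure"
  assumes ens: "ensemble M m E Z g" and m: "1 \<le> m" and g: "g = avg1 \<or> g = avg2" and E: "finite E"
    and net: "has_net E D \<epsilon>\<^sub>0 C" and cone: "\<And>h c. D h \<Longrightarrow> D (\<lambda>e. c * h e)" and D0: "D (\<lambda>_. 0)"
  shows "\<exists>A\<in>sets M. 1 - 2 * exp (C - c\<^sub>0 * real m) \<le> measure M A \<and>
    (\<forall>\<omega>\<in>A. \<forall>h. D h \<longrightarrow> g m (\<lambda>i. dotp E h (\<lambda>e. Z i e \<omega>)) \<le> 12 * L2_set h E \<and>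
        \<alpha>\<^sub>0 / 2 * L2_set h E \<le> avg1 m (\<lambda>i. dotp E h (\<lambda>e. Z i e \<omega>)))"
proof -
  interpret prob_space M using ens by (simp add: ensemble_def)
  obtain T where T: "finite T" "real (card T) \<le> exp C"
    and Tn: "\<And>h. D h \<Longrightarrow> L2_set h E \<le> 1 \<Longrightarrow> \<exists>h'\<in>T. \<exists>d\<^sub>1 d\<^sub>2. D d\<^sub>1 \<and> D d\<^sub>2 \<and> L2_set d\<^sub>1 E \<le> \<epsilon>\<^sub>0 \<and>
        L2_set d\<^sub>2 E \<le> \<epsilon>\<^sub>0 \<and> (\<forall>e\<in>E. h e = h' e + d\<^sub>1 e + d\<^sub>2 e)"
    using net unfolding has_net_def by blast
  define f where "f \<omega> h = avg1 m (\<lambda>i. dotp E h (\<lambda>e. Z i e \<omega>))" for \<omega> h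
  define u where "u \<omega> h = g m (\<lambda>i. dotp E h (\<lambda>e. Z i e \<omega>))" for \<omega> h
  have sf: "seminorm_on E (f \<omega>)" for \<omega> unfolding f_def by (rule seminorm_on_avg[OF E]) simp
  have su: "seminorm_on E (u \<omega>)" for \<omega> unfolding u_def by (rule seminorm_on_avg[OF E g])
  have mlin: "(\<lambda>\<omega>. dotp E h (\<lambda>e. Z i e \<omega>)) \<in> borel_measurable M" if "i < m" for h i
    unfolding dotp_def using ens that
    by (intro borel_measurable_sum borel_measurable_times borel_measurable_const) (auto simp: ensemble_def)
  have mf: "(\<lambda>\<omega>. f \<omega> h) \<in> borel_measurable M" for h
    unfolding f_def avg1_def using mlin by (intro borel_measurable_divide borel_measurable_sum borel_measurable_abs) auto
  have mu: "(\<lambda>\<omega>. u \<omega> h) \<in> borel_measurable M" for h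
  proof -
    have "(\<lambda>\<omega>. avg2 m (\<lambda>i. dotp E h (\<lambda>e. Z i e \<omega>))) \<in> borel_measurable M"
      unfolding avg2_def using mlin
      by (intro measurable_compose[OF _ borel_measurable_sqrt] borel_measurable_divide borel_measurable_sum
          borel_measurable_power) auto
    then show ?thesis using mf[of h] g unfolding u_def f_def by auto
  qed
  have low: "prob {\<omega>\<in>space M. f \<omega> h < \<alpha>\<^sub>0 * L2_set h E} \<le> exp (- c\<^sub>0 * real m)" for h
  proof (rule scaled_tail[OF prob_space_axioms sf, where R = "\<lambda>x t. x < \<alpha>\<^sub>0 * t" and Q = "\<lambda>x. x < \<alpha>\<^sub>0"])
    fix h :: "'e \<Rightarrow> real" assume "L2_set h E = 1"
    have "prob {\<omega>\<in>space M. f \<omega> h < \<alpha>\<^sub>0} \<le> prob {\<omega>\<in>space M. f \<omega> h \<le> \<alpha>\<^sub>0}"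
      using mf[of h] by (intro finite_measure_mono) auto
    also have "\<dots> \<le> exp (- c\<^sub>0 * real m)"
      using ens \<open>L2_set h E = 1\<close> unfolding ensemble_def f_def by blast
    finally show "prob {\<omega>\<in>space M. f \<omega> h < \<alpha>\<^sub>0} \<le> exp (- c\<^sub>0 * real m)" .
  qed (auto simp: mult.commute)
  have up: "prob {\<omega>\<in>space M. 6 * L2_set h E < u \<omega> h} \<le> exp (- c\<^sub>0 * real m)" for h
  proof (rule scaled_tail[OF prob_space_axioms su, where R = "\<lambda>x t. 6 * t < x" and Q = "\<lambda>x. 6 < x"])
    fix h :: "'e \<Rightarrow> real" assume "L2_set h E = 1"
    have "prob {\<omega>\<in>space M. 6 < u \<omega> h} \<le> prob {\<omega>\<in>space M. 6 \<le> u \<omega> h}"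
      using mu[of h] by (intro finite_measure_mono) auto
    also have "\<dots> \<le> exp (- c\<^sub>0 * real m)"
      using ens \<open>L2_set h E = 1\<close> unfolding ensemble_def u_def by blast
    finally show "prob {\<omega>\<in>space M. 6 < u \<omega> h} \<le> exp (- c\<^sub>0 * real m)" .
  qed (auto simp: mult.commute)
  define bad where "bad h = {\<omega>\<in>space M. f \<omega> h < \<alpha>\<^sub>0 * L2_set h E} \<union> {\<omega>\<in>space M. 6 * L2_set h E < u \<omega> h}" for h
  have mbad: "bad h \<in> events" for h unfolding bad_def using mf[of h] mu[of h] by auto
  have pbad: "prob (bad h) \<le> 2 * exp (- c\<^sub>0 * real m)" for h
  proof -
    have "prob (bad h) \<le> prob {\<omega>\<in>space M. f \<omega> h < \<alpha>\<^sub>0 * L2_set h E} + prob {\<omega>\<in>space M. 6 * L2_set h E < u \<omega> h}"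
      unfolding bad_def using mf[of h] mu[of h] by (intro measure_Un_le) auto
    then show ?thesis using low[of h] up[of h] by linarith
  qed
  define A where "A = space M - (\<Union>h\<in>T. bad h)"
  have UT: "(\<Union>h\<in>T. bad h) \<in> events" using T(1) mbad by auto
  have "prob (\<Union>h\<in>T. bad h) \<le> (\<Sum>h\<in>T. prob (bad h))"
    using T(1) mbad by (intro finite_measure_subadditive_finite) auto
  also have "\<dots> \<le> (\<Sum>h\<in>T. 2 * exp (- c\<^sub>0 * real m))" by (intro sum_mono pbad)
  also have "\<dots> = real (card T) * (2 * exp (- c\<^sub>0 * real m))" by simp
  also have "\<dots> \<le> exp C * (2 * exp (- c\<^sub>0 * real m))" using T(2) by (intro mult_right_mono) auto
  also have "\<dots> = 2 * exp (C - c\<^sub>0 * real m)" by (simp add: exp_diff exp_minus field_simps)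
  finally have "1 - 2 * exp (C - c\<^sub>0 * real m) \<le> prob A"
    unfolding A_def using prob_compl[OF UT] by simp
  moreover have "A \<in> events" unfolding A_def using UT by auto
  moreover have "g m (\<lambda>i. dotp E h (\<lambda>e. Z i e \<omega>)) \<le> 12 * L2_set h E \<and>
        \<alpha>\<^sub>0 / 2 * L2_set h E \<le> avg1 m (\<lambda>i. dotp E h (\<lambda>e. Z i e \<omega>))" if \<omega>: "\<omega> \<in> A" and h: "D h" for \<omega> h
  proof -
    have T1: "\<alpha>\<^sub>0 * L2_set h E \<le> f \<omega> h" "u \<omega> h \<le> 6 * L2_set h E" if "h \<in> T" for h
    proof -
      have "\<omega> \<in> space M" "\<omega> \<notin> bad h" using \<omega> that by (auto simp: A_def)
      then show "\<alpha>\<^sub>0 * L2_set h E \<le> f \<omega> h" "u \<omega> h \<le> 6 * L2_set h E" by (auto simp: bad_def)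
    qed
    have fu: "f \<omega> h \<le> u \<omega> h" for h unfolding f_def u_def by (rule avg_facts(4)[OF g])
    have "u \<omega> h \<le> 12 * L2_set h E"
      by (rule rip_of_net(1)[of E "f \<omega>" "u \<omega>" D \<epsilon>\<^sub>0 \<alpha>\<^sub>0 T])
        ((rule sf su fu cone D0 \<epsilon>\<^sub>0 \<alpha>\<^sub>0_pos Tn T1 h | assumption)+)
    moreover have "\<alpha>\<^sub>0 / 2 * L2_set h E \<le> f \<omega> h"
      by (rule rip_of_net(2)[of E "f \<omega>" "u \<omega>" D \<epsilon>\<^sub>0 \<alpha>\<^sub>0 T])
        ((rule sf su fu cone D0 \<epsilon>\<^sub>0 \<alpha>\<^sub>0_pos Tn T1 h | assumption)+)
    ultimately show ?thesis unfolding f_def u_def by simp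
  qed
  ultimately show ?thesis by blast
qed

section \<open>From sparse to compressible directions\<close>

lemma top_subset:
  fixes x :: "'j \<Rightarrow> real"
  assumes "finite R" "K \<le> card R"
  shows "\<exists>B t. B \<subseteq> R \<and> card B = K \<and> (\<forall>j\<in>B. t \<le> x j) \<and> (\<forall>j\<in>R - B. x j \<le> t)"
  using assms(2)
proof (induction K)
  case 0
  have "\<forall>j\<in>R. x j \<le> (\<Sum>j\<in>R. \<bar>x j\<bar>)"
    using member_le_sum[of _ R "\<lambda>j. \<bar>x j\<bar>"] assms(1) by (auto intro: order_trans[OF abs_ge_self])
  then show ?case by (intro exI[of _ "{}"] exI[of _ "\<Sum>j\<in>R. \<bar>x j\<bar>"]) auto
next
  case (Suc K)
  then obtain B t where B: "B \<subseteq> R" "card B = K" "\<forall>j\<in>B. t \<le> x j" "\<forall>j\<in>R - B. x j \<le> t" by auto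
  have finB: "finite B" using B(1) assms(1) finite_subset by blast
  have ne: "R - B \<noteq> {}" using Suc.prems B(1,2) finB by (metis Diff_eq_empty_iff card_mono not_less_eq_eq)
  define mx where "mx = Max (x ` (R - B))"
  have fin: "finite (x ` (R - B))" using assms(1) by auto
  have "mx \<in> x ` (R - B)" unfolding mx_def by (rule Max_in[OF fin]) (use ne in auto)
  then obtain j where j: "j \<in> R - B" "mx = x j" by auto
  have "\<forall>i\<in>R - B. x i \<le> x j" using Max_ge[OF fin] j(2) by (auto simp: mx_def)
  moreover have "\<forall>i\<in>B. x j \<le> x i" using B(3,4) j(1) by (meson order_trans)
  ultimately show ?case
    using B j finB by (intro exI[of _ "insert j B"] exI[of _ "x j"]) auto
qed

text \<open>
  Once the \<open>K\<close> largest entries are removed, the remaining ones are bounded by the mean of the removed ones, so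
  each block of \<open>K\<close> entries is paid for by the sum of the block before it. The first block has none before it and is paid for by
  the given bound \<open>t\<close>.
\<close>

lemma block_bound:
  fixes F :: "'j set \<Rightarrow> real" and c :: "'j \<Rightarrow> real"
  assumes K: "1 \<le> K" and \<beta>: "0 \<le> \<beta>" and c: "\<And>j. 0 \<le> c j"
    and sub: "\<And>I R. finite I \<Longrightarrow> finite R \<Longrightarrow> I \<inter> R = {} \<Longrightarrow> F (I \<union> R) \<le> F I + F R"
    and up: "\<And>I. finite I \<Longrightarrow> card I \<le> K \<Longrightarrow> F I \<le> \<beta> * sqrt (\<Sum>j\<in>I. (c j)\<^sup>2)"
  shows "finite R \<Longrightarrow> 0 \<le> t \<Longrightarrow> (\<And>j. j \<in> R \<Longrightarrow> c j \<le> t) \<Longrightarrow>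
    F R \<le> \<beta> * (sqrt (real K) * t + (\<Sum>j\<in>R. c j) / sqrt (real K))"
proof (induction "card R" arbitrary: R t rule: less_induct)
  case less
  have few: "F I \<le> \<beta> * (sqrt (real K) * t)" if I: "I \<subseteq> R" "card I \<le> K" for I
  proof -
    have finI: "finite I" using I(1) less.prems(1) finite_subset by blast
    have "(\<Sum>j\<in>I. (c j)\<^sup>2) \<le> (\<Sum>j\<in>I. t\<^sup>2)"
      using less.prems(3) I c by (intro sum_mono power_mono) auto
    also have "\<dots> \<le> real K * t\<^sup>2" using I(2) by (simp add: mult_right_mono)
    finally have "sqrt (\<Sum>j\<in>I. (c j)\<^sup>2) \<le> sqrt (real K * t\<^sup>2)" by (rule real_sqrt_le_mono)
    also have "\<dots> = sqrt (real K) * t" using less.prems(2) by (simp add: real_sqrt_mult)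
    finally have "\<beta> * sqrt (\<Sum>j\<in>I. (c j)\<^sup>2) \<le> \<beta> * (sqrt (real K) * t)" by (rule mult_left_mono[OF _ \<beta>])
    then show ?thesis using up[OF finI I(2)] by linarith
  qed
  show ?case
  proof (cases "card R \<le> K")
    case True
    have "\<beta> * (sqrt (real K) * t) \<le> \<beta> * (sqrt (real K) * t + (\<Sum>j\<in>R. c j) / sqrt (real K))"
      using c by (intro mult_left_mono[OF _ \<beta>]) (simp add: sum_nonneg)
    then show ?thesis using few[of R] True by simp
  next
    case False
    then obtain B t' where B: "B \<subseteq> R" "card B = K" "\<forall>j\<in>B. t' \<le> c j" "\<forall>j\<in>R - B. c j \<le> t'"
      using top_subset[OF less.prems(1), of K c] by auto
    have fin: "finite B" "finite (R - B)" using B(1) less.prems(1) finite_subset by auto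
    have ne: "R - B \<noteq> {}" using False B fin by (metis Diff_eq_empty_iff card_mono)
    then obtain j where "j \<in> R - B" by blast
    then have t'0: "0 \<le> t'" using B(4) c[of j] by (meson order_trans)
    have "card (R - B) < card R"
      using B(1,2) K less.prems(1) False fin by (simp add: card_Diff_subset)
    from less.hyps[OF this fin(2) t'0] B(4)
    have rest: "F (R - B) \<le> \<beta> * (sqrt (real K) * t' + (\<Sum>j\<in>R - B. c j) / sqrt (real K))" by blast
    have "real K * t' \<le> (\<Sum>j\<in>B. c j)" using sum_mono[of B "\<lambda>_. t'" c] B(2,3) by simp
    then have "real K * t' / sqrt (real K) \<le> (\<Sum>j\<in>B. c j) / sqrt (real K)" by (rule divide_right_mono) simp
    moreover have "real K * t' / sqrt (real K) = sqrt (real K) * t'"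
      using K by (metis mult.commute of_nat_0_le_iff real_div_sqrt times_divide_eq_right)
    ultimately have step: "sqrt (real K) * t' \<le> (\<Sum>j\<in>B. c j) / sqrt (real K)" by simp
    have split: "(\<Sum>j\<in>R. c j) = (\<Sum>j\<in>B. c j) + (\<Sum>j\<in>R - B. c j)"
      using sum.subset_diff[OF B(1) less.prems(1), of c] by simp
    have "F R \<le> F B + F (R - B)" using sub[OF fin] B(1) by (simp add: Un_absorb1)
    also have "\<dots> \<le> \<beta> * (sqrt (real K) * t) + \<beta> * ((\<Sum>j\<in>B. c j) / sqrt (real K) + (\<Sum>j\<in>R - B. c j) / sqrt (real K))"
      using few[OF B(1)] B(2) order_trans[OF rest mult_left_mono[OF add_right_mono[OF step] \<beta>]] by simp
    also have "\<dots> = \<beta> * (sqrt (real K) * t + (\<Sum>j\<in>R. c j) / sqrt (real K))"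
      by (simp add: split add_divide_distrib algebra_simps)
    finally show ?thesis .
  qed
qed

text \<open>
  \<open>F I\<close> stands for a seminorm of the part of a direction supported on \<open>I\<close>, and \<open>c\<close> for the absolute values of its
  entries. The entries above their scaled mean \<open>S / K\<close> number at most \<open>K\<close>, so \<open>F\<close> is large on them; the rest
  contributes at most a constant times \<open>S / sqrt K\<close>, which is small against the Euclidean norm for
  compressible directions if \<open>K\<close> is a large multiple of the squared compressibility \<open>s\<^sup>2\<close>.
\<close>

lemma compressible_lower_bound:
  fixes F :: "'j set \<Rightarrow> real" and c :: "'j \<Rightarrow> real"
  assumes J: "finite J" and K: "1 \<le> K" and \<alpha>: "0 < \<alpha>" and \<beta>: "0 \<le> \<beta>" and c: "\<And>j. 0 \<le> c j"
    and sub: "\<And>I R. finite I \<Longrightarrow> finite R \<Longrightarrow> I \<inter> R = {} \<Longrightarrow> F (I \<union> R) \<le> F I + F R"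
    and sub': "\<And>I R. finite I \<Longrightarrow> finite R \<Longrightarrow> I \<inter> R = {} \<Longrightarrow> F I \<le> F (I \<union> R) + F R"
    and up: "\<And>I. finite I \<Longrightarrow> card I \<le> K \<Longrightarrow> F I \<le> \<beta> * sqrt (\<Sum>j\<in>I. (c j)\<^sup>2)"
    and low: "\<And>I. finite I \<Longrightarrow> card I \<le> K \<Longrightarrow> \<alpha> * sqrt (\<Sum>j\<in>I. (c j)\<^sup>2) \<le> F I"
    and comp: "(\<Sum>j\<in>J. c j) \<le> s * sqrt (\<Sum>j\<in>J. (c j)\<^sup>2)" and s: "0 \<le> s"
    and Ks: "2 * (\<alpha> + 2 * \<beta>) * s \<le> \<alpha> * sqrt (real K)"
  shows "\<alpha> / 2 * sqrt (\<Sum>j\<in>J. (c j)\<^sup>2) \<le> F J"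
proof -
  define S where "S = (\<Sum>j\<in>J. c j)"
  define q where "q I = sqrt (\<Sum>j\<in>I. (c j)\<^sup>2)" for I
  \<comment> \<open>entries above \<open>t\<close> number at most \<open>K\<close>\<close>
  define t where "t = S / real K"
  have S0: "0 \<le> S" using c by (simp add: S_def sum_nonneg)
  have t0: "0 \<le> t" using S0 by (simp add: t_def)
  define I where "I = {j\<in>J. t < c j}"
  define R where "R = J - I"
  have fin: "finite I" "finite R" and dj: "I \<inter> R = {}" and un: "I \<union> R = J"
    using J by (auto simp: I_def R_def)
  have sqK: "0 < sqrt (real K)" "sqrt (real K) * sqrt (real K) = real K" using K by auto
  have cI: "card I \<le> K"
  proof (rule ccontr)
    assume "\<not> card I \<le> K"
    then have lt: "real K < real (card I)" by simp
    have "real (card I) * t \<le> (\<Sum>j\<in>I. c j)" using sum_mono[of I "\<lambda>_. t" c] by (auto simp: I_def)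
    also have "\<dots> \<le> S" unfolding S_def using J c by (intro sum_mono2) (auto simp: I_def)
    also have "\<dots> = real K * t" using K by (simp add: t_def)
    finally have "t = 0" using lt t0 mult_strict_right_mono[OF lt, of t] by (cases "t = 0") auto
    then have "S = 0" using K by (simp add: t_def)
    then have "\<forall>j\<in>J. c j = 0" using J c by (simp add: S_def sum_nonneg_eq_0_iff)
    then have "I = {}" using t0 by (auto simp: I_def)
    then show False using lt by simp
  qed
  have St: "sqrt (real K) * t = S / sqrt (real K)"
    using sqK by (simp add: t_def field_simps)
  have FR: "F R \<le> \<beta> * (2 * (S / sqrt (real K)))"
  proof -
    have "F R \<le> \<beta> * (sqrt (real K) * t + (\<Sum>j\<in>R. c j) / sqrt (real K))"
      by (rule block_bound[OF K \<beta> c sub up fin(2) t0]) (auto simp: R_def I_def)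
    also have "\<dots> \<le> \<beta> * (S / sqrt (real K) + S / sqrt (real K))"
      unfolding St using J c
      by (intro mult_left_mono[OF _ \<beta>] add_left_mono divide_right_mono)
        (auto simp: S_def R_def intro!: sum_mono2)
    finally show ?thesis by simp
  qed
  have qR: "q R \<le> S / sqrt (real K)"
  proof -
    have "(\<Sum>j\<in>R. (c j)\<^sup>2) \<le> (\<Sum>j\<in>R. t * c j)"
    proof (rule sum_mono)
      fix j assume "j \<in> R"
      then have "c j \<le> t" by (auto simp: R_def I_def)
      then show "(c j)\<^sup>2 \<le> t * c j" using c[of j] by (simp add: power2_eq_square mult_right_mono)
    qed
    also have "\<dots> = t * (\<Sum>j\<in>R. c j)" by (simp add: sum_distrib_left)
    also have "\<dots> \<le> t * S" using J c t0 by (intro mult_left_mono) (auto simp: S_def R_def intro!: sum_mono2)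
    also have "\<dots> = (S / sqrt (real K))\<^sup>2" using K by (simp add: t_def power_divide power2_eq_square)
    finally have "q R \<le> sqrt ((S / sqrt (real K))\<^sup>2)" unfolding q_def by (rule real_sqrt_le_mono)
    then show ?thesis using S0 sqK by simp
  qed
  have qJ: "q J \<le> q I + q R"
  proof -
    have "(\<Sum>j\<in>J. (c j)\<^sup>2) = (\<Sum>j\<in>I. (c j)\<^sup>2) + (\<Sum>j\<in>R. (c j)\<^sup>2)"
      unfolding un[symmetric] using fin dj by (rule sum.union_disjoint)
    then show ?thesis unfolding q_def by (simp add: sqrt_add_le_add_sqrt sum_nonneg)
  qed
  have "\<alpha> * (q J - S / sqrt (real K)) \<le> \<alpha> * q I" using \<alpha> qJ qR by (intro mult_left_mono) auto
  also have "\<dots> \<le> F I" using low[OF fin(1) cI] by (simp add: q_def)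
  also have "\<dots> \<le> F J + F R" using sub'[OF fin dj] un by simp
  finally have 1: "\<alpha> * (q J - S / sqrt (real K)) \<le> F J + \<beta> * (2 * (S / sqrt (real K)))" using FR by linarith
  have reassoc: "a * u \<le> v + (a + 2 * b) * w" if "a * (u - w) \<le> v + b * (2 * w)" for a b u v w :: real
    using that by (simp add: algebra_simps)
  have "(\<alpha> + 2 * \<beta>) * (S / sqrt (real K)) \<le> \<alpha> / 2 * q J"
  proof -
    have "(\<alpha> + 2 * \<beta>) * S \<le> (\<alpha> + 2 * \<beta>) * (s * q J)"
      using comp \<alpha> \<beta> by (intro mult_left_mono) (auto simp: S_def q_def)
    also have "\<dots> = (2 * (\<alpha> + 2 * \<beta>) * s) / 2 * q J" by (simp add: algebra_simps)
    also have "\<dots> \<le> (\<alpha> * sqrt (real K)) / 2 * q J"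
      using Ks by (intro mult_right_mono divide_right_mono) (auto simp: q_def sum_nonneg)
    finally show ?thesis using sqK by (simp add: field_simps)
  qed
  moreover have "\<alpha> * q J \<le> F J + (\<alpha> + 2 * \<beta>) * (S / sqrt (real K))"
    using 1 reassoc by blast
  ultimately have "\<alpha> / 2 * q J \<le> F J" by linarith
  then show ?thesis by (simp add: q_def)
qed

section \<open>Sharpness from growth\<close>

text \<open>
  A common setting for vectors and matrices with explicit carriers: the entries \<open>ent x e\<close> are linear
  coordinates, and the norm is a norm in terms of them.
\<close>

locale entry_space =
  fixes V :: "'v::{plus,minus} nspace" and ent :: "'v \<Rightarrow> 'e \<Rightarrow> real" and E :: "'e set"
  assumes finite_E: "finite E"
    and minus_closed: "x \<in> points V \<Longrightarrow> y \<in> points V \<Longrightarrow> x - y \<in> points V"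
    and comb_closed: "x \<in> points V \<Longrightarrow> y \<in> points V \<Longrightarrow> scale V s x + scale V t y \<in> points V"
    and ent_minus: "x \<in> points V \<Longrightarrow> y \<in> points V \<Longrightarrow> e \<in> E \<Longrightarrow> ent (x - y) e = ent x e - ent y e"
    and ent_comb: "x \<in> points V \<Longrightarrow> y \<in> points V \<Longrightarrow> e \<in> E \<Longrightarrow>
      ent (scale V s x + scale V t y) e = s * ent x e + t * ent y e"
    and ent_eqI: "x \<in> points V \<Longrightarrow> y \<in> points V \<Longrightarrow> (\<And>e. e \<in> E \<Longrightarrow> ent x e = ent y e) \<Longrightarrow> x = y"
    and nrm_nonneg: "x \<in> points V \<Longrightarrow> 0 \<le> nrm V x"
    and nrm_comb: "x \<in> points V \<Longrightarrow> y \<in> points V \<Longrightarrow> z \<in> points V \<Longrightarrow>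
      (\<And>e. e \<in> E \<Longrightarrow> ent z e = s * ent x e + t * ent y e) \<Longrightarrow>
      nrm V z \<le> \<bar>s\<bar> * nrm V x + \<bar>t\<bar> * nrm V y"
    and nrm_zero: "x \<in> points V \<Longrightarrow> nrm V x = 0 \<Longrightarrow> e \<in> E \<Longrightarrow> ent x e = 0"
begin

lemma nrm_triangle: "x \<in> points V \<Longrightarrow> y \<in> points V \<Longrightarrow> nrm V x \<le> nrm V (x - y) + nrm V y"
  using nrm_comb[of "x - y" y x 1 1] by (simp add: minus_closed ent_minus)

lemma nrm_minus_self: "x \<in> points V \<Longrightarrow> nrm V (x - x) = 0"
  using nrm_comb[of x x "x - x" 0 0] nrm_nonneg[of "x - x"] by (simp add: minus_closed ent_minus)

lemma nrm_minus_commute: "x \<in> points V \<Longrightarrow> y \<in> points V \<Longrightarrow> nrm V (x - y) = nrm V (y - x)"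
  using nrm_comb[of "y - x" x "x - y" "-1" 0] nrm_comb[of "x - y" x "y - x" "-1" 0]
  by (simp add: minus_closed ent_minus)

lemma nrm_minus_triangle:
  "x \<in> points V \<Longrightarrow> y \<in> points V \<Longrightarrow> z \<in> points V \<Longrightarrow> nrm V (x - z) \<le> nrm V (x - y) + nrm V (y - z)"
  using nrm_comb[of "x - y" "y - z" "x - z" 1 1] by (simp add: minus_closed ent_minus)

lemma nrm_minus_zero: "x \<in> points V \<Longrightarrow> y \<in> points V \<Longrightarrow> nrm V (x - y) = 0 \<Longrightarrow> x = y"
  using nrm_zero[of "x - y"] by (intro ent_eqI) (auto simp: minus_closed ent_minus)

lemma nrm_lipschitz: "x \<in> points V \<Longrightarrow> y \<in> points V \<Longrightarrow> \<bar>nrm V x - nrm V y\<bar> \<le> nrm V (x - y)"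
  using nrm_triangle[of x y] nrm_triangle[of y x] nrm_minus_commute[of x y] by simp

lemma comb_self: "x \<in> points V \<Longrightarrow> scale V (1 - t) x + scale V t x = x"
  by (rule ent_eqI) (auto simp: comb_closed ent_comb algebra_simps)

lemma convex_fun_nrm: "convex_fun V (nrm V)"
  unfolding convex_fun_def
proof (intro ballI)
  fix x y and t :: real assume xy: "x \<in> points V" "y \<in> points V" and t: "t \<in> {0..1}"
  show "nrm V (scale V (1 - t) x + scale V t y) \<le> (1 - t) * nrm V x + t * nrm V y"
    using nrm_comb[OF xy comb_closed[OF xy], of "1 - t" t "1 - t" t] ent_comb[OF xy] t by simp
qed

lemma dist_to_le: "S \<subseteq> points V \<Longrightarrow> x \<in> points V \<Longrightarrow> y \<in> S \<Longrightarrow> dist_to V x S \<le> nrm V (x - y)"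
  unfolding dist_to_def
  by (rule cINF_lower) (auto intro!: bdd_belowI2[of _ 0] nrm_nonneg minus_closed)

lemma dist_to_nonneg: "S \<noteq> {} \<Longrightarrow> S \<subseteq> points V \<Longrightarrow> x \<in> points V \<Longrightarrow> 0 \<le> dist_to V x S"
  unfolding dist_to_def by (rule cINF_greatest) (auto intro!: nrm_nonneg minus_closed)

text \<open>
  Approximate minimizers of the infimum in \<open>dist_to\<close> carry all estimates on the distance.
\<close>

lemma dist_to_near:
  assumes "S \<noteq> {}" "S \<subseteq> points V" "x \<in> points V" "0 < \<delta>"
  shows "\<exists>y\<in>S. nrm V (x - y) < dist_to V x S + \<delta>"
proof (rule ccontr)
  assume "\<not> ?thesis"
  then have "dist_to V x S + \<delta> \<le> nrm V (x - y)" if "y \<in> S" for y using that by (auto simp: not_less)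
  then have "dist_to V x S + \<delta> \<le> dist_to V x S"
    unfolding dist_to_def[of V x S, symmetric] using assms(1)
    by (subst (2) dist_to_def) (rule cINF_greatest, auto)
  then show False using assms(4) by simp
qed

lemma dist_to_singleton: "dist_to V x {y} = nrm V (x - y)"
  by (simp add: dist_to_def)

lemma dist_to_lipschitz:
  assumes S: "S \<noteq> {}" "S \<subseteq> points V" and x: "x \<in> points V" and y: "y \<in> points V"
  shows "dist_to V x S - dist_to V y S \<le> nrm V (x - y)"
proof (rule field_le_epsilon)
  fix \<delta> :: real assume "0 < \<delta>"
  then obtain z where z: "z \<in> S" "nrm V (y - z) < dist_to V y S + \<delta>" using dist_to_near[OF S y] by blast
  have "dist_to V x S \<le> nrm V (x - z)" by (rule dist_to_le[OF S(2) x z(1)])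
  also have "\<dots> \<le> nrm V (x - y) + nrm V (y - z)" using S z x y by (intro nrm_minus_triangle) auto
  finally show "dist_to V x S - dist_to V y S \<le> nrm V (x - y) + \<delta>" using z(2) by simp
qed

lemma dist_to_convex:
  assumes S: "S \<noteq> {}" "convex_set V S" and x: "x \<in> points V" and y: "y \<in> points V" and t: "t \<in> {0..1}"
  shows "dist_to V (scale V (1 - t) x + scale V t y) S \<le> (1 - t) * dist_to V x S + t * dist_to V y S"
proof (rule field_le_epsilon)
  fix \<delta> :: real assume \<delta>: "0 < \<delta>"
  have SV: "S \<subseteq> points V" using S(2) by (simp add: convex_set_def)
  obtain a where a: "a \<in> S" "nrm V (x - a) < dist_to V x S + \<delta>" using dist_to_near[OF S(1) SV x \<delta>] by blast
  obtain b where b: "b \<in> S" "nrm V (y - b) < dist_to V y S + \<delta>" using dist_to_near[OF S(1) SV y \<delta>] by blast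
  have ab: "a \<in> points V" "b \<in> points V" using a b SV by auto
  let ?z = "scale V (1 - t) x + scale V t y" and ?c = "scale V (1 - t) a + scale V t b"
  have c: "?c \<in> S" using S(2) a(1) b(1) t by (auto simp: convex_set_def)
  have "dist_to V ?z S \<le> nrm V (?z - ?c)" by (rule dist_to_le[OF SV comb_closed[OF x y] c])
  also have "\<dots> \<le> \<bar>1 - t\<bar> * nrm V (x - a) + \<bar>t\<bar> * nrm V (y - b)"
    by (rule nrm_comb) (use x y ab in \<open>auto simp: minus_closed comb_closed ent_minus ent_comb algebra_simps\<close>)
  also have "\<dots> \<le> (1 - t) * (dist_to V x S + \<delta>) + t * (dist_to V y S + \<delta>)"
    using a b t by (intro add_mono) (auto intro!: mult_mono nrm_nonneg minus_closed x y ab)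
  finally show "dist_to V ?z S \<le> (1 - t) * dist_to V x S + t * dist_to V y S + \<delta>"
    by (simp add: algebra_simps)
qed

end

text \<open>
  The deterministic input of a scenario. The last assumption is the decomposability that sharpness rests
  on; \<open>g\<close> is the average that the observation norm becomes after scaling.
\<close>

locale sharp_setup = entry_space V ent E
  for V :: "'v::{plus,minus} nspace" and ent :: "'v \<Rightarrow> 'e \<Rightarrow> real" and E :: "'e set" +
  fixes f :: "'v \<Rightarrow> real" and K :: "'v set" and x0 :: 'v and m :: nat and k :: nat
    and g :: "nat \<Rightarrow> (nat \<Rightarrow> real) \<Rightarrow> real"
  assumes f_convex: "convex_fun V f"
    and f_lipschitz: "x \<in> points V \<Longrightarrow> y \<in> points V \<Longrightarrow> \<bar>f x - f y\<bar> \<le> nrm V (x - y)"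
    and K_cone: "closed_convex_cone V K" and x0_K: "x0 \<in> K" and x0_V: "x0 \<in> points V"
    and g: "g = avg1 \<or> g = avg2" and k: "1 \<le> k"
    and f_x0: "f x0 = nrm V x0"
    and decomposable: "x \<in> points V \<Longrightarrow> nrm V x0 + nrm V (x - x0) -
       4 * sqrt (real k) * L2_set (\<lambda>e. ent x e - ent x0 e) E \<le> f x + 2 * dist_to V x K"
begin

text \<open>
  The residual norm and the penalized objective, as functions of the scaled rows \<open>z i\<close> of the sensing map.
\<close>

definition \<rho> :: "(nat \<Rightarrow> 'e \<Rightarrow> real) \<Rightarrow> 'v \<Rightarrow> real" where
  "\<rho> z x = g m (\<lambda>i. dotp E (\<lambda>e. ent x e - ent x0 e) (z i))"

definition F :: "real \<Rightarrow> (nat \<Rightarrow> 'e \<Rightarrow> real) \<Rightarrow> 'v \<Rightarrow> real" where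
  "F r z x = f x + r * \<rho> z x + 2 * dist_to V x K"

lemma seminorm_z: "seminorm_on E (\<lambda>h. g m (\<lambda>i. dotp E h (z i)))"
  by (rule seminorm_on_avg[OF finite_E g])

lemma KV: "K \<noteq> {}" "K \<subseteq> points V" "convex_set V K"
  using K_cone by (auto simp: closed_convex_cone_def convex_set_def)

lemma \<rho>_nonneg: "0 \<le> \<rho> z x"
  unfolding \<rho>_def by (rule avg_facts(1)[OF g])

lemma \<rho>_x0: "\<rho> z x0 = 0"
  using avg_facts(3)[OF g, of m 0 "\<lambda>_. 0"] by (simp add: \<rho>_def dotp_def)

lemma dist_x0: "dist_to V x0 K = 0"
  using dist_to_le[OF KV(2) x0_V x0_K] dist_to_nonneg[OF KV(1,2) x0_V] nrm_minus_self[OF x0_V] by simp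

lemma F_x0: "F r z x0 = nrm V x0"
  by (simp add: F_def \<rho>_x0 dist_x0 f_x0)

lemma \<rho>_comb:
  assumes x: "x \<in> points V" and y: "y \<in> points V" and t: "t \<in> {0..1}"
  shows "\<rho> z (scale V (1 - t) x + scale V t y) \<le> (1 - t) * \<rho> z x + t * \<rho> z y"
proof -
  let ?G = "\<lambda>h. g m (\<lambda>i. dotp E h (z i))"
  note s = seminorm_onD[OF seminorm_z[of z]]
  have "\<rho> z (scale V (1 - t) x + scale V t y) =
      ?G (\<lambda>e. (1 - t) * (ent x e - ent x0 e) + t * (ent y e - ent x0 e))"
    unfolding \<rho>_def by (rule s(4)) (simp add: ent_comb x y algebra_simps)
  also have "\<dots> \<le> ?G (\<lambda>e. (1 - t) * (ent x e - ent x0 e)) + ?G (\<lambda>e. t * (ent y e - ent x0 e))"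
    by (rule s(2))
  also have "\<dots> = (1 - t) * \<rho> z x + t * \<rho> z y" using t by (simp add: s(3) \<rho>_def)
  finally show ?thesis .
qed

lemma F_convex:
  assumes "0 \<le> r" shows "convex_fun V (F r z)"
  unfolding convex_fun_def
proof (intro ballI)
  fix x y and t :: real assume xy: "x \<in> points V" "y \<in> points V" and t: "t \<in> {0..1}"
  let ?z = "scale V (1 - t) x + scale V t y"
  have "f ?z \<le> (1 - t) * f x + t * f y" using f_convex xy t by (simp add: convex_fun_def)
  moreover have "r * \<rho> z ?z \<le> r * ((1 - t) * \<rho> z x + t * \<rho> z y)"
    using \<rho>_comb[OF xy t] assms by (rule mult_left_mono)
  moreover have "dist_to V ?z K \<le> (1 - t) * dist_to V x K + t * dist_to V y K"
    by (rule dist_to_convex[OF KV(1,3) xy t])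
  moreover have "a + b + 2 * c \<le> a' + b' + 2 * c'" if "a \<le> a'" "b \<le> b'" "c \<le> c'"
    for a b c a' b' c' :: real using that by linarith
  ultimately have "F r z ?z \<le> ((1 - t) * f x + t * f y) + r * ((1 - t) * \<rho> z x + t * \<rho> z y) +
      2 * ((1 - t) * dist_to V x K + t * dist_to V y K)" unfolding F_def by blast
  also have "\<dots> = (1 - t) * F r z x + t * F r z y" by (simp add: F_def algebra_simps)
  finally show "F r z ?z \<le> (1 - t) * F r z x + t * F r z y" .
qed

text \<open>
  The growth inequality contains that \<open>x\<^sub>0\<close> is the only minimizer; convexity is automatic.
  This form is an intersection of closed conditions on the design, which is used for measurability.
\<close>

lemma sharp_around_iff:
  assumes r: "0 \<le> r"
  shows "sharp_around V (1/2) (F r z) {x0} \<longleftrightarrow>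
    (\<forall>x\<in>points V. F r z x0 + 1/2 * nrm V (x - x0) \<le> F r z x)"
proof
  assume L: "sharp_around V (1/2) (F r z) {x0}"
  then have am: "{x0} = argmin V (F r z)"
    and gr: "\<And>x. x \<in> points V \<Longrightarrow> 1/2 * dist_to V x {x0} \<le> F r z x - (INF y\<in>points V. F r z y)"
    by (auto simp: sharp_around_def)
  have mn: "F r z x0 \<le> F r z y" if "y \<in> points V" for y using am that by (auto simp: argmin_def)
  have "(INF y\<in>points V. F r z y) = F r z x0"
  proof (rule antisym)
    show "(INF y\<in>points V. F r z y) \<le> F r z x0"
      by (rule cINF_lower) (use mn x0_V in \<open>auto intro!: bdd_belowI2\<close>)
    show "F r z x0 \<le> (INF y\<in>points V. F r z y)" by (rule cINF_greatest) (use mn x0_V in auto)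
  qed
  then show "\<forall>x\<in>points V. F r z x0 + 1/2 * nrm V (x - x0) \<le> F r z x"
    using gr unfolding dist_to_singleton by (simp add: le_diff_eq add.commute)
next
  assume R: "\<forall>x\<in>points V. F r z x0 + 1/2 * nrm V (x - x0) \<le> F r z x"
  have mn: "F r z x0 \<le> F r z y" if "y \<in> points V" for y
    using R that nrm_nonneg[OF minus_closed[OF that x0_V]] by fastforce
  have inf: "(INF y\<in>points V. F r z y) = F r z x0"
  proof (rule antisym)
    show "(INF y\<in>points V. F r z y) \<le> F r z x0"
      by (rule cINF_lower) (use mn x0_V in \<open>auto intro!: bdd_belowI2\<close>)
    show "F r z x0 \<le> (INF y\<in>points V. F r z y)" by (rule cINF_greatest) (use mn x0_V in auto)
  qed
  have "argmin V (F r z) = {x0}"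
  proof (rule antisym; rule subsetI)
    fix x assume "x \<in> argmin V (F r z)"
    then have x: "x \<in> points V" "F r z x \<le> F r z x0" using x0_V by (auto simp: argmin_def)
    have "F r z x0 + 1/2 * nrm V (x - x0) \<le> F r z x" using R x(1) by blast
    then have "nrm V (x - x0) = 0" using x nrm_nonneg[OF minus_closed[OF x(1) x0_V]] by simp
    then show "x \<in> {x0}" using nrm_minus_zero[OF x(1) x0_V] by simp
  qed (use mn x0_V in \<open>auto simp: argmin_def\<close>)
  moreover have "convex_set V {x0}" using x0_V comb_self by (auto simp: convex_set_def)
  ultimately show "sharp_around V (1/2) (F r z) {x0}"
    using F_convex[OF r] R inf by (auto simp: sharp_around_def dist_to_singleton)
qed

text \<open>
  For a compressible deviation the penalty pays for the loss term of decomposability. For the others the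
  loss term is at most half of the norm of the deviation.
\<close>

lemma sharp_if_good:
  assumes lowb: "\<And>h. h \<in> points V \<Longrightarrow> nrm V h \<le> 8 * sqrt (real k) * L2_set (ent h) E \<Longrightarrow>
      \<alpha> * L2_set (ent h) E \<le> g m (\<lambda>i. dotp E (ent h) (z i))"
    and r: "4 * sqrt (real k) \<le> r * \<alpha>" "0 \<le> r" and x: "x \<in> points V"
  shows "F r z x0 + 1/2 * nrm V (x - x0) \<le> F r z x"
proof -
  define h where "h = x - x0"
  have h: "h \<in> points V" unfolding h_def by (rule minus_closed[OF x x0_V])
  have eh: "ent h e = ent x e - ent x0 e" if "e \<in> E" for e
    unfolding h_def by (rule ent_minus[OF x x0_V that])
  have Lh: "L2_set (\<lambda>e. ent x e - ent x0 e) E = L2_set (ent h) E" by (intro L2_set_cong) (auto simp: eh)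
  have \<rho>h: "\<rho> z x = g m (\<lambda>i. dotp E (ent h) (z i))"
    unfolding \<rho>_def by (rule seminorm_onD(4)[OF seminorm_z]) (simp add: eh)
  have dec: "nrm V x0 + nrm V h - 4 * sqrt (real k) * L2_set (ent h) E \<le> f x + 2 * dist_to V x K"
    using decomposable[OF x] by (simp add: Lh h_def)
  show ?thesis
  proof (cases "nrm V h \<le> 8 * sqrt (real k) * L2_set (ent h) E")
    case True
    have "4 * sqrt (real k) * L2_set (ent h) E \<le> r * \<alpha> * L2_set (ent h) E"
      using r by (intro mult_right_mono) auto
    also have "\<dots> = r * (\<alpha> * L2_set (ent h) E)" by simp
    also have "\<dots> \<le> r * \<rho> z x" unfolding \<rho>h using lowb[OF h True] r(2) by (rule mult_left_mono)
    finally show ?thesis using dec nrm_nonneg[OF h] unfolding F_x0 unfolding F_def h_def by linarith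
  next
    case False
    then show ?thesis using dec mult_nonneg_nonneg[OF r(2) \<rho>_nonneg[of z x]] unfolding F_x0 unfolding F_def h_def by linarith
  qed
qed

lemma lipschitz_if_good:
  assumes upb: "\<And>h. h \<in> points V \<Longrightarrow> g m (\<lambda>i. dotp E (ent h) (z i)) \<le> \<beta> * nrm V h"
    and r: "0 \<le> r" and L: "3 + r * \<beta> \<le> L" and x: "x \<in> points V" and y: "y \<in> points V"
  shows "\<bar>F r z x - F r z y\<bar> \<le> L * nrm V (x - y)"
proof -
  have one: "F r z x - F r z y \<le> L * nrm V (x - y)" if x: "x \<in> points V" and y: "y \<in> points V" for x y
  proof -
    have h: "x - y \<in> points V" by (rule minus_closed[OF x y])
    note s = seminorm_onD[OF seminorm_z[of z]]
    have "\<rho> z x = g m (\<lambda>i. dotp E (\<lambda>e. ent (x - y) e + (ent y e - ent x0 e)) (z i))"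
      unfolding \<rho>_def by (rule s(4)) (simp add: ent_minus x y)
    also have "\<dots> \<le> g m (\<lambda>i. dotp E (ent (x - y)) (z i)) + \<rho> z y" unfolding \<rho>_def by (rule s(2))
    finally have "\<rho> z x - \<rho> z y \<le> \<beta> * nrm V (x - y)" using upb[OF h] by linarith
    from mult_left_mono[OF this r] have "r * \<rho> z x - r * \<rho> z y \<le> r * \<beta> * nrm V (x - y)"
      by (simp add: algebra_simps)
    moreover have "f x - f y \<le> nrm V (x - y)" using f_lipschitz[OF x y] by simp
    moreover have "dist_to V x K - dist_to V y K \<le> nrm V (x - y)" by (rule dist_to_lipschitz[OF KV(1,2) x y])
    ultimately have "F r z x - F r z y \<le> nrm V (x - y) + r * \<beta> * nrm V (x - y) + 2 * nrm V (x - y)"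
      unfolding F_def by linarith
    also have "\<dots> = (3 + r * \<beta>) * nrm V (x - y)" by (simp add: algebra_simps)
    also have "\<dots> \<le> L * nrm V (x - y)" using L nrm_nonneg[OF h] by (rule mult_right_mono)
    finally show ?thesis .
  qed
  show ?thesis using one[OF x y] one[OF y x] nrm_minus_commute[OF x y] by simp
qed

end

section \<open>Measurability of the recovery event\<close>

text \<open>
  On a countable product the Borel sets of the product topology belong to the product algebra. The coordinates
  outside \<open>J\<close> are constant on the space, so a closed set of total functions cuts out a
  measurable event.
\<close>

lemma closed_event_measurable:
  fixes J :: "'j::countable set" and N :: "real measure"
  assumes "closed S" and N: "sets N = sets borel"
  shows "{\<omega> \<in> space (\<Pi>\<^sub>M j\<in>J. N). \<omega> \<in> S} \<in> sets (\<Pi>\<^sub>M j\<in>J. N)"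
proof -
  have "(\<lambda>\<omega>. \<omega>) \<in> measurable (\<Pi>\<^sub>M j\<in>J. N) (\<Pi>\<^sub>M j\<in>UNIV. borel :: real measure)"
  proof (rule measurable_PiM_single')
    fix i :: 'j
    show "(\<lambda>\<omega>. \<omega> i) \<in> borel_measurable (\<Pi>\<^sub>M j\<in>J. N)"
    proof (cases "i \<in> J")
      case True
      then have "(\<lambda>\<omega>. \<omega> i) \<in> measurable (\<Pi>\<^sub>M j\<in>J. N) N" by (rule measurable_component_singleton)
      then show ?thesis using N by (simp cong: measurable_cong_sets)
    next
      case False
      have "(\<lambda>\<omega>. undefined :: real) \<in> borel_measurable (\<Pi>\<^sub>M j\<in>J. N)" by simp
      then show ?thesis
        by (rule measurable_cong[THEN iffD1, rotated]) (use False in \<open>auto simp: space_PiM PiE_def extensional_def\<close>)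
    qed
  qed auto
  moreover have "S \<in> sets (\<Pi>\<^sub>M j\<in>UNIV. borel :: real measure)"
    using assms(1) unfolding sets_PiM_equal_borel by simp
  ultimately have "(\<lambda>\<omega>. \<omega>) -` S \<inter> space (\<Pi>\<^sub>M j\<in>J. N) \<in> sets (\<Pi>\<^sub>M j\<in>J. N)" by (rule measurable_sets)
  moreover have "(\<lambda>\<omega>. \<omega>) -` S \<inter> space (\<Pi>\<^sub>M j\<in>J. N) = {\<omega> \<in> space (\<Pi>\<^sub>M j\<in>J. N). \<omega> \<in> S}" by auto
  ultimately show ?thesis by simp
qed

lemma (in sharp_setup) F_continuous:
  fixes z :: "'b::topological_space \<Rightarrow> nat \<Rightarrow> 'e \<Rightarrow> real"
  assumes "\<And>i e. i < m \<Longrightarrow> e \<in> E \<Longrightarrow> continuous_on UNIV (\<lambda>\<omega>. z \<omega> i e)"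
  shows "continuous_on UNIV (\<lambda>\<omega>. F r (z \<omega>) x)"
proof -
  have "continuous_on UNIV (\<lambda>\<omega>. \<rho> (z \<omega>) x)"
    using g
  proof
    assume "g = avg1"
    then show ?thesis unfolding \<rho>_def dotp_def avg1_def divide_inverse
      using assms by (auto intro!: continuous_intros)
  next
    assume "g = avg2"
    then show ?thesis unfolding \<rho>_def dotp_def avg2_def divide_inverse
      using assms by (auto intro!: continuous_intros)
  qed
  then show ?thesis unfolding F_def by (intro continuous_intros)
qed

section \<open>The recovery event\<close>

text \<open>
  The event on which the theorem holds. The factors 8 and 144 leave room for all scenarios: the
  lower factor is \<open>\<alpha>\<^sub>0 / 4\<close> except in the first covariance scenario, where pairing loses a factor 2, and
  there \<open>144 = 12\<^sup>2\<close> is the square of the upper isometry constant for vectors.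
\<close>

definition well_conditioned :: "'v nspace \<Rightarrow> ('v \<Rightarrow> 'e \<Rightarrow> real) \<Rightarrow> 'e set \<Rightarrow> nat \<Rightarrow> nat \<Rightarrow>
    (nat \<Rightarrow> (nat \<Rightarrow> real) \<Rightarrow> real) \<Rightarrow> (nat \<Rightarrow> 'e \<Rightarrow> real) \<Rightarrow> bool" where
  "well_conditioned V ent E m k g z \<longleftrightarrow>
    (\<forall>h\<in>points V. nrm V h \<le> 8 * sqrt (real k) * L2_set (ent h) E \<longrightarrow>
      \<alpha>\<^sub>0 / 8 * L2_set (ent h) E \<le> g m (\<lambda>i. dotp E (ent h) (z i))) \<and>
    (\<forall>h\<in>points V. g m (\<lambda>i. dotp E (ent h) (z i)) \<le> 144 * nrm V h)"

text \<open>
  \<open>sqrt (penalty_const k) \<alpha>\<^sub>0 / 8 = 4 sqrt k\<close> is the balance required by \<open>sharp_if_good\<close>. The Lipschitz constant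
  adds up 1 for the objective, 2 for the distance and 144 times the penalty weight.
\<close>

definition penalty_const :: real where "penalty_const = (32 / \<alpha>\<^sub>0)\<^sup>2"
definition lipschitz_const :: real where "lipschitz_const = (3 + 144 * (32 / \<alpha>\<^sub>0))\<^sup>2"

lemma const_pos: "0 < penalty_const" "0 < lipschitz_const"
  using \<alpha>\<^sub>0_pos by (auto simp: penalty_const_def lipschitz_const_def add_nonneg_eq_0_iff intro!: zero_less_power add_pos_pos)

lemma sqrt_const:
  "sqrt (penalty_const * real k) = 32 / \<alpha>\<^sub>0 * sqrt (real k)"
  "sqrt (lipschitz_const * real k) = (3 + 144 * (32 / \<alpha>\<^sub>0)) * sqrt (real k)"
  using \<alpha>\<^sub>0_pos by (simp_all add: penalty_const_def lipschitz_const_def real_sqrt_mult del: times_divide_eq_right)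

context sharp_setup
begin

text \<open>
  Off the carrier the penalized objective is arbitrary, so only its values on the carrier may matter.
\<close>

lemma sharp_around_cong:
  assumes "\<And>x. x \<in> points V \<Longrightarrow> P x = Q x"
  shows "sharp_around V \<mu> P X \<longleftrightarrow> sharp_around V \<mu> Q X"
proof -
  have "convex_fun V P \<longleftrightarrow> convex_fun V Q" using assms comb_closed by (simp add: convex_fun_def)
  moreover have "argmin V P = argmin V Q" using assms by (auto simp: argmin_def)
  moreover have "(INF y\<in>points V. P y) = (INF y\<in>points V. Q y)" using assms by (intro INF_cong) auto
  ultimately show ?thesis using assms by (simp add: sharp_around_def)
qed

text \<open>
  The best choice is \<open>L = B\<close> and \<open>\<kappa> = 2 B\<close>, so the quantifiers over \<open>L\<close> and \<open>\<kappa>\<close> disappear.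
\<close>

lemma recovery_event_iff:
  assumes pen: "\<And>x. x \<in> points V \<Longrightarrow> pen x = F r z x" and r: "0 \<le> r" and B: "0 \<le> B"
  shows "(sharp_around V (1/2) pen {x0} \<and>
      (\<exists>L \<kappa>. L \<le> B \<and> lipschitz V L pen \<and> has_condition_number V pen x0 (1/2) L \<kappa> \<and> \<kappa> \<le> 2 * B)) \<longleftrightarrow>
    (\<forall>x\<in>points V. F r z x0 + 1/2 * nrm V (x - x0) \<le> F r z x) \<and>
    (\<forall>x\<in>points V. \<forall>y\<in>points V. \<bar>F r z x - F r z y\<bar> \<le> B * nrm V (x - y))"
    (is "?S \<and> ?L \<longleftrightarrow> ?G \<and> ?B")
proof -
  have SG: "?S \<longleftrightarrow> ?G"
    using sharp_around_cong[of pen "F r z", OF pen] sharp_around_iff[OF r] by blast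
  have lip: "lipschitz V L pen \<longleftrightarrow> 0 \<le> L \<and> (\<forall>x\<in>points V. \<forall>y\<in>points V. \<bar>F r z x - F r z y\<bar> \<le> L * nrm V (x - y))" for L
    using pen by (simp add: lipschitz_def)
  have "?B" if L: ?L
  proof (intro ballI)
    fix x y assume xy: "x \<in> points V" "y \<in> points V"
    obtain L where L: "L \<le> B" "lipschitz V L pen" using L by blast
    have "\<bar>F r z x - F r z y\<bar> \<le> L * nrm V (x - y)" using L(2) lip xy by blast
    also have "\<dots> \<le> B * nrm V (x - y)" using L(1) nrm_nonneg[OF minus_closed[OF xy]] by (rule mult_right_mono)
    finally show "\<bar>F r z x - F r z y\<bar> \<le> B * nrm V (x - y)" .
  qed
  moreover have ?L if S: ?S and b: ?B
  proof (intro exI conjI)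
    show "lipschitz V B pen" using lip B b by blast
    then show "has_condition_number V pen x0 (1/2) B (B / (1/2))"
      unfolding has_condition_number_def using S by blast
  qed auto
  ultimately show ?thesis using SG by blast
qed

text \<open>
  The probability of the recovery event is bounded below by that of a smaller event. For this the
  recovery event has to be measurable; otherwise its measure would be 0 by convention. It is
  a closed condition on the design by \<open>recovery_event_iff\<close>, although it ranges over uncountably many points.
\<close>

lemma recovery_probability:
  fixes sc :: "'v scenario"
  assumes sc: "space_V sc n N = V" "objective sc = f" "cone_K sc n N = K" and sd: "0 < std_dev sc m"
    and obs: "\<And>\<omega> x. x \<in> points V \<Longrightarrow>
      norm_W sc (sensing_map sc n N m \<omega> x - sensing_map sc n N m \<omega> x0) = \<rho> (z \<omega>) x"
    and cont: "\<And>i e. i < m \<Longrightarrow> e \<in> E \<Longrightarrow> continuous_on UNIV (\<lambda>\<omega>. z \<omega> i e)"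
    and A: "A \<in> sets (design_law sc n N m)" "p < measure (design_law sc n N m) A"
    and good: "\<And>\<omega>. \<omega> \<in> A \<Longrightarrow> well_conditioned V ent E m k g (z \<omega>)"
  shows "p < measure (design_law sc n N m) {\<omega> \<in> space (design_law sc n N m).
      recovery_sharp sc n N m x0 (1/2) (sqrt (penalty_const * real k)) 2 \<omega> \<and>
      (\<exists>L \<kappa>. L \<le> sqrt (lipschitz_const * real k) \<and>
         lipschitz (space_V sc n N)
           L (recovery_penalized sc n N m x0 (sqrt (penalty_const * real k)) 2 \<omega>) \<and>
         has_condition_number (space_V sc n N)
           (recovery_penalized sc n N m x0 (sqrt (penalty_const * real k)) 2 \<omega>) x0 (1/2) L \<kappa> \<and>
         \<kappa> \<le> 2 * sqrt (lipschitz_const * real k))}"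
proof -
  define r where "r = sqrt (penalty_const * real k)"
  define B where "B = sqrt (lipschitz_const * real k)"
  have r0: "0 \<le> r" and B0: "0 \<le> B" using const_pos by (simp_all add: r_def B_def)
  let ?M = "design_law sc n N m"
  have "prob_space ?M"
    unfolding design_law_def by (intro prob_space_PiM prob_space_normal_density sd)
  then interpret M: prob_space ?M .
  have pen: "recovery_penalized sc n N m x0 r 2 \<omega> x = F r (z \<omega>) x" if "x \<in> points V" for \<omega> x
    using obs[OF that] by (simp add: recovery_penalized_def penalized_def F_def sc obs_space_def)
  have rs: "recovery_sharp sc n N m x0 (1/2) r 2 \<omega> \<longleftrightarrow>
      sharp_around V (1/2) (recovery_penalized sc n N m x0 r 2 \<omega>) {x0}" for \<omega>
    using f_convex K_cone x0_K x0_V r0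
    by (simp add: recovery_sharp_def sharp_problem_def recovery_penalized_def sc)
  \<comment> \<open>the recovery event, stated on the topological space of all functions\<close>
  define Q where "Q = {\<omega>. (\<forall>x\<in>points V. F r (z \<omega>) x0 + 1/2 * nrm V (x - x0) \<le> F r (z \<omega>) x) \<and>
    (\<forall>x\<in>points V. \<forall>y\<in>points V. \<bar>F r (z \<omega>) x - F r (z \<omega>) y\<bar> \<le> B * nrm V (x - y))}"
  have ev: "{\<omega> \<in> space ?M. recovery_sharp sc n N m x0 (1/2) r 2 \<omega> \<and>
      (\<exists>L \<kappa>. L \<le> B \<and> lipschitz (space_V sc n N) L (recovery_penalized sc n N m x0 r 2 \<omega>) \<and>
         has_condition_number (space_V sc n N) (recovery_penalized sc n N m x0 r 2 \<omega>) x0 (1/2) L \<kappa> \<and>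
         \<kappa> \<le> 2 * B)} = {\<omega> \<in> space ?M. \<omega> \<in> Q}"
  proof (intro Collect_cong conj_cong refl)
    fix \<omega>
    show "(recovery_sharp sc n N m x0 (1/2) r 2 \<omega> \<and>
      (\<exists>L \<kappa>. L \<le> B \<and> lipschitz (space_V sc n N) L (recovery_penalized sc n N m x0 r 2 \<omega>) \<and>
         has_condition_number (space_V sc n N) (recovery_penalized sc n N m x0 r 2 \<omega>) x0 (1/2) L \<kappa> \<and>
         \<kappa> \<le> 2 * B)) \<longleftrightarrow> \<omega> \<in> Q"
      unfolding rs sc(1) Q_def mem_Collect_eq by (rule recovery_event_iff[OF pen r0 B0])
  qed
  have cF: "continuous_on UNIV (\<lambda>\<omega>. F r (z \<omega>) x)" for x by (rule F_continuous[OF cont])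
  have "closed Q"
  proof -
    have "Q = (\<Inter>x\<in>points V. {\<omega>. F r (z \<omega>) x0 + 1/2 * nrm V (x - x0) \<le> F r (z \<omega>) x}) \<inter>
       (\<Inter>x\<in>points V. \<Inter>y\<in>points V. {\<omega>. \<bar>F r (z \<omega>) x - F r (z \<omega>) y\<bar> \<le> B * nrm V (x - y)})"
      by (auto simp: Q_def)
    then show ?thesis
      by (auto intro!: closed_Int closed_INT closed_Collect_le continuous_intros cF)
  qed
  have mQ: "{\<omega> \<in> space ?M. \<omega> \<in> Q} \<in> sets ?M"
    unfolding design_law_def by (rule closed_event_measurable[OF \<open>closed Q\<close>]) simp
  have sk: "1 \<le> sqrt (real k)" using k by simp
  have AQ: "A \<subseteq> {\<omega> \<in> space ?M. \<omega> \<in> Q}"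
  proof
    fix \<omega> assume \<omega>: "\<omega> \<in> A"
    have wc: "well_conditioned V ent E m k g (z \<omega>)" by (rule good[OF \<omega>])
    have "\<omega> \<in> Q" unfolding Q_def mem_Collect_eq
    proof (intro conjI ballI)
      show "F r (z \<omega>) x0 + 1/2 * nrm V (x - x0) \<le> F r (z \<omega>) x" if x: "x \<in> points V" for x
      proof (rule sharp_if_good[OF _ _ r0 x])
        show "\<alpha>\<^sub>0 / 8 * L2_set (ent h) E \<le> g m (\<lambda>i. dotp E (ent h) (z \<omega> i))"
          if "h \<in> points V" "nrm V h \<le> 8 * sqrt (real k) * L2_set (ent h) E" for h
          using wc that unfolding well_conditioned_def by blast
        show "4 * sqrt (real k) \<le> r * (\<alpha>\<^sub>0 / 8)"
          unfolding r_def sqrt_const using \<alpha>\<^sub>0_pos by simp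
      qed
      show "\<bar>F r (z \<omega>) x - F r (z \<omega>) y\<bar> \<le> B * nrm V (x - y)" if x: "x \<in> points V" and y: "y \<in> points V" for x y
      proof (rule lipschitz_if_good[OF _ r0 _ x y])
        show "g m (\<lambda>i. dotp E (ent h) (z \<omega> i)) \<le> 144 * nrm V h" if "h \<in> points V" for h
          using wc that unfolding well_conditioned_def by blast
        show "3 + r * 144 \<le> B" unfolding r_def B_def sqrt_const using sk \<alpha>\<^sub>0_pos by (simp add: distrib_right)
      qed
    qed
    then show "\<omega> \<in> {\<omega> \<in> space ?M. \<omega> \<in> Q}" using \<omega> A(1) sets.sets_into_space by auto
  qed
  have "p < measure ?M {\<omega> \<in> space ?M. \<omega> \<in> Q}"
    using A(2) M.finite_measure_mono[OF AQ mQ] by simp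
  then show ?thesis unfolding ev[symmetric] r_def B_def .
qed

end

section \<open>Isometry on the cone of compressible directions\<close>

text \<open>
  One argument for vectors and matrices: \<open>w j\<close> are signed unit vectors, respectively products of singular vectors,
  and \<open>D\<close> is the class on which the isometry is known.
\<close>

lemma compressible_rip:
  fixes E :: "'e set" and w :: "'j \<Rightarrow> 'e \<Rightarrow> real" and c :: "'j \<Rightarrow> real"
  assumes g: "g = avg1 \<or> g = avg2" and E: "finite E" and J: "finite J" and K: "1 \<le> K"
    and c: "\<And>j. j \<in> J \<Longrightarrow> 0 \<le> c j"
    and L2: "\<And>I. I \<subseteq> J \<Longrightarrow> L2_set (\<lambda>e. \<Sum>j\<in>I. c j * w j e) E = sqrt (\<Sum>j\<in>I. (c j)\<^sup>2)"
    and D: "\<And>I. I \<subseteq> J \<Longrightarrow> card I \<le> K \<Longrightarrow> D (\<lambda>e. \<Sum>j\<in>I. c j * w j e)"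
    and up: "\<And>h. D h \<Longrightarrow> g m (\<lambda>i. dotp E h (z i)) \<le> 12 * L2_set h E"
    and low: "\<And>h. D h \<Longrightarrow> \<alpha>\<^sub>0 / 2 * L2_set h E \<le> avg1 m (\<lambda>i. dotp E h (z i))"
    and h: "\<And>e. e \<in> E \<Longrightarrow> h e = (\<Sum>j\<in>J. c j * w j e)"
  shows "g m (\<lambda>i. dotp E h (z i)) \<le> 12 * (\<Sum>j\<in>J. c j)"
    and "(\<Sum>j\<in>J. c j) \<le> s * L2_set h E \<Longrightarrow> 0 \<le> s \<Longrightarrow> 2 * (\<alpha>\<^sub>0 / 2 + 24) * s \<le> \<alpha>\<^sub>0 / 2 * sqrt (real K) \<Longrightarrow>
      \<alpha>\<^sub>0 / 4 * L2_set h E \<le> avg1 m (\<lambda>i. dotp E h (z i))"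
proof -
  define part where "part I = (\<lambda>e. \<Sum>j\<in>I \<inter> J. c j * w j e)" for I
  \<comment> \<open>index sets reaching beyond \<open>J\<close> are cut down to \<open>J\<close>, so entries outside count as 0\<close>
  define d where "d j = (if j \<in> J then c j else 0)" for j
  have hJ: "h e = part J e" if "e \<in> E" for e using h[OF that] by (simp add: part_def)
  have part_un: "part (I \<union> R) e = part I e + part R e" if "I \<inter> R = {}" for I R e
    unfolding part_def Int_Un_distrib2 using that J by (intro sum.union_disjoint) auto
  have sg: "seminorm_on E (\<lambda>h. g m (\<lambda>i. dotp E h (z i)))" by (rule seminorm_on_avg[OF E g])
  have s1: "seminorm_on E (\<lambda>h. avg1 m (\<lambda>i. dotp E h (z i)))" by (rule seminorm_on_avg[OF E]) simp
  show "g m (\<lambda>i. dotp E h (z i)) \<le> 12 * (\<Sum>j\<in>J. c j)"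
  proof -
    have "g m (\<lambda>i. dotp E (part I) (z i)) \<le> 12 * (\<Sum>j\<in>I. c j)" if "I \<subseteq> J" for I
      using finite_subset[OF that J] that
    proof (induction I)
      case empty
      have "g m (\<lambda>i. 0 * 0) = \<bar>0\<bar> * g m (\<lambda>i. 0)" by (rule avg_facts(3)[OF g])
      then show ?case by (simp add: part_def dotp_def)
    next
      case (insert j I)
      have 1: "g m (\<lambda>i. dotp E (part {j}) (z i)) \<le> 12 * c j"
      proof -
        have Dj: "D (part {j})" using D[of "{j}"] K insert.prems by (simp add: part_def)
        have "L2_set (part {j}) E = sqrt (\<Sum>j\<in>{j}. (c j)\<^sup>2)"
          using L2[of "{j}"] insert.prems by (simp add: part_def)
        then have "L2_set (part {j}) E = c j" using c insert.prems by simp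
        then show ?thesis using up[OF Dj] by simp
      qed
      have "g m (\<lambda>i. dotp E (part (insert j I)) (z i)) = g m (\<lambda>i. dotp E (\<lambda>e. part {j} e + part I e) (z i))"
        by (rule seminorm_onD(4)[OF sg]) (use part_un[of "{j}" I] insert.hyps in simp)
      also have "\<dots> \<le> g m (\<lambda>i. dotp E (part {j}) (z i)) + g m (\<lambda>i. dotp E (part I) (z i))"
        by (rule seminorm_onD(2)[OF sg])
      finally show ?case using 1 insert by simp
    qed
    from this[of J] have "g m (\<lambda>i. dotp E (part J) (z i)) \<le> 12 * (\<Sum>j\<in>J. c j)" by simp
    moreover have "g m (\<lambda>i. dotp E h (z i)) = g m (\<lambda>i. dotp E (part J) (z i))"
      by (rule seminorm_onD(4)[OF sg]) (rule hJ)
    ultimately show ?thesis by simp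
  qed
  assume comp: "(\<Sum>j\<in>J. c j) \<le> s * L2_set h E" and s: "0 \<le> s"
    and Ks: "2 * (\<alpha>\<^sub>0 / 2 + 24) * s \<le> \<alpha>\<^sub>0 / 2 * sqrt (real K)"
  define G where "G I = avg1 m (\<lambda>i. dotp E (part I) (z i))" for I
  have dsum: "(\<Sum>j\<in>I. (d j)\<^sup>2) = (\<Sum>j\<in>I \<inter> J. (c j)\<^sup>2)" if "finite I" for I
    using that by (auto simp: d_def if_distrib sum.inter_restrict intro!: sum.cong)
  have L2h: "L2_set h E = sqrt (\<Sum>j\<in>J. (d j)\<^sup>2)"
  proof -
    have "L2_set h E = L2_set (\<lambda>e. \<Sum>j\<in>J. c j * w j e) E" by (rule L2_set_cong) (simp_all add: h)
    then show ?thesis using L2[of J] dsum[OF J] by simp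
  qed
  have L2p: "L2_set (part I) E = sqrt (\<Sum>j\<in>I. (d j)\<^sup>2)" if "finite I" for I
    unfolding part_def dsum[OF that] by (rule L2) simp
  have Dp: "D (part I)" if "finite I" "card I \<le> K" for I
    unfolding part_def using that card_mono[of I "I \<inter> J"] by (intro D) auto
  have "\<alpha>\<^sub>0 / 2 / 2 * sqrt (\<Sum>j\<in>J. (d j)\<^sup>2) \<le> G J"
  proof (rule compressible_lower_bound[where \<beta> = 12 and K = K and s = s])
    show "finite J" "1 \<le> K" "0 \<le> s" by fact+
    show "0 < \<alpha>\<^sub>0 / 2" using \<alpha>\<^sub>0_pos by simp
    show "0 \<le> (12::real)" by simp
    show "0 \<le> d j" for j using c by (simp add: d_def)
    show "G (I \<union> R) \<le> G I + G R" if "finite I" "finite R" "I \<inter> R = {}" for I R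
    proof -
      have "G (I \<union> R) = avg1 m (\<lambda>i. dotp E (\<lambda>e. part I e + part R e) (z i))"
        unfolding G_def by (rule seminorm_onD(4)[OF s1]) (rule part_un[OF that(3)])
      then show ?thesis unfolding G_def using seminorm_onD(2)[OF s1, of "part I" "part R"] by simp
    qed
    show "G I \<le> G (I \<union> R) + G R" if "finite I" "finite R" "I \<inter> R = {}" for I R
    proof -
      have "G I = avg1 m (\<lambda>i. dotp E (\<lambda>e. part (I \<union> R) e + (-1) * part R e) (z i))"
        unfolding G_def by (rule seminorm_onD(4)[OF s1]) (simp add: part_un[OF that(3)])
      also have "\<dots> \<le> G (I \<union> R) + avg1 m (\<lambda>i. dotp E (\<lambda>e. (-1) * part R e) (z i))"
        unfolding G_def by (rule seminorm_onD(2)[OF s1])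
      also have "avg1 m (\<lambda>i. dotp E (\<lambda>e. (-1) * part R e) (z i)) = \<bar>-1\<bar> * G R"
        unfolding G_def by (rule seminorm_onD(3)[OF s1])
      finally show ?thesis by simp
    qed
    show "G I \<le> 12 * sqrt (\<Sum>j\<in>I. (d j)\<^sup>2)" if "finite I" "card I \<le> K" for I
      using avg_facts(4)[OF g, of m "\<lambda>i. dotp E (part I) (z i)"] up[OF Dp[OF that]]
      unfolding G_def L2p[OF that(1)] by simp
    show "\<alpha>\<^sub>0 / 2 * sqrt (\<Sum>j\<in>I. (d j)\<^sup>2) \<le> G I" if "finite I" "card I \<le> K" for I
      using low[OF Dp[OF that]] unfolding G_def L2p[OF that(1)] .
    show "(\<Sum>j\<in>J. d j) \<le> s * sqrt (\<Sum>j\<in>J. (d j)\<^sup>2)" using comp unfolding L2h by (simp add: d_def)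
    show "2 * (\<alpha>\<^sub>0 / 2 + 2 * 12) * s \<le> \<alpha>\<^sub>0 / 2 * sqrt (real K)" using Ks by simp
  qed
  moreover have "avg1 m (\<lambda>i. dotp E h (z i)) = G J"
    unfolding G_def by (rule seminorm_onD(4)[OF s1]) (rule hJ)
  ultimately show "\<alpha>\<^sub>0 / 4 * L2_set h E \<le> avg1 m (\<lambda>i. dotp E h (z i))" unfolding L2h by simp
qed

text \<open>
  The isometry is needed for sparsity (rank) \<open>\<tau> k\<close>, where \<open>\<tau>\<close> is what \<open>compressible_lower_bound\<close> asks for at
  compressibility \<open>s = 8 sqrt k\<close>.
\<close>

definition \<tau> :: nat where "\<tau> = nat \<lceil>(16 * (\<alpha>\<^sub>0 / 2 + 24) / (\<alpha>\<^sub>0 / 2))\<^sup>2\<rceil>"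

lemma \<tau>: "1 \<le> \<tau>" "2 * (\<alpha>\<^sub>0 / 2 + 24) * (8 * sqrt (real k)) \<le> \<alpha>\<^sub>0 / 2 * sqrt (real (\<tau> * k))"
proof -
  define q where "q = 16 * (\<alpha>\<^sub>0 / 2 + 24) / (\<alpha>\<^sub>0 / 2)"
  have q: "1 \<le> q" "\<alpha>\<^sub>0 / 2 * q = 16 * (\<alpha>\<^sub>0 / 2 + 24)" using \<alpha>\<^sub>0_pos by (auto simp: q_def field_simps)
  have t: "q\<^sup>2 \<le> real \<tau>" unfolding \<tau>_def q_def[symmetric] by (rule real_nat_ceiling_ge)
  then have "1 \<le> real \<tau>" using q(1) one_le_power[of q 2] by linarith
  then show "1 \<le> \<tau>" by simp
  have "q \<le> sqrt (real \<tau>)" using t q(1) by (intro real_le_rsqrt) auto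
  then have "\<alpha>\<^sub>0 / 2 * q * sqrt (real k) \<le> \<alpha>\<^sub>0 / 2 * sqrt (real \<tau>) * sqrt (real k)"
    using \<alpha>\<^sub>0_pos by (intro mult_right_mono mult_left_mono) auto
  then show "2 * (\<alpha>\<^sub>0 / 2 + 24) * (8 * sqrt (real k)) \<le> \<alpha>\<^sub>0 / 2 * sqrt (real (\<tau> * k))"
    unfolding q(2) by (simp add: real_sqrt_mult algebra_simps)
qed

lemma sparse_compressible_rip:
  fixes h :: "nat \<Rightarrow> real"
  assumes g: "g = avg1 \<or> g = avg2" and k: "1 \<le> k"
    and up: "\<And>h. sparse_on {..<n} (real (\<tau> * k)) h \<Longrightarrow> g m (\<lambda>i. dotp {..<n} h (z i)) \<le> 12 * L2_set h {..<n}"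
    and low: "\<And>h. sparse_on {..<n} (real (\<tau> * k)) h \<Longrightarrow>
      \<alpha>\<^sub>0 / 2 * L2_set h {..<n} \<le> avg1 m (\<lambda>i. dotp {..<n} h (z i))"
  shows "g m (\<lambda>i. dotp {..<n} h (z i)) \<le> 12 * (\<Sum>i<n. \<bar>h i\<bar>)"
    and "(\<Sum>i<n. \<bar>h i\<bar>) \<le> 8 * sqrt (real k) * L2_set h {..<n} \<Longrightarrow>
      \<alpha>\<^sub>0 / 4 * L2_set h {..<n} \<le> avg1 m (\<lambda>i. dotp {..<n} h (z i))"
proof -
  define w where "w j e = (if e = j then sgn (h j) else 0)" for j e :: nat
  have part: "(\<Sum>j\<in>I. \<bar>h j\<bar> * w j e) = (if e \<in> I then h e else 0)" if "I \<subseteq> {..<n}" for I e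
  proof -
    have "(\<Sum>j\<in>I. \<bar>h j\<bar> * w j e) = (\<Sum>j\<in>I. if e = j then h e else 0)"
      by (intro sum.cong refl) (auto simp: w_def abs_mult_sgn)
    then show ?thesis using finite_subset[OF that] by simp
  qed
  have L2: "L2_set (\<lambda>e. \<Sum>j\<in>I. \<bar>h j\<bar> * w j e) {..<n} = sqrt (\<Sum>j\<in>I. \<bar>h j\<bar>\<^sup>2)" if I: "I \<subseteq> {..<n}" for I
  proof -
    have "(\<Sum>e<n. (if e \<in> I then h e else 0)\<^sup>2) = (\<Sum>e\<in>{..<n} \<inter> I. (h e)\<^sup>2)"
      by (subst sum.inter_restrict) (auto intro!: sum.cong)
    then show ?thesis unfolding part[OF I] L2_set_def using I by (simp add: Int_absorb1)
  qed
  have D: "sparse_on {..<n} (real (\<tau> * k)) (\<lambda>e. \<Sum>j\<in>I. \<bar>h j\<bar> * w j e)" if I: "I \<subseteq> {..<n}" "card I \<le> \<tau> * k" for I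
  proof -
    have "card {e \<in> {..<n}. (\<Sum>j\<in>I. \<bar>h j\<bar> * w j e) \<noteq> 0} \<le> card I"
      unfolding part[OF I(1)] using finite_subset[OF I(1)] by (intro card_mono) auto
    then show ?thesis unfolding sparse_on_def using I(2) by linarith
  qed
  have K: "1 \<le> \<tau> * k" using \<tau>(1) k by simp
  have h: "h e = (\<Sum>j<n. \<bar>h j\<bar> * w j e)" if "e \<in> {..<n}" for e using part[of "{..<n}" e] that by simp
  note rip = compressible_rip[where J = "{..<n}" and w = w and c = "\<lambda>j. \<bar>h j\<bar>" and
      D = "sparse_on {..<n} (real (\<tau> * k))", OF g finite_lessThan finite_lessThan K]
  show "g m (\<lambda>i. dotp {..<n} h (z i)) \<le> 12 * (\<Sum>i<n. \<bar>h i\<bar>)"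
    by (rule rip(1)) ((rule abs_ge_zero L2 D up low h | assumption)+)
  show "\<alpha>\<^sub>0 / 4 * L2_set h {..<n} \<le> avg1 m (\<lambda>i. dotp {..<n} h (z i))"
    if "(\<Sum>i<n. \<bar>h i\<bar>) \<le> 8 * sqrt (real k) * L2_set h {..<n}"
    by (rule rip(2)[where s = "8 * sqrt (real k)"])
      ((rule abs_ge_zero L2 D up low h that \<tau>(2) | assumption | simp)+)
qed

lemma low_rank_compressible_rip:
  assumes g: "g = avg1 \<or> g = avg2" and k: "1 \<le> k" and H: "H \<in> carrier_mat n N"
    and up: "\<And>h. low_rank n N (\<tau> * k) h \<Longrightarrow>
      g m (\<lambda>i. dotp ({..<n} \<times> {..<N}) h (z i)) \<le> 12 * L2_set h ({..<n} \<times> {..<N})"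
    and low: "\<And>h. low_rank n N (\<tau> * k) h \<Longrightarrow>
      \<alpha>\<^sub>0 / 2 * L2_set h ({..<n} \<times> {..<N}) \<le> avg1 m (\<lambda>i. dotp ({..<n} \<times> {..<N}) h (z i))"
  shows "g m (\<lambda>i. dotp ({..<n} \<times> {..<N}) (($$) H) (z i)) \<le> 12 * schatten1_norm H"
    and "schatten1_norm H \<le> 8 * sqrt (real k) * L2_set (($$) H) ({..<n} \<times> {..<N}) \<Longrightarrow>
      \<alpha>\<^sub>0 / 4 * L2_set (($$) H) ({..<n} \<times> {..<N}) \<le> avg1 m (\<lambda>i. dotp ({..<n} \<times> {..<N}) (($$) H) (z i))"
proof -
  obtain J \<sigma> u v where svd: "is_svd n N (($$) H) J \<sigma> u v" and S: "schatten1_norm H = (\<Sum>j\<in>J. \<sigma> j)"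
    using svd_exists[OF H] by blast
  let ?E = "{..<n} \<times> {..<N}"
  have J: "finite J" and u: "ons {..<n} J u" and v: "ons {..<N} J v" and \<sigma>: "\<And>j. j \<in> J \<Longrightarrow> 0 \<le> \<sigma> j"
    and ent: "\<And>p q. p < n \<Longrightarrow> q < N \<Longrightarrow> H $$ (p, q) = (\<Sum>j\<in>J. \<sigma> j * u j p * v j q)"
    using svd by (auto simp: is_svd_def less_imp_le)
  define w where "w j e = u j (fst e) * v j (snd e)" for j and e :: "nat \<times> nat"
  have L2: "L2_set (\<lambda>e. \<Sum>j\<in>I. \<sigma> j * w j e) ?E = sqrt (\<Sum>j\<in>I. (\<sigma> j)\<^sup>2)" if I: "I \<subseteq> J" for I
  proof -
    have "(L2_set (\<lambda>e. \<Sum>j\<in>I. \<sigma> j * w j e) ?E)\<^sup>2 =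
        (\<Sum>j\<in>I. dotp {..<n} (\<lambda>p. \<sigma> j * u j p) (\<lambda>p. \<sigma> j * u j p) * dotp {..<N} (v j) (v j))"
    proof (rule L2_set_orthogonal_sum)
      show "finite I" by (rule finite_subset[OF I J])
      show "(\<Sum>j\<in>I. \<sigma> j * w j (p, q)) = (\<Sum>i\<in>I. (\<sigma> i * u i p) * v i q)" for p q
        by (simp add: w_def mult.assoc)
      show "dotp {..<n} (\<lambda>p. \<sigma> i * u i p) (\<lambda>p. \<sigma> j * u j p) = 0 \<or> dotp {..<N} (v i) (v j) = 0"
        if "i \<in> I" "j \<in> I" "i \<noteq> j" for i j
      proof -
        have "i \<in> J" "j \<in> J" using that I by auto
        then have "dotp {..<N} (v i) (v j) = (if i = j then 1 else 0)" using v unfolding ons_def by blast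
        then show ?thesis using that(3) by simp
      qed
    qed
    also have "\<dots> = (\<Sum>j\<in>I. (\<sigma> j)\<^sup>2)"
    proof (rule sum.cong[OF refl])
      fix j assume "j \<in> I"
      then have "dotp {..<n} (u j) (u j) = 1" "dotp {..<N} (v j) (v j) = 1"
        using u v I by (auto simp: ons_def)
      then show "dotp {..<n} (\<lambda>p. \<sigma> j * u j p) (\<lambda>p. \<sigma> j * u j p) * dotp {..<N} (v j) (v j) = (\<sigma> j)\<^sup>2"
        by (simp add: dotp_scale_left dotp_scale_right power2_eq_square)
    qed
    finally show ?thesis by (simp add: real_sqrt_unique)
  qed
  have D: "low_rank n N (\<tau> * k) (\<lambda>e. \<Sum>j\<in>I. \<sigma> j * w j e)" if I: "I \<subseteq> J" "card I \<le> \<tau> * k" for I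
  proof -
    have fI: "finite I" by (rule finite_subset[OF I(1) J])
    obtain b where b: "bij_betw b {..<card I} I" using ex_bij_betw_nat_finite[OF fI] by (auto simp: atLeast0LessThan)
    have "(\<Sum>j\<in>I. \<sigma> j * w j (p, q)) =
        (\<Sum>i<\<tau> * k. (if i < card I then \<sigma> (b i) * u (b i) p else 0) * v (b i) q)" for p q
    proof -
      have "(\<Sum>j\<in>I. \<sigma> j * w j (p, q)) = (\<Sum>i<card I. \<sigma> (b i) * w (b i) (p, q))"
        using b by (rule sum.reindex_bij_betw[symmetric])
      also have "\<dots> = (\<Sum>i<\<tau> * k. (if i < card I then \<sigma> (b i) * u (b i) p else 0) * v (b i) q)"
        by (rule sum.mono_neutral_cong_left) (use I(2) in \<open>auto simp: w_def mult.assoc\<close>)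
      finally show ?thesis .
    qed
    then show ?thesis unfolding low_rank_def by (intro exI allI impI)
  qed
  have K: "1 \<le> \<tau> * k" using \<tau>(1) k by simp
  have h: "H $$ e = (\<Sum>j\<in>J. \<sigma> j * w j e)" if "e \<in> ?E" for e
    using ent that by (auto simp: w_def mult.assoc)
  have E: "finite ?E" by simp
  note rip = compressible_rip[where w = w and c = \<sigma> and D = "low_rank n N (\<tau> * k)", OF g E J K]
  show "g m (\<lambda>i. dotp ?E (($$) H) (z i)) \<le> 12 * schatten1_norm H" unfolding S
    by (rule rip(1)) ((rule \<sigma> L2 D up low h | assumption)+)
  show "\<alpha>\<^sub>0 / 4 * L2_set (($$) H) ?E \<le> avg1 m (\<lambda>i. dotp ?E (($$) H) (z i))"
    if "schatten1_norm H \<le> 8 * sqrt (real k) * L2_set (($$) H) ?E"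
    by (rule rip(2)[where s = "8 * sqrt (real k)"])
      ((rule \<sigma> L2 D up low h that[unfolded S] \<tau>(2) | assumption | simp)+)
qed

section \<open>The spaces and objectives of the scenarios\<close>

lemma entry_space_vec: "entry_space (vec_space_l1 n) ($) {..<n}"
proof
  fix x y z :: "real vec" and s t :: real
  assume x: "x \<in> points (vec_space_l1 n)" and y: "y \<in> points (vec_space_l1 n)"
  then have xy: "x \<in> carrier_vec n" "y \<in> carrier_vec n" by (simp_all add: vec_space_l1_def)
  show "x - y \<in> points (vec_space_l1 n)" "scale (vec_space_l1 n) s x + scale (vec_space_l1 n) t y \<in> points (vec_space_l1 n)"
    using xy by (simp_all add: vec_space_l1_def)
  show "(x - y) $ e = x $ e - y $ e" "(scale (vec_space_l1 n) s x + scale (vec_space_l1 n) t y) $ e = s * x $ e + t * y $ e"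
    if "e \<in> {..<n}" for e using xy that by (simp_all add: vec_space_l1_def)
  show "x = y" if "\<And>e. e \<in> {..<n} \<Longrightarrow> x $ e = y $ e" using xy that by (intro eq_vecI) auto
  assume z: "z \<in> points (vec_space_l1 n)" and ent: "\<And>e. e \<in> {..<n} \<Longrightarrow> z $ e = s * x $ e + t * y $ e"
  have "(\<Sum>i<n. \<bar>z $ i\<bar>) \<le> (\<Sum>i<n. \<bar>s\<bar> * \<bar>x $ i\<bar> + \<bar>t\<bar> * \<bar>y $ i\<bar>)"
    using ent by (intro sum_mono) (simp add: abs_triangle_ineq[THEN order_trans] abs_mult[symmetric])
  then show "nrm (vec_space_l1 n) z \<le> \<bar>s\<bar> * nrm (vec_space_l1 n) x + \<bar>t\<bar> * nrm (vec_space_l1 n) y"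
    using xy z by (simp add: vec_space_l1_def l1_norm_def sum.distrib sum_distrib_left)
qed (auto simp: vec_space_l1_def l1_norm_def sum_nonneg sum_nonneg_eq_0_iff)

lemma entry_space_mat: "entry_space (mat_space_s1 n N) ($$) ({..<n} \<times> {..<N})"
proof
  fix x y z :: "real mat" and s t :: real
  assume x: "x \<in> points (mat_space_s1 n N)" and y: "y \<in> points (mat_space_s1 n N)"
  then have xy: "x \<in> carrier_mat n N" "y \<in> carrier_mat n N" by (simp_all add: mat_space_s1_def)
  show "x - y \<in> points (mat_space_s1 n N)" "scale (mat_space_s1 n N) s x + scale (mat_space_s1 n N) t y \<in> points (mat_space_s1 n N)"
    using xy by (simp_all add: mat_space_s1_def minus_carrier_mat)
  show "(x - y) $$ e = x $$ e - y $$ e"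
    "(scale (mat_space_s1 n N) s x + scale (mat_space_s1 n N) t y) $$ e = s * x $$ e + t * y $$ e"
    if "e \<in> {..<n} \<times> {..<N}" for e using xy that by (auto simp: mat_space_s1_def)
  show "x = y" if "\<And>e. e \<in> {..<n} \<times> {..<N} \<Longrightarrow> x $$ e = y $$ e" using xy that by (intro eq_matI) auto
  assume z: "z \<in> points (mat_space_s1 n N)"
    and ent: "\<And>e. e \<in> {..<n} \<times> {..<N} \<Longrightarrow> z $$ e = s * x $$ e + t * y $$ e"
  have "z \<in> carrier_mat n N" using z by (simp add: mat_space_s1_def)
  then have "schatten1_norm z \<le> \<bar>s\<bar> * schatten1_norm x + \<bar>t\<bar> * schatten1_norm y"
    by (rule schatten1_le_combination[OF xy]) (simp add: ent)
  then show "nrm (mat_space_s1 n N) z \<le> \<bar>s\<bar> * nrm (mat_space_s1 n N) x + \<bar>t\<bar> * nrm (mat_space_s1 n N) y"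
    by (simp add: mat_space_s1_def)
qed (auto simp: mat_space_s1_def schatten1_nonneg schatten1_zero_imp)

lemma sym_mats_iff: "X \<in> sym_mats n \<longleftrightarrow> X \<in> carrier_mat n n \<and> (\<forall>p<n. \<forall>q<n. X $$ (p, q) = X $$ (q, p))"
proof
  assume X: "X \<in> sym_mats n"
  then have c: "X \<in> carrier_mat n n" "transpose_mat X = X" by (auto simp: sym_mats_def)
  have "X $$ (p, q) = X $$ (q, p)" if "p < n" "q < n" for p q
  proof -
    have "transpose_mat X $$ (p, q) = X $$ (q, p)" using c(1) that by (intro index_transpose_mat(1)) auto
    then show ?thesis using c(2) by simp
  qed
  then show "X \<in> carrier_mat n n \<and> (\<forall>p<n. \<forall>q<n. X $$ (p, q) = X $$ (q, p))" using c(1) by blast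
next
  assume "X \<in> carrier_mat n n \<and> (\<forall>p<n. \<forall>q<n. X $$ (p, q) = X $$ (q, p))"
  then show "X \<in> sym_mats n" unfolding sym_mats_def by (auto intro!: eq_matI)
qed

lemma entry_space_sym: "entry_space (sym_space_s1 n) ($$) ({..<n} \<times> {..<n})"
proof -
  interpret M: entry_space "mat_space_s1 n n" "($$)" "{..<n} \<times> {..<n}" by (rule entry_space_mat)
  have sub: "x \<in> points (mat_space_s1 n n)" if "x \<in> points (sym_space_s1 n)" for x
    using that by (simp add: sym_space_s1_def mat_space_s1_def sym_mats_iff)
  have eq: "scale (sym_space_s1 n) = scale (mat_space_s1 n n)" "nrm (sym_space_s1 n) = nrm (mat_space_s1 n n)"
    by (simp_all add: sym_space_s1_def mat_space_s1_def)
  show ?thesis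
  proof
    show "finite ({..<n} \<times> {..<n})" by simp
  next
    fix x y :: "real mat" and s t :: real
    assume "x \<in> points (sym_space_s1 n)" "y \<in> points (sym_space_s1 n)"
    then show "x - y \<in> points (sym_space_s1 n)" "scale (sym_space_s1 n) s x + scale (sym_space_s1 n) t y \<in> points (sym_space_s1 n)"
      by (auto simp: sym_space_s1_def sym_mats_iff)
  qed (auto simp: eq dest!: sub intro: M.ent_minus M.ent_comb M.ent_eqI M.nrm_nonneg M.nrm_comb M.nrm_zero)
qed

lemma (in entry_space) closed_convex_cone_points: 
  assumes "x \<in> points V" "\<And>x t. x \<in> points V \<Longrightarrow> scale V t x \<in> points V"
  shows "closed_convex_cone V (points V)"
  using assms comb_closed by (auto simp: closed_convex_cone_def convex_set_def closed_in_norm_def)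

text \<open>
  Off the support of \<open>a\<close> nothing is lost; on the support the loss is at most \<open>2 \<bar>h i\<bar>\<close>.
\<close>

lemma l1_norm_decomposable:
  fixes a h :: "nat \<Rightarrow> real"
  assumes "card {i. i < n \<and> a i \<noteq> 0} \<le> k"
  shows "(\<Sum>i<n. \<bar>a i\<bar>) + (\<Sum>i<n. \<bar>h i\<bar>) - 4 * sqrt (real k) * L2_set h {..<n} \<le> (\<Sum>i<n. \<bar>a i + h i\<bar>)"
proof -
  define T where "T = {i. i < n \<and> a i \<noteq> 0}"
  have T: "T \<subseteq> {..<n}" by (auto simp: T_def)
  have "(\<Sum>i\<in>T. \<bar>h i\<bar>) \<le> sqrt (real k) * L2_set h {..<n}"
  proof (rule sum_le_sqrt_card)
    have "(\<Sum>i\<in>T. \<bar>h i\<bar>\<^sup>2) \<le> (\<Sum>i<n. \<bar>h i\<bar>\<^sup>2)" using T by (intro sum_mono2) auto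
    then show "(\<Sum>i\<in>T. \<bar>h i\<bar>\<^sup>2) \<le> (L2_set h {..<n})\<^sup>2" by (simp add: L2_set_def sum_nonneg)
  qed (use assms in \<open>auto simp: T_def\<close>)
  moreover have "0 \<le> sqrt (real k) * L2_set h {..<n}" by (intro mult_nonneg_nonneg) auto
  ultimately have "2 * (\<Sum>i\<in>T. \<bar>h i\<bar>) \<le> 4 * sqrt (real k) * L2_set h {..<n}"
    unfolding mult.assoc by linarith
  moreover have "(\<Sum>i<n. \<bar>a i\<bar> + \<bar>h i\<bar> - 2 * (if i \<in> T then \<bar>h i\<bar> else 0)) \<le> (\<Sum>i<n. \<bar>a i + h i\<bar>)"
    by (intro sum_mono) (auto simp: T_def)
  moreover have "(\<Sum>i<n. if i \<in> T then \<bar>h i\<bar> else 0) = (\<Sum>i\<in>T. \<bar>h i\<bar>)"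
    using T by (simp add: sum.inter_restrict[symmetric] Int_absorb1)
  ultimately show ?thesis by (simp add: sum.distrib sum_subtractf flip: sum_distrib_left)
qed

lemma sharp_setup_sparse:
  assumes x0: "x0 \<in> sparse_vecs n k" and k: "1 \<le> k" and g: "g = avg1 \<or> g = avg2"
  shows "sharp_setup (vec_space_l1 n) ($) {..<n} l1_norm (carrier_vec n) x0 k g"
proof -
  interpret entry_space "vec_space_l1 n" "($)" "{..<n}" by (rule entry_space_vec)
  have V: "points (vec_space_l1 n) = carrier_vec n" "nrm (vec_space_l1 n) = l1_norm"
    by (simp_all add: vec_space_l1_def)
  have x0c: "x0 \<in> carrier_vec n" using x0 by (simp add: sparse_vecs_def)
  show ?thesis
  proof unfold_locales
    show "convex_fun (vec_space_l1 n) l1_norm" using convex_fun_nrm by (simp add: V)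
    show "\<bar>l1_norm x - l1_norm y\<bar> \<le> nrm (vec_space_l1 n) (x - y)"
      if "x \<in> points (vec_space_l1 n)" "y \<in> points (vec_space_l1 n)" for x y
      using nrm_lipschitz[OF that] by (simp add: V)
    show cone: "closed_convex_cone (vec_space_l1 n) (carrier_vec n)"
      using closed_convex_cone_points[of x0] x0c by (simp add: vec_space_l1_def)
    show "nrm (vec_space_l1 n) x0 + nrm (vec_space_l1 n) (x - x0) -
        4 * sqrt (real k) * L2_set (\<lambda>e. x $ e - x0 $ e) {..<n} \<le> l1_norm x + 2 * dist_to (vec_space_l1 n) x (carrier_vec n)"
      if x: "x \<in> points (vec_space_l1 n)" for x
    proof -
      have xc: "x \<in> carrier_vec n" using x V by simp
      have "l1_norm x0 + l1_norm (x - x0) - 4 * sqrt (real k) * L2_set (\<lambda>e. x $ e - x0 $ e) {..<n} \<le> l1_norm x"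
        using l1_norm_decomposable[of n "($) x0" k "\<lambda>e. x $ e - x0 $ e"] x0 x0c xc
        by (simp add: l1_norm_def sparse_vecs_def)
      moreover have "0 \<le> dist_to (vec_space_l1 n) x (carrier_vec n)"
        using x0c x by (intro dist_to_nonneg) (auto simp: V)
      ultimately show ?thesis by (simp add: V)
    qed
  qed (use x0c k g in \<open>auto simp: V\<close>)
qed

lemma sharp_setup_low_rank:
  assumes x0: "x0 \<in> rank_le n N k" and k: "1 \<le> k" and g: "g = avg1 \<or> g = avg2"
  shows "sharp_setup (mat_space_s1 n N) ($$) ({..<n} \<times> {..<N}) schatten1_norm (carrier_mat n N) x0 k g"
proof -
  interpret entry_space "mat_space_s1 n N" "($$)" "{..<n} \<times> {..<N}" by (rule entry_space_mat)
  have V: "points (mat_space_s1 n N) = carrier_mat n N" "nrm (mat_space_s1 n N) = schatten1_norm"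
    by (simp_all add: mat_space_s1_def)
  have x0c: "x0 \<in> carrier_mat n N" "vec_space.rank n x0 \<le> k" using x0 by (auto simp: rank_le_def)
  show ?thesis
  proof unfold_locales
    show "convex_fun (mat_space_s1 n N) schatten1_norm" using convex_fun_nrm by (simp add: V)
    show "\<bar>schatten1_norm x - schatten1_norm y\<bar> \<le> nrm (mat_space_s1 n N) (x - y)"
      if "x \<in> points (mat_space_s1 n N)" "y \<in> points (mat_space_s1 n N)" for x y
      using nrm_lipschitz[OF that] by (simp add: V)
    show cone: "closed_convex_cone (mat_space_s1 n N) (carrier_mat n N)"
      using closed_convex_cone_points[of x0] x0c by (simp add: mat_space_s1_def)
    show "nrm (mat_space_s1 n N) x0 + nrm (mat_space_s1 n N) (x - x0) -
        4 * sqrt (real k) * L2_set (\<lambda>e. x $$ e - x0 $$ e) ({..<n} \<times> {..<N}) \<le>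
        schatten1_norm x + 2 * dist_to (mat_space_s1 n N) x (carrier_mat n N)"
      if x: "x \<in> points (mat_space_s1 n N)" for x
    proof -
      have xc: "x \<in> carrier_mat n N" using x V by simp
      have hc: "x - x0 \<in> carrier_mat n N" using x0c(1) by (rule minus_carrier_mat)
      have "x0 + (x - x0) = x" using xc x0c by (intro eq_matI) auto
      moreover have "L2_set (($$) (x - x0)) ({..<n} \<times> {..<N}) = L2_set (\<lambda>e. x $$ e - x0 $$ e) ({..<n} \<times> {..<N})"
        using xc x0c by (intro L2_set_cong) auto
      ultimately have "schatten1_norm x0 + schatten1_norm (x - x0) -
          4 * sqrt (real k) * L2_set (\<lambda>e. x $$ e - x0 $$ e) ({..<n} \<times> {..<N}) \<le> schatten1_norm x"
        using nuclear_norm_decomposable[OF x0c(1) hc x0c(2)] by simp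
      moreover have "0 \<le> dist_to (mat_space_s1 n N) x (carrier_mat n N)"
        using x0c x by (intro dist_to_nonneg) (auto simp: V)
      ultimately show ?thesis by (simp add: V)
    qed
  qed (use x0c k g in \<open>auto simp: V\<close>)
qed

lemma psd_mats_iff: "X \<in> psd_mats n \<longleftrightarrow> X \<in> sym_mats n \<and> (\<forall>x. 0 \<le> bil n n (($$) X) x x)"
proof
  assume "X \<in> psd_mats n"
  then show "X \<in> sym_mats n \<and> (\<forall>x. 0 \<le> bil n n (($$) X) x x)"
    using psd_bil_nonneg by (auto simp: psd_mats_def)
next
  assume R: "X \<in> sym_mats n \<and> (\<forall>x. 0 \<le> bil n n (($$) X) x x)"
  then have X: "X \<in> carrier_mat n n" by (simp add: sym_mats_def)
  have "v \<bullet> (X *\<^sub>v v) = bil n n (($$) X) (($) v) (($) v)" if v: "v \<in> carrier_vec n" for v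
  proof -
    have "v \<bullet> (X *\<^sub>v v) = (\<Sum>p<n. v $ p * (\<Sum>q<n. X $$ (p, q) * v $ q))"
      using X v by (simp add: scalar_prod_def atLeast0LessThan row_def)
    then show ?thesis by (simp add: bil_def sum_distrib_left mult_ac)
  qed
  then show "X \<in> psd_mats n" using R by (simp add: psd_mats_def)
qed

text \<open>
  Closedness holds because each quadratic form is continuous with respect to the nuclear norm.
\<close>

lemma closed_convex_cone_psd: "closed_convex_cone (sym_space_s1 n) (psd_mats n)"
proof -
  interpret entry_space "sym_space_s1 n" "($$)" "{..<n} \<times> {..<n}" by (rule entry_space_sym)
  have V: "points (sym_space_s1 n) = sym_mats n" "nrm (sym_space_s1 n) = schatten1_norm" "scale (sym_space_s1 n) = (\<cdot>\<^sub>m)"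
    by (simp_all add: sym_space_s1_def)
  have comb: "bil n n (($$) (s \<cdot>\<^sub>m X + t \<cdot>\<^sub>m Y)) x x = s * bil n n (($$) X) x x + t * bil n n (($$) Y) x x"
    if "X \<in> sym_mats n" "Y \<in> sym_mats n" for s t X Y x
  proof -
    have "bil n n (($$) (s \<cdot>\<^sub>m X + t \<cdot>\<^sub>m Y)) x x = bil n n (\<lambda>e. s * X $$ e + t * Y $$ e) x x"
      using that by (intro bil_cong) (auto simp: sym_mats_def)
    then show ?thesis by (simp add: bil_add bil_scale)
  qed
  have sub: "psd_mats n \<subseteq> sym_mats n" by (auto simp: psd_mats_def)
  have "0\<^sub>m n n \<in> psd_mats n" by (auto simp: psd_mats_iff sym_mats_iff bil_def)
  moreover have "convex_set (sym_space_s1 n) (psd_mats n)"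
    unfolding convex_set_def V
  proof (intro conjI ballI sub)
    fix X Y and t :: real assume XY: "X \<in> psd_mats n" "Y \<in> psd_mats n" and t: "t \<in> {0..1}"
    have "(1 - t) \<cdot>\<^sub>m X + t \<cdot>\<^sub>m Y \<in> sym_mats n"
      using comb_closed[of X Y "1 - t" t] XY sub by (auto simp: V)
    moreover have "0 \<le> bil n n (($$) ((1 - t) \<cdot>\<^sub>m X + t \<cdot>\<^sub>m Y)) x x" for x
      using XY t sub by (subst comb) (auto simp: psd_mats_iff intro!: add_nonneg_nonneg mult_nonneg_nonneg)
    ultimately show "(1 - t) \<cdot>\<^sub>m X + t \<cdot>\<^sub>m Y \<in> psd_mats n" by (simp add: psd_mats_iff)
  qed
  moreover have "\<forall>X\<in>psd_mats n. \<forall>t\<ge>0. t \<cdot>\<^sub>m X \<in> psd_mats n"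
  proof (intro ballI allI impI)
    fix X and t :: real assume X: "X \<in> psd_mats n" and t: "0 \<le> t"
    have Xs: "X \<in> carrier_mat n n" using X sub by (auto simp: sym_mats_def)
    have "bil n n (($$) (t \<cdot>\<^sub>m X)) x x = t * bil n n (($$) X) x x" for x
      unfolding bil_scale[symmetric] using Xs by (intro bil_cong) auto
    then show "t \<cdot>\<^sub>m X \<in> psd_mats n" using X t by (auto simp: psd_mats_iff sym_mats_iff)
  qed
  moreover have "closed_in_norm (sym_space_s1 n) (psd_mats n)"
    unfolding closed_in_norm_def V
  proof (intro allI ballI impI)
    fix s :: "nat \<Rightarrow> real mat" and X
    assume X: "X \<in> sym_mats n" and s: "(\<forall>i. s i \<in> psd_mats n) \<and> (\<lambda>i. schatten1_norm (s i - X)) \<longlonglongrightarrow> 0"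
    have "0 \<le> bil n n (($$) X) x x" for x
    proof -
      have low: "- (dotp {..<n} x x * schatten1_norm (s i - X)) \<le> bil n n (($$) X) x x" for i
      proof -
        have c: "s i \<in> carrier_mat n n" "X \<in> carrier_mat n n" using s X sub by (auto simp: sym_mats_def)
        have "bil n n (($$) (s i - X)) x x = bil n n (\<lambda>e. s i $$ e - X $$ e) x x"
          using c by (intro bil_cong) auto
        then have "bil n n (($$) (s i - X)) x x = bil n n (($$) (s i)) x x - bil n n (($$) X) x x"
          by (simp add: bil_diff)
        moreover have "\<bar>bil n n (($$) (s i - X)) x x\<bar> \<le> dotp {..<n} x x * schatten1_norm (s i - X)"
          using c by (intro abs_bil_le_general) auto
        moreover have "0 \<le> bil n n (($$) (s i)) x x" using s by (auto intro: psd_bil_nonneg)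
        ultimately show ?thesis by linarith
      qed
      have "(\<lambda>i. - (dotp {..<n} x x * schatten1_norm (s i - X))) \<longlonglongrightarrow> - (dotp {..<n} x x * 0)"
        using s by (intro tendsto_intros) auto
      then have "- (dotp {..<n} x x * 0) \<le> bil n n (($$) X) x x"
        by (rule LIMSEQ_le_const2) (use low in auto)
      then show ?thesis by simp
    qed
    then show "X \<in> psd_mats n" using X by (simp add: psd_mats_iff)
  qed
  ultimately show ?thesis unfolding closed_convex_cone_def V by auto
qed

text \<open>
  For \<open>y\<close> in the cone, \<open>\<parallel>x\<parallel> \<le> \<parallel>x - y\<parallel> + tr y \<le> tr x + 2 \<parallel>x - y\<parallel>\<close>. So the trace plus twice the distance to the
  cone dominates the nuclear norm, with equality at the signal, and decomposability is inherited. This is why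
  the weight of the distance is 2.
\<close>

lemma sharp_setup_psd:
  assumes x0: "x0 \<in> psd_mats n \<inter> rank_le n n k" and k: "1 \<le> k" and g: "g = avg1 \<or> g = avg2"
  shows "sharp_setup (sym_space_s1 n) ($$) ({..<n} \<times> {..<n}) mat_trace (psd_mats n) x0 k g"
proof -
  interpret entry_space "sym_space_s1 n" "($$)" "{..<n} \<times> {..<n}" by (rule entry_space_sym)
  have V: "points (sym_space_s1 n) = sym_mats n" "nrm (sym_space_s1 n) = schatten1_norm"
    by (simp_all add: sym_space_s1_def)
  have sub: "psd_mats n \<subseteq> sym_mats n" by (auto simp: psd_mats_def)
  have car: "X \<in> carrier_mat n n" if "X \<in> sym_mats n" for X using that by (simp add: sym_mats_def)
  have x0': "x0 \<in> psd_mats n" "x0 \<in> sym_mats n" "x0 \<in> rank_le n n k" using x0 sub by auto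
  interpret M: sharp_setup "mat_space_s1 n n" "($$)" "{..<n} \<times> {..<n}" schatten1_norm "carrier_mat n n" x0 m k g
    by (rule sharp_setup_low_rank[OF x0'(3) k g])
  have tr: "mat_trace x - mat_trace y = mat_trace (x - y)" if "x \<in> sym_mats n" "y \<in> sym_mats n" for x y
    using car[OF that(1)] car[OF that(2)] by (simp add: mat_trace_def sum_subtractf)
  have lip: "\<bar>mat_trace x - mat_trace y\<bar> \<le> schatten1_norm (x - y)" if "x \<in> sym_mats n" "y \<in> sym_mats n" for x y
    unfolding tr[OF that] by (rule abs_trace_le[OF minus_carrier_mat[OF car[OF that(2)]]])
  have nuc: "schatten1_norm x \<le> mat_trace x + 2 * dist_to (sym_space_s1 n) x (psd_mats n)" if x: "x \<in> sym_mats n" for x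
  proof -
    have "(schatten1_norm x - mat_trace x) / 2 \<le> dist_to (sym_space_s1 n) x (psd_mats n)"
      unfolding dist_to_def V
    proof (rule cINF_greatest)
      show "psd_mats n \<noteq> {}" using x0' by auto
      fix y assume y: "y \<in> psd_mats n"
      have "schatten1_norm x \<le> schatten1_norm (x - y) + schatten1_norm y"
        using nrm_triangle[of x y] x y sub by (auto simp: V)
      moreover have "mat_trace y \<le> mat_trace x + schatten1_norm (x - y)" using lip[of x y] x y sub by auto
      ultimately show "(schatten1_norm x - mat_trace x) / 2 \<le> schatten1_norm (x - y)"
        using schatten1_psd[OF y] by simp
    qed
    then show ?thesis by simp
  qed
  show ?thesis
  proof unfold_locales
    have "mat_trace (scale (sym_space_s1 n) (1 - t) x + scale (sym_space_s1 n) t y) = (1 - t) * mat_trace x + t * mat_trace y"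
      if "x \<in> sym_mats n" "y \<in> sym_mats n" for x y t
      using car[OF that(1)] car[OF that(2)]
      by (simp add: mat_trace_def sym_space_s1_def sum.distrib sum_distrib_left)
    then show "convex_fun (sym_space_s1 n) mat_trace" by (simp add: convex_fun_def V)
    show "\<bar>mat_trace x - mat_trace y\<bar> \<le> nrm (sym_space_s1 n) (x - y)"
      if "x \<in> points (sym_space_s1 n)" "y \<in> points (sym_space_s1 n)" for x y
      using lip that by (simp add: V)
    show "closed_convex_cone (sym_space_s1 n) (psd_mats n)" by (rule closed_convex_cone_psd)
    show "mat_trace x0 = nrm (sym_space_s1 n) x0" using schatten1_psd[OF x0'(1)] by (simp add: V)
    show "nrm (sym_space_s1 n) x0 + nrm (sym_space_s1 n) (x - x0) -
        4 * sqrt (real k) * L2_set (\<lambda>e. x $$ e - x0 $$ e) ({..<n} \<times> {..<n}) \<le>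
        mat_trace x + 2 * dist_to (sym_space_s1 n) x (psd_mats n)"
      if x: "x \<in> points (sym_space_s1 n)" for x
    proof -
      have xs: "x \<in> sym_mats n" using x by (simp add: V)
      have MV: "points (mat_space_s1 n n) = carrier_mat n n" "nrm (mat_space_s1 n n) = schatten1_norm"
        by (simp_all add: mat_space_s1_def)
      have "dist_to (mat_space_s1 n n) x (carrier_mat n n) = 0"
      proof (rule antisym)
        have "dist_to (mat_space_s1 n n) x (carrier_mat n n) \<le> nrm (mat_space_s1 n n) (x - x)"
          using car[OF xs] by (intro M.dist_to_le) (auto simp: MV)
        then show "dist_to (mat_space_s1 n n) x (carrier_mat n n) \<le> 0"
          using M.nrm_minus_self[of x] car[OF xs] by (simp add: MV)
        show "0 \<le> dist_to (mat_space_s1 n n) x (carrier_mat n n)"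
          using car[OF xs] by (intro M.dist_to_nonneg) (auto simp: MV)
      qed
      then show ?thesis using M.decomposable[of x] car[OF xs] nuc[OF xs] by (simp add: V MV)
    qed
  qed (use x0' k g in \<open>auto simp: V\<close>)
qed

section \<open>The design as a standard Gaussian family\<close>

lemma product_normal_std_gaussians:
  fixes J :: "'j set" and \<sigma> :: real
  assumes \<sigma>: "0 < \<sigma>" and J: "J \<noteq> {}"
  shows "std_gaussians (\<Pi>\<^sub>M j\<in>J. density lborel (normal_density 0 \<sigma>)) J (\<lambda>j \<omega>. \<omega> j / \<sigma>)"
proof -
  let ?N = "density lborel (\<lambda>x. ennreal (normal_density 0 \<sigma> x))"
  let ?M = "\<Pi>\<^sub>M j\<in>J. ?N"
  interpret prob_space ?M by (intro prob_space_PiM prob_space_normal_density \<sigma>)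
  interpret P: product_prob_space "\<lambda>_. ?N" J
    by (intro product_prob_spaceI prob_space_normal_density \<sigma>)
  have rv: "(\<lambda>\<omega>. \<omega> j) \<in> borel_measurable ?M" if "j \<in> J" for j
  proof -
    have "(\<lambda>\<omega>. \<omega> j) \<in> measurable ?M ?N" using that by (rule measurable_component_singleton)
    then show ?thesis by (simp cong: measurable_cong_sets)
  qed
  have d: "distr ?M lborel (\<lambda>\<omega>. \<omega> j) = ?N" if "j \<in> J" for j
  proof -
    have "distr ?M lborel (\<lambda>\<omega>. \<omega> j) = distr ?M ?N (\<lambda>\<omega>. \<omega> j)" by (rule distr_cong) auto
    then show ?thesis using P.PiM_component[OF that] by simp
  qed
  have db: "distr ?M borel (\<lambda>\<omega>. \<omega> j) = ?N" if "j \<in> J" for j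
  proof -
    have "distr ?M borel (\<lambda>\<omega>. \<omega> j) = distr ?M lborel (\<lambda>\<omega>. \<omega> j)" by (rule distr_cong) auto
    then show ?thesis using d[OF that] by (rule trans)
  qed
  have "distr ?M (\<Pi>\<^sub>M j\<in>J. borel) (\<lambda>\<omega>. \<lambda>j\<in>J. \<omega> j) = distr ?M ?M (\<lambda>\<omega>. \<omega>)"
  proof (rule distr_cong)
    show "sets (\<Pi>\<^sub>M j\<in>J. borel) = sets ?M" by (rule sets_PiM_cong) auto
    show "(\<lambda>j\<in>J. \<omega> j) = \<omega>" if "\<omega> \<in> space ?M" for \<omega>
      using that by (simp add: space_PiM PiE_restrict)
  qed simp
  also have "\<dots> = ?M" by (rule distr_id)
  also have "\<dots> = (\<Pi>\<^sub>M j\<in>J. distr ?M borel (\<lambda>\<omega>. \<omega> j))" by (rule PiM_cong) (simp_all add: db)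
  finally have "indep_vars (\<lambda>_. borel) (\<lambda>j \<omega>. \<omega> j) J"
    using rv J by (subst indep_vars_iff_distr_eq_PiM') auto
  then have "indep_vars (\<lambda>_. borel) (\<lambda>j \<omega>. \<omega> j / \<sigma>) J"
    by (rule indep_vars_compose2[where Y = "\<lambda>_ x. x / \<sigma>"]) auto
  moreover have "distributed ?M lborel (\<lambda>\<omega>. \<omega> j / \<sigma>) std_normal_density" if j: "j \<in> J" for j
  proof -
    have "distributed ?M lborel (\<lambda>\<omega>. \<omega> j) (normal_density 0 \<sigma>)"
      unfolding distributed_def using rv[OF j] d[OF j] by simp
    then show ?thesis using normal_standard_normal_convert[OF \<sigma>, of "\<lambda>\<omega>. \<omega> j" 0] by simp
  qed
  ultimately show ?thesis unfolding std_gaussians_def using prob_space_axioms by blast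
qed

section \<open>Restricted isometry events\<close>

text \<open>
  The logarithm of the size of the net is at most this constant times the threshold.
\<close>

definition low_rank_entropy :: real where
  "low_rank_entropy = 2 * real \<tau> * (4 / \<epsilon>\<^sub>0\<^sup>2 + 2)"

text \<open>
  The factor 2 in front of the mesh term turns the additive constant of the net size into a multiple
  of the threshold, whose logarithmic factor is at least \<open>1/2\<close>.
\<close>

definition sparse_entropy :: real where
  "sparse_entropy = real \<tau> * (2 * (1 / \<epsilon>\<^sub>0\<^sup>2 + 2) + 1)"

lemma low_rank_isometry:
  assumes ens: "ensemble M m ({..<n} \<times> {..<N}) Z g" and m: "1 \<le> m" and g: "g = avg1 \<or> g = avg2"
    and n: "1 \<le> n" "1 \<le> N" and k: "1 \<le> k"
  shows "\<exists>A\<in>sets M. 1 - 2 * exp (low_rank_entropy * (real (max n N) * real k) - c\<^sub>0 * real m) \<le> measure M A \<and>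
    (\<forall>\<omega>\<in>A. \<forall>H\<in>carrier_mat n N.
      g m (\<lambda>i. dotp ({..<n} \<times> {..<N}) (($$) H) (\<lambda>e. Z i e \<omega>)) \<le> 12 * schatten1_norm H \<and>
      (schatten1_norm H \<le> 8 * sqrt (real k) * L2_set (($$) H) ({..<n} \<times> {..<N}) \<longrightarrow>
       \<alpha>\<^sub>0 / 4 * L2_set (($$) H) ({..<n} \<times> {..<N}) \<le> avg1 m (\<lambda>i. dotp ({..<n} \<times> {..<N}) (($$) H) (\<lambda>e. Z i e \<omega>))))"
proof -
  let ?E = "{..<n} \<times> {..<N}"
  have K: "1 \<le> \<tau> * k" using \<tau>(1) k by simp
  have half: "2 * (\<epsilon>\<^sub>0 / 2) = \<epsilon>\<^sub>0" by simp
  have "has_net ?E (low_rank n N (\<tau> * k)) (2 * (\<epsilon>\<^sub>0 / 2)) (real (\<tau> * k) * real (n + N) * (1 / (\<epsilon>\<^sub>0 / 2)\<^sup>2 + 2))"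
    using \<epsilon>\<^sub>0(1) by (intro low_rank_net n K) simp
  moreover have "real (\<tau> * k) * real (n + N) * (1 / (\<epsilon>\<^sub>0 / 2)\<^sup>2 + 2) \<le> low_rank_entropy * (real (max n N) * real k)"
  proof -
    have "real (\<tau> * k) * real (n + N) * (1 / (\<epsilon>\<^sub>0 / 2)\<^sup>2 + 2) \<le>
        real (\<tau> * k) * (2 * real (max n N)) * (1 / (\<epsilon>\<^sub>0 / 2)\<^sup>2 + 2)"
      by (intro mult_right_mono mult_left_mono) auto
    also have "\<dots> = low_rank_entropy * (real (max n N) * real k)"
      by (simp add: low_rank_entropy_def power_divide algebra_simps)
    finally show ?thesis .
  qed
  ultimately have net: "has_net ?E (low_rank n N (\<tau> * k)) \<epsilon>\<^sub>0 (low_rank_entropy * (real (max n N) * real k))"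
    unfolding half by (rule has_net_mono)
  have cone: "low_rank n N (\<tau> * k) (\<lambda>e. c * h e)" if lr: "low_rank n N (\<tau> * k) h" for h c
  proof -
    obtain x y where "\<forall>p<n. \<forall>q<N. h (p, q) = (\<Sum>i<\<tau> * k. x i p * y i q)" using lr unfolding low_rank_def by blast
    then have "\<forall>p<n. \<forall>q<N. c * h (p, q) = (\<Sum>i<\<tau> * k. (c * x i p) * y i q)"
      by (simp add: sum_distrib_left mult.assoc)
    then show ?thesis unfolding low_rank_def by (intro exI)
  qed
  have D0: "low_rank n N (\<tau> * k) (\<lambda>_. 0)"
    unfolding low_rank_def by (rule exI[of _ "\<lambda>_ _. 0"]) simp
  have E: "finite ?E" by simp
  obtain A where A: "A \<in> sets M"
    "1 - 2 * exp (low_rank_entropy * (real (max n N) * real k) - c\<^sub>0 * real m) \<le> measure M A"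
    and rip: "\<And>\<omega> h. \<omega> \<in> A \<Longrightarrow> low_rank n N (\<tau> * k) h \<Longrightarrow> g m (\<lambda>i. dotp ?E h (\<lambda>e. Z i e \<omega>)) \<le> 12 * L2_set h ?E"
      "\<And>\<omega> h. \<omega> \<in> A \<Longrightarrow> low_rank n N (\<tau> * k) h \<Longrightarrow> \<alpha>\<^sub>0 / 2 * L2_set h ?E \<le> avg1 m (\<lambda>i. dotp ?E h (\<lambda>e. Z i e \<omega>))"
    using rip_with_high_probability[OF ens m g E net cone D0] by blast
  show ?thesis
  proof (rule bexI[OF _ A(1)], intro conjI A(2) ballI impI)
    fix \<omega> and H :: "real mat" assume \<omega>: "\<omega> \<in> A" and H: "H \<in> carrier_mat n N"
    show "g m (\<lambda>i. dotp ?E (($$) H) (\<lambda>e. Z i e \<omega>)) \<le> 12 * schatten1_norm H"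
      by (rule low_rank_compressible_rip(1)[OF g k H]) ((rule rip[OF \<omega>] | assumption)+)
    show "\<alpha>\<^sub>0 / 4 * L2_set (($$) H) ?E \<le> avg1 m (\<lambda>i. dotp ?E (($$) H) (\<lambda>e. Z i e \<omega>))"
      if "schatten1_norm H \<le> 8 * sqrt (real k) * L2_set (($$) H) ?E"
      by (rule low_rank_compressible_rip(2)[OF g k H]) ((rule rip[OF \<omega>] that | assumption)+)
  qed
qed

lemma ln2_ge_half: "1/2 \<le> ln (2::real)"
  using ln2_ge_two_thirds by simp

lemma sparse_isometry:
  assumes ens: "ensemble M m {..<n} Z g" and m: "1 \<le> m" and g: "g = avg1 \<or> g = avg2"
    and n: "1 \<le> n" and k: "1 \<le> k"
  shows "\<exists>A\<in>sets M. 1 - 2 * exp (sparse_entropy * sparse_threshold n k - c\<^sub>0 * real m) \<le> measure M A \<and>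
    (\<forall>\<omega>\<in>A. \<forall>h.
      g m (\<lambda>i. dotp {..<n} h (\<lambda>e. Z i e \<omega>)) \<le> 12 * (\<Sum>i<n. \<bar>h i\<bar>) \<and>
      ((\<Sum>i<n. \<bar>h i\<bar>) \<le> 8 * sqrt (real k) * L2_set h {..<n} \<longrightarrow>
       \<alpha>\<^sub>0 / 4 * L2_set h {..<n} \<le> avg1 m (\<lambda>i. dotp {..<n} h (\<lambda>e. Z i e \<omega>))))"
proof -
  define K where "K = real (\<tau> * k)"
  define L where "L = max (ln 2) (ln (real n / real k))"
  have K: "0 < K" "K = real \<tau> * real k" using \<tau>(1) k by (auto simp: K_def)
  have L: "1/2 \<le> L" using ln2_ge_half by (simp add: L_def)
  have lnK: "max 0 (ln (real (card {..<n}) / K)) \<le> L"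
  proof -
    have "real n / K \<le> real n / real k"
      using K k \<tau>(1) by (intro divide_left_mono) (auto simp: mult_le_cancel_right1)
    then have "ln (real n / K) \<le> ln (real n / real k)" using n K(1) k by (subst ln_le_cancel_iff) auto
    then show ?thesis using L by (simp add: L_def)
  qed
  have "has_net {..<n} (sparse_on {..<n} K) \<epsilon>\<^sub>0 (K * (1 / \<epsilon>\<^sub>0\<^sup>2 + 2 + max 0 (ln (real (card {..<n}) / K))))"
    by (intro sparse_net K \<epsilon>\<^sub>0(1)) simp
  moreover have "K * (1 / \<epsilon>\<^sub>0\<^sup>2 + 2 + max 0 (ln (real (card {..<n}) / K))) \<le> sparse_entropy * sparse_threshold n k"
  proof -
    have e1: "(1 / \<epsilon>\<^sub>0\<^sup>2 + 2) * 1 \<le> (1 / \<epsilon>\<^sub>0\<^sup>2 + 2) * (2 * L)" using L by (intro mult_left_mono) auto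
    then have "1 / \<epsilon>\<^sub>0\<^sup>2 + 2 + max 0 (ln (real (card {..<n}) / K)) \<le> (1 / \<epsilon>\<^sub>0\<^sup>2 + 2) * (2 * L) + L"
      by (intro add_mono lnK) (use e1 in simp)
    also have "\<dots> = (2 * (1 / \<epsilon>\<^sub>0\<^sup>2 + 2) + 1) * L" by (simp add: algebra_simps)
    finally have "K * (1 / \<epsilon>\<^sub>0\<^sup>2 + 2 + max 0 (ln (real (card {..<n}) / K))) \<le> K * ((2 * (1 / \<epsilon>\<^sub>0\<^sup>2 + 2) + 1) * L)"
      by (rule mult_left_mono) (use K in simp)
    also have "\<dots> = sparse_entropy * sparse_threshold n k"
      by (simp add: sparse_entropy_def sparse_threshold_def K(2) L_def)
    finally show ?thesis .
  qed
  ultimately have net: "has_net {..<n} (sparse_on {..<n} K) \<epsilon>\<^sub>0 (sparse_entropy * sparse_threshold n k)"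
    by (rule has_net_mono)
  have cone: "sparse_on {..<n} K (\<lambda>e. c * h e)" if "sparse_on {..<n} K h" for h c
  proof -
    have "card {e\<in>{..<n}. c * h e \<noteq> 0} \<le> card {e\<in>{..<n}. h e \<noteq> 0}" by (intro card_mono) auto
    then show ?thesis using that unfolding sparse_on_def by linarith
  qed
  have D0: "sparse_on {..<n} K (\<lambda>_. 0)" using K by (simp add: sparse_on_def)
  obtain A where A: "A \<in> sets M"
    "1 - 2 * exp (sparse_entropy * sparse_threshold n k - c\<^sub>0 * real m) \<le> measure M A"
    and rip: "\<And>\<omega> h. \<omega> \<in> A \<Longrightarrow> sparse_on {..<n} K h \<Longrightarrow> g m (\<lambda>i. dotp {..<n} h (\<lambda>e. Z i e \<omega>)) \<le> 12 * L2_set h {..<n}"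
      "\<And>\<omega> h. \<omega> \<in> A \<Longrightarrow> sparse_on {..<n} K h \<Longrightarrow> \<alpha>\<^sub>0 / 2 * L2_set h {..<n} \<le> avg1 m (\<lambda>i. dotp {..<n} h (\<lambda>e. Z i e \<omega>))"
    using rip_with_high_probability[OF ens m g finite_lessThan net cone D0] by blast
  show ?thesis
  proof (rule bexI[OF _ A(1)], intro conjI A(2) ballI allI impI)
    fix \<omega> and h :: "nat \<Rightarrow> real" assume \<omega>: "\<omega> \<in> A"
    show "g m (\<lambda>i. dotp {..<n} h (\<lambda>e. Z i e \<omega>)) \<le> 12 * (\<Sum>i<n. \<bar>h i\<bar>)"
      by (rule sparse_compressible_rip(1)[OF g k, folded K_def]) ((rule rip[OF \<omega>] | assumption)+)
    show "\<alpha>\<^sub>0 / 4 * L2_set h {..<n} \<le> avg1 m (\<lambda>i. dotp {..<n} h (\<lambda>e. Z i e \<omega>))"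
      if "(\<Sum>i<n. \<bar>h i\<bar>) \<le> 8 * sqrt (real k) * L2_set h {..<n}"
      by (rule sparse_compressible_rip(2)[OF g k, folded K_def]) ((rule rip[OF \<omega>] that | assumption)+)
  qed
qed

section \<open>Sharp recovery with high probability\<close>

definition sharp_recovery_whp :: "'v::{plus,minus} scenario \<Rightarrow> bool" where
  "sharp_recovery_whp sc \<longleftrightarrow> (\<exists>C>0. \<exists>c\<^sub>1>0. \<exists>c\<^sub>2>0. \<exists>c>0.
        \<forall>n\<ge>1. \<forall>N\<ge>1. \<forall>k\<ge>1. \<forall>m. \<forall>x0 \<in> signals sc n N k.
          real m \<ge> C * threshold sc n N k \<longrightarrow>
          measure (design_law sc n N m) {\<omega> \<in> space (design_law sc n N m).
            recovery_sharp sc n N m x0 (1/2) (sqrt (c\<^sub>1 * real k)) 2 \<omega> \<and>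
            (\<exists>L \<kappa>. L \<le> sqrt (c\<^sub>2 * real k) \<and>
               lipschitz (space_V sc n N)
                 L (recovery_penalized sc n N m x0 (sqrt (c\<^sub>1 * real k)) 2 \<omega>) \<and>
               has_condition_number (space_V sc n N)
                 (recovery_penalized sc n N m x0 (sqrt (c\<^sub>1 * real k)) 2 \<omega>) x0 (1/2) L \<kappa> \<and>
               \<kappa> \<le> 2 * sqrt (c\<^sub>2 * real k))}
          > 1 - exp (- c * real m))"

text \<open>
  The net size and the factor 4 of the union bound cost at most half of the exponent once \<open>m\<close> is a
  large multiple of the threshold. The threshold is at least \<open>ln 2\<close>, which also absorbs the factor 4.
\<close>

lemma failure_probability_absorbed:
  fixes \<Lambda> T a :: real
  assumes "0 \<le> \<Lambda>" "ln 2 \<le> T" "0 < a" "a \<le> 1" and m: "2 * (\<Lambda> + 4) / a * T \<le> real m"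
  shows "4 * exp (\<Lambda> * T - a * real m) < exp (- (a / 2) * real m)" "2 \<le> m"
proof -
  have am: "2 * ((\<Lambda> + 4) * T) \<le> a * real m" using m assms(3) by (simp add: field_simps)
  have T: "1/2 \<le> T" using ln2_ge_half assms(2) by linarith
  have "ln 4 = 2 * ln (2::real)" using ln_realpow[of "2::real" 2] by simp
  then have l4: "ln 4 < 4 * T" using assms(2) T by linarith
  have ex: "2 * ((\<Lambda> + 4) * T) = 2 * (\<Lambda> * T) + 8 * T" by (simp add: algebra_simps)
  have "4 * exp (\<Lambda> * T - a * real m) = exp (ln 4 + (\<Lambda> * T - a * real m))" by (subst exp_add) simp
  also have "ln 4 + (\<Lambda> * T - a * real m) < - (a / 2) * real m" using am l4 unfolding ex by simp
  finally show "4 * exp (\<Lambda> * T - a * real m) < exp (- (a / 2) * real m)" by simp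
  have "0 \<le> \<Lambda> * T" using assms(1) T by simp
  then have "4 \<le> a * real m" using am T unfolding ex by linarith
  also have "\<dots> \<le> 1 * real m" using assms(4) by (intro mult_right_mono) auto
  finally show "2 \<le> m" by simp
qed

text \<open>
  Keeps the four witnesses apart when the quantifier prefix is instantiated.
\<close>

lemma four_positive_constantsI:
  fixes C c\<^sub>1 c\<^sub>2 c :: real
  assumes "0 < C" "0 < c\<^sub>1" "0 < c\<^sub>2" "0 < c" "P C c\<^sub>1 c\<^sub>2 c"
  shows "\<exists>C>0. \<exists>c\<^sub>1>0. \<exists>c\<^sub>2>0. \<exists>c>0. P C c\<^sub>1 c\<^sub>2 c"
  using assms by blast

text \<open>
  What remains per scenario: the deterministic setting, the representation of the observation norm as an
  average, and the conditioning of the design. The constants do not depend on the dimensions because \<open>\<Lambda>\<close>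
  does not.
\<close>

lemma sharp_recovery_whpI:
  fixes sc :: "'v::{plus,minus} scenario" and ent :: "'v \<Rightarrow> 'e \<Rightarrow> real"
  assumes \<Lambda>: "0 \<le> \<Lambda>"
    and sharp: "\<And>n N k x0. 1 \<le> n \<Longrightarrow> 1 \<le> N \<Longrightarrow> 1 \<le> k \<Longrightarrow> x0 \<in> signals sc n N k \<Longrightarrow>
      sharp_setup (space_V sc n N) ent (E n N) (objective sc) (cone_K sc n N) x0 k g"
    and sd: "\<And>m. 1 \<le> m \<Longrightarrow> 0 < std_dev sc m"
    and thr: "\<And>n N k. 1 \<le> n \<Longrightarrow> 1 \<le> N \<Longrightarrow> 1 \<le> k \<Longrightarrow> ln 2 \<le> threshold sc n N k"
    and obs: "\<And>n N m \<omega> x x0. 1 \<le> m \<Longrightarrow> x \<in> points (space_V sc n N) \<Longrightarrow> x0 \<in> points (space_V sc n N) \<Longrightarrow>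
      norm_W sc (sensing_map sc n N m \<omega> x - sensing_map sc n N m \<omega> x0) =
      g m (\<lambda>i. dotp (E n N) (\<lambda>e. ent x e - ent x0 e) (z m \<omega> i))"
    and cont: "\<And>m i e. continuous_on UNIV (\<lambda>\<omega>. z m \<omega> i e)"
    and wc: "\<And>n N k m. 1 \<le> n \<Longrightarrow> 1 \<le> N \<Longrightarrow> 1 \<le> k \<Longrightarrow> 2 \<le> m \<Longrightarrow> \<exists>A\<in>sets (design_law sc n N m).
      1 - 4 * exp (\<Lambda> * threshold sc n N k - c\<^sub>0 / 3 * real m) \<le> measure (design_law sc n N m) A \<and>
      (\<forall>\<omega>\<in>A. well_conditioned (space_V sc n N) ent (E n N) m k g (z m \<omega>))"
  shows "sharp_recovery_whp sc"
  unfolding sharp_recovery_whp_def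
proof (rule four_positive_constantsI[where C = "2 * (\<Lambda> + 4) / (c\<^sub>0 / 3)", OF _ const_pos, where c = "c\<^sub>0 / 3 / 2"];
    (intro allI impI ballI)?)
  show "0 < 2 * (\<Lambda> + 4) / (c\<^sub>0 / 3)" "0 < c\<^sub>0 / 3 / 2" using \<Lambda> c\<^sub>0_pos by simp_all
  fix n N k m x0 assume nk: "1 \<le> n" "1 \<le> N" "1 \<le> k" and x0: "x0 \<in> signals sc n N k"
    and m: "2 * (\<Lambda> + 4) / (c\<^sub>0 / 3) * threshold sc n N k \<le> real m"
  have c0: "0 < c\<^sub>0 / 3" "c\<^sub>0 / 3 \<le> 1" by (simp_all add: c\<^sub>0_def)
  note fail = failure_probability_absorbed[OF \<Lambda> thr[OF nk] c0 m]
  interpret S: sharp_setup "space_V sc n N" ent "E n N" "objective sc" "cone_K sc n N" x0 m k g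
    by (rule sharp[OF nk x0])
  obtain A where A: "A \<in> sets (design_law sc n N m)"
    "1 - 4 * exp (\<Lambda> * threshold sc n N k - c\<^sub>0 / 3 * real m) \<le> measure (design_law sc n N m) A"
    and good: "\<And>\<omega>. \<omega> \<in> A \<Longrightarrow> well_conditioned (space_V sc n N) ent (E n N) m k g (z m \<omega>)"
    using wc[OF nk fail(2)] by blast
  have m1: "1 \<le> m" using fail(2) by simp
  have pA: "1 - exp (- (c\<^sub>0 / 3 / 2) * real m) < measure (design_law sc n N m) A"
    using A(2) fail(1) by linarith
  show "1 - exp (- (c\<^sub>0 / 3 / 2) * real m) < measure (design_law sc n N m) {\<omega> \<in> space (design_law sc n N m).
      recovery_sharp sc n N m x0 (1/2) (sqrt (penalty_const * real k)) 2 \<omega> \<and>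
      (\<exists>L \<kappa>. L \<le> sqrt (lipschitz_const * real k) \<and>
         lipschitz (space_V sc n N)
           L (recovery_penalized sc n N m x0 (sqrt (penalty_const * real k)) 2 \<omega>) \<and>
         has_condition_number (space_V sc n N)
           (recovery_penalized sc n N m x0 (sqrt (penalty_const * real k)) 2 \<omega>) x0 (1/2) L \<kappa> \<and>
         \<kappa> \<le> 2 * sqrt (lipschitz_const * real k))}"
  proof (rule S.recovery_probability[OF refl refl refl sd[OF m1] _ cont A(1) pA good])
    show "norm_W sc (sensing_map sc n N m \<omega> x - sensing_map sc n N m \<omega> x0) = S.\<rho> (z m \<omega>) x"
      if "x \<in> points (space_V sc n N)" for \<omega> x
      unfolding S.\<rho>_def by (rule obs[OF m1 that S.x0_V])
  qed
qed

section \<open>Observation norms as averages of Gaussian forms\<close>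

lemma l1_norm_observations:
  assumes m: "1 \<le> m" and A: "\<And>i. i < m \<Longrightarrow> A i = dotp E u (a i)" "\<And>i. i < m \<Longrightarrow> B i = dotp E v (a i)"
    and z: "\<And>i e. e \<in> E \<Longrightarrow> z i e = real m * a i e"
  shows "l1_norm (Matrix.vec m A - Matrix.vec m B) = avg1 m (\<lambda>i. dotp E (\<lambda>e. u e - v e) (z i))"
proof -
  have "dotp E (\<lambda>e. u e - v e) (z i) = real m * (A i - B i)" if "i < m" for i
    unfolding A[OF that] dotp_def
    by (simp add: z sum_subtractf[symmetric] sum_distrib_left algebra_simps cong: sum.cong)
  then show ?thesis using m by (simp add: l1_norm_def avg1_def abs_mult flip: sum_distrib_left)
qed

lemma l2_norm_observations:
  assumes m: "1 \<le> m" and A: "\<And>i. i < m \<Longrightarrow> A i = dotp E u (a i)" "\<And>i. i < m \<Longrightarrow> B i = dotp E v (a i)"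
    and z: "\<And>i e. e \<in> E \<Longrightarrow> z i e = sqrt (real m) * a i e"
  shows "l2_norm (Matrix.vec m A - Matrix.vec m B) = avg2 m (\<lambda>i. dotp E (\<lambda>e. u e - v e) (z i))"
proof -
  have "dotp E (\<lambda>e. u e - v e) (z i) = sqrt (real m) * (A i - B i)" if "i < m" for i
    unfolding A[OF that] dotp_def
    by (simp add: z sum_subtractf[symmetric] sum_distrib_left algebra_simps cong: sum.cong)
  then show ?thesis using m by (simp add: l2_norm_def avg2_def power_mult_distrib flip: sum_distrib_left)
qed

lemma gvec_scalar_prod: "x \<in> carrier_vec n \<Longrightarrow> gvec \<omega> i p n \<bullet> x = dotp {..<n} (($) x) (\<lambda>q. \<omega> (i, p, q))"
  by (simp add: scalar_prod_def dotp_def gvec_def atLeast0LessThan mult.commute)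

lemma trace_inner_dotp:
  assumes X: "X \<in> carrier_mat n N" and Y: "Y \<in> carrier_mat n N"
  shows "trace_inner X Y = dotp ({..<n} \<times> {..<N}) (($$) Y) (($$) X)"
proof -
  have "trace_inner X Y = (\<Sum>j<N. \<Sum>i<n. X $$ (i, j) * Y $$ (i, j))"
    using X Y by (simp add: trace_inner_def mat_trace_def scalar_prod_def atLeast0LessThan)
  also have "\<dots> = (\<Sum>i<n. \<Sum>j<N. Y $$ (i, j) * X $$ (i, j))"
    by (subst sum.swap) (simp add: mult.commute)
  also have "\<dots> = dotp ({..<n} \<times> {..<N}) (($$) Y) (($$) X)"
    by (simp add: dotp_def sum.cartesian_product case_prod_unfold)
  finally show ?thesis .
qed

lemma dotp_cong: "(\<And>e. e \<in> E \<Longrightarrow> h e = h' e) \<Longrightarrow> (\<And>e. e \<in> E \<Longrightarrow> z e = z' e) \<Longrightarrow> dotp E h z = dotp E h' z'"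
  by (simp add: dotp_def)

lemma dotp_rank_one: "dotp ({..<n} \<times> {..<N}) h (\<lambda>(p, q). x p * y q) = bil n N h x y"
  by (simp add: dotp_def bil_def sum.cartesian_product case_prod_unfold mult.assoc)

section \<open>Well-conditioned designs\<close>

lemma design_std_gaussians:
  assumes "0 < std_dev sc m" "1 \<le> m" "blocks sc n N \<noteq> {}"
  shows "std_gaussians (design_law sc n N m) ({..<m} \<times> blocks sc n N) (\<lambda>j \<omega>. \<omega> j / std_dev sc m)"
  unfolding design_law_def using assms
  by (intro product_normal_std_gaussians) (auto simp: lessThan_empty_iff)

text \<open>
  Brings the scenarios to the common form of the failure probability, which is dictated by the first covariance
  scenario: two events, and possibly only \<open>m / 3\<close> pairs of measurements.
\<close>

lemma exp_bound_weaken: "\<Lambda> \<le> \<Lambda>' \<Longrightarrow> 0 \<le> T \<Longrightarrow> 1 - 4 * exp (\<Lambda>' * T - c\<^sub>0 / 3 * real m) \<le> 1 - 2 * exp (\<Lambda> * T - c\<^sub>0 * real m)"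
proof -
  assume a: "\<Lambda> \<le> \<Lambda>'" "0 \<le> T"
  have "\<Lambda> * T - c\<^sub>0 * real m \<le> \<Lambda>' * T - c\<^sub>0 / 3 * real m"
    using mult_right_mono[OF a] mult_right_mono[of "c\<^sub>0 / 3" "c\<^sub>0" "real m"] c\<^sub>0_pos by linarith
  then have "exp (\<Lambda> * T - c\<^sub>0 * real m) \<le> exp (\<Lambda>' * T - c\<^sub>0 / 3 * real m)" by simp
  then show ?thesis using exp_gt_zero[of "\<Lambda>' * T - c\<^sub>0 / 3 * real m"] by linarith
qed

lemma well_conditioned_of_isometry:
  assumes "g = avg1 \<or> g = avg2"
    and "\<And>h. h \<in> points V \<Longrightarrow> g m (\<lambda>i. dotp E (ent h) (z i)) \<le> 12 * nrm V h"
    and "\<And>h. h \<in> points V \<Longrightarrow> nrm V h \<le> 8 * sqrt (real k) * L2_set (ent h) E \<Longrightarrow>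
      \<alpha>\<^sub>0 / 4 * L2_set (ent h) E \<le> avg1 m (\<lambda>i. dotp E (ent h) (z i))"
    and "\<And>h. h \<in> points V \<Longrightarrow> 0 \<le> nrm V h"
  shows "well_conditioned V ent E m k g z"
  unfolding well_conditioned_def
proof (intro conjI ballI impI)
  fix h assume h: "h \<in> points V"
  show "g m (\<lambda>i. dotp E (ent h) (z i)) \<le> 144 * nrm V h" using assms(2,4)[OF h] by linarith
  assume "nrm V h \<le> 8 * sqrt (real k) * L2_set (ent h) E"
  from assms(3)[OF h this] have "\<alpha>\<^sub>0 / 4 * L2_set (ent h) E \<le> g m (\<lambda>i. dotp E (ent h) (z i))"
    using avg_facts(4)[OF assms(1)] by (rule order_trans)
  moreover have "\<alpha>\<^sub>0 / 8 * L2_set (ent h) E \<le> \<alpha>\<^sub>0 / 4 * L2_set (ent h) E"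
    using \<alpha>\<^sub>0_pos by (intro mult_right_mono) auto
  ultimately show "\<alpha>\<^sub>0 / 8 * L2_set (ent h) E \<le> g m (\<lambda>i. dotp E (ent h) (z i))" by linarith
qed

lemma sparse_threshold_ge: "1 \<le> k \<Longrightarrow> ln 2 \<le> sparse_threshold n k"
proof -
  assume k: "1 \<le> k"
  have "1 * ln 2 \<le> real k * max (ln 2) (ln (real n / real k))"
    using k ln2_ge_half by (intro mult_mono) auto
  then show ?thesis by (simp add: sparse_threshold_def)
qed

lemma entropy_nonneg: "0 \<le> sparse_entropy" "0 \<le> low_rank_entropy"
  by (simp_all add: sparse_entropy_def low_rank_entropy_def)

lemma sparse_recovery_whp:
  assumes W: "nW = l1_norm \<and> sd = (\<lambda>m. 1 / real m) \<and> g = avg1 \<or> nW = l2_norm \<and> sd = (\<lambda>m. 1 / sqrt (real m)) \<and> g = avg2"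
  shows "sharp_recovery_whp (sparse_recovery nW sd)"
proof -
  let ?sc = "sparse_recovery nW sd"
  have g: "g = avg1 \<or> g = avg2" using W by blast
  have sc: "space_V ?sc n N = vec_space_l1 n" "objective ?sc = l1_norm" "cone_K ?sc n N = carrier_vec n"
    "signals ?sc n N k = sparse_vecs n k" "threshold ?sc n N k = sparse_threshold n k" "std_dev ?sc = sd"
    "blocks ?sc n N = {0} \<times> {..<n}" "norm_W ?sc = nW" for n N k
    by (simp_all add: sparse_recovery_def)
  have sd: "0 < sd m" if "1 \<le> m" for m using W that by auto
  let ?z = "\<lambda>m (\<omega> :: sample) i q. \<omega> (i, 0, q) / sd m"
  show ?thesis
  proof (rule sharp_recovery_whpI[where ent = "($)" and E = "\<lambda>n N. {..<n}" and g = g and z = ?z, OF entropy_nonneg(1)])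
    show "sharp_setup (space_V ?sc n N) ($) {..<n} (objective ?sc) (cone_K ?sc n N) x0 k g"
      if "1 \<le> k" "x0 \<in> signals ?sc n N k" for n N k x0
      using sharp_setup_sparse[OF _ that(1) g, of x0 n] that(2) unfolding sc by blast
    show "0 < std_dev ?sc m" if "1 \<le> m" for m using sd[OF that] by (simp add: sc)
    show "ln 2 \<le> threshold ?sc n N k" if "1 \<le> k" for n N k using sparse_threshold_ge[OF that] by (simp add: sc)
    show "continuous_on UNIV (\<lambda>\<omega>. ?z m \<omega> i e)" for m i e
      unfolding divide_inverse by (intro continuous_intros continuous_on_product_coordinates)
    show "norm_W ?sc (sensing_map ?sc n N m \<omega> x - sensing_map ?sc n N m \<omega> x0) =
        g m (\<lambda>i. dotp {..<n} (\<lambda>e. x $ e - x0 $ e) (?z m \<omega> i))"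
      if m: "1 \<le> m" and x: "x \<in> points (space_V ?sc n N)" "x0 \<in> points (space_V ?sc n N)" for n N m \<omega> x x0
    proof -
      have A: "sensing_map ?sc n N m \<omega> y = Matrix.vec m (\<lambda>i. dotp {..<n} (($) y) (\<lambda>q. \<omega> (i, 0, q)))"
        if "y \<in> points (space_V ?sc n N)" for y
        using that by (simp add: sensing_map_def sparse_recovery_def gvec_scalar_prod vec_space_l1_def)
      from W show ?thesis
      proof (elim disjE conjE)
        assume *: "nW = l1_norm" "sd = (\<lambda>m. 1 / real m)" "g = avg1"
        show ?thesis unfolding A[OF x(1)] A[OF x(2)] sc unfolding * by (rule l1_norm_observations[OF m refl refl]) simp
      next
        assume *: "nW = l2_norm" "sd = (\<lambda>m. 1 / sqrt (real m))" "g = avg2"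
        show ?thesis unfolding A[OF x(1)] A[OF x(2)] sc unfolding * by (rule l2_norm_observations[OF m refl refl]) simp
      qed
    qed
    show "\<exists>A\<in>sets (design_law ?sc n N m).
        1 - 4 * exp (sparse_entropy * threshold ?sc n N k - c\<^sub>0 / 3 * real m) \<le> measure (design_law ?sc n N m) A \<and>
        (\<forall>\<omega>\<in>A. well_conditioned (space_V ?sc n N) ($) {..<n} m k g (?z m \<omega>))"
      if nk: "1 \<le> n" "1 \<le> k" "2 \<le> m" for n N k m
    proof -
      have m: "1 \<le> m" using nk by simp
      have G: "std_gaussians (design_law ?sc n N m) ({..<m} \<times> {0} \<times> {..<n}) (\<lambda>j \<omega>. \<omega> j / sd m)"
        using design_std_gaussians[of ?sc m n N] sd[OF m] m nk by (simp add: sc lessThan_empty_iff)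
      have "ensemble (design_law ?sc n N m) m {..<n} (\<lambda>i q \<omega>. \<omega> (i, 0, q) / sd m) g"
        by (rule gaussian_ensemble[OF G m _ _ _ _ g, where \<iota> = "\<lambda>i q. (i, 0, q)"])
          (auto simp: inj_on_def disjoint_family_on_def)
      from sparse_isometry[OF this m g nk(1,2)] obtain A where A: "A \<in> sets (design_law ?sc n N m)"
        "1 - 2 * exp (sparse_entropy * sparse_threshold n k - c\<^sub>0 * real m) \<le> measure (design_law ?sc n N m) A"
        and iso: "\<And>\<omega> h. \<omega> \<in> A \<Longrightarrow> g m (\<lambda>i. dotp {..<n} h (?z m \<omega> i)) \<le> 12 * (\<Sum>i<n. \<bar>h i\<bar>)"
          "\<And>\<omega> h. \<omega> \<in> A \<Longrightarrow> (\<Sum>i<n. \<bar>h i\<bar>) \<le> 8 * sqrt (real k) * L2_set h {..<n} \<Longrightarrow>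
            \<alpha>\<^sub>0 / 4 * L2_set h {..<n} \<le> avg1 m (\<lambda>i. dotp {..<n} h (?z m \<omega> i))"
        by blast
      have l1: "nrm (vec_space_l1 n) h = (\<Sum>i<n. \<bar>h $ i\<bar>)" if "h \<in> points (vec_space_l1 n)" for h
        using that by (simp add: vec_space_l1_def l1_norm_def)
      have "well_conditioned (vec_space_l1 n) ($) {..<n} m k g (?z m \<omega>)" if "\<omega> \<in> A" for \<omega>
        by (rule well_conditioned_of_isometry[OF g]) (use iso[OF that] in \<open>simp_all add: l1 sum_nonneg\<close>)
      moreover have "1 - 4 * exp (sparse_entropy * sparse_threshold n k - c\<^sub>0 / 3 * real m) \<le> measure (design_law ?sc n N m) A"
        using exp_bound_weaken[OF order_refl, of "sparse_threshold n k"] sparse_threshold_ge[OF nk(2), of n] ln2_ge_half A(2)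
        by (intro order_trans[OF _ A(2)]) auto
      ultimately show ?thesis unfolding sc using A(1) by blast
    qed
  qed
qed

lemma mat_well_conditioned:
  assumes ens: "ensemble M m ({..<n} \<times> {..<N}) Z g" and m: "1 \<le> m" and g: "g = avg1 \<or> g = avg2"
    and n: "1 \<le> n" "1 \<le> N" and k: "1 \<le> k"
  shows "\<exists>A\<in>sets M. 1 - 4 * exp (low_rank_entropy * (real (max n N) * real k) - c\<^sub>0 / 3 * real m) \<le> measure M A \<and>
    (\<forall>\<omega>\<in>A. well_conditioned (mat_space_s1 n N) ($$) ({..<n} \<times> {..<N}) m k g (\<lambda>i e. Z i e \<omega>))"
proof -
  let ?E = "{..<n} \<times> {..<N}"
  from low_rank_isometry[OF ens m g n k] obtain A where A: "A \<in> sets M"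
    "1 - 2 * exp (low_rank_entropy * (real (max n N) * real k) - c\<^sub>0 * real m) \<le> measure M A"
    and iso: "\<And>\<omega> H. \<omega> \<in> A \<Longrightarrow> H \<in> carrier_mat n N \<Longrightarrow> g m (\<lambda>i. dotp ?E (($$) H) (\<lambda>e. Z i e \<omega>)) \<le> 12 * schatten1_norm H"
      "\<And>\<omega> H. \<omega> \<in> A \<Longrightarrow> H \<in> carrier_mat n N \<Longrightarrow> schatten1_norm H \<le> 8 * sqrt (real k) * L2_set (($$) H) ?E \<Longrightarrow>
        \<alpha>\<^sub>0 / 4 * L2_set (($$) H) ?E \<le> avg1 m (\<lambda>i. dotp ?E (($$) H) (\<lambda>e. Z i e \<omega>))"
    by blast
  have "well_conditioned (mat_space_s1 n N) ($$) ?E m k g (\<lambda>i e. Z i e \<omega>)" if "\<omega> \<in> A" for \<omega>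
    by (rule well_conditioned_of_isometry[OF g]) (use iso[OF that] schatten1_nonneg in \<open>auto simp: mat_space_s1_def\<close>)
  moreover have "1 - 4 * exp (low_rank_entropy * (real (max n N) * real k) - c\<^sub>0 / 3 * real m) \<le> measure M A"
    by (rule order_trans[OF exp_bound_weaken A(2)]) auto
  ultimately show ?thesis using A(1) by blast
qed

lemma well_conditioned_sym:
  "well_conditioned (mat_space_s1 n n) ($$) E m k g z \<Longrightarrow> well_conditioned (sym_space_s1 n) ($$) E m k g z"
  by (simp add: well_conditioned_def mat_space_s1_def sym_space_s1_def sym_mats_def)

lemma well_conditioned_cong:
  assumes "\<And>h i. h \<in> points V \<Longrightarrow> i < m \<Longrightarrow> dotp E (ent h) (z i) = dotp E (ent h) (z' i)" and g: "g = avg1 \<or> g = avg2"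
  shows "well_conditioned V ent E m k g z \<longleftrightarrow> well_conditioned V ent E m k g z'"
proof -
  have "g m (\<lambda>i. dotp E (ent h) (z i)) = g m (\<lambda>i. dotp E (ent h) (z' i))" if "h \<in> points V" for h
    using assms(1)[OF that] by (rule avg_facts(6)[OF g])
  then show ?thesis by (simp add: well_conditioned_def)
qed

lemma max_threshold_ge: "1 \<le> n \<Longrightarrow> 1 \<le> k \<Longrightarrow> ln 2 \<le> real n * real k"
proof -
  assume "1 \<le> n" "1 \<le> k"
  then have "1 * 1 \<le> real n * real k" by (intro mult_mono) auto
  moreover have "ln 2 \<le> (1::real)" using ln_le_minus_one[of "2::real"] by simp
  ultimately show ?thesis by linarith
qed

lemma matrix_sensing_I_whp:
  assumes W: "nW = l1_norm \<and> sd = (\<lambda>m. 1 / real m) \<and> g = avg1 \<or> nW = l2_norm \<and> sd = (\<lambda>m. 1 / sqrt (real m)) \<and> g = avg2"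
  shows "sharp_recovery_whp (matrix_sensing_I nW sd)"
proof -
  let ?sc = "matrix_sensing_I nW sd"
  have g: "g = avg1 \<or> g = avg2" using W by blast
  have sc: "space_V ?sc n N = mat_space_s1 n N" "objective ?sc = schatten1_norm" "cone_K ?sc n N = carrier_mat n N"
    "signals ?sc n N k = rank_le n N k" "threshold ?sc n N k = real (max n N) * real k" "std_dev ?sc = sd"
    "blocks ?sc n N = {..<n} \<times> {..<N}" "norm_W ?sc = nW" for n N k
    by (simp_all add: matrix_sensing_I_def)
  have sd: "0 < sd m" if "1 \<le> m" for m using W that by auto
  let ?z = "\<lambda>m (\<omega> :: sample) i (e :: nat \<times> nat). \<omega> (i, e) / sd m"
  show ?thesis
  proof (rule sharp_recovery_whpI[where ent = "($$)" and E = "\<lambda>n N. {..<n} \<times> {..<N}" and g = g and z = ?z, OF entropy_nonneg(2)])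
    show "sharp_setup (space_V ?sc n N) ($$) ({..<n} \<times> {..<N}) (objective ?sc) (cone_K ?sc n N) x0 k g"
      if "1 \<le> k" "x0 \<in> signals ?sc n N k" for n N k x0
      using sharp_setup_low_rank[OF _ that(1) g, of x0 n N] that(2) unfolding sc by blast
    show "0 < std_dev ?sc m" if "1 \<le> m" for m using sd[OF that] by (simp add: sc)
    show "ln 2 \<le> threshold ?sc n N k" if "1 \<le> n" "1 \<le> k" for n N k
      unfolding sc using that by (intro max_threshold_ge) auto
    show "continuous_on UNIV (\<lambda>\<omega>. ?z m \<omega> i e)" for m i e
      unfolding divide_inverse by (intro continuous_intros continuous_on_product_coordinates)
    show "norm_W ?sc (sensing_map ?sc n N m \<omega> x - sensing_map ?sc n N m \<omega> x0) =
        g m (\<lambda>i. dotp ({..<n} \<times> {..<N}) (\<lambda>e. x $$ e - x0 $$ e) (?z m \<omega> i))"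
      if m: "1 \<le> m" and x: "x \<in> points (space_V ?sc n N)" "x0 \<in> points (space_V ?sc n N)" for n N m \<omega> x x0
    proof -
      have A: "sensing_map ?sc n N m \<omega> y = Matrix.vec m (\<lambda>i. dotp ({..<n} \<times> {..<N}) (($$) y) (\<lambda>e. \<omega> (i, e)))"
        if "y \<in> points (space_V ?sc n N)" for y
      proof -
        have "trace_inner (gmat \<omega> i n N) y = dotp ({..<n} \<times> {..<N}) (($$) y) (\<lambda>e. \<omega> (i, e))" for i
          using that by (subst trace_inner_dotp[of _ n N]) (auto simp: gmat_def mat_space_s1_def sc intro!: dotp_cong)
        then show ?thesis by (simp add: sensing_map_def matrix_sensing_I_def)
      qed
      from W show ?thesis
      proof (elim disjE conjE)
        assume *: "nW = l1_norm" "sd = (\<lambda>m. 1 / real m)" "g = avg1"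
        show ?thesis unfolding A[OF x(1)] A[OF x(2)] sc unfolding * by (rule l1_norm_observations[OF m refl refl]) simp
      next
        assume *: "nW = l2_norm" "sd = (\<lambda>m. 1 / sqrt (real m))" "g = avg2"
        show ?thesis unfolding A[OF x(1)] A[OF x(2)] sc unfolding * by (rule l2_norm_observations[OF m refl refl]) simp
      qed
    qed
    show "\<exists>A\<in>sets (design_law ?sc n N m).
        1 - 4 * exp (low_rank_entropy * threshold ?sc n N k - c\<^sub>0 / 3 * real m) \<le> measure (design_law ?sc n N m) A \<and>
        (\<forall>\<omega>\<in>A. well_conditioned (space_V ?sc n N) ($$) ({..<n} \<times> {..<N}) m k g (?z m \<omega>))"
      if nk: "1 \<le> n" "1 \<le> N" "1 \<le> k" "2 \<le> m" for n N k m
    proof -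
      have m: "1 \<le> m" using nk by simp
      have G: "std_gaussians (design_law ?sc n N m) ({..<m} \<times> {..<n} \<times> {..<N}) (\<lambda>j \<omega>. \<omega> j / sd m)"
        using design_std_gaussians[of ?sc m n N] sd[OF m] m nk by (simp add: sc lessThan_empty_iff)
      have "ensemble (design_law ?sc n N m) m ({..<n} \<times> {..<N}) (\<lambda>i e \<omega>. \<omega> (i, e) / sd m) g"
        by (rule gaussian_ensemble[OF G m _ _ _ _ g, where \<iota> = "\<lambda>i e. (i, e)"])
          (auto simp: inj_on_def disjoint_family_on_def)
      from mat_well_conditioned[OF this m g nk(1-3)] show ?thesis unfolding sc .
    qed
  qed
qed

lemma matrix_sensing_II_whp: "sharp_recovery_whp matrix_sensing_II"
proof -
  let ?sc = matrix_sensing_II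
  have sc: "space_V ?sc n N = mat_space_s1 n N" "objective ?sc = schatten1_norm" "cone_K ?sc n N = carrier_mat n N"
    "signals ?sc n N k = rank_le n N k" "threshold ?sc n N k = real (max n N) * real k"
    "std_dev ?sc m = 1 / sqrt (real m)"
    "blocks ?sc n N = {0} \<times> {..<n} \<union> {1} \<times> {..<N}" "norm_W ?sc = l1_norm" for n N k m
    by (simp_all add: matrix_sensing_II_def)
  let ?z = "\<lambda>m (\<omega> :: sample) i (p :: nat, q :: nat). (\<omega> (i, 0, p) / (1 / sqrt (real m))) * (\<omega> (i, 1, q) / (1 / sqrt (real m)))"
  show ?thesis
  proof (rule sharp_recovery_whpI[where ent = "($$)" and E = "\<lambda>n N. {..<n} \<times> {..<N}" and g = avg1 and z = ?z, OF entropy_nonneg(2)])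
    show "sharp_setup (space_V ?sc n N) ($$) ({..<n} \<times> {..<N}) (objective ?sc) (cone_K ?sc n N) x0 k avg1"
      if "1 \<le> k" "x0 \<in> signals ?sc n N k" for n N k x0
      using sharp_setup_low_rank[OF _ that(1), of x0 n N avg1] that(2) unfolding sc by blast
    show "0 < std_dev ?sc m" if "1 \<le> m" for m using that by (simp add: sc)
    show "ln 2 \<le> threshold ?sc n N k" if "1 \<le> n" "1 \<le> k" for n N k
      unfolding sc using that by (intro max_threshold_ge) auto
    show "continuous_on UNIV (\<lambda>\<omega>. ?z m \<omega> i e)" for m i e
      unfolding divide_inverse case_prod_unfold by (intro continuous_intros continuous_on_product_coordinates)
    show "norm_W ?sc (sensing_map ?sc n N m \<omega> x - sensing_map ?sc n N m \<omega> x0) =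
        avg1 m (\<lambda>i. dotp ({..<n} \<times> {..<N}) (\<lambda>e. x $$ e - x0 $$ e) (?z m \<omega> i))"
      if m: "1 \<le> m" and x: "x \<in> points (space_V ?sc n N)" "x0 \<in> points (space_V ?sc n N)" for n N m \<omega> x x0
    proof -
      have A: "sensing_map ?sc n N m \<omega> y = Matrix.vec m (\<lambda>i. dotp ({..<n} \<times> {..<N}) (($$) y) (\<lambda>(p, q). \<omega> (i, 0, p) * \<omega> (i, 1, q)))"
        if "y \<in> points (space_V ?sc n N)" for y
      proof -
        have "trace_inner (outer (gvec \<omega> i 0 n) (gvec \<omega> i 1 N)) y =
            dotp ({..<n} \<times> {..<N}) (($$) y) (\<lambda>(p, q). \<omega> (i, 0, p) * \<omega> (i, 1, q))" for i
          using that by (subst trace_inner_dotp[of _ n N]) (auto simp: outer_def gvec_def mat_space_s1_def sc intro!: dotp_cong)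
        then show ?thesis by (simp add: sensing_map_def matrix_sensing_II_def)
      qed
      show ?thesis unfolding A[OF x(1)] A[OF x(2)] sc
        by (rule l1_norm_observations[OF m refl refl]) auto
    qed
    show "\<exists>A\<in>sets (design_law ?sc n N m).
        1 - 4 * exp (low_rank_entropy * threshold ?sc n N k - c\<^sub>0 / 3 * real m) \<le> measure (design_law ?sc n N m) A \<and>
        (\<forall>\<omega>\<in>A. well_conditioned (space_V ?sc n N) ($$) ({..<n} \<times> {..<N}) m k avg1 (?z m \<omega>))"
      if nk: "1 \<le> n" "1 \<le> N" "1 \<le> k" "2 \<le> m" for n N k m
    proof -
      have m: "1 \<le> m" using nk by simp
      have G: "std_gaussians (design_law ?sc n N m) ({..<m} \<times> ({0} \<times> {..<n} \<union> {1} \<times> {..<N})) (\<lambda>j \<omega>. \<omega> j / (1 / sqrt (real m)))"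
        using design_std_gaussians[of ?sc m n N] m nk by (simp add: sc lessThan_empty_iff)
      have "ensemble (design_law ?sc n N m) m ({..<n} \<times> {..<N})
          (\<lambda>i (p, q) \<omega>. (\<omega> (i, 0, p) / (1 / sqrt (real m))) * (\<omega> (i, 1, q) / (1 / sqrt (real m)))) avg1"
        by (rule bilinear_ensemble[OF G m, where \<iota> = "\<lambda>i p. (i, 0, p)" and \<kappa> = "\<lambda>i q. (i, 1, q)"])
          (auto simp: inj_on_def disjoint_family_on_def)
      from mat_well_conditioned[OF this m _ nk(1-3)] show ?thesis unfolding sc by (simp add: case_prod_unfold)
    qed
  qed
qed

section \<open>Covariance estimation\<close>

text \<open>
  \<open>(x - y)\<^sup>T X (x + y) = x\<^sup>T X x - y\<^sup>T X y\<close>, since the mixed terms cancel by symmetry.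
\<close>

lemma symmetric_polarization:
  assumes X: "X \<in> sym_mats n"
  shows "bil n n (($$) X) (\<lambda>p. (x p - y p) / sqrt 2) (\<lambda>p. (x p + y p) / sqrt 2) =
    (bil n n (($$) X) x x - bil n n (($$) X) y y) / 2"
proof -
  let ?b = "bil n n (($$) X)"
  have s: "(1 / sqrt 2) * (1 / sqrt 2) = (1/2 :: real)" by simp
  have "?b (\<lambda>p. (x p - y p) / sqrt 2) (\<lambda>p. (x p + y p) / sqrt 2) =
      ?b (\<lambda>p. (1 / sqrt 2) * (x p - y p)) (\<lambda>p. (1 / sqrt 2) * (x p - (-1) * y p))"
    by simp
  also have "\<dots> = (1 / sqrt 2) * (1 / sqrt 2) * ?b (\<lambda>p. x p - y p) (\<lambda>p. x p - (-1) * y p)"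
    unfolding bil_scale_left bil_scale_right by (simp only: mult.assoc)
  also have "\<dots> = (?b x x + ?b x y - (?b y x + ?b y y)) / 2"
    unfolding s bil_diff_left bil_diff_right bil_scale_right by (simp add: algebra_simps)
  also have "\<dots> = (?b x x - ?b y y) / 2" using sym_bil_commute[OF X, of x y] by simp
  finally show ?thesis .
qed

text \<open>
  The measurements are differences of two quadratic forms, hence bilinear forms in the rotated vectors.
\<close>

lemma covariance_II_whp: "sharp_recovery_whp covariance_estimation_II"
proof -
  let ?sc = covariance_estimation_II
  have sc: "space_V ?sc n N = sym_space_s1 n" "objective ?sc = mat_trace" "cone_K ?sc n N = psd_mats n"
    "signals ?sc n N k = psd_mats n \<inter> rank_le n n k" "threshold ?sc n N k = real n * real k"
    "std_dev ?sc m = 1 / sqrt (2 * real m)"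
    "blocks ?sc n N = {0, 1} \<times> {..<n}" "norm_W ?sc = l1_norm" for n N k m
    by (simp_all add: covariance_estimation_II_def)
  define z :: "nat \<Rightarrow> sample \<Rightarrow> nat \<Rightarrow> nat \<times> nat \<Rightarrow> real" where
    "z = (\<lambda>m \<omega> i (p, q). real m * (\<omega> (i, 0, p) * \<omega> (i, 0, q) - \<omega> (i, 1, p) * \<omega> (i, 1, q)))"
  show ?thesis
  proof (rule sharp_recovery_whpI[where ent = "($$)" and E = "\<lambda>n N. {..<n} \<times> {..<n}" and g = avg1 and z = z, OF entropy_nonneg(2)])
    show "sharp_setup (space_V ?sc n N) ($$) ({..<n} \<times> {..<n}) (objective ?sc) (cone_K ?sc n N) x0 k avg1"
      if "1 \<le> k" "x0 \<in> signals ?sc n N k" for n N k x0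
      using sharp_setup_psd[OF _ that(1), of x0 n avg1] that(2) unfolding sc by blast
    show "0 < std_dev ?sc m" if "1 \<le> m" for m using that by (simp add: sc)
    show "ln 2 \<le> threshold ?sc n N k" if "1 \<le> n" "1 \<le> k" for n N k
      unfolding sc using that by (intro max_threshold_ge)
    show "continuous_on UNIV (\<lambda>\<omega>. z m \<omega> i e)" for m i e
      unfolding z_def case_prod_unfold by (intro continuous_intros continuous_on_product_coordinates)
    show "norm_W ?sc (sensing_map ?sc n N m \<omega> x - sensing_map ?sc n N m \<omega> x0) =
        avg1 m (\<lambda>i. dotp ({..<n} \<times> {..<n}) (\<lambda>e. x $$ e - x0 $$ e) (z m \<omega> i))"
      if m: "1 \<le> m" and x: "x \<in> points (space_V ?sc n N)" "x0 \<in> points (space_V ?sc n N)" for n N m \<omega> x x0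
    proof -
      have A: "sensing_map ?sc n N m \<omega> y = Matrix.vec m (\<lambda>i. dotp ({..<n} \<times> {..<n}) (($$) y)
          (\<lambda>(p, q). \<omega> (i, 0, p) * \<omega> (i, 0, q) - \<omega> (i, 1, p) * \<omega> (i, 1, q)))"
        if "y \<in> points (space_V ?sc n N)" for y
      proof -
        have "y \<in> carrier_mat n n" using that by (simp add: sc sym_space_s1_def sym_mats_def)
        then have "trace_inner (outer (gvec \<omega> i 0 n) (gvec \<omega> i 0 n) - outer (gvec \<omega> i 1 n) (gvec \<omega> i 1 n)) y =
            dotp ({..<n} \<times> {..<n}) (($$) y) (\<lambda>(p, q). \<omega> (i, 0, p) * \<omega> (i, 0, q) - \<omega> (i, 1, p) * \<omega> (i, 1, q))" for i
          by (subst trace_inner_dotp[of _ n n]) (auto simp: outer_def gvec_def intro!: dotp_cong minus_carrier_mat)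
        then show ?thesis by (simp add: sensing_map_def covariance_estimation_II_def)
      qed
      show ?thesis unfolding A[OF x(1)] A[OF x(2)] sc
        by (rule l1_norm_observations[OF m refl refl]) (auto simp: z_def)
    qed
    show "\<exists>A\<in>sets (design_law ?sc n N m).
        1 - 4 * exp (low_rank_entropy * threshold ?sc n N k - c\<^sub>0 / 3 * real m) \<le> measure (design_law ?sc n N m) A \<and>
        (\<forall>\<omega>\<in>A. well_conditioned (space_V ?sc n N) ($$) ({..<n} \<times> {..<n}) m k avg1 (z m \<omega>))"
      if nk: "1 \<le> n" "1 \<le> N" "1 \<le> k" "2 \<le> m" for n N k m
    proof -
      have m: "1 \<le> m" using nk by simp
      define G where "G j \<omega> = \<omega> j / (1 / sqrt (2 * real m))" for j and \<omega> :: sample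
      have G: "std_gaussians (design_law ?sc n N m) ({..<m} \<times> {0, 1} \<times> {..<n}) G"
        using design_std_gaussians[of ?sc m n N] m nk by (simp add: sc lessThan_empty_iff G_def[abs_def])
      have "\<exists>G' :: nat \<times> nat \<times> nat \<Rightarrow> sample \<Rightarrow> real. std_gaussians (design_law ?sc n N m) ({..<m} \<times> {0, 1} \<times> {..<n}) G' \<and>
          (\<forall>s\<in>{..<m} \<times> {..<n}. \<forall>\<omega>.
            G' ((\<lambda>(i, p). (i, 0, p)) s) \<omega> = (G ((\<lambda>(i, p). (i, 0, p)) s) \<omega> - G ((\<lambda>(i, p). (i, 1, p)) s) \<omega>) / sqrt 2 \<and>
            G' ((\<lambda>(i, p). (i, 1, p)) s) \<omega> = (G ((\<lambda>(i, p). (i, 0, p)) s) \<omega> + G ((\<lambda>(i, p). (i, 1, p)) s) \<omega>) / sqrt 2)"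
        by (rule std_gaussians_rotate[OF G, where a = "\<lambda>(i, p). (i, 0, p)" and b = "\<lambda>(i, p). (i, 1, p)"])
          (auto simp: inj_on_def)
      then obtain G' :: "nat \<times> nat \<times> nat \<Rightarrow> sample \<Rightarrow> real" where G': "std_gaussians (design_law ?sc n N m) ({..<m} \<times> {0, 1} \<times> {..<n}) G'"
        and rot: "\<And>i p \<omega>. i < m \<Longrightarrow> p < n \<Longrightarrow> G' (i, 0, p) \<omega> = (G (i, 0, p) \<omega> - G (i, 1, p) \<omega>) / sqrt 2"
          "\<And>i p \<omega>. i < m \<Longrightarrow> p < n \<Longrightarrow> G' (i, 1, p) \<omega> = (G (i, 0, p) \<omega> + G (i, 1, p) \<omega>) / sqrt 2"
        by force
      have "ensemble (design_law ?sc n N m) m ({..<n} \<times> {..<n}) (\<lambda>i (p, q) \<omega>. G' (i, 0, p) \<omega> * G' (i, 1, q) \<omega>) avg1"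
        by (rule bilinear_ensemble[OF G' m, where \<iota> = "\<lambda>i p. (i, 0, p)" and \<kappa> = "\<lambda>i q. (i, 1, q)"])
          (auto simp: inj_on_def disjoint_family_on_def)
      from mat_well_conditioned[OF this m _ nk(1) nk(1) nk(3)] obtain A where A: "A \<in> sets (design_law ?sc n N m)"
        "1 - 4 * exp (low_rank_entropy * (real n * real k) - c\<^sub>0 / 3 * real m) \<le> measure (design_law ?sc n N m) A"
        and wc: "\<And>\<omega>. \<omega> \<in> A \<Longrightarrow> well_conditioned (mat_space_s1 n n) ($$) ({..<n} \<times> {..<n}) m k avg1
          (\<lambda>i (p, q). G' (i, 0, p) \<omega> * G' (i, 1, q) \<omega>)"
        by (auto simp: case_prod_unfold)
      have "well_conditioned (sym_space_s1 n) ($$) ({..<n} \<times> {..<n}) m k avg1 (z m \<omega>)" if "\<omega> \<in> A" for \<omega>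
      proof (rule well_conditioned_cong[THEN iffD1, OF _ _ well_conditioned_sym[OF wc[OF that]]])
        fix h i assume h: "h \<in> points (sym_space_s1 n)" and i: "i < m"
        have hs: "h \<in> sym_mats n" using h by (simp add: sym_space_s1_def)
        let ?a = "\<lambda>p. G (i, 0, p) \<omega>" and ?b = "\<lambda>p. G (i, 1, p) \<omega>"
        have "dotp ({..<n} \<times> {..<n}) (($$) h) (\<lambda>(p, q). G' (i, 0, p) \<omega> * G' (i, 1, q) \<omega>) =
            bil n n (($$) h) (\<lambda>p. (?a p - ?b p) / sqrt 2) (\<lambda>p. (?a p + ?b p) / sqrt 2)"
          unfolding dotp_rank_one by (rule bil_cong_vec) (simp_all only: rot i)
        also have "\<dots> = (bil n n (($$) h) ?a ?a - bil n n (($$) h) ?b ?b) / 2" by (rule symmetric_polarization[OF hs])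
        also have "\<dots> = dotp ({..<n} \<times> {..<n}) (($$) h) (z m \<omega> i)"
          unfolding dotp_rank_one[symmetric] dotp_def sum_subtractf[symmetric] sum_divide_distrib
          by (intro sum.cong refl) (auto simp: z_def G_def algebra_simps)
        finally show "dotp ({..<n} \<times> {..<n}) (($$) h) (\<lambda>(p, q). G' (i, 0, p) \<omega> * G' (i, 1, q) \<omega>) =
            dotp ({..<n} \<times> {..<n}) (($$) h) (z m \<omega> i)" .
      qed simp
      then show ?thesis unfolding sc using A by blast
    qed
  qed
qed

text \<open>
  \<open>\<bar>y (2 j)\<bar> + \<bar>y (2 j + 1)\<bar>\<close> is at least the absolute difference. For odd \<open>m\<close> the last measurement is
  dropped, and the factor \<open>1/2\<close> accounts for it.
\<close>

lemma avg1_pairs: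
  fixes y :: "nat \<Rightarrow> real"
  assumes m: "2 \<le> m" and v: "\<And>j. j < m div 2 \<Longrightarrow> v j = (y (2 * j) - y (2 * j + 1)) / 2"
  shows "avg1 (m div 2) v / 2 \<le> avg1 m y"
proof -
  define M where "M = m div 2"
  have M: "1 \<le> M" "2 * M \<le> m" "real m \<le> 4 * real M" using m by (auto simp: M_def)
  have "2 * (\<Sum>j<M. \<bar>v j\<bar>) \<le> (\<Sum>j<M. \<bar>y (2 * j)\<bar> + \<bar>y (2 * j + 1)\<bar>)"
    unfolding sum_distrib_left by (intro sum_mono) (simp add: v M_def)
  also have "\<dots> = (\<Sum>i<2 * M. \<bar>y i\<bar>)" by (induction M) simp_all
  also have "\<dots> \<le> (\<Sum>i<m. \<bar>y i\<bar>)" using M(2) by (intro sum_mono2) auto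
  finally have le: "2 * (\<Sum>j<M. \<bar>v j\<bar>) \<le> (\<Sum>i<m. \<bar>y i\<bar>)" .
  have S0: "0 \<le> (\<Sum>j<M. \<bar>v j\<bar>)" by (simp add: sum_nonneg)
  have "avg1 M v / 2 = 2 * (\<Sum>j<M. \<bar>v j\<bar>) / (4 * real M)" by (simp add: avg1_def)
  also have "\<dots> \<le> 2 * (\<Sum>j<M. \<bar>v j\<bar>) / real m" using M m S0 by (intro divide_left_mono) auto
  also have "\<dots> \<le> avg1 m y" unfolding avg1_def using le by (rule divide_right_mono) simp
  finally show ?thesis by (simp add: M_def)
qed

text \<open>
  In terms of the singular vectors, \<open>x\<^sup>T H x = \<Sum> \<sigma> j \<langle>u j, x\<rangle> \<langle>v j, x\<rangle>\<close>, and each product is at most half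
  the sum of the two squares, whose averages are controlled.
\<close>

lemma avg1_quadratic_form_le:
  assumes H: "H \<in> carrier_mat n n"
    and lin: "\<And>h. avg2 m (\<lambda>i. dotp {..<n} h (x i)) \<le> 12 * L2_set h {..<n}"
  shows "avg1 m (\<lambda>i. bil n n (($$) H) (x i) (x i)) \<le> 144 * schatten1_norm H"
proof -
  obtain J \<sigma> u v where svd: "is_svd n n (($$) H) J \<sigma> u v" and S: "schatten1_norm H = (\<Sum>j\<in>J. \<sigma> j)"
    using svd_exists[OF H] by blast
  have u: "ons {..<n} J u" and v: "ons {..<n} J v" and \<sigma>: "\<And>j. j \<in> J \<Longrightarrow> 0 \<le> \<sigma> j"
    and ent: "\<And>p q. p < n \<Longrightarrow> q < n \<Longrightarrow> H $$ (p, q) = (\<Sum>j\<in>J. \<sigma> j * u j p * v j q)"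
    using svd by (auto simp: is_svd_def less_imp_le)
  have sq: "(\<Sum>i<m. (dotp {..<n} w (x i))\<^sup>2) / real m \<le> 144" if "dotp {..<n} w w = 1" for w
  proof -
    have "L2_set w {..<n} = 1" using that by (simp add: dotp_self power2_eq_1_iff)
      (smt (verit) L2_set_nonneg)
    then have "sqrt ((\<Sum>i<m. (dotp {..<n} w (x i))\<^sup>2) / real m) \<le> 12"
      using lin[of w] by (simp add: avg2_def)
    then show ?thesis using real_sqrt_le_iff[of _ "144"] by (simp add: real_sqrt_le_iff[of _ 144, simplified])
  qed
  have bound: "\<bar>bil n n (($$) H) (x i) (x i)\<bar> \<le>
      (\<Sum>j\<in>J. \<sigma> j * (((dotp {..<n} (u j) (x i))\<^sup>2 + (dotp {..<n} (v j) (x i))\<^sup>2) / 2))" for i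
  proof -
    have "bil n n (($$) H) (x i) (x i) = (\<Sum>j\<in>J. \<sigma> j * dotp {..<n} (x i) (u j) * dotp {..<n} (v j) (x i))"
      by (rule bil_rank_one_sum) (rule ent)
    also have "\<dots> = (\<Sum>j\<in>J. \<sigma> j * (dotp {..<n} (u j) (x i) * dotp {..<n} (v j) (x i)))"
      by (intro sum.cong refl) (metis dotp_commute mult.assoc)
    finally have "\<bar>bil n n (($$) H) (x i) (x i)\<bar> = \<bar>\<Sum>j\<in>J. \<sigma> j * (dotp {..<n} (u j) (x i) * dotp {..<n} (v j) (x i))\<bar>"
      by simp
    also have "\<dots> \<le> (\<Sum>j\<in>J. \<bar>\<sigma> j * (dotp {..<n} (u j) (x i) * dotp {..<n} (v j) (x i))\<bar>)" by (rule sum_abs)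
    also have "\<dots> \<le> (\<Sum>j\<in>J. \<sigma> j * (((dotp {..<n} (u j) (x i))\<^sup>2 + (dotp {..<n} (v j) (x i))\<^sup>2) / 2))"
    proof (rule sum_mono)
      fix j assume j: "j \<in> J"
      have "\<bar>s * t\<bar> \<le> (s\<^sup>2 + t\<^sup>2) / 2" for s t :: real
        using sum_squares_bound[of "\<bar>s\<bar>" "\<bar>t\<bar>"] by (simp add: abs_mult)
      then show "\<bar>\<sigma> j * (dotp {..<n} (u j) (x i) * dotp {..<n} (v j) (x i))\<bar> \<le>
          \<sigma> j * (((dotp {..<n} (u j) (x i))\<^sup>2 + (dotp {..<n} (v j) (x i))\<^sup>2) / 2)"
        unfolding abs_mult[of "\<sigma> j"] using \<sigma>[OF j] by (simp only: abs_of_nonneg) (rule mult_left_mono)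
    qed
    finally show ?thesis .
  qed
  have "avg1 m (\<lambda>i. bil n n (($$) H) (x i) (x i)) \<le>
      (\<Sum>i<m. \<Sum>j\<in>J. \<sigma> j * (((dotp {..<n} (u j) (x i))\<^sup>2 + (dotp {..<n} (v j) (x i))\<^sup>2) / 2)) / real m"
    unfolding avg1_def using bound by (intro divide_right_mono sum_mono) auto
  also have "\<dots> = (\<Sum>j\<in>J. \<sigma> j * (((\<Sum>i<m. (dotp {..<n} (u j) (x i))\<^sup>2) / real m +
      (\<Sum>i<m. (dotp {..<n} (v j) (x i))\<^sup>2) / real m) / 2))"
    by (subst sum.swap) (simp add: sum_divide_distrib sum_distrib_left sum.distrib add_divide_distrib distrib_left divide_divide_eq_left mult.commute)
  also have "\<dots> \<le> (\<Sum>j\<in>J. \<sigma> j * 144)"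
  proof (rule sum_mono)
    fix j assume j: "j \<in> J"
    then have "dotp {..<n} (u j) (u j) = 1" "dotp {..<n} (v j) (v j) = 1" using u v by (auto simp: ons_def)
    moreover have "(a + b) / 2 \<le> 144" if "a \<le> 144" "b \<le> 144" for a b :: real using that by simp
    ultimately have "((\<Sum>i<m. (dotp {..<n} (u j) (x i))\<^sup>2) / real m + (\<Sum>i<m. (dotp {..<n} (v j) (x i))\<^sup>2) / real m) / 2 \<le> 144"
      using sq by blast
    then show "\<sigma> j * (((\<Sum>i<m. (dotp {..<n} (u j) (x i))\<^sup>2) / real m +
      (\<Sum>i<m. (dotp {..<n} (v j) (x i))\<^sup>2) / real m) / 2) \<le> \<sigma> j * 144"
      using \<sigma>[OF j] by (rule mult_left_mono)
  qed
  also have "\<dots> = 144 * schatten1_norm H" by (simp add: S sum_distrib_right[symmetric])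
  finally show ?thesis .
qed

text \<open>
  Lower and upper bound come from different events. The lower bound rotates the pairs of measurements \<open>2 j\<close> and
  \<open>2 j + 1\<close> and uses the low rank isometry for the bilinear forms of these pairs. The upper bound uses the
  isometry of the Gaussian vectors on all of \<open>\<real>\<^sup>n\<close>, for which the trivial sparsity \<open>n\<close> is enough.
\<close>

lemma covariance_I_whp: "sharp_recovery_whp covariance_estimation_I"
proof -
  let ?sc = covariance_estimation_I
  have sc: "space_V ?sc n N = sym_space_s1 n" "objective ?sc = mat_trace" "cone_K ?sc n N = psd_mats n"
    "signals ?sc n N k = psd_mats n \<inter> rank_le n n k" "threshold ?sc n N k = real n * real k"
    "std_dev ?sc m = 1 / sqrt (real m)"
    "blocks ?sc n N = {0} \<times> {..<n}" "norm_W ?sc = l1_norm" for n N k m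
    by (simp_all add: covariance_estimation_I_def)
  let ?\<Lambda> = "low_rank_entropy + (1 / \<epsilon>\<^sub>0\<^sup>2 + 2)"
  have \<Lambda>: "0 \<le> ?\<Lambda>" using entropy_nonneg(2) by simp
  define z :: "nat \<Rightarrow> sample \<Rightarrow> nat \<Rightarrow> nat \<times> nat \<Rightarrow> real" where
    "z = (\<lambda>m \<omega> i (p, q). (\<omega> (i, 0, p) / (1 / sqrt (real m))) * (\<omega> (i, 0, q) / (1 / sqrt (real m))))"
  show ?thesis
  proof (rule sharp_recovery_whpI[where ent = "($$)" and E = "\<lambda>n N. {..<n} \<times> {..<n}" and g = avg1 and z = z, OF \<Lambda>])
    show "sharp_setup (space_V ?sc n N) ($$) ({..<n} \<times> {..<n}) (objective ?sc) (cone_K ?sc n N) x0 k avg1"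
      if "1 \<le> k" "x0 \<in> signals ?sc n N k" for n N k x0
      using sharp_setup_psd[OF _ that(1), of x0 n avg1] that(2) unfolding sc by blast
    show "0 < std_dev ?sc m" if "1 \<le> m" for m using that by (simp add: sc)
    show "ln 2 \<le> threshold ?sc n N k" if "1 \<le> n" "1 \<le> k" for n N k
      unfolding sc using that by (intro max_threshold_ge)
    show "continuous_on UNIV (\<lambda>\<omega>. z m \<omega> i e)" for m i e
      unfolding z_def case_prod_unfold divide_inverse by (intro continuous_intros continuous_on_product_coordinates)
    show "norm_W ?sc (sensing_map ?sc n N m \<omega> x - sensing_map ?sc n N m \<omega> x0) =
        avg1 m (\<lambda>i. dotp ({..<n} \<times> {..<n}) (\<lambda>e. x $$ e - x0 $$ e) (z m \<omega> i))"
      if m: "1 \<le> m" and x: "x \<in> points (space_V ?sc n N)" "x0 \<in> points (space_V ?sc n N)" for n N m \<omega> x x0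
    proof -
      have A: "sensing_map ?sc n N m \<omega> y = Matrix.vec m (\<lambda>i. dotp ({..<n} \<times> {..<n}) (($$) y)
          (\<lambda>(p, q). \<omega> (i, 0, p) * \<omega> (i, 0, q)))"
        if "y \<in> points (space_V ?sc n N)" for y
      proof -
        have "y \<in> carrier_mat n n" using that by (simp add: sc sym_space_s1_def sym_mats_def)
        then have "trace_inner (outer (gvec \<omega> i 0 n) (gvec \<omega> i 0 n)) y =
            dotp ({..<n} \<times> {..<n}) (($$) y) (\<lambda>(p, q). \<omega> (i, 0, p) * \<omega> (i, 0, q))" for i
          by (subst trace_inner_dotp[of _ n n]) (auto simp: outer_def gvec_def intro!: dotp_cong)
        then show ?thesis by (simp add: sensing_map_def covariance_estimation_I_def)
      qed
      show ?thesis unfolding A[OF x(1)] A[OF x(2)] sc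
        by (rule l1_norm_observations[OF m refl refl]) (auto simp: z_def)
    qed
    show "\<exists>A\<in>sets (design_law ?sc n N m).
        1 - 4 * exp (?\<Lambda> * threshold ?sc n N k - c\<^sub>0 / 3 * real m) \<le> measure (design_law ?sc n N m) A \<and>
        (\<forall>\<omega>\<in>A. well_conditioned (space_V ?sc n N) ($$) ({..<n} \<times> {..<n}) m k avg1 (z m \<omega>))"
      if nk: "1 \<le> n" "1 \<le> N" "1 \<le> k" "2 \<le> m" for n N k m
    proof -
      let ?M = "design_law ?sc n N m" and ?E = "{..<n} \<times> {..<n}" and ?J = "{..<m} \<times> {0} \<times> {..<n}"
      \<comment> \<open>number of pairs; \<open>m \<ge> 2\<close> makes it positive\<close>
      define m' where "m' = m div 2"
      have "m \<le> 3 * m'" unfolding m'_def using nk(4) by presburger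
      then have m: "1 \<le> m" "1 \<le> m'" "real m \<le> 3 * real m'" using nk by (auto simp: m'_def)
      have lt: "2 * j < m" "2 * j + 1 < m" if "j < m'" for j using that by (auto simp: m'_def)
      define G where "G j \<omega> = \<omega> j / (1 / sqrt (real m))" for j and \<omega> :: sample
      have G: "std_gaussians ?M ?J G"
        using design_std_gaussians[of ?sc m n N] m nk by (simp add: sc lessThan_empty_iff G_def[abs_def])
      then interpret M: prob_space ?M by (simp add: std_gaussians_def)
      have zG: "dotp ?E (($$) h) (z m \<omega> i) = bil n n (($$) h) (\<lambda>p. G (i, 0, p) \<omega>) (\<lambda>p. G (i, 0, p) \<omega>)" for h \<omega> i
        unfolding dotp_rank_one[symmetric] by (simp add: z_def G_def)
      have "\<exists>G' :: nat \<times> nat \<times> nat \<Rightarrow> sample \<Rightarrow> real. std_gaussians ?M ?J G' \<and>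
          (\<forall>s\<in>{..<m'} \<times> {..<n}. \<forall>\<omega>.
            G' ((\<lambda>(j, p). (2 * j, 0, p)) s) \<omega> =
              (G ((\<lambda>(j, p). (2 * j, 0, p)) s) \<omega> - G ((\<lambda>(j, p). (2 * j + 1, 0, p)) s) \<omega>) / sqrt 2 \<and>
            G' ((\<lambda>(j, p). (2 * j + 1, 0, p)) s) \<omega> =
              (G ((\<lambda>(j, p). (2 * j, 0, p)) s) \<omega> + G ((\<lambda>(j, p). (2 * j + 1, 0, p)) s) \<omega>) / sqrt 2)"
      proof (rule std_gaussians_rotate[OF G, where a = "\<lambda>(j, p). (2 * j, 0, p)" and b = "\<lambda>(j, p). (2 * j + 1, 0, p)"])
        show "(\<lambda>(j, p). (2 * j, 0, p)) ` ({..<m'} \<times> {..<n}) \<inter> (\<lambda>(j, p). (2 * j + 1, 0 :: nat, p)) ` ({..<m'} \<times> {..<n}) = {}"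
          by auto presburger
      qed (use lt in \<open>auto simp: inj_on_def\<close>)
      then obtain G' :: "nat \<times> nat \<times> nat \<Rightarrow> sample \<Rightarrow> real" where G': "std_gaussians ?M ?J G'"
        and rot: "\<And>j p \<omega>. j < m' \<Longrightarrow> p < n \<Longrightarrow> G' (2 * j, 0, p) \<omega> = (G (2 * j, 0, p) \<omega> - G (2 * j + 1, 0, p) \<omega>) / sqrt 2"
          "\<And>j p \<omega>. j < m' \<Longrightarrow> p < n \<Longrightarrow> G' (2 * j + 1, 0, p) \<omega> = (G (2 * j, 0, p) \<omega> + G (2 * j + 1, 0, p) \<omega>) / sqrt 2"
        by force
      have "ensemble ?M m' ?E (\<lambda>j (p, q) \<omega>. G' (2 * j, 0, p) \<omega> * G' (2 * j + 1, 0, q) \<omega>) avg1"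
      proof (rule bilinear_ensemble[OF G' m(2), where \<iota> = "\<lambda>j p. (2 * j, 0, p)" and \<kappa> = "\<lambda>j q. (2 * j + 1, 0, q)"])
        show "disjoint_family_on (\<lambda>j. (\<lambda>p. (2 * j, 0 :: nat, p)) ` {..<n} \<union> (\<lambda>q. (2 * j + 1, 0, q)) ` {..<n}) {..<m'}"
          by (auto simp: disjoint_family_on_def)
      qed (use lt in \<open>auto simp: inj_on_def\<close>)
      from low_rank_isometry[OF this m(2) _ nk(1) nk(1) nk(3)] obtain A\<^sub>1 where A\<^sub>1: "A\<^sub>1 \<in> sets ?M"
        "1 - 2 * exp (low_rank_entropy * (real n * real k) - c\<^sub>0 * real m') \<le> measure ?M A\<^sub>1"
        and low: "\<And>\<omega> H. \<omega> \<in> A\<^sub>1 \<Longrightarrow> H \<in> carrier_mat n n \<Longrightarrow> schatten1_norm H \<le> 8 * sqrt (real k) * L2_set (($$) H) ?E \<Longrightarrow>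
          \<alpha>\<^sub>0 / 4 * L2_set (($$) H) ?E \<le> avg1 m' (\<lambda>j. dotp ?E (($$) H) (\<lambda>(p, q). G' (2 * j, 0, p) \<omega> * G' (2 * j + 1, 0, q) \<omega>))"
        by (auto simp: case_prod_unfold)
      have ens2: "ensemble ?M m {..<n} (\<lambda>i q. G (i, 0, q)) avg2"
        by (rule gaussian_ensemble[OF G m(1), where \<iota> = "\<lambda>i q. (i, 0, q)"])
          (auto simp: inj_on_def disjoint_family_on_def)
      have "has_net {..<n} (sparse_on {..<n} (real n)) \<epsilon>\<^sub>0 (real n * (1 / \<epsilon>\<^sub>0\<^sup>2 + 2 + max 0 (ln (real (card {..<n}) / real n))))"
        using nk by (intro sparse_net \<epsilon>\<^sub>0(1)) auto
      then have net2: "has_net {..<n} (sparse_on {..<n} (real n)) \<epsilon>\<^sub>0 (real n * (1 / \<epsilon>\<^sub>0\<^sup>2 + 2))" using nk by simp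
      have all_sparse: "sparse_on {..<n} (real n) h" for h
        using card_mono[OF finite_lessThan, of "{e \<in> {..<n}. h e \<noteq> 0}" n] by (auto simp: sparse_on_def)
      obtain A\<^sub>2 where A\<^sub>2: "A\<^sub>2 \<in> sets ?M" "1 - 2 * exp (real n * (1 / \<epsilon>\<^sub>0\<^sup>2 + 2) - c\<^sub>0 * real m) \<le> measure ?M A\<^sub>2"
        and up: "\<And>\<omega> h. \<omega> \<in> A\<^sub>2 \<Longrightarrow> avg2 m (\<lambda>i. dotp {..<n} h (\<lambda>q. G (i, 0, q) \<omega>)) \<le> 12 * L2_set h {..<n}"
        using rip_with_high_probability[OF ens2 m(1) _ finite_lessThan net2 all_sparse all_sparse] all_sparse by blast
      have wc: "well_conditioned (sym_space_s1 n) ($$) ?E m k avg1 (z m \<omega>)" if \<omega>: "\<omega> \<in> A\<^sub>1" "\<omega> \<in> A\<^sub>2" for \<omega>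
        unfolding well_conditioned_def
      proof (intro conjI ballI impI)
        fix h assume "h \<in> points (sym_space_s1 n)"
        then have hs: "h \<in> sym_mats n" and hc: "h \<in> carrier_mat n n" by (simp_all add: sym_space_s1_def sym_mats_def)
        have "avg1 m (\<lambda>i. dotp ?E (($$) h) (z m \<omega> i)) \<le> 144 * schatten1_norm h"
          unfolding zG using up[OF \<omega>(2)] by (intro avg1_quadratic_form_le[OF hc]) (simp add: dotp_def)
        then show "avg1 m (\<lambda>i. dotp ?E (($$) h) (z m \<omega> i)) \<le> 144 * nrm (sym_space_s1 n) h"
          by (simp add: sym_space_s1_def)
        assume "nrm (sym_space_s1 n) h \<le> 8 * sqrt (real k) * L2_set (($$) h) ?E"
        then have "schatten1_norm h \<le> 8 * sqrt (real k) * L2_set (($$) h) ?E" by (simp add: sym_space_s1_def)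
        from low[OF \<omega>(1) hc this]
        have 1: "\<alpha>\<^sub>0 / 4 * L2_set (($$) h) ?E \<le> avg1 m' (\<lambda>j. dotp ?E (($$) h) (\<lambda>(p, q). G' (2 * j, 0, p) \<omega> * G' (2 * j + 1, 0, q) \<omega>))" .
        have "avg1 m' (\<lambda>j. dotp ?E (($$) h) (\<lambda>(p, q). G' (2 * j, 0, p) \<omega> * G' (2 * j + 1, 0, q) \<omega>)) / 2 \<le>
            avg1 m (\<lambda>i. dotp ?E (($$) h) (z m \<omega> i))"
          unfolding m'_def
        proof (rule avg1_pairs[OF nk(4)])
          fix j assume "j < m div 2"
          then have j: "j < m'" by (simp add: m'_def)
          let ?a = "\<lambda>p. G (2 * j, 0, p) \<omega>" and ?b = "\<lambda>p. G (2 * j + 1, 0, p) \<omega>"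
          have "dotp ?E (($$) h) (\<lambda>(p, q). G' (2 * j, 0, p) \<omega> * G' (2 * j + 1, 0, q) \<omega>) =
              bil n n (($$) h) (\<lambda>p. (?a p - ?b p) / sqrt 2) (\<lambda>p. (?a p + ?b p) / sqrt 2)"
            unfolding dotp_rank_one by (rule bil_cong_vec) (simp_all only: rot j)
          then show "dotp ?E (($$) h) (\<lambda>(p, q). G' (2 * j, 0, p) \<omega> * G' (2 * j + 1, 0, q) \<omega>) =
              (dotp ?E (($$) h) (z m \<omega> (2 * j)) - dotp ?E (($$) h) (z m \<omega> (2 * j + 1))) / 2"
            unfolding zG symmetric_polarization[OF hs] .
        qed
        then show "\<alpha>\<^sub>0 / 8 * L2_set (($$) h) ?E \<le> avg1 m (\<lambda>i. dotp ?E (($$) h) (z m \<omega> i))" using 1 by linarith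
      qed
      have "1 - 4 * exp (?\<Lambda> * (real n * real k) - c\<^sub>0 / 3 * real m) \<le> measure ?M (A\<^sub>1 \<inter> A\<^sub>2)"
      proof -
        let ?e = "exp (?\<Lambda> * (real n * real k) - c\<^sub>0 / 3 * real m)"
        have \<Lambda>ex: "?\<Lambda> * (real n * real k) = low_rank_entropy * (real n * real k) + (1 / \<epsilon>\<^sub>0\<^sup>2 + 2) * (real n * real k)"
          by (rule distrib_right)
        have "c\<^sub>0 / 3 * real m \<le> c\<^sub>0 / 3 * (3 * real m')" using m(3) c\<^sub>0_pos by (intro mult_left_mono) auto
        then have cm': "c\<^sub>0 / 3 * real m \<le> c\<^sub>0 * real m'" by simp
        have cm: "c\<^sub>0 / 3 * real m \<le> c\<^sub>0 * real m" using c\<^sub>0_pos by (intro mult_right_mono) auto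
        have "0 \<le> low_rank_entropy * (real n * real k)" "0 \<le> (1 / \<epsilon>\<^sub>0\<^sup>2 + 2) * (real n * real k)"
          using entropy_nonneg by auto
        moreover have "real n * (1 / \<epsilon>\<^sub>0\<^sup>2 + 2) * 1 \<le> real n * (1 / \<epsilon>\<^sub>0\<^sup>2 + 2) * real k" using nk by (intro mult_left_mono) auto
        then have "real n * (1 / \<epsilon>\<^sub>0\<^sup>2 + 2) \<le> (1 / \<epsilon>\<^sub>0\<^sup>2 + 2) * (real n * real k)" by (simp add: mult_ac)
        ultimately have "exp (low_rank_entropy * (real n * real k) - c\<^sub>0 * real m') \<le> ?e"
          "exp (real n * (1 / \<epsilon>\<^sub>0\<^sup>2 + 2) - c\<^sub>0 * real m) \<le> ?e"
          unfolding exp_le_cancel_iff \<Lambda>ex using cm cm' by linarith+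
        moreover have "measure ?M A\<^sub>1 + measure ?M A\<^sub>2 - 1 \<le> measure ?M (A\<^sub>1 \<inter> A\<^sub>2)"
        proof -
          have "measure ?M (A\<^sub>1 \<union> A\<^sub>2) + measure ?M (A\<^sub>1 \<inter> A\<^sub>2) = measure ?M A\<^sub>1 + measure ?M A\<^sub>2"
            using M.finite_measure_Union'[OF A\<^sub>1(1) A\<^sub>2(1)] M.finite_measure_Diff'[OF A\<^sub>2(1) A\<^sub>1(1)] by (simp add: Int_commute)
          then show ?thesis using M.prob_le_1[of "A\<^sub>1 \<union> A\<^sub>2"] by linarith
        qed
        ultimately show ?thesis using A\<^sub>1(2) A\<^sub>2(2) by linarith
      qed
      then show ?thesis unfolding sc using wc A\<^sub>1(1) A\<^sub>2(1) by (intro bexI[of _ "A\<^sub>1 \<inter> A\<^sub>2"]) auto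
    qed
  qed
qed

section \<open>Sharp recovery in all scenarios\<close>

theorem theorem1:
  shows
    "(\<forall>sc \<in> {sparse_recovery_l2, sparse_recovery_l1}.
        \<exists>C>0. \<exists>c\<^sub>1>0. \<exists>c\<^sub>2>0. \<exists>c>0.
        \<forall>n\<ge>1. \<forall>N\<ge>1. \<forall>k\<ge>1. \<forall>m. \<forall>x0 \<in> signals sc n N k.
          real m \<ge> C * threshold sc n N k \<longrightarrow>
          measure (design_law sc n N m) {\<omega> \<in> space (design_law sc n N m).
            recovery_sharp sc n N m x0 (1/2) (sqrt (c\<^sub>1 * real k)) 2 \<omega> \<and>
            (\<exists>L \<kappa>. L \<le> sqrt (c\<^sub>2 * real k) \<and>
               lipschitz (space_V sc n N)
                 L (recovery_penalized sc n N m x0 (sqrt (c\<^sub>1 * real k)) 2 \<omega>) \<and>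
               has_condition_number (space_V sc n N)
                 (recovery_penalized sc n N m x0 (sqrt (c\<^sub>1 * real k)) 2 \<omega>) x0 (1/2) L \<kappa> \<and>
               \<kappa> \<le> 2 * sqrt (c\<^sub>2 * real k))}
          > 1 - exp (- c * real m)) \<and>
     (\<forall>sc \<in> {matrix_sensing_I_l2, matrix_sensing_I_l1, matrix_sensing_II,
              covariance_estimation_I, covariance_estimation_II}.
        \<exists>C>0. \<exists>c\<^sub>1>0. \<exists>c\<^sub>2>0. \<exists>c>0.
        \<forall>n\<ge>1. \<forall>N\<ge>1. \<forall>k\<ge>1. \<forall>m. \<forall>x0 \<in> signals sc n N k.
          real m \<ge> C * threshold sc n N k \<longrightarrow>
          measure (design_law sc n N m) {\<omega> \<in> space (design_law sc n N m).
            recovery_sharp sc n N m x0 (1/2) (sqrt (c\<^sub>1 * real k)) 2 \<omega> \<and>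
            (\<exists>L \<kappa>. L \<le> sqrt (c\<^sub>2 * real k) \<and>
               lipschitz (space_V sc n N)
                 L (recovery_penalized sc n N m x0 (sqrt (c\<^sub>1 * real k)) 2 \<omega>) \<and>
               has_condition_number (space_V sc n N)
                 (recovery_penalized sc n N m x0 (sqrt (c\<^sub>1 * real k)) 2 \<omega>) x0 (1/2) L \<kappa> \<and>
               \<kappa> \<le> 2 * sqrt (c\<^sub>2 * real k))}
          > 1 - exp (- c * real m))"
proof -
  have "sharp_recovery_whp sparse_recovery_l2"
    unfolding sparse_recovery_l2_def by (rule sparse_recovery_whp[where g = avg2]) simp
  moreover have "sharp_recovery_whp sparse_recovery_l1"
    unfolding sparse_recovery_l1_def by (rule sparse_recovery_whp[where g = avg1]) simp
  ultimately have vectors: "\<forall>sc\<in>{sparse_recovery_l2, sparse_recovery_l1}. sharp_recovery_whp sc"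
    by simp
  have "sharp_recovery_whp matrix_sensing_I_l2"
    unfolding matrix_sensing_I_l2_def by (rule matrix_sensing_I_whp[where g = avg2]) simp
  moreover have "sharp_recovery_whp matrix_sensing_I_l1"
    unfolding matrix_sensing_I_l1_def by (rule matrix_sensing_I_whp[where g = avg1]) simp
  ultimately have matrices: "\<forall>sc\<in>{matrix_sensing_I_l2, matrix_sensing_I_l1, matrix_sensing_II,
      covariance_estimation_I, covariance_estimation_II}. sharp_recovery_whp sc"
    using matrix_sensing_II_whp covariance_I_whp covariance_II_whp by simp
  from vectors matrices show ?thesis unfolding sharp_recovery_whp_def by (rule conjI)
qed

end
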